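(* Let $F$ be a field with $\operatorname{char}(F)\neq 2$ and let $A$ be a central simple $F$-algebra of exponent $2$ and degree $n=2m$. Then every nonempty open subvariety $U\subset\acute{e}t_m(A)$ is R-trivial.
   Context: The exponent of $A$ is the order of its class in $Br(F)$. For a central simple $F$-algebra $A$ of degree $n$ (so $\dim_F A=n^2$) and $m\mid n$, $\acute{e}t_m(A)$ is the $F$-scheme representing the functor sending an $F$-scheme $X$ to the set of sheaves of commutative étale $\mathcal{O}_X$-subalgebras $E\subset A\otimes_F\mathcal{O}_X$ of type $[\frac nm,\dots,\frac nm]$ ($m$ entries), meaning that étale-locally $E=\bigoplus_{i=1}^m\mathcal{O}e_i$ with $e_i$ orthogonal idempotents such that each right ideal $e_iA$ has reduced rank $n/m$ (i.e. rank $n\cdot n/m$). Concretely, $\acute{e}t_m(A)$ is the quotient by $S_m$ of the open subscheme of $V_{n/m}(A)^m$ consisting of $m$-tuples of right ideals $(I_1,\dots,I_m)$ of reduced dimension $n/m$ with $\bigoplus I_j=A$. Two points $p_1,p_2\in X(F)$ of an $F$-scheme $X$ are elementarily linked if there is a rational map $\phi:\mathbb{P}^1_F\dashrightarrow X$ with $p_1,p_2$ both in the image of $\phi$ on $F$-points; R-equivalence is the equivalence relation on $X(F)$ generated by this. $X$ is R-trivial if $X(F)/R$ has exactly one element. *)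

theory Defs
  imports
    Complex_Main
    "HOL-Library.Function_Algebras"
    "HOL-Algebra.Algebraic_Closure_Type"
begin

section \<open>Central simple algebras\<close>

locale fin_dim_algebra = finite_dimensional_vector_space scale Basis
  for scale :: "'f::field \<Rightarrow> 'a::ring_1 \<Rightarrow> 'a" and Basis :: "'a set" +
  assumes scale_mult_left: "scale c x * y = scale c (x * y)"
    and scale_mult_right: "x * scale c y = scale c (x * y)"

definition two_sided_ideal :: "'a::ring_1 set \<Rightarrow> bool" where
  "two_sided_ideal I \<longleftrightarrow> 0 \<in> I \<and> (\<forall>x\<in>I. \<forall>y\<in>I. x + y \<in> I) \<and>
     (\<forall>x\<in>I. \<forall>a. a * x \<in> I \<and> x * a \<in> I)"

text \<open>The fixed \<open>Basis\<close> is arbitrary; it only serves to write down coordinates for scalar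
  extensions, tensor powers and Grassmannians of the algebra. The zero ring is excluded by the class
  \<open>ring_1\<close>.\<close>

locale central_simple_algebra = fin_dim_algebra scale Basis
  for scale :: "'f::field \<Rightarrow> 'a::ring_1 \<Rightarrow> 'a" and Basis :: "'a set" +
  assumes central: "{z. \<forall>x. z * x = x * z} = range (\<lambda>c. scale c 1)"
    and simple: "two_sided_ideal (I :: 'a set) \<Longrightarrow> I = {0} \<or> I = UNIV"

definition has_degree :: "('f::field \<Rightarrow> 'a::ring_1 \<Rightarrow> 'a) \<Rightarrow> nat \<Rightarrow> bool" where
  "has_degree scale n \<longleftrightarrow> vector_space.dim scale UNIV = n\<^sup>2"


section \<open>Algebras in coordinates\<close>

definition fscale :: "'k::field \<Rightarrow> ('i \<Rightarrow> 'k) \<Rightarrow> 'i \<Rightarrow> 'k" where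
  "fscale c x = (\<lambda>i. c * x i)"

interpretation fun_vs: vector_space fscale
  by unfold_locales (auto simp: fscale_def fun_eq_iff algebra_simps)

text \<open>An algebra with basis \<open>(b\<^sub>i)\<close> indexed by the finite set \<open>idx\<close> and structure
  constants \<open>b\<^sub>i b\<^sub>j = (\<Sum>k. sc i j k b\<^sub>k)\<close>. Its elements are represented by their coordinate
  functions, which are required to vanish outside \<open>idx\<close>.\<close>

record ('k, 'i) sc_algebra =
  idx :: "'i set"
  sc :: "'i \<Rightarrow> 'i \<Rightarrow> 'i \<Rightarrow> 'k"

definition coord_space :: "'i set \<Rightarrow> ('i \<Rightarrow> 'k::field) set" where
  "coord_space I = {x. \<forall>i. i \<notin> I \<longrightarrow> x i = 0}"

definition sc_mult :: "('k::field, 'i) sc_algebra \<Rightarrow> ('i \<Rightarrow> 'k) \<Rightarrow> ('i \<Rightarrow> 'k) \<Rightarrow> 'i \<Rightarrow> 'k" where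
  "sc_mult A x y =
     (\<lambda>k. if k \<in> idx A then \<Sum>i\<in>idx A. \<Sum>j\<in>idx A. x i * y j * sc A i j k else 0)"

definition sc_iso :: "('k::field, 'i) sc_algebra \<Rightarrow> ('k, 'j) sc_algebra \<Rightarrow> bool" where
  "sc_iso A B \<longleftrightarrow> (\<exists>h. bij_betw h (coord_space (idx A)) (coord_space (idx B)) \<and>
     (\<forall>x\<in>coord_space (idx A). \<forall>y\<in>coord_space (idx A).
        h (x + y) = h x + h y \<and> h (sc_mult A x y) = sc_mult B (h x) (h y)) \<and>
     (\<forall>c. \<forall>x\<in>coord_space (idx A). h (fscale c x) = fscale c (h x)))"

definition coord_algebra ::
    "('f::field \<Rightarrow> 'a::ring_1 \<Rightarrow> 'a) \<Rightarrow> 'a set \<Rightarrow> ('f, 'a) sc_algebra" where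
  "coord_algebra scale Basis =
     \<lparr>idx = Basis, sc = (\<lambda>a b c. module.representation scale Basis (a * b) c)\<rparr>"

text \<open>Scalar extension to the algebraic closure.\<close>

definition geom_algebra ::
    "('f::field \<Rightarrow> 'a::ring_1 \<Rightarrow> 'a) \<Rightarrow> 'a set \<Rightarrow> ('f alg_closure, 'a) sc_algebra" where
  "geom_algebra scale Basis =
     \<lparr>idx = Basis, sc = (\<lambda>a b c. to_ac (sc (coord_algebra scale Basis) a b c))\<rparr>"

definition to_geom ::
    "('f::field \<Rightarrow> 'a::ring_1 \<Rightarrow> 'a) \<Rightarrow> 'a set \<Rightarrow> 'a \<Rightarrow> 'a \<Rightarrow> 'f alg_closure" where
  "to_geom scale Basis x = (\<lambda>b. to_ac (module.representation scale Basis x b))"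


section \<open>Brauer equivalence and the exponent\<close>

text \<open>\<open>matrix_algebra r A\<close> is the algebra of \<open>r \<times> r\<close> matrices over \<open>A\<close>, with basis
  \<open>b\<^sub>a E\<^sub>i\<^sub>j\<close> indexed by \<open>((i, j), a)\<close>.\<close>

definition matrix_algebra ::
    "nat \<Rightarrow> ('k::field, 'i) sc_algebra \<Rightarrow> ('k, (nat \<times> nat) \<times> 'i) sc_algebra" where
  "matrix_algebra r A =
     \<lparr>idx = ({..<r} \<times> {..<r}) \<times> idx A,
      sc = (\<lambda>((i, j), a) ((i', j'), b) ((i'', j''), c).
              if j = i' \<and> i'' = i \<and> j'' = j' then sc A a b c else 0)\<rparr>"

definition brauer_equiv :: "('k::field, 'i) sc_algebra \<Rightarrow> ('k, 'j) sc_algebra \<Rightarrow> bool" where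
  "brauer_equiv A B \<longleftrightarrow>
     (\<exists>r s. 0 < r \<and> 0 < s \<and> sc_iso (matrix_algebra r A) (matrix_algebra s B))"

text \<open>The basis of \<open>A \<otimes> \<dots> \<otimes> A\<close> consists of the tensors \<open>b\<^bsub>i1\<^esub> \<otimes> \<dots> \<otimes> b\<^bsub>ik\<^esub>\<close>, indexed by
  lists of length \<open>k\<close>; for \<open>k = 0\<close> this is the base field.\<close>

definition tensor_power :: "('k::field, 'i) sc_algebra \<Rightarrow> nat \<Rightarrow> ('k, 'i list) sc_algebra" where
  "tensor_power A k =
     \<lparr>idx = {xs. length xs = k \<and> set xs \<subseteq> idx A},
      sc = (\<lambda>xs ys zs. \<Prod>p<k. sc A (nth xs p) (nth ys p) (nth zs p))\<rparr>"

definition base_field :: "('k::field, unit) sc_algebra" where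
  "base_field = \<lparr>idx = UNIV, sc = (\<lambda>_ _ _. 1)\<rparr>"

text \<open>The product of the Brauer group is induced by the tensor product and its neutral element is
  the class of the base field, so that the \<open>k\<close>-th power of the class of \<open>A\<close> is trivial iff the
  \<open>k\<close>-th tensor power of \<open>A\<close> is Brauer equivalent to the base field.\<close>

definition has_exponent ::
    "('f::field \<Rightarrow> 'a::ring_1 \<Rightarrow> 'a) \<Rightarrow> 'a set \<Rightarrow> nat \<Rightarrow> bool" where
  "has_exponent scale Basis d \<longleftrightarrow> 0 < d \<and>
     brauer_equiv (tensor_power (coord_algebra scale Basis) d) base_field \<and>
     (\<forall>k. 0 < k \<and> k < d \<longrightarrow>
        \<not> brauer_equiv (tensor_power (coord_algebra scale Basis) k) base_field)"


section \<open>Subvarieties of Grassmannians\<close>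

text \<open>A (geometrically reduced) quasi-projective variety over \<open>'f\<close> is described by its points over
  the algebraic closure: here as a set of \<open>m\<close>-dimensional subspaces of the space of functions on a
  finite set \<open>I\<close>. Such a subspace is spanned by a frame \<open>u 0, \<dots>, u (m - 1)\<close>, and the Grassmannian
  is the quotient of the variety of frames by the action of the general linear group. Its Zariski
  topology and the morphisms into and out of it, all defined over \<open>'f\<close>, are expressed by
  polynomials in the entries \<open>u j i\<close> with coefficients in \<open>'f\<close>.\<close>

definition frame :: "'i set \<Rightarrow> nat \<Rightarrow> (nat \<Rightarrow> 'i \<Rightarrow> 'k::field) \<Rightarrow> bool" where
  "frame I m u \<longleftrightarrow> (\<forall>j<m. u j \<in> coord_space I) \<and>
     inj_on u {..<m} \<and> fun_vs.independent (u ` {..<m})"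

definition frame_span :: "nat \<Rightarrow> (nat \<Rightarrow> 'i \<Rightarrow> 'k::field) \<Rightarrow> ('i \<Rightarrow> 'k) set" where
  "frame_span m u = fun_vs.span (u ` {..<m})"

definition grassmannian :: "'i set \<Rightarrow> nat \<Rightarrow> ('i \<Rightarrow> 'k::field) set set" where
  "grassmannian I m = {frame_span m u | u. frame I m u}"

inductive polyfun ::
    "'i set \<Rightarrow> nat \<Rightarrow> ((nat \<Rightarrow> 'i \<Rightarrow> 'f::field alg_closure) \<Rightarrow> 'f alg_closure) \<Rightarrow> bool"
  for I :: "'i set" and m :: nat where
  const: "polyfun I m (\<lambda>u. to_ac c)"
| coord: "j < m \<Longrightarrow> i \<in> I \<Longrightarrow> polyfun I m (\<lambda>u. u j i)"
| add: "polyfun I m p \<Longrightarrow> polyfun I m q \<Longrightarrow> polyfun I m (\<lambda>u. p u + q u)"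
| mult: "polyfun I m p \<Longrightarrow> polyfun I m q \<Longrightarrow> polyfun I m (\<lambda>u. p u * q u)"

text \<open>The quotient topology: a set of subspaces is open iff the set of their frames is.\<close>

definition grass_open :: "'i set \<Rightarrow> nat \<Rightarrow> ('i \<Rightarrow> 'f::field alg_closure) set set \<Rightarrow> bool" where
  "grass_open I m W \<longleftrightarrow> W \<subseteq> grassmannian I m \<and>
     (\<exists>P. (\<forall>p\<in>P. polyfun I m p) \<and>
          (\<forall>u. frame I m u \<longrightarrow> (frame_span m u \<in> W \<longleftrightarrow> (\<exists>p\<in>P. p u \<noteq> 0))))"

definition open_subvariety ::
    "'i set \<Rightarrow> nat \<Rightarrow> ('i \<Rightarrow> 'f::field alg_closure) set set \<Rightarrow>
     ('i \<Rightarrow> 'f alg_closure) set set \<Rightarrow> bool" where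
  "open_subvariety I m Y U \<longleftrightarrow> (\<exists>W. grass_open I m W \<and> U = Y \<inter> W)"

text \<open>Points defined over \<open>'f\<close>: the subspaces spanned by vectors with coordinates in \<open>'f\<close>.\<close>

definition rational_points ::
    "'i set \<Rightarrow> nat \<Rightarrow> ('i \<Rightarrow> 'f::field alg_closure) set set \<Rightarrow>
     ('i \<Rightarrow> 'f alg_closure) set set" where
  "rational_points I m Y =
     {E \<in> Y. \<exists>u. frame I m u \<and> (\<forall>j<m. \<forall>i. u j i \<in> range to_ac) \<and> E = frame_span m u}"

text \<open>A morphism lifts, locally on its source, to a map into the variety of frames of the target.
  Composed with the map sending a frame of the source to the point it spans, this lift has entries
  that are locally quotients of polynomials; multiplying the frame by a common denominator makes
  them polynomials.\<close>

definition morphism ::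
    "'j set \<Rightarrow> nat \<Rightarrow> ('j \<Rightarrow> 'f::field alg_closure) set set \<Rightarrow>
     'i set \<Rightarrow> nat \<Rightarrow> ('i \<Rightarrow> 'f alg_closure) set set \<Rightarrow>
     (('j \<Rightarrow> 'f alg_closure) set \<Rightarrow> ('i \<Rightarrow> 'f alg_closure) set) \<Rightarrow> bool" where
  "morphism J k V I m Y \<phi> \<longleftrightarrow> (\<forall>E\<in>V. \<phi> E \<in> Y) \<and>
     (\<forall>E\<in>V. \<exists>W v. grass_open J k W \<and> E \<in> W \<and>
        (\<forall>j<m. \<forall>i\<in>I. polyfun J k (\<lambda>u. v u j i)) \<and>
        (\<forall>u. frame J k u \<and> frame_span k u \<in> V \<inter> W \<longrightarrow>
           frame I m (v u) \<and> frame_span m (v u) = \<phi> (frame_span k u)))"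


section \<open>R-equivalence\<close>

abbreviation P1_idx :: "nat set" where
  "P1_idx \<equiv> {..<2}"

definition P1 :: "(nat \<Rightarrow> 'f::field alg_closure) set set" where
  "P1 = grassmannian P1_idx 1"

definition elem_linked ::
    "'i set \<Rightarrow> nat \<Rightarrow> ('i \<Rightarrow> 'f::field alg_closure) set set \<Rightarrow>
     (('i \<Rightarrow> 'f alg_closure) set \<times> ('i \<Rightarrow> 'f alg_closure) set) set" where
  "elem_linked I m Y =
     {(p, q). p \<in> rational_points I m Y \<and> q \<in> rational_points I m Y \<and>
        (\<exists>V \<phi>. open_subvariety P1_idx 1 P1 V \<and> V \<noteq> {} \<and> morphism P1_idx 1 V I m Y \<phi> \<and>
           p \<in> \<phi> ` rational_points P1_idx 1 V \<and> q \<in> \<phi> ` rational_points P1_idx 1 V)}"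

definition R_equivalence ::
    "'i set \<Rightarrow> nat \<Rightarrow> ('i \<Rightarrow> 'f::field alg_closure) set set \<Rightarrow>
     (('i \<Rightarrow> 'f alg_closure) set \<times> ('i \<Rightarrow> 'f alg_closure) set) set" where
  "R_equivalence I m Y = \<Inter>{r. equiv (rational_points I m Y) r \<and> elem_linked I m Y \<subseteq> r}"

definition R_trivial :: "'i set \<Rightarrow> nat \<Rightarrow> ('i \<Rightarrow> 'f::field alg_closure) set set \<Rightarrow> bool" where
  "R_trivial I m Y \<longleftrightarrow> card (rational_points I m Y // R_equivalence I m Y) = 1"


section \<open>Varieties of etale subalgebras\<close>

text \<open>The points over the algebraic closure of the scheme of commutative etale subalgebras of type
  \<open>[n/m, \<dots>, n/m]\<close> of an algebra of degree \<open>n\<close>. There every etale algebra is split, so these are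
  the subalgebras spanned by orthogonal idempotents \<open>e 0, \<dots>, e (m - 1)\<close> with sum 1 that generate
  right ideals of reduced rank \<open>n/m\<close>. The scheme is smooth and locally closed in the Grassmannian of
  \<open>m\<close>-dimensional subspaces; its points over \<open>'f\<close> are the subspaces defined over \<open>'f\<close> that become
  of this form over the algebraic closure, that is, the etale subalgebras of this type of the
  original algebra.\<close>

definition etale_variety ::
    "('f::field \<Rightarrow> 'a::ring_1 \<Rightarrow> 'a) \<Rightarrow> 'a set \<Rightarrow> nat \<Rightarrow> nat \<Rightarrow> ('a \<Rightarrow> 'f alg_closure) set set" where
  "etale_variety scale Basis n m = {E. \<exists>e.
     (\<forall>i<m. e i \<in> coord_space Basis) \<and>
     (\<forall>i<m. \<forall>j<m. sc_mult (geom_algebra scale Basis) (e i) (e j) = (if i = j then e i else 0)) \<and>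
     (\<Sum>i<m. e i) = to_geom scale Basis 1 \<and>
     (\<forall>i<m. fun_vs.dim (sc_mult (geom_algebra scale Basis) (e i) ` coord_space Basis)
              = n * (n div m)) \<and>
     E = fun_vs.span (e ` {..<m})}"

end

theory Submission
  imports Defs
begin

text \<open>Over the algebraic closure the algebra \<open>A\<close> becomes a matrix algebra. Since its tensor square is
  split, the matrices have a form \<open>V\<close> over the base field that is stable under \<open>M \<mapsto> x M y\<^sup>T\<close> for
  \<open>x, y \<in> A\<close>; it turns out to be stable under transposition as well. Finite fields are excluded by
  Lang's theorem, so rational points are dense in affine spaces. Idempotents of rank two as in the
  definition of the variety are self-adjoint for some invertible alternating matrix, so by density
  \<open>V\<close> contains an invertible alternating \<open>J\<close>, and the \<open>a \<in> A\<close> for which \<open>a J\<close> is alternating form a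
  linear space \<open>S\<close>.

  If \<open>a, t \<in> S\<close> and \<open>a\<close> is invertible, then \<open>a t\<close> is self-adjoint for the alternating form \<open>a J\<close>.
  Hence its minimal polynomial has degree at most \<open>m\<close>, and if this degree is \<open>m\<close> and the polynomial is
  separable, then \<open>a t\<close> generates an etale subalgebra with idempotents of rank two. Conversely, a
  generator \<open>x\<close> of such a subalgebra is self-adjoint for some invertible alternating matrix, which can
  be chosen of the form \<open>a J\<close> with \<open>a \<in> S\<close>, and then \<open>x = a t\<close> with \<open>t \<in> S\<close>. Thus every rational point
  comes from a rational point of an open subset of \<open>S \<times> S\<close>, and the lines of \<open>S \<times> S\<close> yield rational
  curves joining any two rational points of \<open>U\<close>.\<close>

section \<open>Independent families and density\<close>

text \<open>The matrix \<open>J\<close> makes \<open>x \<mapsto> J x^T J'\<close> a symplectic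
  involution of the algebra, with \<open>S\<close> as its space of symmetric elements; passing from
  \<open>J\<close> to \<open>a J\<close> twists it until it fits a given etale subalgebra. The gain
  of the products \<open>a t\<close> is that a minimal polynomial of degree at most
  \<open>m\<close>, a closed condition on an arbitrary element, holds for them automatically. Only
  open conditions remain, and these cut out an open part of an affine space.

  The obstacle is rationality. The algebra consists of matrices only over the closure, where matrix
  entries say nothing about the base field. Hence open conditions are written in coordinates with
  respect to \<open>Basis\<close>, and matrices over the closure are brought down to the form by
  linear functionals of the closure over the base field. For the transposition, irreducibility of
  the sandwich action gives stability only up to a scalar, and an irrational scalar has to be
  excluded by a separate count of dimensions. Openness rests throughout on dual frames with rational
  entries instead of determinants.\<close>

locale vec_sp = vector_space scale
  for scale :: "'a::field \<Rightarrow> 'b::ab_group_add \<Rightarrow> 'b" (infixr "*s" 75)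
begin

text \<open>Independence of a family counts repeated members as a dependence, unlike independence of
  the image set. Powers of an element and columns of a matrix require this.\<close>

definition indep_fam :: "'i set \<Rightarrow> ('i \<Rightarrow> 'b) \<Rightarrow> bool" where
  "indep_fam I x \<longleftrightarrow> (\<forall>c. (\<Sum>i\<in>I. c i *s x i) = 0 \<longrightarrow> (\<forall>i\<in>I. c i = 0))"

lemma indep_fam_iff:
  assumes "finite I"
  shows "indep_fam I x \<longleftrightarrow> inj_on x I \<and> local.independent (x ` I)"
proof safe
  assume ind: "indep_fam I x"
  show inj: "inj_on x I"
  proof (rule inj_onI, rule ccontr)
    fix i j assume ij: "i \<in> I" "j \<in> I" "x i = x j" "i \<noteq> j"
    define c :: "_ \<Rightarrow> 'a" where "c k = (if k = i then 1 else if k = j then -1 else 0)" for k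
    have "(\<Sum>k\<in>I. c k *s x k) = (\<Sum>k\<in>{i,j}. c k *s x k)"
      using assms ij by (intro sum.mono_neutral_right) (auto simp: c_def)
    also have "\<dots> = 0" using ij by (simp add: c_def)
    finally have "c i = 0" using ind ij by (auto simp: indep_fam_def)
    then show False by (simp add: c_def)
  qed
  assume "local.dependent (x ` I)"
  then obtain u v where u: "(\<Sum>w\<in>x ` I. u w *s w) = 0" "v \<in> x ` I" "u v \<noteq> 0"
    using assms dependent_finite[of "x ` I"] by auto
  then have "(\<Sum>i\<in>I. u (x i) *s x i) = 0" using inj by (simp add: sum.reindex)
  then show False using ind u(2,3) by (auto simp: indep_fam_def)
next
  assume inj: "inj_on x I" and ind: "local.independent (x ` I)"
  show "indep_fam I x"
    unfolding indep_fam_def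
  proof safe
    fix c i assume c: "(\<Sum>i\<in>I. c i *s x i) = 0" "i \<in> I"
    have "(\<Sum>v\<in>x ` I. c (the_inv_into I x v) *s v) = 0"
      using c inj by (simp add: sum.reindex the_inv_into_f_f)
    then have "\<forall>v\<in>x ` I. c (the_inv_into I x v) = 0"
      using independentD[OF ind, of "x ` I" "\<lambda>v. c (the_inv_into I x v)"] assms by auto
    then show "c i = 0" using c(2) inj by (auto simp: the_inv_into_f_f)
  qed
qed

lemma indep_famD: "indep_fam I x \<Longrightarrow> (\<Sum>i\<in>I. c i *s x i) = 0 \<Longrightarrow> i \<in> I \<Longrightarrow> c i = 0"
  by (auto simp: indep_fam_def)

lemma indep_fam_eqD:
  assumes "indep_fam I x" "(\<Sum>i\<in>I. c i *s x i) = (\<Sum>i\<in>I. d i *s x i)" "i \<in> I"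
  shows "c i = d i"
  using indep_famD[OF assms(1), of "\<lambda>i. c i - d i"] assms(2,3)
  by (simp add: scale_left_diff_distrib sum_subtractf)

lemma span_family:
  assumes "finite I"
  shows "y \<in> local.span (x ` I) \<longleftrightarrow> (\<exists>c. y = (\<Sum>i\<in>I. c i *s x i))"
proof
  assume "y \<in> local.span (x ` I)"
  then show "\<exists>c. y = (\<Sum>i\<in>I. c i *s x i)"
  proof (induction rule: span_induct_alt)
    case base
    show ?case by (intro exI[of _ "\<lambda>_. 0"]) simp
  next
    case (step k v y)
    then obtain i c where i: "i \<in> I" "v = x i" "y = (\<Sum>i\<in>I. c i *s x i)" by auto
    have "k *s v + y = (\<Sum>j\<in>I. (c j + (if j = i then k else 0)) *s x j)"
      using i assms by (simp add: scale_left_distrib sum.distrib if_distrib[of "\<lambda>u. u *s _"] cong: if_cong)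
    then show ?case by (rule exI[of "\<lambda>c. k *s v + y = (\<Sum>i\<in>I. c i *s x i)"])
  qed
qed (blast intro: span_sum span_scale span_base)

lemma indep_fam_card_le:
  assumes "finite I" "indep_fam I x" "x ` I \<subseteq> local.span B" "finite B"
  shows "card I \<le> card B"
proof -
  have "inj_on x I" "local.independent (x ` I)" using assms indep_fam_iff by auto
  then show ?thesis
    using independent_span_bound[OF assms(4) _ assms(3)] by (simp add: card_image)
qed

lemma dependent_family:
  assumes "finite I" "x ` I \<subseteq> local.span B" "finite B" "card B < card I"
  obtains c i where "(\<Sum>i\<in>I. c i *s x i) = 0" "i \<in> I" "c i \<noteq> 0"
  using indep_fam_card_le[OF assms(1) _ assms(2,3)] assms(4) unfolding indep_fam_def
  by (meson leD)

lemma indep_fam_insert: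
  assumes "finite I" "i \<notin> I" "indep_fam I x" "x i \<notin> local.span (x ` I)"
  shows "indep_fam (insert i I) x"
proof -
  have "inj_on x I" "local.independent (x ` I)" using assms indep_fam_iff by auto
  moreover have "x i \<notin> x ` I" using assms(4) span_base by blast
  ultimately show ?thesis
    using assms independent_insertI[of "x i" "x ` I"] by (subst indep_fam_iff) auto
qed

lemma indep_fam_mono: "finite J \<Longrightarrow> I \<subseteq> J \<Longrightarrow> indep_fam J x \<Longrightarrow> indep_fam I x"
  by (simp add: indep_fam_iff finite_subset) (meson inj_on_subset independent_mono image_mono)

lemma indep_fam_spans:
  assumes "finite I" "indep_fam I x" "x ` I \<subseteq> local.span B" "finite B" "card B \<le> card I" 
  shows "local.span (x ` I) = local.span B"
proof
  show "local.span (x ` I) \<subseteq> local.span B" using assms(3) by (simp add: span_minimal)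
  show "local.span B \<subseteq> local.span (x ` I)"
  proof (rule ccontr)
    assume "\<not> ?thesis"
    then obtain y where y: "y \<in> local.span B" "y \<notin> local.span (x ` I)" by auto
    have inj: "inj_on x I" and ind: "local.independent (x ` I)" using assms indep_fam_iff by auto
    have "y \<notin> x ` I" using y(2) span_base by blast
    then have "card (insert y (x ` I)) = Suc (card I)" using inj assms(1) by (simp add: card_image)
    moreover have "local.independent (insert y (x ` I))" using ind y(2) by (rule independent_insertI[rotated])
    ultimately have "Suc (card I) \<le> card B"
      using independent_span_bound[OF assms(4), of "insert y (x ` I)"] assms(3) y(1) by auto
    then show False using assms(5) by simp
  qed
qed

lemma indep_basis_of:
  assumes "W \<subseteq> local.span B0" "finite B0"
  obtains B where "B \<subseteq> W" "finite B" "local.independent B" "W \<subseteq> local.span B" "card B \<le> card B0"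
proof -
  obtain B where B: "B \<subseteq> W" "local.independent B" "W \<subseteq> local.span B"
    using maximal_independent_subset[of W] by blast
  have "finite B \<and> card B \<le> card B0"
    using independent_span_bound[OF assms(2) B(2)] B(1) assms(1) by blast
  with B that[of B] show ?thesis by simp
qed

section \<open>The density theorem for operators whose commutant consists of scalars\<close>

context
  fixes W :: "'b set" and S :: "('b \<Rightarrow> 'b) set"
  assumes W: "local.subspace W"
    and S_in: "\<And>f x. f \<in> S \<Longrightarrow> x \<in> W \<Longrightarrow> f x \<in> W"
    and S_add: "\<And>f x y. f \<in> S \<Longrightarrow> x \<in> W \<Longrightarrow> y \<in> W \<Longrightarrow> f (x + y) = f x + f y"
    and S_scale: "\<And>f c x. f \<in> S \<Longrightarrow> x \<in> W \<Longrightarrow> f (c *s x) = c *s f x"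
    and zero_S: "(\<lambda>x. 0) \<in> S"
    and add_S: "\<And>f g. f \<in> S \<Longrightarrow> g \<in> S \<Longrightarrow> (\<lambda>x. f x + g x) \<in> S"
    and scale_S: "\<And>f c. f \<in> S \<Longrightarrow> (\<lambda>x. c *s f x) \<in> S"
    and comp_S: "\<And>f g. f \<in> S \<Longrightarrow> g \<in> S \<Longrightarrow> (\<lambda>x. f (g x)) \<in> S"
    and irred: "\<And>x y. x \<in> W \<Longrightarrow> x \<noteq> 0 \<Longrightarrow> y \<in> W \<Longrightarrow> \<exists>f\<in>S. f x = y"
    and commutant: "\<And>T. (\<And>x. x \<in> W \<Longrightarrow> T x \<in> W) \<Longrightarrow>
       (\<And>x y. x \<in> W \<Longrightarrow> y \<in> W \<Longrightarrow> T (x + y) = T x + T y) \<Longrightarrow>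
       (\<And>c x. x \<in> W \<Longrightarrow> T (c *s x) = c *s T x) \<Longrightarrow>
       (\<And>f x. f \<in> S \<Longrightarrow> x \<in> W \<Longrightarrow> T (f x) = f (T x)) \<Longrightarrow> \<exists>c. \<forall>x\<in>W. T x = c *s x"
begin

private lemma S_zero: "f \<in> S \<Longrightarrow> f 0 = 0"
  using S_scale[of f 0 0] subspace_0[OF W] by simp

private lemma S_diff: "f \<in> S \<Longrightarrow> x \<in> W \<Longrightarrow> y \<in> W \<Longrightarrow> f (x - y) = f x - f y"
  using S_add[of f x "(-1) *s y"] S_scale[of f y "-1"] subspace_scale[OF W, of y "-1"]
  by simp

private lemma S_vanish:
  assumes "f \<in> S" "Z \<subseteq> W" "\<forall>x\<in>Z. f x = 0" "y \<in> local.span Z"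
  shows "f y = 0"
proof -
  have "y \<in> W \<and> f y = 0"
    using assms(4)
  proof (induction rule: span_induct_alt)
    case base
    show ?case using S_zero assms(1) subspace_0[OF W] by simp
  next
    case (step c x y)
    have "x \<in> W" using step assms(2) by blast
    with step assms show ?case
      using S_add[of f "c *s x" y] S_scale[of f x c] subspace_add[OF W] subspace_scale[OF W] by simp
  qed
  then show ?thesis ..
qed

text \<open>If every operator of \<open>S\<close> that kills \<open>Z\<close> and \<open>x\<close>
  also killed \<open>y\<close>, then \<open>s x \<mapsto> s y\<close>, for \<open>s\<close> killing
  \<open>Z\<close>, would be a well-defined map of \<open>W\<close> commuting with \<open>S\<close>,
  hence a scalar \<open>c\<close>. Then \<open>y - c x\<close> would be killed by everything that
  kills \<open>Z\<close>, and the induction hypothesis would put it into the span of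
  \<open>Z\<close>.\<close>

lemma density_separate:
  assumes "finite Z" "Z \<subseteq> W" "y \<in> W" "y \<notin> local.span Z"
  shows "\<exists>f\<in>S. (\<forall>x\<in>Z. f x = 0) \<and> f y \<noteq> 0"
  using assms
proof (induction Z arbitrary: y)
  case empty
  then have "y \<noteq> 0" by auto
  with empty irred[of y y] obtain f where "f \<in> S" "f y = y" by blast
  with \<open>y \<noteq> 0\<close> show ?case by (intro bexI[of _ f]) auto
next
  case (insert x Z)
  show ?case
  proof (cases "x \<in> local.span Z")
    case True
    then have "local.span (insert x Z) = local.span Z" by (rule span_redundant)
    then have "y \<notin> local.span Z" "Z \<subseteq> W" using insert.prems by auto
    then obtain f where f: "f \<in> S" "\<forall>x\<in>Z. f x = 0" "f y \<noteq> 0"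
      using insert.IH[of y] insert.prems(2) by blast
    with True S_vanish[of f Z x] \<open>Z \<subseteq> W\<close> show ?thesis by blast
  next
    case False
    define J where "J = {f \<in> S. \<forall>x\<in>Z. f x = 0}"
    have xW: "x \<in> W" and ZW: "Z \<subseteq> W" using insert.prems by auto
    obtain s0 where s0: "s0 \<in> J" "s0 x \<noteq> 0" using insert.IH[OF ZW xW False] by (auto simp: J_def)
    have JS: "f \<in> S" if "f \<in> J" for f using that by (simp add: J_def)
    have Jadd: "(\<lambda>x. f x + g x) \<in> J" if "f \<in> J" "g \<in> J" for f g
      using that add_S by (auto simp: J_def)
    have Jscale: "(\<lambda>x. c *s f x) \<in> J" if "f \<in> J" for f c
      using that scale_S by (auto simp: J_def)
    have Jcomp: "(\<lambda>x. f (g x)) \<in> J" if "f \<in> S" "g \<in> J" for f g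
      using that comp_S S_zero by (auto simp: J_def)
    \<comment> \<open>Irreducibility carries the nonzero vector \<open>s0 x\<close> to any
      \<open>w\<close>, so that the map \<open>T\<close> below is determined on all of
      \<open>W\<close>.\<close>
    have Jx: "\<exists>s\<in>J. s x = w" if "w \<in> W" for w
    proof -
      have "s0 x \<in> W" using S_in[OF JS[OF s0(1)] xW] .
      then have "\<exists>f\<in>S. f (s0 x) = w" using s0(2) \<open>w \<in> W\<close> by (intro irred)
      then obtain f where f: "f \<in> S" "f (s0 x) = w" ..
      show ?thesis by (rule bexI[where x = "\<lambda>x. f (s0 x)"]) (use f Jcomp[OF f(1) s0(1)] in simp_all)
    qed
    show ?thesis
    proof (rule ccontr)
      assume "\<not> ?thesis"
      then have no: "s y = 0" if "s \<in> J" "s x = 0" for s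
        using that JS[OF that(1)] unfolding J_def by blast
      \<comment> \<open>The choice of the operator is harmless: by \<open>no\<close>, two operators
        of \<open>J\<close> that agree at \<open>x\<close> agree at \<open>y\<close>.\<close>
      define T where "T w = (SOME s. s \<in> J \<and> s x = w) y" for w
      have T: "T (s x) = s y" if s: "s \<in> J" for s
      proof -
        define s' where "s' = (SOME s'. s' \<in> J \<and> s' x = s x)"
        have s': "s' \<in> J \<and> s' x = s x" 
          unfolding s'_def by (rule someI[where x = s]) (simp add: s)
        have "(\<lambda>z. s' z + (-1) *s s z) \<in> J"
          using Jadd[OF conjunct1[OF s'] Jscale[OF s, of "-1"]] .
        then have "s' y + (-1) *s s y = 0" by (rule no) (use s' in simp)
        then show ?thesis by (simp add: T_def s'_def)
      qed
      have "\<exists>c. \<forall>w\<in>W. T w = c *s w"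
      proof (rule commutant)
        fix w assume w: "w \<in> W"
        obtain s where s: "s \<in> J" "s x = w" using Jx[OF w] by blast
        show "T w \<in> W" using T[OF s(1)] s S_in JS insert.prems by auto
        show "T (c *s w) = c *s T w" for c using T[OF Jscale[OF s(1), of c]] T[OF s(1)] s by simp
        show "T (f w) = f (T w)" if "f \<in> S" for f
          using T[OF Jcomp[OF that s(1)]] T[OF s(1)] s by simp
        fix w' assume w': "w' \<in> W"
        obtain s' where s': "s' \<in> J" "s' x = w'" using Jx[OF w'] by blast
        show "T (w + w') = T w + T w'" using T[OF Jadd[OF s(1) s'(1)]] T[OF s(1)] T[OF s'(1)] s s' by simp
      qed
      then obtain c where c: "\<And>w. w \<in> W \<Longrightarrow> T w = c *s w" by auto
      have "s (y - c *s x) = 0" if s: "s \<in> J" for s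
      proof -
        have "s (y - c *s x) = s y - c *s s x"
          using S_diff[OF JS[OF s] insert.prems(2) subspace_scale[OF W xW, of c]]
            S_scale[OF JS[OF s] xW, of c] by simp
        also have "s y = c *s s x" using T[OF s] c[OF S_in[OF JS[OF s] xW]] by simp
        finally show ?thesis by simp
      qed
      moreover have "y - c *s x \<in> W"
        using xW insert.prems subspace_scale[OF W] subspace_diff[OF W] by simp
      ultimately have "y - c *s x \<in> local.span Z" using insert.IH[OF ZW] by (auto simp: J_def)
      then have "(y - c *s x) + c *s x \<in> local.span (insert x Z)"
        by (intro span_add) (auto intro: span_scale span_base span_mono[THEN subsetD, of Z])
      then show False using insert.prems by simp
    qed
  qed
qed

text \<open>Separation gives for each basis vector an operator that kills the other ones;
  irreducibility adjusts its value at the vector itself, and the results are added.\<close>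

lemma density:
  assumes B: "finite B" "B \<subseteq> W" "local.independent B" and t: "\<And>b. b \<in> B \<Longrightarrow> t b \<in> W"
  shows "\<exists>f\<in>S. \<forall>b\<in>B. f b = t b"
proof -
  have "\<exists>f\<in>S. (\<forall>x\<in>B - {b}. f x = 0) \<and> f b = t b" if b: "b \<in> B" for b
  proof -
    have "b \<notin> local.span (B - {b})" using B(3) b by (auto simp: dependent_def)
    then obtain f where f: "f \<in> S" "\<forall>x\<in>B - {b}. f x = 0" "f b \<noteq> 0"
      using density_separate[of "B - {b}" b] B b by blast
    obtain g where g: "g \<in> S" "g (f b) = t b" using irred[of "f b" "t b"] f S_in B b t by blast
    show ?thesis
      by (rule bexI[where x = "\<lambda>x. g (f x)"])
        (use comp_S[OF g(1) f(1)] f(2) g(2) S_zero[OF g(1)] in auto)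
  qed
  then obtain F where F: "\<And>b. b \<in> B \<Longrightarrow> F b \<in> S \<and> (\<forall>x\<in>B - {b}. F b x = 0) \<and> F b b = t b"
    by metis
  have "(\<lambda>x. \<Sum>b\<in>B'. F b x) \<in> S" if "finite B'" "B' \<subseteq> B" for B'
    using that
  proof (induction B')
    case (insert b B')
    then have "(\<lambda>x. F b x + (\<Sum>b\<in>B'. F b x)) \<in> S" by (intro add_S) (use F in auto)
    with insert show ?case by simp
  qed (simp add: zero_S)
  then have "(\<lambda>x. \<Sum>b\<in>B. F b x) \<in> S" using B(1) by blast
  moreover have "(\<Sum>b\<in>B. F b x) = t x" if "x \<in> B" for x
  proof -
    have "(\<Sum>b\<in>B. F b x) = (\<Sum>b\<in>{x}. F b x)"
      using B(1) that F by (intro sum.mono_neutral_right) auto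
    then show ?thesis using F that by simp
  qed
  ultimately show ?thesis by (intro bexI[where x = "\<lambda>x. \<Sum>b\<in>B. F b x"]) simp_all
qed

end

section \<open>Polynomials in a linear operator\<close>

definition lin_on :: "'b set \<Rightarrow> ('b \<Rightarrow> 'b) \<Rightarrow> bool" where
  "lin_on W T \<longleftrightarrow> local.subspace W \<and> (\<forall>x\<in>W. T x \<in> W) \<and> (\<forall>x\<in>W. \<forall>y\<in>W. T (x + y) = T x + T y) \<and>
     (\<forall>c. \<forall>x\<in>W. T (c *s x) = c *s T x)"

lemma lin_onD:
  assumes "lin_on W T"
  shows "local.subspace W" "x \<in> W \<Longrightarrow> T x \<in> W" "x \<in> W \<Longrightarrow> y \<in> W \<Longrightarrow> T (x + y) = T x + T y"
    "x \<in> W \<Longrightarrow> T (c *s x) = c *s T x"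
  using assms by (auto simp: lin_on_def)

lemma lin_on_0: "lin_on W T \<Longrightarrow> T 0 = 0"
  using lin_onD(4)[of W T 0 0] subspace_0[OF lin_onD(1)] by simp

lemma lin_on_sum:
  assumes "lin_on W T" "finite I" "\<And>i. i \<in> I \<Longrightarrow> x i \<in> W"
  shows "T (\<Sum>i\<in>I. c i *s x i) = (\<Sum>i\<in>I. c i *s T (x i))"
  using assms(2,3)
proof (induction I)
  case (insert i I)
  have "(\<Sum>i\<in>I. c i *s x i) \<in> W"
    using insert assms(1) by (auto intro!: subspace_sum subspace_scale simp: lin_on_def)
  then show ?case using insert assms(1) by (auto simp: lin_on_def subspace_scale)
qed (simp add: lin_on_0[OF assms(1)])

lemma lin_on_pow: "lin_on W T \<Longrightarrow> x \<in> W \<Longrightarrow> (T ^^ i) x \<in> W"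
  by (induction i) (auto simp: lin_on_def)

text \<open>The operator \<open>p(T)\<close>. Since \<open>T\<close> is linear only on a subspace,
  it is kept as a function applied to a vector and not as an element of an algebra.\<close>

definition pop :: "('b \<Rightarrow> 'b) \<Rightarrow> 'a poly \<Rightarrow> 'b \<Rightarrow> 'b" where
  "pop T p x = (\<Sum>i\<le>degree p. coeff p i *s (T ^^ i) x)"

lemma pop_bound: "degree p \<le> N \<Longrightarrow> pop T p x = (\<Sum>i\<le>N. coeff p i *s (T ^^ i) x)"
  unfolding pop_def by (intro sum.mono_neutral_left) (auto simp: coeff_eq_0)

lemma pop_0 [simp]: "pop T 0 x = 0" by (simp add: pop_def)

lemma pop_pCons:
  assumes "lin_on W T" "x \<in> W"
  shows "pop T (pCons a p) x = a *s x + T (pop T p x)"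
proof -
  have "pop T (pCons a p) x = (\<Sum>i\<le>Suc (degree p). coeff (pCons a p) i *s (T ^^ i) x)"
    by (rule pop_bound) (simp add: degree_pCons_le)
  also have "\<dots> = a *s x + (\<Sum>i\<le>degree p. coeff p i *s T ((T ^^ i) x))"
    by (subst sum.atMost_Suc_shift) simp
  also have "(\<Sum>i\<le>degree p. coeff p i *s T ((T ^^ i) x)) = T (pop T p x)"
    unfolding pop_def using assms by (subst lin_on_sum[OF assms(1)]) (auto intro: lin_on_pow)
  finally show ?thesis .
qed

lemma pop_in: "lin_on W T \<Longrightarrow> x \<in> W \<Longrightarrow> pop T p x \<in> W"
  unfolding pop_def by (intro subspace_sum subspace_scale lin_on_pow) (auto simp: lin_on_def)

lemma pop_add: "pop T (p + q) x = pop T p x + pop T q x"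
  using pop_bound[of p "max (degree p) (degree q)" T x] pop_bound[of q "max (degree p) (degree q)" T x]
    pop_bound[of "p + q" "max (degree p) (degree q)" T x]
  by (simp add: degree_add_le scale_left_distrib sum.distrib)

lemma pop_smult: "pop T (smult c p) x = c *s pop T p x"
  using pop_bound[of "smult c p" "degree p" T x]
  by (simp add: pop_def degree_smult_le scale_sum_right)

lemma pop_diff: "pop T (p - q) x = pop T p x - pop T q x"
  using pop_add[of T "p - q" q x] by simp

lemma pop_sum: "pop T (\<Sum>i\<in>I. p i) x = (\<Sum>i\<in>I. pop T (p i) x)"
  by (induction I rule: infinite_finite_induct) (auto simp: pop_add)

lemma pop_mult:
  assumes "lin_on W T" "x \<in> W"
  shows "pop T (p * q) x = pop T p (pop T q x)"
proof (induction p)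
  case (pCons a p)
  then show ?case
    using assms by (simp add: pop_add pop_smult pop_pCons[OF assms(1)] pop_in lin_on_0[OF assms(1)])
qed simp

lemma pop_pow: "lin_on W T \<Longrightarrow> x \<in> W \<Longrightarrow> pop T (monom c i) x = c *s (T ^^ i) x"
  by (cases "c = 0")
    (simp_all add: pop_def degree_monom_eq if_distrib[of "\<lambda>u. u *s _"] sum.delta' cong: if_cong)

lemma lin_on_pop:
  assumes "lin_on W T"
  shows "lin_on W (pop T p)"
proof (induction p)
  case 0
  show ?case using assms subspace_0 by (auto simp: lin_on_def)
next
  case (pCons a p)
  show ?case
    unfolding lin_on_def
  proof (intro conjI allI ballI)
    show "local.subspace W" using assms by (simp add: lin_on_def)
    fix x assume x: "x \<in> W"
    show "pop T (pCons a p) x \<in> W" using assms x by (rule pop_in)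
    show "pop T (pCons a p) (c *s x) = c *s pop T (pCons a p) x" for c
      using assms x pCons.IH
      by (simp add: pop_pCons[OF assms] lin_onD subspace_scale scale_right_distrib mult.commute pop_in)
    fix y assume y: "y \<in> W"
    show "pop T (pCons a p) (x + y) = pop T (pCons a p) x + pop T (pCons a p) y"
      using assms x y pCons.IH
      by (simp add: pop_pCons[OF assms] lin_onD subspace_add scale_right_distrib pop_in)
  qed
qed

text \<open>There is one more iterate than the spanning set has elements, hence a linear relation,
  whose coefficients form the polynomial.\<close>

lemma ex_annihilator:
  assumes T: "lin_on W T" and x: "x \<in> W" and B: "finite B" "W \<subseteq> local.span B"
  obtains p where "p \<noteq> 0" "pop T p x = 0" "degree p \<le> card B"
proof -
  have "(\<lambda>i. (T ^^ i) x) ` {..card B} \<subseteq> local.span B" using lin_on_pow[OF T x] B by auto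
  then obtain c i where c: "(\<Sum>i\<le>card B. c i *s (T ^^ i) x) = 0" "i \<le> card B" "c i \<noteq> 0"
    using dependent_family[of "{..card B}" "\<lambda>i. (T ^^ i) x" B] B(1) by (simp add: image_subset_iff) blast
  define p where "p = (\<Sum>i\<le>card B. monom (c i) i)"
  have co: "coeff p j = (if j \<le> card B then c j else 0)" for j
    unfolding p_def by (simp add: coeff_sum sum.delta)
  have "p \<noteq> 0" using co[of i] c by auto
  moreover have "degree p \<le> card B" using co by (intro degree_le) auto
  moreover have "pop T p x = 0" using c(1) pop_bound[OF \<open>degree p \<le> card B\<close>, of T x] co by simp
  ultimately show ?thesis using that[of p] by simp
qed

end

text \<open>Given \<open>w\<close> outside the members of \<open>Q\<close> and \<open>u\<close>
  outside \<open>N\<close>, the line \<open>w + t u\<close> meets each of the subspaces in at most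
  one point, and an infinite field has a parameter left over.\<close>

lemma union_of_subspaces:
  fixes scale :: "'k::field \<Rightarrow> 'v::ab_group_add \<Rightarrow> 'v"
  assumes "vector_space scale" "infinite (UNIV :: 'k set)" "finite Q"
    "\<And>N. N \<in> Q \<Longrightarrow> module.subspace scale N" "module.subspace scale W"
    "\<And>N. N \<in> Q \<Longrightarrow> \<not> W \<subseteq> N"
  shows "\<exists>w\<in>W. \<forall>N\<in>Q. w \<notin> N"
  using assms(3,4,6)
proof (induction Q)
  interpret vector_space scale by fact
  case empty
  then show ?case using subspace_0[OF assms(5)] by auto
next
  interpret vector_space scale by fact
  case (insert N Q)
  have "\<exists>w\<in>W. \<forall>N\<in>Q. w \<notin> N" by (rule insert.IH) (use insert.prems in blast)+
  then obtain w where w: "w \<in> W" "\<forall>N\<in>Q. w \<notin> N" by blast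
  obtain u where u: "u \<in> W" "u \<notin> N" using insert by blast
  have uniq: "t = t'" if M: "M \<in> insert N Q" "w + scale t u \<in> M" "w + scale t' u \<in> M" for M t t'
  proof (rule ccontr)
    assume ne: "t \<noteq> t'"
    have sM: "subspace M" using insert.prems M(1) by blast
    have "(w + scale t u) - (w + scale t' u) \<in> M" using M subspace_diff[OF sM] by blast
    then have "scale (t - t') u \<in> M" by (simp add: scale_left_diff_distrib)
    then have "scale (inverse (t - t')) (scale (t - t') u) \<in> M" using subspace_scale[OF sM] by blast
    then have uM: "u \<in> M" using ne by simp
    then have "(w + scale t u) - scale t u \<in> M" using M subspace_diff[OF sM] subspace_scale[OF sM] by blast
    then have "w \<in> M" by simp
    with uM u(2) w(2) M(1) show False by auto
  qed
  have "finite {t. w + scale t u \<in> M}" if "M \<in> insert N Q" for M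
  proof (cases "\<exists>t. w + scale t u \<in> M")
    case True
    then obtain t where t: "w + scale t u \<in> M" by blast
    have "{t. w + scale t u \<in> M} \<subseteq> {t}" using uniq[OF that _ t] by blast
    then show ?thesis using finite_subset by blast
  qed simp
  then have "finite (\<Union>M\<in>insert N Q. {t. w + scale t u \<in> M})" using insert by blast
  then obtain t where "t \<notin> (\<Union>M\<in>insert N Q. {t. w + scale t u \<in> M})"
    using ex_new_if_finite[OF assms(2)] by blast
  moreover have "w + scale t u \<in> W" using w u subspace_add[OF assms(5)] subspace_scale[OF assms(5)] by blast
  ultimately show ?case by blast
qed

interpretation fv: vec_sp fscale
  by (rule vec_sp.intro) (rule fun_vs.vector_space_axioms)

context vec_sp
begin

lemma max_indep_subfam:
  assumes "finite I"
  obtains J where "J \<subseteq> I" "indep_fam J x" "x ` I \<subseteq> local.span (x ` J)"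
proof -
  obtain B where B: "B \<subseteq> x ` I" "local.independent B" "x ` I \<subseteq> local.span B"
    using maximal_independent_subset[of "x ` I"] by blast
  then obtain J where J: "J \<subseteq> I" "inj_on x J" "B = x ` J" by (auto simp: subset_image_inj)
  then have "indep_fam J x" using B finite_subset[OF J(1) assms] by (simp add: indep_fam_iff)
  then show ?thesis using J B that[of J] by simp
qed

lemma dim_family:
  assumes "finite I" "indep_fam I y" "y ` I \<subseteq> V" "V \<subseteq> local.span (y ` I)"
  shows "dim V = card I"
proof -
  have "inj_on y I" "local.independent (y ` I)" using assms(2) indep_fam_iff[OF assms(1)] by auto
  then show ?thesis using dim_unique[OF assms(3,4)] by (simp add: card_image)
qed

lemma indep_fam_le_dim:
  assumes "finite I" "indep_fam I y" "y ` I \<subseteq> V" "V \<subseteq> local.span B" "finite B"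
  shows "card I \<le> dim V"
proof -
  obtain C where C: "C \<subseteq> V" "finite C" "local.independent C" "V \<subseteq> local.span C"
    using indep_basis_of[OF assms(4,5)] by metis
  have "card I \<le> card C" using assms(1-3) C by (intro indep_fam_card_le) auto
  also have "card C = dim V" using C by (intro dim_unique[symmetric]) auto
  finally show ?thesis .
qed

end

text \<open>Over a finite field, 1 plus the product of all \<open>X - a\<close> has no root.\<close>

lemma infinite_alg_closed: "infinite (UNIV :: 'k::alg_closed_field set)"
proof
  assume fin: "finite (UNIV :: 'k set)"
  define p :: "'k poly" where "p = (\<Prod>a\<in>UNIV. [:-a, 1:])"
  have dp: "degree p = card (UNIV :: 'k set)"
    unfolding p_def by (subst degree_prod_eq_sum_degree) auto
  have "card (UNIV :: 'k set) > 0" using fin by (simp add: card_gt_0_iff)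
  then have "degree (p + 1) > 0" using dp by (subst degree_add_eq_left) auto
  then obtain z where "poly (p + 1) z = 0" using alg_closed_imp_poly_has_root by blast
  moreover have "poly p z = 0" using fin by (simp add: p_def poly_prod)
  ultimately show False by simp
qed

lemma root_factor:
  assumes "poly (p :: 'k::field poly) a = 0"
  obtains q where "p = [:-a, 1:] * q"
  using assms by (metis dvdE poly_eq_0_iff_dvd)

text \<open>The minimal polynomial \<open>p\<close> on \<open>W\<close> is already the annihilator
  of a single vector. For each root \<open>a\<close> the vectors killed by
  \<open>p / (X - a)\<close> form a proper subspace, because \<open>p\<close> has least degree, and
  some vector avoids these finitely many subspaces.\<close>

lemma ex_min_vector:
  fixes scale :: "'k::alg_closed_field \<Rightarrow> 'v::ab_group_add \<Rightarrow> 'v"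
  assumes "vec_sp scale" and T: "vec_sp.lin_on scale W T" and B: "finite B" "W \<subseteq> module.span scale B"
  shows "\<exists>w\<in>W. \<exists>p. p \<noteq> 0 \<and> (\<forall>x\<in>W. vec_sp.pop scale T p x = 0) \<and>
    (\<forall>f. f \<noteq> 0 \<longrightarrow> vec_sp.pop scale T f w = 0 \<longrightarrow> degree p \<le> degree f)"
proof -
  interpret vec_sp scale by fact
  have W: "subspace W" using T by (simp add: lin_on_def)
  obtain C where C: "C \<subseteq> W" "finite C" "W \<subseteq> span C"
    using indep_basis_of[OF B(2,1)] by metis
  define kills where "kills p \<longleftrightarrow> p \<noteq> 0 \<and> (\<forall>x\<in>W. pop T p x = 0)" for p
  have "\<exists>p. p \<noteq> 0 \<and> pop T p x = 0" if "x \<in> W" for x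
    using ex_annihilator[OF T that B] by metis
  then obtain P where P: "\<And>x. x \<in> W \<Longrightarrow> P x \<noteq> 0 \<and> pop T (P x) x = 0" by metis
  have "kills (\<Prod>x\<in>C. P x)"
    unfolding kills_def
  proof (intro conjI ballI)
    show "(\<Prod>x\<in>C. P x) \<noteq> 0" using C P by (subst prod_zero_iff) auto
    have Cz: "pop T (\<Prod>x\<in>C. P x) c = 0" if "c \<in> C" for c
    proof -
      have cW: "c \<in> W" using that C by blast
      have "(\<Prod>x\<in>C. P x) = (\<Prod>x\<in>C - {c}. P x) * P c"
        using C(2) that by (simp add: prod.remove mult.commute)
      then show ?thesis
        using P[OF cW] pop_mult[OF T cW] lin_on_0[OF lin_on_pop[OF T]] by simp
    qed
    fix x assume "x \<in> W"
    then have "x \<in> span C" using C by blast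
    then show "pop T (\<Prod>x\<in>C. P x) x = 0"
    proof -
      obtain c where c: "x = (\<Sum>v\<in>C. scale (c v) v)"
        using \<open>x \<in> span C\<close> span_family[OF C(2), of x "\<lambda>v. v"] by auto
      show ?thesis
        unfolding c using C Cz by (subst lin_on_sum[OF lin_on_pop[OF T] C(2)]) auto
    qed
  qed
  then obtain p where p: "kills p" and pmin: "\<And>q. kills q \<Longrightarrow> degree p \<le> degree q"
    using exists_least_iff[of "\<lambda>d. \<exists>p. kills p \<and> degree p = d"] by (metis not_le)
  have p0: "p \<noteq> 0" using p by (simp add: kills_def)
  define N where "N a = {x \<in> W. pop T (p div [:-a, 1:]) x = 0}" for a
  have sub: "subspace (N a)" for a
  proof (rule subspaceI)
    have L: "lin_on W (pop T (p div [:-a, 1:]))" using T by (rule lin_on_pop)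
    show "0 \<in> N a" using W L by (simp add: N_def subspace_0 lin_on_0)
    show "x + y \<in> N a" if "x \<in> N a" "y \<in> N a" for x y
      using that lin_onD(3)[OF L, of x y] subspace_add[OF W, of x y] by (simp add: N_def)
    show "scale c x \<in> N a" if "x \<in> N a" for c x
      using that lin_onD(4)[OF L, of x c] subspace_scale[OF W, of x c] by (simp add: N_def)
  qed
  have proper: "\<not> W \<subseteq> N a" if ra: "poly p a = 0" for a
  proof
    assume "W \<subseteq> N a"
    obtain q where q: "p = [:-a, 1:] * q" by (rule root_factor[OF ra])
    have "q \<noteq> 0" using q p0 by auto
    have "p div [:-a, 1:] = q" unfolding q by (rule nonzero_mult_div_cancel_left) simp
    then have "kills q"
      unfolding kills_def using subsetD[OF \<open>W \<subseteq> N a\<close>] \<open>q \<noteq> 0\<close> by (simp add: N_def)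
    moreover have "degree p = Suc (degree q)" unfolding q using \<open>q \<noteq> 0\<close> by (subst degree_mult_eq) auto
    ultimately show False using pmin[of q] by simp
  qed
  have fN: "finite (N ` {a. poly p a = 0})" using p0 poly_roots_finite by blast
  then obtain w where w: "w \<in> W" "\<And>a. poly p a = 0 \<Longrightarrow> w \<notin> N a"
  proof -
    have "\<exists>w\<in>W. \<forall>M\<in>N ` {a. poly p a = 0}. w \<notin> M"
      by (rule union_of_subspaces[OF vector_space_axioms infinite_alg_closed fN _ W])
        (use sub proper in blast)+
    then show ?thesis using that by blast
  qed
  have "degree p \<le> degree f" if f: "f \<noteq> 0" "pop T f w = 0" for f
  proof -
    obtain f' where f': "f' \<noteq> 0 \<and> pop T f' w = 0"
      and min: "\<And>g. g \<noteq> 0 \<Longrightarrow> pop T g w = 0 \<Longrightarrow> degree f' \<le> degree g"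
      using exists_least_iff[of "\<lambda>d. \<exists>g. (g \<noteq> 0 \<and> pop T g w = 0) \<and> degree g = d"] f
      by (metis not_le)
    have pw: "pop T p w = 0" using p w by (simp add: kills_def)
    \<comment> \<open>The least annihilator \<open>f'\<close> of \<open>w\<close> divides
      \<open>p\<close>; a root of the quotient would put \<open>w\<close> into one of the avoided
      subspaces.\<close>
    have "p = (p div f') * f' + p mod f'" by simp
    then have "pop T p w = pop T (p div f' * f') w + pop T (p mod f') w" by (metis pop_add)
    moreover have "pop T (p div f' * f') w = 0"
      using pop_mult[OF T w(1)] f' lin_on_0[OF lin_on_pop[OF T]] by simp
    ultimately have "pop T (p mod f') w = 0" using pw by simp
    then have "p mod f' = 0" using min[of "p mod f'"] degree_mod_less[of f' p] f' by force
    then obtain g where g: "p = f' * g" by (metis dvd_def mod_eq_0_iff_dvd)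
    have g0: "g \<noteq> 0" "f' \<noteq> 0" using g p0 by auto
    have "degree g = 0"
    proof (rule ccontr)
      assume "degree g \<noteq> 0"
      then obtain a where a: "poly g a = 0" using alg_closed_imp_poly_has_root by blast
      obtain g' where g': "g = [:-a, 1:] * g'" by (rule root_factor[OF a])
      have "p div [:-a, 1:] = g' * f'"
        unfolding g g' by (subst mult.left_commute) (subst nonzero_mult_div_cancel_left, simp_all)
      moreover have "pop T (g' * f') w = 0"
        using pop_mult[OF T w(1)] f' lin_on_0[OF lin_on_pop[OF T]] by simp
      ultimately have "w \<in> N a" using w by (simp add: N_def)
      moreover have "poly p a = 0" using a g by simp
      ultimately show False using w(2) by blast
    qed
    then have "degree p = degree f'" using g g0 by (simp add: degree_mult_eq)
    then show ?thesis using min f by simp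
  qed
  then show ?thesis using w(1) p by (auto simp: kills_def)
qed

text \<open>Standard basis vectors; for pairs of indices these are the matrix units.\<close>

definition dlt :: "'i \<Rightarrow> 'i \<Rightarrow> 'k::field" where
  "dlt i = (\<lambda>j. if j = i then 1 else 0)"

lemma sum_fun_apply: "(\<Sum>i\<in>I. f i) x = (\<Sum>i\<in>I. f i x)" for f :: "'i \<Rightarrow> 'j \<Rightarrow> 'k::comm_monoid_add"
  by (induction I rule: infinite_finite_induct) auto

lemma fscale_apply [simp]: "fscale c x i = c * x i"
  by (simp add: fscale_def)

lemma coord_expand:
  assumes "finite I" "x \<in> coord_space I"
  shows "x = (\<Sum>i\<in>I. fscale (x i) (dlt i))"
proof
  fix j
  show "x j = (\<Sum>i\<in>I. fscale (x i) (dlt i)) j"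
    using assms by (cases "j \<in> I") (auto simp: sum_fun_apply dlt_def coord_space_def if_distrib cong: if_cong)
qed

lemma dlt_in: "i \<in> I \<Longrightarrow> dlt i \<in> coord_space I"
  by (auto simp: dlt_def coord_space_def)

lemma subspace_coord: "fun_vs.subspace (coord_space I)"
  by (intro fun_vs.subspaceI) (auto simp: coord_space_def)

lemma coord_span: "finite I \<Longrightarrow> coord_space I \<subseteq> fun_vs.span (dlt ` I)"
  by (subst fv.span_family subset_eq)+ (auto intro: coord_expand simp: fv.span_family)

lemma indep_coord:
  assumes "finite I" "finite J" "fv.indep_fam J x" "x ` J \<subseteq> coord_space I"
  shows "card J \<le> card I"
proof -
  have "card J \<le> card (dlt ` I :: ('a \<Rightarrow> 'c) set)"
    using assms coord_span[OF assms(1)] by (intro fv.indep_fam_card_le) auto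
  also have "\<dots> \<le> card I" using assms(1) by (rule card_image_le)
  finally show ?thesis .
qed

lemma inj_dlt: "inj_on (dlt :: _ \<Rightarrow> _ \<Rightarrow> 'k::field) I"
  by (rule inj_onI) (metis dlt_def zero_neq_one)

lemma indep_dlt:
  assumes "finite I"
  shows "fv.indep_fam I (dlt :: _ \<Rightarrow> _ \<Rightarrow> 'k::field)"
  unfolding fv.indep_fam_def
proof safe
  fix c :: "'a \<Rightarrow> 'k" and i assume "(\<Sum>i\<in>I. fscale (c i) (dlt i)) = 0" "i \<in> I"
  then have "(\<Sum>j\<in>I. fscale (c j) (dlt j)) i = 0" by simp
  then show "c i = 0" using assms \<open>i \<in> I\<close> by (simp add: sum_fun_apply dlt_def if_distrib cong: if_cong)
qed

lemma dim_coord: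
  assumes "finite I"
  shows "fun_vs.dim (coord_space I :: (_ \<Rightarrow> 'k::field) set) = card I"
proof -
  have "fun_vs.independent (dlt ` I :: (_ \<Rightarrow> 'k) set)" using indep_dlt[OF assms] fv.indep_fam_iff[OF assms] by blast
  then have "fun_vs.dim (coord_space I :: (_ \<Rightarrow> 'k::field) set) = card (dlt ` I :: (_ \<Rightarrow> 'k) set)"
    using coord_span[OF assms] dlt_in by (intro fun_vs.dim_unique) auto
  then show ?thesis by (simp add: card_image inj_dlt)
qed

section \<open>Self-adjoint operators of a nondegenerate alternating form\<close>

lemma selfadjoint_min_degree:
  fixes scale :: "'k::alg_closed_field \<Rightarrow> 'v::ab_group_add \<Rightarrow> 'v" and \<omega> :: "'v \<Rightarrow> 'v \<Rightarrow> 'k"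
  assumes "vec_sp scale" and T: "vec_sp.lin_on scale W T" and B: "finite B" "W \<subseteq> module.span scale B"
    and two: "(2::'k) \<noteq> 0"
    and add1: "\<And>x y z. \<omega> (x + y) z = \<omega> x z + \<omega> y z" and sc1: "\<And>c x z. \<omega> (scale c x) z = c * \<omega> x z"
    and alt: "\<And>x y. \<omega> y x = - \<omega> x y"
    and nondeg: "\<And>x. x \<in> W \<Longrightarrow> (\<And>y. y \<in> W \<Longrightarrow> \<omega> x y = 0) \<Longrightarrow> x = 0"
    and self: "\<And>x y. x \<in> W \<Longrightarrow> y \<in> W \<Longrightarrow> \<omega> (T x) y = \<omega> x (T y)"
  shows "\<exists>p. p \<noteq> 0 \<and> (\<forall>x\<in>W. vec_sp.pop scale T p x = 0) \<and> 2 * degree p \<le> card B"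
proof -
  interpret vec_sp scale by fact
  have W: "subspace W" using T by (simp add: lin_on_def)
  obtain w p where w: "w \<in> W" and p: "p \<noteq> 0" "\<And>x. x \<in> W \<Longrightarrow> pop T p x = 0"
    and min: "\<And>f. f \<noteq> 0 \<Longrightarrow> pop T f w = 0 \<Longrightarrow> degree p \<le> degree f"
    using ex_min_vector[OF assms(1) T B] by blast
  define d where "d = degree p"
  define y where "y i = (T ^^ i) w" for i
  have yW: "y i \<in> W" for i unfolding y_def using T w by (rule lin_on_pow)
  have Ty: "T (y i) = y (Suc i)" for i by (simp add: y_def)
  have ind: "indep_fam {..<d} y"
    unfolding indep_fam_def
  proof safe
    fix c i assume c: "(\<Sum>i<d. scale (c i) (y i)) = 0" and i: "i < d"
    define f where "f = (\<Sum>i<d. monom (c i) i)"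
    have co: "coeff f j = (if j < d then c j else 0)" for j
      unfolding f_def by (simp add: coeff_sum)
    have "pop T f w = (\<Sum>i<d. scale (c i) (y i))"
      unfolding f_def pop_sum y_def by (simp add: pop_pow[OF T w])
    then have "f = 0 \<or> d \<le> degree f" using min[of f] c by (auto simp: d_def)
    moreover have "degree f < d" using i co by (intro degree_lessI) auto
    ultimately have "f = 0" by simp
    then show "c i = 0" using co[of i] i by simp
  qed
  \<comment> \<open>Self-adjointness makes the pairing of two iterates depend only on the sum of
    their indices. Together with the change of sign under exchange this makes the span of the
    iterates isotropic, so that it has at most half of the dimension.\<close>
  have shift: "\<omega> (y i) (y (j + k)) = \<omega> (y (i + k)) (y j)" for i j k
  proof (induction k arbitrary: i)
    case (Suc k)
    have "\<omega> (y i) (y (j + Suc k)) = \<omega> (y (Suc i)) (y (j + k))"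
      using self[OF yW yW, of i "j + k"] by (simp add: Ty)
    then show ?case using Suc by simp
  qed simp
  have neg_self: "c = 0" if "c = - c" for c :: 'k
  proof -
    have "2 * c = 0" using that by (metis add.right_inverse mult_2)
    then show ?thesis using two by simp
  qed
  have self0: "\<omega> x x = 0" for x by (rule neg_self) (rule alt)
  have iso0: "\<omega> (y i) (y j) = 0" if "i \<le> j" for i j
  proof (cases "even (j - i)")
    case True
    then obtain k where "j - i = 2 * k" by (elim evenE)
    then have "j = i + k + k" using that by simp
    then show ?thesis using shift[of i "i + k" k] self0 by simp
  next
    case False
    then obtain k where "j - i = 2 * k + 1" by (elim oddE)
    then have "j = Suc (i + k) + k" using that by simp
    then have "\<omega> (y i) (y j) = \<omega> (y (i + k)) (y (Suc (i + k)))" using shift[of i "Suc (i + k)" k] by simp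
    also have "\<dots> = \<omega> (y (Suc (i + k))) (y (i + k))" using self[OF yW yW, of "i + k" "i + k"] by (simp add: Ty)
    also have "\<dots> = - \<omega> (y (i + k)) (y (Suc (i + k)))" by (rule alt)
    also have "\<omega> (y (i + k)) (y (Suc (i + k))) = \<omega> (y i) (y j)"
      using \<open>\<omega> (y i) (y j) = \<omega> (y (i + k)) (y (Suc (i + k)))\<close> by simp
    finally show ?thesis by (rule neg_self)
  qed
  then have iso: "\<omega> (y i) (y j) = 0" for i j
    by (cases "i \<le> j") (use alt[of "y j" "y i"] in auto)
  have "2 * d \<le> card B"
  proof (rule ccontr)
    assume "\<not> ?thesis"
    define Y where "Y = y ` {..<d}"
    have Y: "independent Y" "card Y = d" "Y \<subseteq> W" "finite Y"
      using ind yW by (auto simp: Y_def indep_fam_iff card_image)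
    obtain C where C: "Y \<subseteq> C" "C \<subseteq> W" "independent C" "W \<subseteq> span C"
      using maximal_independent_subset_extend[OF Y(3,1)] by blast
    have fC: "finite C" "card C \<le> card B" using independent_span_bound[OF B(1) C(3)] C(2) B(2) by auto
    define Z where "Z = C - Y"
    have fZ: "finite Z" using fC by (simp add: Z_def)
    have cZ: "card Z < d" using \<open>\<not> 2 * d \<le> card B\<close> fC C(1) Y by (simp add: Z_def card_Diff_subset)
    \<comment> \<open>\<open>h i\<close> records the pairings of \<open>y i\<close> with the
      complement \<open>Z\<close>. It has fewer than \<open>d\<close> coordinates, so some
      nontrivial combination of the iterates is orthogonal to \<open>Z\<close> and, by isotropy, to
      all of \<open>W\<close>.\<close>
    define h where "h i = (\<lambda>z. if z \<in> Z then \<omega> (y i) z else 0)" for i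
    have "h ` {..<d} \<subseteq> coord_space Z" by (auto simp: h_def coord_space_def)
    then have "\<not> fv.indep_fam {..<d} h" using indep_coord[OF fZ, of "{..<d}" h] cZ by auto
    then obtain c i where c: "(\<Sum>i<d. fscale (c i) (h i)) = 0" "i < d" "c i \<noteq> 0"
      by (auto simp: fv.indep_fam_def)
    define x where "x = (\<Sum>i<d. scale (c i) (y i))"
    have xW: "x \<in> W" unfolding x_def using W yW by (intro subspace_sum subspace_scale)
    have om_sum: "\<omega> (\<Sum>i<k. scale (c i) (y i)) z = (\<Sum>i<k. c i * \<omega> (y i) z)" for k z
      using sc1[of 0 0 z] by (induction k) (auto simp: add1 sc1)
    have "\<omega> x z = 0" if "z \<in> C" for z
    proof (cases "z \<in> Y")
      case True
      then show ?thesis unfolding x_def om_sum using iso by (auto simp: Y_def)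
    next
      case False
      then have "(\<Sum>i<d. fscale (c i) (h i)) z = (\<Sum>i<d. c i * \<omega> (y i) z)"
        using that by (simp add: sum_fun_apply h_def Z_def)
      then show ?thesis unfolding x_def om_sum using c(1) by simp
    qed
    moreover have "\<omega> x z = 0" if "z \<in> span C" "\<And>z. z \<in> C \<Longrightarrow> \<omega> x z = 0" for z
      using that(1)
    proof (induction rule: span_induct_alt)
      case base
      show ?case using alt[of x 0] sc1[of 0 0 x] by simp
    next
      case (step k u v)
      then show ?case using that(2) alt[of x] add1 sc1 by (metis add.right_neutral mult_zero_right neg_equal_0_iff_equal)
    qed
    ultimately have "x = 0" using nondeg[OF xW] C(4) by blast
    then have "c i = 0" using indep_famD[OF ind] c(2) by (simp add: x_def)
    with c(3) show False by simp
  qed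
  then show ?thesis using p by (auto simp: d_def)
qed

section \<open>Alternating matrices\<close>

type_synonym 'k mtx = "nat \<times> nat \<Rightarrow> 'k"

text \<open>The size of a matrix is encoded in its support. Matrices are thereby vectors of a
  coordinate space, and all of the linear algebra for functions applies to them.\<close>

definition mats :: "nat \<Rightarrow> 'k::field mtx set" where
  "mats n = coord_space ({..<n} \<times> {..<n})"

definition mm :: "nat \<Rightarrow> 'k::field mtx \<Rightarrow> 'k mtx \<Rightarrow> 'k mtx" where
  "mm n A B = (\<lambda>(i, j). \<Sum>k<n. A (i, k) * B (k, j))"

definition idm :: "nat \<Rightarrow> 'k::field mtx" where
  "idm n = (\<lambda>(i, j). if i = j \<and> i < n then 1 else 0)"

definition mt :: "'k mtx \<Rightarrow> 'k mtx" where
  "mt A = (\<lambda>(i, j). A (j, i))"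

definition mv :: "nat \<Rightarrow> 'k::field mtx \<Rightarrow> (nat \<Rightarrow> 'k) \<Rightarrow> nat \<Rightarrow> 'k" where
  "mv n A v = (\<lambda>i. \<Sum>k<n. A (i, k) * v k)"

definition dot :: "nat \<Rightarrow> (nat \<Rightarrow> 'k::field) \<Rightarrow> (nat \<Rightarrow> 'k) \<Rightarrow> 'k" where
  "dot n v w = (\<Sum>i<n. v i * w i)"

definition mpow :: "nat \<Rightarrow> 'k::field mtx \<Rightarrow> nat \<Rightarrow> 'k mtx" where
  "mpow n A k = (mm n A ^^ k) (idm n)"

definition outer :: "(nat \<Rightarrow> 'k::field) \<Rightarrow> (nat \<Rightarrow> 'k) \<Rightarrow> 'k mtx" where
  "outer u v = (\<lambda>(i, j). u i * v j)"

lemma mm_apply: "mm n A B (i, j) = (\<Sum>k<n. A (i, k) * B (k, j))" by (simp add: mm_def)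
lemma mt_apply [simp]: "mt A (i, j) = A (j, i)" by (simp add: mt_def)
lemma idm_apply: "idm n (i, j) = (if i = j \<and> i < n then 1 else 0)" by (simp add: idm_def)
lemma outer_apply [simp]: "outer u v (i, j) = u i * v j" by (simp add: outer_def)

lemma mtx_eqI: "(\<And>i j. A (i, j) = B (i, j)) \<Longrightarrow> A = B" for A B :: "'k mtx"
  by auto

lemma mats_iff: "A \<in> mats n \<longleftrightarrow> (\<forall>i j. \<not> (i < n \<and> j < n) \<longrightarrow> A (i, j) = 0)"
  by (auto simp: mats_def coord_space_def)

lemma matsD: "A \<in> mats n \<Longrightarrow> \<not> (i < n \<and> j < n) \<Longrightarrow> A (i, j) = 0"
  by (auto simp: mats_iff)

lemma subspace_mats: "fun_vs.subspace (mats n)"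
  unfolding mats_def by (rule subspace_coord)

lemma mm_assoc: "mm n (mm n A B) C = mm n A (mm n B C)"
proof (rule mtx_eqI)
  fix i j
  have "mm n (mm n A B) C (i, j) = (\<Sum>k<n. \<Sum>l<n. A (i, l) * B (l, k) * C (k, j))"
    by (simp add: mm_apply sum_distrib_right)
  also have "\<dots> = (\<Sum>l<n. \<Sum>k<n. A (i, l) * B (l, k) * C (k, j))" by (rule sum.swap)
  also have "\<dots> = mm n A (mm n B C) (i, j)" by (simp add: mm_apply sum_distrib_left mult.assoc)
  finally show "mm n (mm n A B) C (i, j) = mm n A (mm n B C) (i, j)" .
qed

lemma mm_in [simp]: "A \<in> mats n \<Longrightarrow> B \<in> mats n \<Longrightarrow> mm n A B \<in> mats n"
  by (auto simp: mats_iff mm_apply)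

lemma idm_in [simp]: "idm n \<in> mats n" by (auto simp: mats_iff idm_apply)

lemma mt_in [simp]: "mt A \<in> mats n \<longleftrightarrow> A \<in> mats n" by (auto simp: mats_iff)

lemma mm_idl: "A \<in> mats n \<Longrightarrow> mm n (idm n) A = A"
proof (rule mtx_eqI)
  fix i j assume A: "A \<in> mats n"
  have "mm n (idm n) A (i, j) = (\<Sum>k<n. if k = i then A (i, j) else 0)"
    unfolding mm_apply by (intro sum.cong) (auto simp: idm_apply)
  then show "mm n (idm n) A (i, j) = A (i, j)" using matsD[OF A] by simp
qed

lemma mm_add_left: "mm n (A + B) C = mm n A C + mm n B C"
  by (rule mtx_eqI) (simp add: mm_apply distrib_right sum.distrib)

lemma mm_add_right: "mm n A (B + C) = mm n A B + mm n A C"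
  by (rule mtx_eqI) (simp add: mm_apply distrib_left sum.distrib)

lemma mm_uminus_left: "mm n (- A) C = - mm n A C"
  by (rule mtx_eqI) (simp add: mm_apply sum_negf)

lemma mm_uminus_right: "mm n A (- C) = - mm n A C"
  by (rule mtx_eqI) (simp add: mm_apply sum_negf)

lemma mm_diff_left: "mm n (A - B) C = mm n A C - mm n B C"
  by (rule mtx_eqI) (simp add: mm_apply left_diff_distrib sum_subtractf)

lemma mm_diff_right: "mm n A (B - C) = mm n A B - mm n A C"
  by (rule mtx_eqI) (simp add: mm_apply right_diff_distrib sum_subtractf)

lemma mm_fscale_left: "mm n (fscale c A) B = fscale c (mm n A B)"
  by (rule mtx_eqI) (simp add: mm_apply sum_distrib_left mult.assoc)

lemma mm_fscale_right: "mm n A (fscale c B) = fscale c (mm n A B)"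
  by (rule mtx_eqI) (simp add: mm_apply sum_distrib_left mult.left_commute)

lemma mm_0_left [simp]: "mm n 0 A = 0" by (rule mtx_eqI) (simp add: mm_apply)
lemma mm_0_right [simp]: "mm n A 0 = 0" by (rule mtx_eqI) (simp add: mm_apply)

lemma mm_sum_left: "mm n (\<Sum>i\<in>I. f i) A = (\<Sum>i\<in>I. mm n (f i) A)"
  by (induction I rule: infinite_finite_induct)
    (simp_all only: sum.infinite sum.empty sum.insert not_False_eq_True mm_0_left mm_add_left)

lemma mm_sum_right: "mm n A (\<Sum>i\<in>I. f i) = (\<Sum>i\<in>I. mm n A (f i))"
  by (induction I rule: infinite_finite_induct)
    (simp_all only: sum.infinite sum.empty sum.insert not_False_eq_True mm_0_right mm_add_right)

lemma mt_mm: "mt (mm n A B) = mm n (mt B) (mt A)"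
  by (rule mtx_eqI) (simp add: mm_apply mult.commute)

lemma mt_mt [simp]: "mt (mt A) = A" by (rule mtx_eqI) simp
lemma mt_add: "mt (A + B) = mt A + mt B" by (rule mtx_eqI) simp
lemma mt_diff: "mt (A - B) = mt A - mt B" for A :: "'k::field mtx" by (rule mtx_eqI) simp
lemma mt_fscale: "mt (fscale c A) = fscale c (mt A)" by (rule mtx_eqI) simp
lemma mt_0 [simp]: "mt 0 = (0 :: 'k::field mtx)" by (rule mtx_eqI) simp
lemma mt_idm [simp]: "mt (idm n) = idm n" by (rule mtx_eqI) (auto simp: idm_apply)
lemma mm_idr: "A \<in> mats n \<Longrightarrow> mm n A (idm n) = A"
  using arg_cong[OF mm_idl[of "mt A" n], of mt] by (simp add: mt_mm)

lemma mt_sum: "mt (\<Sum>i\<in>I. f i) = (\<Sum>i\<in>I. mt (f i))" for f :: "_ \<Rightarrow> 'k::field mtx"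
  by (induction I rule: infinite_finite_induct)
    (simp_all only: sum.infinite sum.empty sum.insert not_False_eq_True mt_0 mt_add)
lemma mt_outer [simp]: "mt (outer u v) = outer v u" by (rule mtx_eqI) (simp add: mult.commute)

lemma dlt_pair: "dlt (i, j) (k, l) = (if k = i \<and> l = j then 1 else 0)"
  by (simp add: dlt_def)

lemma dlt_mats [simp]: "i < n \<Longrightarrow> j < n \<Longrightarrow> dlt (i, j) \<in> mats n"
  by (simp add: mats_def dlt_in)

lemma mm_dlt_right: "a < n \<Longrightarrow> mm n A (dlt (a, l)) (i, j) = (if j = l then A (i, a) else 0)"
  by (simp add: mm_apply dlt_pair if_distrib[of "\<lambda>u. _ * u"] cong: if_cong)

lemma mm_dlt_left: "a < n \<Longrightarrow> mm n (dlt (l, a)) A (i, j) = (if i = l then A (a, j) else 0)"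
  by (simp add: mm_apply dlt_pair if_distrib[of "\<lambda>u. u * _"] cong: if_cong)

lemma mats_expand: "A \<in> mats n \<Longrightarrow> A = (\<Sum>(i, j)\<in>{..<n} \<times> {..<n}. fscale (A (i, j)) (dlt (i, j)))"
  using coord_expand[of "{..<n} \<times> {..<n}" A] by (simp add: mats_def case_prod_unfold)

lemma idm_expand: "idm n = (\<Sum>i<n. dlt (i, i))"
  by (rule mtx_eqI) (auto simp: idm_apply sum_fun_apply dlt_pair sum.delta' cong: if_cong conj_cong)

lemma dim_mats: "fun_vs.dim (mats n :: 'k::field mtx set) = n * n"
  unfolding mats_def by (subst dim_coord) auto

lemma mv_mm: "mv n (mm n A B) v = mv n A (mv n B v)"
proof
  fix i
  have "mv n (mm n A B) v i = (\<Sum>k<n. \<Sum>l<n. A (i, l) * B (l, k) * v k)"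
    by (simp add: mv_def mm_apply sum_distrib_right)
  also have "\<dots> = (\<Sum>l<n. \<Sum>k<n. A (i, l) * B (l, k) * v k)" by (rule sum.swap)
  also have "\<dots> = mv n A (mv n B v) i" by (simp add: mv_def sum_distrib_left mult.assoc)
  finally show "mv n (mm n A B) v i = mv n A (mv n B v) i" .
qed

lemma mv_idm: "v \<in> coord_space {..<n} \<Longrightarrow> mv n (idm n) v = v"
proof
  fix i assume v: "v \<in> coord_space {..<n}"
  have "mv n (idm n) v i = (\<Sum>k<n. if k = i then v i else 0)"
    unfolding mv_def by (intro sum.cong) (auto simp: idm_apply)
  then show "mv n (idm n) v i = v i" using v by (simp add: coord_space_def)
qed

lemma mv_in [simp]: "A \<in> mats n \<Longrightarrow> mv n A v \<in> coord_space {..<n}"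
  by (auto simp: mv_def coord_space_def mats_iff)

lemma mv_add: "mv n A (v + w) = mv n A v + mv n A w"
  by (rule ext) (simp add: mv_def distrib_left sum.distrib)

lemma mv_add_mat: "mv n (A + B) v = mv n A v + mv n B v"
  by (rule ext) (simp add: mv_def distrib_right sum.distrib)

lemma mv_fscale: "mv n A (fscale c v) = fscale c (mv n A v)"
  by (rule ext) (simp add: mv_def sum_distrib_left mult.left_commute)

lemma mv_fscale_mat: "mv n (fscale c A) v = fscale c (mv n A v)"
  by (rule ext) (simp add: mv_def sum_distrib_left mult.assoc)

lemma mv_dlt: "a < n \<Longrightarrow> mv n A (dlt a) i = A (i, a)"
  by (simp add: mv_def dlt_def if_distrib[of "\<lambda>u. _ * u"] cong: if_cong)

lemma dot_mv: "dot n (mv n A v) w = dot n v (mv n (mt A) w)"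
proof -
  have "dot n (mv n A v) w = (\<Sum>i<n. \<Sum>k<n. A (i, k) * v k * w i)"
    by (simp add: dot_def mv_def sum_distrib_right)
  also have "\<dots> = (\<Sum>k<n. \<Sum>i<n. A (i, k) * v k * w i)" by (rule sum.swap)
  also have "\<dots> = dot n v (mv n (mt A) w)"
    by (simp add: dot_def mv_def sum_distrib_left mult_ac)
  finally show ?thesis .
qed

lemma dot_commute: "dot n v w = dot n w v" by (simp add: dot_def mult.commute)
lemma dot_add: "dot n (v + v') w = dot n v w + dot n v' w"
  by (simp add: dot_def distrib_right sum.distrib)
lemma dot_fscale: "dot n (fscale c v) w = c * dot n v w"
  by (simp add: dot_def sum_distrib_left mult.assoc)
lemma dot_uminus: "dot n v (- w) = - dot n v w"
  by (simp add: dot_def sum_negf)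
lemma dot_dlt: "a < n \<Longrightarrow> dot n v (dlt a) = v a"
  by (simp add: dot_def dlt_def if_distrib[of "\<lambda>u. _ * u"] cong: if_cong)

lemma mm_outer: "mm n (outer u v) (outer w z) = fscale (dot n v w) (outer u z)"
  by (rule mtx_eqI) (simp add: mm_apply dot_def sum_distrib_left sum_distrib_right mult_ac)

lemma mpow_0 [simp]: "mpow n A 0 = idm n" by (simp add: mpow_def)
lemma mpow_Suc: "mpow n A (Suc k) = mm n A (mpow n A k)" by (simp add: mpow_def)
lemma mpow_in [simp]: "A \<in> mats n \<Longrightarrow> mpow n A k \<in> mats n"
  by (induction k) (auto simp: mpow_Suc)

lemma mpow_comm: "A \<in> mats n \<Longrightarrow> mm n (mpow n A k) A = mm n A (mpow n A k)"
  by (induction k) (auto simp: mpow_Suc mm_idl mm_idr mm_assoc)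

lemma mt_mpow: "A \<in> mats n \<Longrightarrow> mt (mpow n A k) = mpow n (mt A) k"
  by (induction k) (auto simp: mpow_Suc mt_mm mpow_comm)

lemma mv_mpow: "v \<in> coord_space {..<n} \<Longrightarrow> mv n (mpow n A k) v = (mv n A ^^ k) v"
  by (induction k) (auto simp: mpow_Suc mv_idm mv_mm)

lemma lin_on_mv: "A \<in> mats n \<Longrightarrow> fv.lin_on (coord_space {..<n}) (mv n A)"
  unfolding fv.lin_on_def using subspace_coord by (auto simp: mv_add mv_fscale)

text \<open>The cyclic subspaces of a product of two alternating matrices are isotropic, which halves
  the degree of the minimal polynomial.\<close>

lemma alternating_product_annihilator:
  fixes B C :: "'k::alg_closed_field mtx"
  assumes two: "(2::'k) \<noteq> 0" and B: "B \<in> mats n" "mt B = - B" and C: "C \<in> mats n" "mt C = - C"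
    and B': "mm n B' B = idm n"
  shows "\<exists>p. p \<noteq> 0 \<and> 2 * degree p \<le> n \<and>
    (\<Sum>i\<le>degree p. fscale (coeff p i) (mpow n (mm n B C) i)) = 0"
proof -
  define A where "A = mm n B C"
  have A: "A \<in> mats n" using B C by (simp add: A_def)
  have At: "mt A = mm n C B" using B C by (simp add: A_def mt_mm mm_uminus_left mm_uminus_right)
  define W where "W = (coord_space {..<n} :: (nat \<Rightarrow> 'k) set)"
  define \<omega> where "\<omega> v w = dot n v (mv n B w)" for v w
  have mvm: "mv n (- B) v = - mv n B v" for v by (rule ext) (simp add: mv_def sum_negf)
  have om: "\<omega> v w = - dot n (mv n B v) w" for v w
    unfolding \<omega>_def dot_mv by (simp add: B mvm dot_uminus)
  \<comment> \<open>For the form \<open>v^T B w\<close> it is the transpose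
    \<open>A^T = C B\<close>, and not \<open>A = B C\<close>, that is self-adjoint: both sides of
    the condition are given by \<open>B C B\<close>.\<close>
  have T: "fv.lin_on W (mv n (mt A))" unfolding W_def using A by (intro lin_on_mv) simp
  have "\<exists>p. p \<noteq> 0 \<and> (\<forall>x\<in>W. fv.pop (mv n (mt A)) p x = 0) \<and> 2 * degree p \<le> card (dlt ` {..<n} :: (nat \<Rightarrow> 'k) set)"
  proof (rule selfadjoint_min_degree[OF _ T _ _ two])
    show "vec_sp (fscale :: 'k \<Rightarrow> (nat \<Rightarrow> 'k) \<Rightarrow> _)" by (rule fv.vec_sp_axioms)
    show "finite (dlt ` {..<n} :: (nat \<Rightarrow> 'k) set)" by simp
    show "W \<subseteq> fun_vs.span (dlt ` {..<n})" unfolding W_def by (rule coord_span) simp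
    show "\<omega> (x + y) z = \<omega> x z + \<omega> y z" for x y z by (simp add: \<omega>_def dot_add)
    show "\<omega> (fscale c x) z = c * \<omega> x z" for c x z by (simp add: \<omega>_def dot_fscale)
    show "\<omega> y x = - \<omega> x y" for x y using om[of y x] by (simp add: \<omega>_def dot_commute)
    show "x = 0" if x: "x \<in> W" "\<And>y. y \<in> W \<Longrightarrow> \<omega> x y = 0" for x
    proof -
      have "mv n B x i = 0" for i
      proof (cases "i < n")
        case True
        then have "dlt i \<in> W" by (simp add: W_def dlt_in)
        then have "dot n (mv n B x) (dlt i) = 0" using om[of x "dlt i"] x(2) by simp
        then show ?thesis using True by (simp add: dot_dlt)
      next
        case False
        then show ?thesis using B(1) by (simp add: mv_def mats_iff)
      qed
      then have "mv n B x = 0" by auto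
      then have "mv n (mm n B' B) x = 0" unfolding mv_mm by (auto simp: mv_def)
      then show "x = 0" using x(1) by (simp add: B' mv_idm W_def)
    qed
    show "\<omega> (mv n (mt A) x) y = \<omega> x (mv n (mt A) y)" for x y
      unfolding \<omega>_def dot_mv mt_mt by (simp only: At) (simp only: A_def mv_mm)
  qed
  then obtain p where p: "p \<noteq> 0" "\<And>x. x \<in> W \<Longrightarrow> fv.pop (mv n (mt A)) p x = 0"
    and dp: "2 * degree p \<le> card (dlt ` {..<n} :: (nat \<Rightarrow> 'k) set)" by blast
  have "card (dlt ` {..<n} :: (nat \<Rightarrow> 'k) set) \<le> n" using card_image_le[of "{..<n}"] by simp
  moreover have "(\<Sum>k\<le>degree p. fscale (coeff p k) (mpow n A k)) (i, j) = 0" for i j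
  proof (cases "i < n \<and> j < n")
    case True
    then have d: "dlt i \<in> W" by (simp add: W_def dlt_in)
    have "0 = fv.pop (mv n (mt A)) p (dlt i) j" using p(2)[OF d] by simp
    also have "\<dots> = (\<Sum>k\<le>degree p. coeff p k * mv n (mpow n (mt A) k) (dlt i) j)"
      unfolding fv.pop_def using d by (simp add: sum_fun_apply mv_mpow W_def)
    also have "\<dots> = (\<Sum>k\<le>degree p. coeff p k * mpow n A k (i, j))"
      using True A by (simp add: mv_dlt mt_mpow[symmetric])
    finally show ?thesis by (simp add: sum_fun_apply)
  next
    case False
    have "mpow n A k (i, j) = 0" for k using A False by (intro matsD[OF mpow_in]) auto
    then show ?thesis by (simp add: sum_fun_apply)
  qed
  then have "(\<Sum>k\<le>degree p. fscale (coeff p k) (mpow n A k)) = 0" by (intro mtx_eqI) simp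
  ultimately show ?thesis using p(1) dp unfolding A_def by (intro exI[of _ p]) simp
qed

text \<open>If the entry at \<open>(i, j)\<close> is nonzero, then the columns \<open>i\<close> and
  \<open>j\<close> are independent, because the diagonal vanishes and the entry at
  \<open>(j, i)\<close> is nonzero too. Each of them contributes \<open>n\<close> independent
  elements of the right ideal.\<close>

lemma alternating_right_ideal:
  fixes M :: "'k::field mtx"
  assumes two: "(2::'k) \<noteq> 0" and M: "M \<in> mats n" "mt M = - M" "M \<noteq> 0"
  shows "\<exists>x. fv.indep_fam ({..<2::nat} \<times> {..<n}) x \<and> x ` ({..<2} \<times> {..<n}) \<subseteq> mm n M ` mats n"
proof -
  have anti: "M (i, j) = - M (j, i)" for i j
    using fun_cong[OF M(2), of "(j, i)"] by simp
  have diag: "M (i, i) = 0" for i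
  proof -
    have "2 * M (i, i) = 0" using anti[of i i] by (metis add.right_inverse mult_2)
    then show ?thesis using two by simp
  qed
  obtain i j where ij: "M (i, j) \<noteq> 0" using M(3) by (metis mtx_eqI zero_fun_apply)
  then have lt: "i < n" "j < n" using M(1) by (auto simp: mats_iff)
  define r where "r a = (if a = (0::nat) then i else j)" for a
  define x where "x = (\<lambda>(a, l). mm n M (dlt (r a, l)))"
  have x: "x (a, l) (s, t) = (if t = l then M (s, r a) else 0)" for a l s t
    unfolding x_def r_def using lt by (simp add: mm_dlt_right)
  have "fv.indep_fam ({..<2::nat} \<times> {..<n}) x"
    unfolding fv.indep_fam_def
  proof (intro allI impI ballI)
    fix c b assume c: "(\<Sum>b\<in>{..<2} \<times> {..<n}. fscale (c b) (x b)) = 0" and b: "b \<in> {..<2::nat} \<times> {..<n}"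
    obtain a l where al: "b = (a, l)" "a < 2" "l < n" using b by auto
    have "(\<Sum>b\<in>{..<2} \<times> {..<n}. fscale (c b) (x b)) (s, l) = c (0, l) * M (s, i) + c (1, l) * M (s, j)" for s
    proof -
      have "(\<Sum>b\<in>{..<2} \<times> {..<n}. fscale (c b) (x b)) (s, l)
        = (\<Sum>a<2. \<Sum>l'<n. c (a, l') * (if l = l' then M (s, r a) else 0))"
        by (simp add: sum_fun_apply sum.cartesian_product case_prod_unfold x[unfolded split_paired_all, simplified])
           (intro sum.cong refl, auto simp: x)
      also have "\<dots> = (\<Sum>a<2. c (a, l) * M (s, r a))"
        using al by (simp add: if_distrib[of "\<lambda>u. _ * u"] cong: if_cong)
      finally show ?thesis by (simp add: numeral_2_eq_2 r_def)
    qed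
    then have eq: "c (0, l) * M (s, i) + c (1, l) * M (s, j) = 0" for s using c by simp
    have "c (1, l) = 0" using eq[of i] diag ij by simp
    moreover have "c (0, l) = 0" using eq[of j] diag ij anti[of j i] by simp
    moreover have "a = 0 \<or> a = 1" using al by auto
    ultimately show "c b = 0" using al by auto
  qed
  moreover have "x ` ({..<2} \<times> {..<n}) \<subseteq> mm n M ` mats n"
    unfolding x_def r_def using lt by auto
  ultimately show ?thesis by blast
qed

text \<open>The right ideal of \<open>e\<close> has dimension \<open>n\<close> times the rank of
  \<open>e\<close>. So two columns \<open>a\<close> and \<open>b\<close> form a basis of the column
  space, and the coordinates \<open>q\<close>, \<open>q'\<close> of all columns give the rank
  factorization of \<open>e\<close>.\<close>

lemma rank_two_columns:
  fixes e :: "'k::field mtx"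
  assumes e: "e \<in> mats n" and dim: "fun_vs.dim (mm n e ` mats n) = 2 * n" and n: "n > 0"
  shows "\<exists>a b q q'. a < n \<and> b < n \<and>
    (\<forall>i k. e (i, k) = e (i, a) * q k + e (i, b) * q' k) \<and>
    (\<forall>c d. (\<forall>i. c * e (i, a) + d * e (i, b) = 0) \<longrightarrow> c = 0 \<and> d = 0) \<and>
    q \<in> coord_space {..<n} \<and> q' \<in> coord_space {..<n}"
proof -
  define col where "col a = (\<lambda>i. e (i, a))" for a
  obtain J where J: "J \<subseteq> {..<n}" "fv.indep_fam J col" "col ` {..<n} \<subseteq> fun_vs.span (col ` J)"
    using fv.max_indep_subfam[of "{..<n}" col] by auto
  have fJ: "finite J" using J(1) finite_subset by blast
  have "\<exists>g. col k = (\<Sum>a\<in>J. fscale (g a) (col a))" if "k < n" for k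
    using J(3) that fv.span_family[OF fJ] by blast
  then obtain g where g: "\<And>k. k < n \<Longrightarrow> col k = (\<Sum>a\<in>J. fscale (g k a) (col a))" by metis
  have ge: "e (i, k) = (\<Sum>a\<in>J. g k a * e (i, a))" if "k < n" for i k
    using fun_cong[OF g[OF that], of i] by (simp add: sum_fun_apply col_def)
  define y where "y = (\<lambda>(a, l). mm n e (dlt (a, l)))"
  have y: "y (a, l) (s, t) = (if t = l then e (s, a) else 0)" if "a \<in> J" for a l s t
    unfolding y_def using J(1) that by (simp add: mm_dlt_right subset_eq)
  have ysum: "(\<Sum>b\<in>J \<times> {..<n}. fscale (c b) (y b)) (s, t) = (if t < n then \<Sum>a\<in>J. c (a, t) * e (s, a) else 0)"
    for c s t
  proof -
    have "(\<Sum>b\<in>J \<times> {..<n}. fscale (c b) (y b)) (s, t)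
      = (\<Sum>a\<in>J. \<Sum>l<n. c (a, l) * (if t = l then e (s, a) else 0))"
      unfolding sum_fun_apply sum.cartesian_product by (intro sum.cong refl) (auto simp: y)
    also have "\<dots> = (if t < n then \<Sum>a\<in>J. c (a, t) * e (s, a) else 0)"
      by (simp add: if_distrib[of "\<lambda>u. _ * u"] cong: if_cong)
    finally show ?thesis .
  qed
  have "fun_vs.dim (mm n e ` mats n) = card (J \<times> {..<n})"
  proof (rule fv.dim_family)
    show "finite (J \<times> {..<n})" using fJ by simp
    show "fv.indep_fam (J \<times> {..<n}) y"
      unfolding fv.indep_fam_def
    proof (intro allI impI ballI)
      fix c b assume c: "(\<Sum>b\<in>J \<times> {..<n}. fscale (c b) (y b)) = 0" and b: "b \<in> J \<times> {..<n}"
      obtain a l where al: "b = (a, l)" "a \<in> J" "l < n" using b by auto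
      have "(\<Sum>a\<in>J. fscale (c (a, l)) (col a)) = 0"
      proof
        fix s show "(\<Sum>a\<in>J. fscale (c (a, l)) (col a)) s = 0 s"
          using ysum[of c s l] al c by (simp add: sum_fun_apply col_def)
      qed
      then show "c b = 0" using fv.indep_famD[OF J(2)] al by simp
    qed
    show "y ` (J \<times> {..<n}) \<subseteq> mm n e ` mats n" unfolding y_def using J(1) by auto
    show "mm n e ` mats n \<subseteq> fun_vs.span (y ` (J \<times> {..<n}))"
    proof safe
      fix N :: "'k mtx" assume N: "N \<in> mats n"
      define c where "c = (\<lambda>(a, l). \<Sum>k<n. g k a * N (k, l))"
      have "mm n e N = (\<Sum>b\<in>J \<times> {..<n}. fscale (c b) (y b))"
      proof (rule mtx_eqI)
        fix s t
        show "mm n e N (s, t) = (\<Sum>b\<in>J \<times> {..<n}. fscale (c b) (y b)) (s, t)"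
        proof (cases "t < n")
          case True
          have "mm n e N (s, t) = (\<Sum>k<n. \<Sum>a\<in>J. g k a * e (s, a) * N (k, t))"
            by (simp add: mm_apply ge sum_distrib_right)
          also have "\<dots> = (\<Sum>a\<in>J. \<Sum>k<n. g k a * e (s, a) * N (k, t))" by (rule sum.swap)
          also have "\<dots> = (\<Sum>a\<in>J. c (a, t) * e (s, a))"
            unfolding c_def prod.case sum_distrib_right by (intro sum.cong refl) (simp add: mult_ac)
          finally show ?thesis using True by (simp add: ysum)
        next
          case False
          then show ?thesis using N by (simp add: ysum mm_apply mats_iff)
        qed
      qed
      then show "mm n e N \<in> fun_vs.span (y ` (J \<times> {..<n}))"
        using fv.span_family[of "J \<times> {..<n}"] fJ by auto
    qed
  qed
  then have "card J = 2" using dim n by (simp add: card_cartesian_product)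
  then obtain a b where ab: "J = {a, b}" "a \<noteq> b" by (meson card_2_iff)
  define q where "q r k = (if k < n then g k r else 0)" for r k
  have dec: "e (i, k) = e (i, a) * q a k + e (i, b) * q b k" for i k
  proof (cases "k < n")
    case True
    then show ?thesis using ge[OF True, of i] ab by (simp add: q_def mult.commute)
  next
    case False
    then show ?thesis using e by (simp add: q_def mats_iff)
  qed
  have ind: "c = 0 \<and> d = 0" if "\<forall>i. c * e (i, a) + d * e (i, b) = 0" for c d
  proof -
    have "(\<Sum>r\<in>J. fscale (if r = a then c else d) (col r)) = 0"
      using that ab by (intro ext) (simp add: sum_fun_apply col_def)
    from fv.indep_famD[OF J(2) this, of a] fv.indep_famD[OF J(2) this, of b] show ?thesis using ab by simp
  qed
  have qin: "q r \<in> coord_space {..<n}" for r by (auto simp: q_def coord_space_def)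
  have lt: "a < n" "b < n" using J(1) ab by auto
  show ?thesis
    by (rule exI[where x = a], rule exI[where x = b], rule exI[where x = "q a"], rule exI[where x = "q b"],
      (intro conjI lt qin allI dec impI; (drule ind)?; simp?))
qed

text \<open>Write \<open>e i\<close> as \<open>p q^T + p' q'^T\<close>. Over all \<open>i\<close>
  the vectors \<open>p\<close>, \<open>p'\<close> and \<open>q\<close>, \<open>q'\<close> are dual
  bases, since the \<open>e i\<close> are orthogonal idempotents with sum 1. The matrix
  \<open>B\<close> is the orthogonal sum of the hyperbolic planes spanned by \<open>p i\<close> and
  \<open>p' i\<close>, and multiplication by \<open>e i\<close> projects it to one of them.\<close>

lemma ex_alternating_compatible:
  fixes e :: "nat \<Rightarrow> 'k::field mtx"
  assumes n: "n > 0" and e: "\<And>i. i < m \<Longrightarrow> e i \<in> mats n"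
    and orth: "\<And>i j. i < m \<Longrightarrow> j < m \<Longrightarrow> mm n (e i) (e j) = (if i = j then e i else 0)"
    and sum1: "(\<Sum>i<m. e i) = idm n"
    and dim: "\<And>i. i < m \<Longrightarrow> fun_vs.dim (mm n (e i) ` mats n) = 2 * n"
  shows "\<exists>B\<in>mats n. \<exists>B'\<in>mats n. mt B = - B \<and> mm n B' B = idm n \<and> mm n B B' = idm n \<and>
    (\<forall>i<m. mt (mm n (e i) B) = - mm n (e i) B)"
proof -
  define Q where "Q i = (\<lambda>(a, b, q, q'). a < n \<and> b < n \<and>
    (\<forall>r k. e i (r, k) = e i (r, a) * q k + e i (r, b) * q' k) \<and>
    (\<forall>c d. (\<forall>r. c * e i (r, a) + d * e i (r, b) = 0) \<longrightarrow> c = 0 \<and> d = 0) \<and>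
    q \<in> coord_space {..<n} \<and> q' \<in> coord_space {..<n})" for i
  have "\<exists>t. Q i t" if i: "i < m" for i
  proof -
    obtain a b q q' where "Q i (a, b, q, q')"
      unfolding Q_def prod.case using rank_two_columns[OF e[OF i] dim[OF i] n] by blast
    then show ?thesis ..
  qed
  then obtain t where t: "\<And>i. i < m \<Longrightarrow> Q i (t i)" by metis
  define a where "a i = fst (t i)" for i
  define b where "b i = fst (snd (t i))" for i
  define q where "q i = fst (snd (snd (t i)))" for i
  define q' where "q' i = snd (snd (snd (t i)))" for i
  have tt: "Q i (a i, b i, q i, q' i)" if "i < m" for i
    using t[OF that] by (simp add: a_def b_def q_def q'_def)
  have dec: "e i (r, k) = e i (r, a i) * q i k + e i (r, b i) * q' i k" if "i < m" for i r k
    using tt[OF that] unfolding Q_def prod.case by blast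
  have ind: "c = 0 \<and> d = 0" if "i < m" "\<forall>r. c * e i (r, a i) + d * e i (r, b i) = 0" for i c d
    using tt[OF that(1)] that(2) unfolding Q_def prod.case by blast
  have q: "q i \<in> coord_space {..<n} \<and> q' i \<in> coord_space {..<n}" if "i < m" for i
    using tt[OF that] unfolding Q_def prod.case by blast
  define p where "p i = (\<lambda>r. e i (r, a i))" for i
  define p' where "p' i = (\<lambda>r. e i (r, b i))" for i
  have eq: "e i = outer (p i) (q i) + outer (p' i) (q' i)" if "i < m" for i
    by (rule mtx_eqI) (simp only: plus_fun_apply outer_apply p_def p'_def, rule dec[OF that])
  have col: "mv n (e i) (\<lambda>r. e j (r, c)) = (\<lambda>r. if i = j then e j (r, c) else 0)" if "i < m" "j < m" for i j c
    using fun_cong[OF orth[OF that]] by (auto simp: mv_def mm_apply fun_eq_iff)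
  \<comment> \<open>The coefficients \<open>(c, d)\<close> are \<open>(1, 0)\<close> for the vector
    \<open>p j\<close> and \<open>(0, 1)\<close> for \<open>p' j\<close>, which treats both columns
    at once.\<close>
  have dots: "dot n (q i) v = (if i = j then c else 0) \<and> dot n (q' i) v = (if i = j then d else 0)"
    if ij: "i < m" "j < m" and v: "v = (\<lambda>r. c * p j r + d * p' j r)" "c * d = 0" "c + d = 1" "c = 0 \<or> d = 0"
      and vc: "v = (\<lambda>r. e j (r, s))" for i j v c d s
  proof -
    have mv: "mv n (e i) v r = p i r * dot n (q i) v + p' i r * dot n (q' i) v" for r
      unfolding eq[OF ij(1)] mv_def dot_def
      by (simp add: sum_distrib_left algebra_simps sum.distrib)
    have "mv n (e i) v r = (if i = j then v r else 0)" for r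
      unfolding vc using col[OF ij, of s] by (simp add: fun_eq_iff)
    then have "p i r * dot n (q i) v + p' i r * dot n (q' i) v = (if i = j then c * p i r + d * p' i r else 0)" for r
      using mv[of r] v(1) by auto
    then have "\<forall>r. (dot n (q i) v - (if i = j then c else 0)) * e i (r, a i)
        + (dot n (q' i) v - (if i = j then d else 0)) * e i (r, b i) = 0"
      by (auto simp: p_def p'_def algebra_simps)
    from ind[OF ij(1) this] show ?thesis by simp
  qed
  have qp: "dot n (q i) (p j) = (if i = j then 1 else 0)" "dot n (q' i) (p j) = 0"
    if "i < m" "j < m" for i j
    using dots[OF that, of "p j" 1 0 "a j"] by (auto simp: p_def p'_def)
  have qp': "dot n (q i) (p' j) = 0" "dot n (q' i) (p' j) = (if i = j then 1 else 0)"
    if "i < m" "j < m" for i j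
    using dots[OF that, of "p' j" 0 1 "b j"] by (auto simp: p_def p'_def)
  define B where "B = (\<Sum>i<m. outer (p i) (p' i) - outer (p' i) (p i))"
  define B' where "B' = (\<Sum>i<m. outer (q' i) (q i) - outer (q i) (q' i))"
  have outer_in: "outer u v \<in> mats n" if "u \<in> coord_space {..<n}" "v \<in> coord_space {..<n}" for u v
    using that by (auto simp: mats_iff coord_space_def)
  have p_in: "p i \<in> coord_space {..<n}" "p' i \<in> coord_space {..<n}" if "i < m" for i
    using e[OF that] by (auto simp: p_def p'_def coord_space_def mats_iff)
  have Bin: "B \<in> mats n" unfolding B_def
    using p_in outer_in by (intro fun_vs.subspace_sum[OF subspace_mats] fun_vs.subspace_diff[OF subspace_mats]) auto
  have B'in: "B' \<in> mats n" unfolding B'_def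
    using q outer_in by (intro fun_vs.subspace_sum[OF subspace_mats] fun_vs.subspace_diff[OF subspace_mats]) auto
  have f0: "fscale 0 A = 0" "fscale 1 A = A" for A :: "'k mtx" by (auto simp: fun_eq_iff)
  have Bt: "mt B = - B" "mt B' = - B'"
    by (simp_all add: B_def B'_def mt_sum mt_diff sum_negf[symmetric])
  have "mm n B B' = (\<Sum>i<m. \<Sum>j<m. if i = j then e i else 0)"
    unfolding B_def B'_def mm_sum_left mm_sum_right
    by (subst sum.swap, intro sum.cong refl)
      (auto simp: mm_diff_left mm_diff_right mm_outer qp qp' dot_commute[of n "p _"] dot_commute[of n "p' _"] f0 eq)
  also have "\<dots> = idm n" using sum1 by simp
  finally have BB': "mm n B B' = idm n" .
  have "mm n B' B = mt (mm n (mt B) (mt B'))" by (simp add: mt_mm)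
  also have "\<dots> = idm n" by (simp add: Bt mm_uminus_left mm_uminus_right BB')
  finally have B'B: "mm n B' B = idm n" .
  have "mm n (e i) B = outer (p i) (p' i) - outer (p' i) (p i)" if i: "i < m" for i
  proof -
    have "mm n (e i) B = (\<Sum>j<m. if i = j then outer (p i) (p' i) - outer (p' i) (p i) else 0)"
      unfolding B_def mm_sum_right using i
      by (intro sum.cong refl) (auto simp: eq mm_add_left mm_diff_right mm_outer qp qp' f0)
    then show ?thesis using i by simp
  qed
  then show ?thesis using Bin B'in Bt BB' B'B by (intro bexI[of _ B] bexI[of _ B'] conjI) (auto simp: mt_diff)
qed

section \<open>Splitting over the algebraic closure\<close>

context vec_sp
begin

lemma dim_psubset:
  assumes "local.subspace V" "V \<subset> V'" "V' \<subseteq> local.span B" "finite B"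
  shows "dim V < dim V'"
proof -
  obtain C where C: "C \<subseteq> V" "finite C" "local.independent C" "V \<subseteq> local.span C"
    using indep_basis_of[of V B] assms by (metis order_trans psubset_imp_subset)
  obtain y where y: "y \<in> V'" "y \<notin> V" using assms(2) by auto
  have sC: "local.span C \<subseteq> V" using C(1) assms(1) by (rule span_minimal)
  have yC: "y \<notin> local.span C" using y sC by blast
  have "card (insert y C) \<le> dim V'"
  proof (rule indep_fam_le_dim[where y = "\<lambda>x. x", OF _ _ _ assms(3,4)])
    show "indep_fam (insert y C) (\<lambda>x. x)"
      using C yC independent_insertI by (subst indep_fam_iff) auto
  qed (use C y assms(2) in auto)
  moreover have "dim V = card C" using C by (intro dim_unique) auto
  moreover have "y \<notin> C" using yC span_base by blast
  ultimately show ?thesis using C(2) by simp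
qed

end

text \<open>Take a polynomial of least degree that kills some nonzero vector \<open>z\<close>.
  Splitting off a linear factor leaves \<open>q\<close> with \<open>q(T) z\<close> nonzero, and this
  is an eigenvector.\<close>

lemma ex_eigenvector:
  fixes scale :: "'k::alg_closed_field \<Rightarrow> 'v::ab_group_add \<Rightarrow> 'v"
  assumes "vec_sp scale" and T: "vec_sp.lin_on scale W T" and B: "finite B" "W \<subseteq> module.span scale B"
    and x: "x \<in> W" "x \<noteq> 0"
  shows "\<exists>y\<in>W. \<exists>a. y \<noteq> 0 \<and> T y = scale a y"
proof -
  interpret vec_sp scale by fact
  define good where "good p \<longleftrightarrow> p \<noteq> 0 \<and> (\<exists>x\<in>W. x \<noteq> 0 \<and> pop T p x = 0)" for p
  obtain p where "good p" using ex_annihilator[OF T x(1) B] x unfolding good_def by metis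
  then obtain p where p: "good p" and pmin: "\<And>q. good q \<Longrightarrow> degree p \<le> degree q"
    using exists_least_iff[of "\<lambda>d. \<exists>p. good p \<and> degree p = d"] by (metis not_le)
  obtain z where z: "z \<in> W" "z \<noteq> 0" "pop T p z = 0" and p0: "p \<noteq> 0"
    using p by (auto simp: good_def)
  have "degree p \<noteq> 0"
  proof
    assume "degree p = 0"
    then have "scale (coeff p 0) z = 0" using z(3) by (simp add: pop_def)
    then show False using z(2) \<open>degree p = 0\<close> p0 leading_coeff_0_iff[of p] by simp
  qed
  then obtain a where a: "poly p a = 0" using alg_closed_imp_poly_has_root by blast
  obtain q where q: "p = [:-a, 1:] * q" by (rule root_factor[OF a])
  have q0: "q \<noteq> 0" using q p0 by auto
  have "degree p = Suc (degree q)" unfolding q using q0 by (subst degree_mult_eq) auto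
  then have "\<not> good q" using pmin[of q] by auto
  then have y0: "pop T q z \<noteq> 0" using z q0 by (auto simp: good_def)
  have yW: "pop T q z \<in> W" using T z(1) by (rule pop_in)
  have "pop T [:-a, 1:] (pop T q z) = 0" using z(3) pop_mult[OF T z(1), of "[:-a, 1:]" q] q by simp
  then have "T (pop T q z) = scale a (pop T q z)"
    using yW by (simp add: pop_pCons[OF T] lin_on_0[OF T])
  then show ?thesis using yW y0 by blast
qed

section \<open>Scalar extension of the algebra and its minimal left ideals\<close>

context central_simple_algebra
begin

abbreviation "rp x b \<equiv> representation Basis x b"
abbreviation "gm \<equiv> sc_mult (geom_algebra scale Basis)"
abbreviation "tg \<equiv> to_geom scale Basis"
abbreviation "CS \<equiv> (coord_space Basis :: ('a \<Rightarrow> 'f alg_closure) set)"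

lemma rp_sum: "(\<Sum>b\<in>Basis. scale (rp x b) b) = x"
  using sum_representation_eq[OF independent_Basis _ finite_Basis order_refl, of x] span_Basis by simp

lemma rp_add: "rp (x + y) b = rp x b + rp y b"
  using representation_add[OF independent_Basis, of y x] span_Basis by simp

lemma rp_scale: "rp (scale c x) b = c * rp x b"
  using representation_scale[OF independent_Basis, of x c] span_Basis by simp

lemma rp_sum_fun: "rp (\<Sum>i\<in>I. f i) b = (\<Sum>i\<in>I. rp (f i) b)"
  using representation_sum[OF independent_Basis, of I f] span_Basis by simp

lemma rp_out: "b \<notin> Basis \<Longrightarrow> rp x b = 0"
  using representation_ne_zero by blast

lemma rp_Basis: "b \<in> Basis \<Longrightarrow> rp b c = (if c = b then 1 else 0)"
  using representation_basis[OF independent_Basis] by (simp add: eq_commute)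

lemma tg_apply: "tg x b = to_ac (rp x b)" by (simp add: to_geom_def)

lemma tg_in [simp]: "tg x \<in> CS" by (auto simp: coord_space_def tg_apply rp_out)

lemma tg_add: "tg (x + y) = tg x + tg y" by (rule ext) (simp add: tg_apply rp_add)

lemma tg_scale: "tg (scale c x) = fscale (to_ac c) (tg x)" by (rule ext) (simp add: tg_apply rp_scale)

lemma tg_0 [simp]: "tg 0 = 0" using tg_scale[of 0 0] by (simp add: fun_eq_iff)

lemma tg_sum: "tg (\<Sum>i\<in>I. f i) = (\<Sum>i\<in>I. tg (f i))"
  by (rule ext) (simp add: tg_apply rp_sum_fun sum_fun_apply to_ac_sum)

lemma tg_Basis: "b \<in> Basis \<Longrightarrow> tg b = dlt b"
  by (rule ext) (simp add: tg_apply rp_Basis dlt_def)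

lemma tg_inj: "tg x = tg y \<Longrightarrow> x = y"
proof -
  assume "tg x = tg y"
  then have "to_ac (rp x b) = to_ac (rp y b)" for b by (metis tg_apply)
  then have eq: "rp x b = rp y b" for b by simp
  have "x = (\<Sum>b\<in>Basis. scale (rp x b) b)" by (rule rp_sum[symmetric])
  also have "\<dots> = (\<Sum>b\<in>Basis. scale (rp y b) b)" by (intro sum.cong refl) (simp only: eq)
  also have "\<dots> = y" by (rule rp_sum)
  finally show "x = y" .
qed

lemma CS_expand: "z \<in> CS \<Longrightarrow> z = (\<Sum>b\<in>Basis. fscale (z b) (tg b))"
  using coord_expand[OF finite_Basis, of z] by (simp add: tg_Basis)

lemma subspace_CS: "fun_vs.subspace CS" by (rule subspace_coord)

lemma CS_span: "CS \<subseteq> fun_vs.span (dlt ` Basis)" using coord_span[OF finite_Basis] .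

lemma gm_apply: "gm x y k = (if k \<in> Basis then \<Sum>i\<in>Basis. \<Sum>j\<in>Basis. x i * y j * to_ac (rp (i * j) k) else 0)"
  by (simp add: sc_mult_def geom_algebra_def coord_algebra_def)

lemma gm_in [simp]: "gm x y \<in> CS" by (auto simp: coord_space_def gm_apply)

lemma gm_add_left: "gm (x + x') y = gm x y + gm x' y"
  by (rule ext) (simp add: gm_apply distrib_right sum.distrib)

lemma gm_add_right: "gm x (y + y') = gm x y + gm x y'"
  by (rule ext) (simp add: gm_apply distrib_left distrib_right sum.distrib)

lemma gm_fscale_left: "gm (fscale c x) y = fscale c (gm x y)"
  by (rule ext) (simp add: gm_apply sum_distrib_left mult.assoc)

lemma gm_fscale_right: "gm x (fscale c y) = fscale c (gm x y)"
  by (rule ext) (simp add: gm_apply sum_distrib_left mult_ac)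

lemma gm_0 [simp]: "gm 0 y = 0" "gm x 0 = 0"
  by (rule ext, simp add: gm_apply)+

lemma gm_sum_left: "gm (\<Sum>i\<in>I. f i) y = (\<Sum>i\<in>I. gm (f i) y)"
  by (induction I rule: infinite_finite_induct)
    (simp_all only: sum.infinite sum.empty sum.insert not_False_eq_True gm_0 gm_add_left)

lemma gm_sum_right: "gm x (\<Sum>i\<in>I. f i) = (\<Sum>i\<in>I. gm x (f i))"
  by (induction I rule: infinite_finite_induct)
    (simp_all only: sum.infinite sum.empty sum.insert not_False_eq_True gm_0 gm_add_right)

lemma tg_mult: "tg (x * y) = gm (tg x) (tg y)"
proof
  fix k
  have "x * y = (\<Sum>i\<in>Basis. scale (rp x i) i) * (\<Sum>j\<in>Basis. scale (rp y j) j)" by (simp only: rp_sum)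
  also have "\<dots> = (\<Sum>i\<in>Basis. \<Sum>j\<in>Basis. scale (rp x i * rp y j) (i * j))"
    unfolding sum_product by (intro sum.cong refl) (simp add: scale_mult_left scale_mult_right)
  finally have "x * y = (\<Sum>i\<in>Basis. \<Sum>j\<in>Basis. scale (rp x i * rp y j) (i * j))" .
  then have "rp (x * y) k = (\<Sum>i\<in>Basis. \<Sum>j\<in>Basis. rp x i * rp y j * rp (i * j) k)"
    by (simp only: rp_sum_fun rp_scale)
  then show "tg (x * y) k = gm (tg x) (tg y) k"
    by (simp add: gm_apply tg_apply to_ac_sum rp_out)
qed

text \<open>The scalar extension is spanned by the algebra, so identities that are linear in each
  argument can be checked on algebra elements.\<close>

lemma CS_induct [consumes 1, case_names zero step]:
  assumes "z \<in> CS" "P 0" "\<And>c x z. z \<in> CS \<Longrightarrow> P z \<Longrightarrow> P (fscale c (tg x) + z)"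
  shows "P z"
proof -
  have "z \<in> fun_vs.span (range tg)"
    by (subst CS_expand[OF assms(1)]) (intro fun_vs.span_sum fun_vs.span_scale fun_vs.span_base rangeI)
  then have "z \<in> CS \<and> P z"
  proof (induction rule: fun_vs.span_induct_alt)
    case base
    show ?case using assms(2) subspace_CS fun_vs.subspace_0 by blast
  next
    case (step c x y)
    then obtain a where x: "x = tg a" by blast
    from step have y: "y \<in> CS" "P y" by auto
    show ?case unfolding x
      using assms(3)[OF y] fun_vs.subspace_add[OF subspace_CS fun_vs.subspace_scale[OF subspace_CS tg_in] y(1)]
      by blast
  qed
  then show ?thesis ..
qed

lemma gm_assoc:
  assumes "x \<in> CS" "y \<in> CS"
  shows "gm (gm x y) z = gm x (gm y z)"
proof -
  \<comment> \<open>Nothing is assumed about \<open>z\<close> outside the basis. As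
    \<open>gm\<close> reads only coordinates in the basis, \<open>z\<close> may be truncated, which
    makes the induction available.\<close>
  define z' where "z' = (\<lambda>i. if i \<in> Basis then z i else 0)"
  have z': "z' \<in> CS" by (auto simp: z'_def coord_space_def)
  have gz: "gm w z = gm w z'" for w
    by (rule ext) (auto simp: gm_apply z'_def intro!: sum.cong)
  have "gm (gm x y) z' = gm x (gm y z')"
  using assms(1)
proof (induction x rule: CS_induct)
  case (step c a x)
  have "gm (gm (tg a) y) z' = gm (tg a) (gm y z')"
    using assms(2)
  proof (induction y rule: CS_induct)
    case (step c b y)
    have "gm (gm (tg a) (tg b)) z' = gm (tg a) (gm (tg b) z')"
      using z'
    proof (induction z' rule: CS_induct)
      case (step c d z)
      then show ?case
        by (simp only: gm_add_right gm_fscale_right tg_mult[symmetric] mult.assoc)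
    qed (simp only: gm_0)
    with step show ?case
      by (simp only: gm_add_right gm_fscale_right gm_add_left gm_fscale_left)
  qed (simp only: gm_0)
  with step show ?case by (simp only: gm_add_left gm_fscale_left)
qed (simp only: gm_0)
  then show ?thesis by (simp only: gz)
qed

lemma gm_1_left: "z \<in> CS \<Longrightarrow> gm (tg 1) z = z"
  by (induction z rule: CS_induct) (simp_all only: gm_0 gm_add_right gm_fscale_right tg_mult[symmetric] mult_1_left)

lemma gm_1_right: "z \<in> CS \<Longrightarrow> gm z (tg 1) = z"
  by (induction z rule: CS_induct) (simp_all only: gm_0 gm_add_left gm_fscale_left tg_mult[symmetric] mult_1_right)

text \<open>The multiplication algebra, that is, the image of the tensor product of the algebra with
  its opposite in the linear operators.\<close>

inductive_set mult_ops :: "('a \<Rightarrow> 'a) set" where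
  mul: "(\<lambda>x. a * x * b) \<in> mult_ops"
| add: "f \<in> mult_ops \<Longrightarrow> g \<in> mult_ops \<Longrightarrow> (\<lambda>x. f x + g x) \<in> mult_ops"

lemma mult_ops_linear:
  "f \<in> mult_ops \<Longrightarrow> f (x + y) = f x + f y"
  "f \<in> mult_ops \<Longrightarrow> f (scale c x) = scale c (f x)"
  by (induction f rule: mult_ops.induct)
    (simp_all add: distrib_left distrib_right scale_mult_left scale_mult_right scale_right_distrib)

lemma mult_ops_comp:
  assumes "f \<in> mult_ops" "g \<in> mult_ops"
  shows "(\<lambda>x. f (g x)) \<in> mult_ops"
  using assms(1)
proof (induction f rule: mult_ops.induct)
  case (mul a b)
  show ?case using assms(2)
  proof (induction g rule: mult_ops.induct)
    case (mul c d)
    show ?case using mult_ops.mul[of "a * c" "d * b"] by (simp add: mult.assoc)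
  next
    case (add f g)
    then show ?case using mult_ops.add[of "\<lambda>x. a * f x * b" "\<lambda>x. a * g x * b"]
      by (simp add: distrib_left distrib_right)
  qed
next
  case (add f h)
  show ?case using mult_ops.add[OF add.IH] .
qed

text \<open>The algebra is an irreducible module over its multiplication algebra, since submodules
  are two-sided ideals, and the commutant is the center. Density therefore produces every linear
  map.\<close>

lemma mult_ops_dense:
  shows "\<exists>f\<in>mult_ops. \<forall>b\<in>Basis. f b = t b"
proof -
  interpret F: vec_sp scale by (rule vec_sp.intro) (rule vector_space_axioms)
  show ?thesis
  proof (rule F.density[where W = UNIV])
    show "subspace UNIV" by (rule subspace_UNIV)
    show "(\<lambda>x. 0) \<in> mult_ops" using mult_ops.mul[of 0 0] by simp
    show "(\<lambda>x. scale c (f x)) \<in> mult_ops" if "f \<in> mult_ops" for f c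
      using mult_ops_comp[OF mult_ops.mul[of "scale c 1" 1] that] by (simp add: scale_mult_left)
    show "\<exists>f\<in>mult_ops. f x = y" if "x \<noteq> 0" for x y
    proof -
      define I where "I = (\<lambda>f. f x) ` mult_ops"
      have "two_sided_ideal I"
        unfolding two_sided_ideal_def
      proof (intro conjI ballI allI)
        show "0 \<in> I" unfolding I_def
          by (rule image_eqI[where x = "\<lambda>x. 0 * x * 0"]) (simp, rule mult_ops.mul)
        fix u assume "u \<in> I"
        then obtain f where f: "f \<in> mult_ops" "u = f x" by (auto simp: I_def)
        show "a * u \<in> I" for a unfolding I_def
          by (rule image_eqI[where x = "\<lambda>x. a * f x * 1"])
            (simp add: f, rule mult_ops_comp[OF mult_ops.mul f(1)])
        show "u * a \<in> I" for a unfolding I_def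
          by (rule image_eqI[where x = "\<lambda>x. 1 * f x * a"])
            (simp add: f, rule mult_ops_comp[OF mult_ops.mul f(1)])
        fix v assume "v \<in> I"
        then obtain g where g: "g \<in> mult_ops" "v = g x" by (auto simp: I_def)
        show "u + v \<in> I" unfolding I_def
          by (rule image_eqI[where x = "\<lambda>x. f x + g x"]) (simp add: f g, rule mult_ops.add[OF f(1) g(1)])
      qed
      moreover have "x \<in> I" unfolding I_def
        by (rule image_eqI[where x = "\<lambda>x. 1 * x * 1"]) (simp, rule mult_ops.mul)
      ultimately have "I = UNIV" using simple[of I] that by auto
      then have "y \<in> I" by simp
      then show ?thesis by (auto simp: I_def)
    qed
    show "\<exists>c. \<forall>x\<in>UNIV. T x = scale c x"
      if T: "\<And>f x. f \<in> mult_ops \<Longrightarrow> x \<in> UNIV \<Longrightarrow> T (f x) = f (T x)" for T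
    proof -
      \<comment> \<open>Commuting with left and right multiplications, \<open>T\<close> is both
        right and left multiplication by \<open>T 1\<close>, so \<open>T 1\<close> is
        central.\<close>
      have l: "T x = x * T 1" for x using T[OF mult_ops.mul[of x 1], of 1] by simp
      have r: "T x = T 1 * x" for x using T[OF mult_ops.mul[of 1 x], of 1] by simp
      have "T 1 * x = x * T 1" for x by (simp only: l[symmetric] r[symmetric])
      then have "T 1 \<in> {z. \<forall>x. z * x = x * z}" by blast
      then obtain c where "T 1 = scale c 1" using central by auto
      then have "T x = scale c x" for x by (subst l) (simp add: scale_mult_right)
      then show ?thesis by blast
    qed
  qed (auto simp: mult_ops_linear mult_ops_comp mult_ops.add finite_Basis independent_Basis)
qed

lemma mult_ops_extend:
  assumes "f \<in> mult_ops"
  shows "\<exists>ts. \<forall>x. f x = (\<Sum>(a, b)\<leftarrow>ts. a * x * b)"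
  using assms
proof (induction f rule: mult_ops.induct)
  case (mul a b)
  show ?case by (rule exI[of _ "[(a, b)]"]) simp
next
  case (add f g)
  then obtain ts us where "\<forall>x. f x = (\<Sum>(a, b)\<leftarrow>ts. a * x * b)" "\<forall>x. g x = (\<Sum>(a, b)\<leftarrow>us. a * x * b)" by blast
  then show ?case by (intro exI[of _ "ts @ us"]) simp
qed

definition geom_op :: "('a \<times> 'a) list \<Rightarrow> ('a \<Rightarrow> 'f alg_closure) \<Rightarrow> 'a \<Rightarrow> 'f alg_closure" where
  "geom_op ts z = (\<Sum>(a, b)\<leftarrow>ts. gm (gm (tg a) z) (tg b))"

lemma geom_op_Cons: "geom_op ((a, b) # ts) z = gm (gm (tg a) z) (tg b) + geom_op ts z"
  by (simp add: geom_op_def)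

lemma geom_op_Nil: "geom_op [] z = 0" by (simp add: geom_op_def)

lemma geom_op_linear: "geom_op ts (fscale c z + w) = fscale c (geom_op ts z) + geom_op ts w"
proof (induction ts)
  case Nil
  show ?case by (simp only: geom_op_Nil fun_vs.scale_zero_right add_0_right)
next
  case (Cons t ts)
  obtain a b where t: "t = (a, b)" by fastforce
  show ?case
    by (simp only: t geom_op_Cons Cons gm_add_right gm_add_left gm_fscale_left gm_fscale_right
        fun_vs.scale_right_distrib) (simp only: add_ac)
qed

lemma geom_op_tg: "geom_op ts (tg x) = tg (\<Sum>(a, b)\<leftarrow>ts. a * x * b)"
proof (induction ts)
  case (Cons t ts)
  obtain a b where t: "t = (a, b)" by fastforce
  have "(\<Sum>(a, b)\<leftarrow>t # ts. a * x * b) = a * x * b + (\<Sum>(a, b)\<leftarrow>ts. a * x * b)" by (simp add: t)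
  then show ?case by (simp only: Cons t geom_op_Cons tg_mult tg_add)
qed (simp add: geom_op_Nil)

lemma geom_op_zero: "geom_op ts 0 = 0"
proof (induction ts)
  case (Cons t ts)
  obtain a b where t: "t = (a, b)" by fastforce
  show ?case by (simp only: t geom_op_Cons Cons gm_0 add_0)
qed (simp only: geom_op_Nil)

text \<open>By density, the linear map that sends \<open>b\<close> to 1 and all other basis elements
  to 0 is a sum of two-sided multiplications. Such a sum makes sense over the closure as well and
  there still extracts the coordinate at \<open>b\<close>.\<close>

lemma geom_projection:
  assumes b: "b \<in> Basis"
  shows "\<exists>ts. \<forall>z\<in>CS. geom_op ts z = fscale (z b) (tg 1)"
proof -
  obtain f where f: "f \<in> mult_ops" "\<forall>c\<in>Basis. f c = (if c = b then 1 else 0)"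
    using mult_ops_dense[of "\<lambda>c. if c = b then 1 else 0"] by blast
  obtain ts where ts: "\<And>x. f x = (\<Sum>(a, b)\<leftarrow>ts. a * x * b)" using mult_ops_extend[OF f(1)] by blast
  have fx: "f x = scale (rp x b) 1" for x
  proof -
    have "f (\<Sum>c\<in>B. scale (rp x c) c) = (\<Sum>c\<in>B. scale (rp x c) (f c))" for B
      by (induction B rule: infinite_finite_induct)
        (use mult_ops_linear[OF f(1)] mult_ops_linear(2)[OF f(1), of 0 0] in simp_all)
    then have "f x = (\<Sum>c\<in>Basis. scale (rp x c) (f c))" using rp_sum[of x] by metis
    also have "\<dots> = (\<Sum>c\<in>Basis. if c = b then scale (rp x b) 1 else 0)"
      using f(2) by (intro sum.cong) auto
    finally show ?thesis using b finite_Basis by simp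
  qed
  have "geom_op ts z = fscale (z b) (tg 1)" if "z \<in> CS" for z
    using that
  proof (induction z rule: CS_induct)
    case zero
    show ?case unfolding geom_op_zero by (rule ext) simp
  next
    case (step c x z)
    have "geom_op ts (tg x) = fscale (tg x b) (tg 1)"
      by (simp only: geom_op_tg ts[symmetric] fx tg_scale tg_apply)
    moreover have "(fscale c (tg x) + z) b = c * tg x b + z b" by simp
    ultimately show ?case
      using step by (simp only: geom_op_linear fun_vs.scale_left_distrib fun_vs.scale_scale)
  qed
  then show ?thesis by blast
qed

text \<open>Simplicity survives scalar extension: extracting a nonzero coordinate of an element of
  the ideal by two-sided multiplications yields a nonzero multiple of 1.\<close>

lemma geom_simple:
  assumes I: "fun_vs.subspace I" "\<And>z a. z \<in> I \<Longrightarrow> gm (tg a) z \<in> I" "\<And>z a. z \<in> I \<Longrightarrow> gm z (tg a) \<in> I"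
    and z: "z \<in> I" "z \<in> CS" "z \<noteq> 0"
  shows "tg 1 \<in> I"
proof -
  obtain b where b: "z b \<noteq> 0" using z(3) by (metis ext zero_fun_apply)
  then have "b \<in> Basis" using z(2) by (auto simp: coord_space_def)
  then obtain ts where ts: "geom_op ts z = fscale (z b) (tg 1)" using geom_projection z(2) by blast
  have "geom_op us z \<in> I" for us
  proof (induction us)
    case Nil
    show ?case using fun_vs.subspace_0[OF I(1)] by (simp only: geom_op_Nil)
  next
    case (Cons t us)
    obtain a b where t: "t = (a, b)" by fastforce
    show ?case unfolding t geom_op_Cons using Cons I z by (intro fun_vs.subspace_add[OF I(1)]) auto
  qed
  then have "fscale (z b) (tg 1) \<in> I" using ts by metis
  then have "fscale (inverse (z b)) (fscale (z b) (tg 1)) \<in> I" using fun_vs.subspace_scale[OF I(1)] by blast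
  then show ?thesis using b by (simp add: fun_vs.scale_scale)
qed

lemma tg_1_neq_0: "tg 1 \<noteq> 0" using tg_inj[of 1 0] by auto

definition left_ideal :: "('a \<Rightarrow> 'f alg_closure) set \<Rightarrow> bool" where
  "left_ideal L \<longleftrightarrow> fun_vs.subspace L \<and> L \<subseteq> CS \<and> (\<forall>w\<in>CS. \<forall>z\<in>L. gm w z \<in> L)"

text \<open>For a nonzero left ideal of least dimension, the multiples of any nonzero element form a
  nonzero left ideal inside it, hence all of it.\<close>

lemma ex_minimal_left_ideal:
  "\<exists>L. left_ideal L \<and> L \<noteq> {0} \<and> (\<forall>x\<in>L. \<forall>y\<in>L. x \<noteq> 0 \<longrightarrow> (\<exists>w\<in>CS. gm w x = y))"
proof -
  define P where "P L \<longleftrightarrow> left_ideal L \<and> L \<noteq> {0}" for L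
  have "CS \<noteq> {0}" using tg_1_neq_0 tg_in[of 1] by blast
  then have "P CS" unfolding P_def left_ideal_def using subspace_CS gm_in by blast
  then obtain L where L: "P L" and min: "\<And>M. P M \<Longrightarrow> fun_vs.dim L \<le> fun_vs.dim M"
    using ex_has_least_nat[of P CS fun_vs.dim] by blast
  have L': "fun_vs.subspace L" "L \<subseteq> CS" "\<And>w z. w \<in> CS \<Longrightarrow> z \<in> L \<Longrightarrow> gm w z \<in> L"
    using L by (auto simp: P_def left_ideal_def)
  have tr: "\<exists>w\<in>CS. gm w x = y" if x: "x \<in> L" "x \<noteq> 0" and y: "y \<in> L" for x y
  proof -
    define M where "M = (\<lambda>w. gm w x) ` CS"
    have xCS: "x \<in> CS" using x L' by blast
    have sub: "fun_vs.subspace M"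
    proof (rule fun_vs.subspaceI)
      show "0 \<in> M" unfolding M_def
        by (rule image_eqI[of _ _ 0]) (simp_all add: fun_vs.subspace_0[OF subspace_CS])
      show "u + v \<in> M" if uv: "u \<in> M" "v \<in> M" for u v
      proof -
        obtain a b where "u = gm a x" "v = gm b x" "a \<in> CS" "b \<in> CS" using uv by (auto simp: M_def)
        then show ?thesis unfolding M_def
          by (intro image_eqI[of _ _ "a + b"]) (simp_all only: gm_add_left fun_vs.subspace_add[OF subspace_CS])
      qed
      show "fscale c u \<in> M" if uM: "u \<in> M" for c u
      proof -
        obtain a where "u = gm a x" "a \<in> CS" using uM by (auto simp: M_def)
        then show ?thesis unfolding M_def
          by (intro image_eqI[of _ _ "fscale c a"]) (simp_all only: gm_fscale_left fun_vs.subspace_scale[OF subspace_CS])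
      qed
    qed
    have "x \<in> M" unfolding M_def using gm_1_left[OF xCS] by (intro image_eqI[of _ _ "tg 1"]) simp_all
    moreover have "gm w z \<in> M" if wz: "w \<in> CS" "z \<in> M" for w z
    proof -
      obtain a where "z = gm a x" "a \<in> CS" using wz by (auto simp: M_def)
      then show ?thesis unfolding M_def using wz xCS
        by (intro image_eqI[of _ _ "gm w a"]) (simp_all add: gm_assoc)
    qed
    ultimately have "P M" unfolding P_def left_ideal_def using sub x by (auto simp: M_def)
    have "M \<subseteq> L" unfolding M_def using L' x by auto
    then have "M = L"
      using fv.dim_psubset[OF sub, of L "dlt ` Basis"] min[OF \<open>P M\<close>] L'(2) CS_span finite_Basis by auto
    then show ?thesis using y by (auto simp: M_def)
  qed
  with L show ?thesis unfolding P_def by blast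
qed

text \<open>Wedderburn's theorem over an algebraically closed field. The scalar extension acts on a
  minimal left ideal; density makes the action surjective onto matrices, simplicity makes it
  injective, and comparing dimensions identifies the size with the degree.\<close>

lemma splitting:
  assumes "has_degree scale n"
  shows "\<exists>\<eta>. bij_betw \<eta> CS (mats n) \<and> (\<forall>z w. z \<in> CS \<longrightarrow> w \<in> CS \<longrightarrow> \<eta> (z + w) = \<eta> z + \<eta> w) \<and>
    (\<forall>c z. z \<in> CS \<longrightarrow> \<eta> (fscale c z) = fscale c (\<eta> z)) \<and>
    (\<forall>z w. z \<in> CS \<longrightarrow> w \<in> CS \<longrightarrow> \<eta> (gm z w) = mm n (\<eta> z) (\<eta> w)) \<and> \<eta> (tg 1) = idm n"
proof -
  obtain L where L: "left_ideal L" "L \<noteq> {0}"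
    and trans: "\<And>x y. x \<in> L \<Longrightarrow> x \<noteq> 0 \<Longrightarrow> y \<in> L \<Longrightarrow> \<exists>w\<in>CS. gm w x = y"
    using ex_minimal_left_ideal by blast
  have sL: "fun_vs.subspace L" and LCS: "L \<subseteq> CS" and Lgm: "\<And>w z. w \<in> CS \<Longrightarrow> z \<in> L \<Longrightarrow> gm w z \<in> L"
    using L by (auto simp: left_ideal_def)
  have fB: "finite (dlt ` Basis :: ('a \<Rightarrow> 'f alg_closure) set)" using finite_Basis by simp
  have LB: "L \<subseteq> fun_vs.span (dlt ` Basis)" using LCS CS_span by blast
  obtain C where C: "C \<subseteq> L" "finite C" "fun_vs.independent C" "L \<subseteq> fun_vs.span C"
    using fv.indep_basis_of[OF LB fB] by metis
  have spC: "fun_vs.span C = L" using C sL fun_vs.span_minimal by blast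
  define k where "k = card C"
  obtain l where l: "bij_betw l {..<k} C"
    using ex_bij_betw_nat_finite[OF C(2)] by (auto simp: k_def atLeast0LessThan)
  have lC: "l ` {..<k} = C" and lL: "\<And>i. i < k \<Longrightarrow> l i \<in> L" using l C(1) by (auto simp: bij_betw_def)
  have ind: "fv.indep_fam {..<k} l" using l C by (subst fv.indep_fam_iff) (auto simp: bij_betw_def)
  have dense: "\<exists>f\<in>gm ` CS. \<forall>b\<in>C. f b = t b" if t: "\<And>b. b \<in> C \<Longrightarrow> t b \<in> L" for t
  proof (rule fv.density[where W = L and B = C and S = "gm ` CS"])
    show "fun_vs.subspace L" "finite C" "C \<subseteq> L" "fun_vs.independent C" by fact+
    show "\<And>b. b \<in> C \<Longrightarrow> t b \<in> L" by (rule t)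
    show "\<And>f x. f \<in> gm ` CS \<Longrightarrow> x \<in> L \<Longrightarrow> f x \<in> L" using Lgm by auto
    show "\<And>f x y. f \<in> gm ` CS \<Longrightarrow> x \<in> L \<Longrightarrow> y \<in> L \<Longrightarrow> f (x + y) = f x + f y"
      by (auto simp only: gm_add_right)
    show "\<And>f c x. f \<in> gm ` CS \<Longrightarrow> x \<in> L \<Longrightarrow> f (fscale c x) = fscale c (f x)"
      by (auto simp only: gm_fscale_right)
    show "(\<lambda>x. 0) \<in> gm ` CS"
      by (rule image_eqI[of _ _ 0]) (auto simp: fun_vs.subspace_0[OF subspace_CS])
    show "(\<lambda>x. f x + g x) \<in> gm ` CS" if fg: "f \<in> gm ` CS" "g \<in> gm ` CS" for f g
    proof -
      obtain a b where "f = gm a" "g = gm b" "a \<in> CS" "b \<in> CS" using fg by auto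
      then show ?thesis
        by (intro image_eqI[of _ _ "a + b"], intro ext, simp only: gm_add_left)
          (simp only: fun_vs.subspace_add[OF subspace_CS])
    qed
    show "(\<lambda>x. fscale c (f x)) \<in> gm ` CS" if f: "f \<in> gm ` CS" for f c
    proof -
      obtain a where "f = gm a" "a \<in> CS" using f by auto
      then show ?thesis
        by (intro image_eqI[of _ _ "fscale c a"], intro ext, simp only: gm_fscale_left)
          (simp only: fun_vs.subspace_scale[OF subspace_CS])
    qed
    show "(\<lambda>x. f (g x)) \<in> gm ` CS" if fg: "f \<in> gm ` CS" "g \<in> gm ` CS" for f g
    proof -
      obtain a b where "f = gm a" "g = gm b" "a \<in> CS" "b \<in> CS" using fg by auto
      then show ?thesis
        by (intro image_eqI[of _ _ "gm a b"], intro ext, simp only: gm_assoc) simp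
    qed
    show "\<exists>f\<in>gm ` CS. f x = y" if "x \<in> L" "x \<noteq> 0" "y \<in> L" for x y using trans[OF that] by auto
    show "\<exists>c. \<forall>x\<in>L. T x = fscale c x"
      if T: "\<And>x. x \<in> L \<Longrightarrow> T x \<in> L" "\<And>x y. x \<in> L \<Longrightarrow> y \<in> L \<Longrightarrow> T (x + y) = T x + T y"
        "\<And>c x. x \<in> L \<Longrightarrow> T (fscale c x) = fscale c (T x)"
        "\<And>f x. f \<in> gm ` CS \<Longrightarrow> x \<in> L \<Longrightarrow> T (f x) = f (T x)" for T
    proof -
      have lin: "fv.lin_on L T" unfolding fv.lin_on_def using sL T(1-3) by blast
      obtain x where x: "x \<in> L" "x \<noteq> 0" using L(2) fun_vs.subspace_0[OF sL] by blast
      \<comment> \<open>The commuting map has an eigenvector \<open>y\<close>, and since every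
        element of \<open>L\<close> is a multiple of \<open>y\<close>, it is the scalar
        \<open>a\<close> everywhere.\<close>
      obtain y a where y: "y \<in> L" "y \<noteq> 0" "T y = fscale a y"
        using ex_eigenvector[OF fv.vec_sp_axioms lin fB LB x] by blast
      have "T z = fscale a z" if "z \<in> L" for z
      proof -
        obtain w where w: "w \<in> CS" "gm w y = z" using trans[OF y(1,2) \<open>z \<in> L\<close>] by blast
        have "T (gm w y) = gm w (T y)" using T(4)[OF imageI[OF w(1)] y(1)] .
        then show ?thesis using y(3) w(2) by (simp add: gm_fscale_right)
      qed
      then show ?thesis by blast
    qed
  qed
  have uniq: "M = N" if M: "M \<in> mats k" "N \<in> mats k"
    and eq: "\<And>j. j < k \<Longrightarrow> (\<Sum>i<k. fscale (M (i, j)) (l i)) = (\<Sum>i<k. fscale (N (i, j)) (l i))" for M N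
  proof (rule mtx_eqI)
    fix i j show "M (i, j) = N (i, j)"
      using fv.indep_fam_eqD[OF ind eq[of j], of i] matsD[OF M(1), of i j] matsD[OF M(2), of i j]
      by (cases "i < k \<and> j < k") auto
  qed
  have ex: "\<exists>M. M \<in> mats k \<and> (\<forall>j<k. gm z (l j) = (\<Sum>i<k. fscale (M (i, j)) (l i)))" if "z \<in> CS" for z
  proof -
    have "\<exists>c. gm z (l j) = (\<Sum>i<k. fscale (c i) (l i))" if "j < k" for j
      using Lgm[OF \<open>z \<in> CS\<close> lL[OF that]] spC lC fv.span_family[of "{..<k}" "gm z (l j)" l] by auto
    then obtain c where c: "\<And>j. j < k \<Longrightarrow> gm z (l j) = (\<Sum>i<k. fscale (c j i) (l i))" by metis
    show ?thesis
      by (rule exI[of _ "\<lambda>(i, j). if i < k \<and> j < k then c j i else 0"]) (auto simp: mats_iff c intro!: sum.cong)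
  qed
  have "\<forall>z\<in>CS. \<exists>M. M \<in> mats k \<and> (\<forall>j<k. gm z (l j) = (\<Sum>i<k. fscale (M (i, j)) (l i)))"
    using ex by (rule ballI)
  from bchoice[OF this] obtain \<eta> where
    \<eta>': "\<forall>z\<in>CS. \<eta> z \<in> mats k \<and> (\<forall>j<k. gm z (l j) = (\<Sum>i<k. fscale (\<eta> z (i, j)) (l i)))" ..
  have \<eta>: "\<eta> z \<in> mats k \<and> (\<forall>j<k. gm z (l j) = (\<Sum>i<k. fscale (\<eta> z (i, j)) (l i)))" if "z \<in> CS" for z
    by (rule bspec[OF \<eta>' that])
  have \<eta>_in: "\<eta> z \<in> mats k" if "z \<in> CS" for z using \<eta>[OF that] by blast
  have act: "gm z (l j) = (\<Sum>i<k. fscale (\<eta> z (i, j)) (l i))" if "z \<in> CS" "j < k" for z j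
    using \<eta>[OF that(1)] that(2) by blast
  have \<eta>_eqI: "\<eta> z = M" if "z \<in> CS" "M \<in> mats k" "\<And>j. j < k \<Longrightarrow> gm z (l j) = (\<Sum>i<k. fscale (M (i, j)) (l i))" for z M
    using uniq[OF \<eta>_in[OF that(1)] that(2)] act[OF that(1)] that(3) by simp
  have \<eta>_add: "\<eta> (z + w) = \<eta> z + \<eta> w" if "z \<in> CS" "w \<in> CS" for z w
    using that \<eta>_in by (intro \<eta>_eqI)
      (auto simp: act gm_add_left sum.distrib fun_vs.scale_left_distrib
        intro!: fun_vs.subspace_add[OF subspace_CS] fun_vs.subspace_add[OF subspace_mats])
  have \<eta>_scale: "\<eta> (fscale c z) = fscale c (\<eta> z)" if "z \<in> CS" for c z
    using that \<eta>_in by (intro \<eta>_eqI)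
      (auto simp: act gm_fscale_left fun_vs.scale_sum_right
        intro!: fun_vs.subspace_scale[OF subspace_CS] fun_vs.subspace_scale[OF subspace_mats])
  have \<eta>_mult: "\<eta> (gm z w) = mm k (\<eta> z) (\<eta> w)" if zw: "z \<in> CS" "w \<in> CS" for z w
  proof (rule \<eta>_eqI)
    fix j assume j: "j < k"
    have "l j \<in> CS" using lL[OF j] LCS by blast
    then have "gm (gm z w) (l j) = gm z (\<Sum>i<k. fscale (\<eta> w (i, j)) (l i))"
      using zw j by (simp only: gm_assoc act)
    also have "\<dots> = (\<Sum>i<k. fscale (\<eta> w (i, j)) (\<Sum>r<k. fscale (\<eta> z (r, i)) (l r)))"
      unfolding gm_sum_right gm_fscale_right using zw by (intro sum.cong refl) (simp add: act)
    also have "\<dots> = (\<Sum>r<k. fscale (mm k (\<eta> z) (\<eta> w) (r, j)) (l r))"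
      unfolding fun_vs.scale_sum_right
      by (subst sum.swap) (simp add: mm_apply fun_vs.scale_sum_left fun_vs.scale_scale mult.commute)
    finally show "gm (gm z w) (l j) = (\<Sum>i<k. fscale (mm k (\<eta> z) (\<eta> w) (i, j)) (l i))" .
  qed (use zw \<eta>_in in simp_all)
  have \<eta>_1: "\<eta> (tg 1) = idm k"
  proof (rule \<eta>_eqI)
    fix j assume j: "j < k"
    have "(\<Sum>i<k. fscale (idm k (i, j)) (l i)) = (\<Sum>i<k. if i = j then l i else 0)"
      by (intro sum.cong) (auto simp: idm_apply fun_eq_iff)
    then show "gm (tg 1) (l j) = (\<Sum>i<k. fscale (idm k (i, j)) (l i))"
      using lL[OF j] LCS j gm_1_left by auto
  qed simp_all
  have surj: "\<exists>z\<in>CS. \<eta> z = M" if M: "M \<in> mats k" for M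
  proof -
    \<comment> \<open>The columns of \<open>M\<close> prescribe the images of the basis of
      \<open>L\<close>; density finds an element acting in this way.\<close>
    define t where "t b = (\<Sum>i<k. fscale (M (i, the_inv_into {..<k} l b)) (l i))" for b
    have "t b \<in> L" for b unfolding t_def using lL by (intro fun_vs.subspace_sum[OF sL] fun_vs.subspace_scale[OF sL]) auto
    then obtain w where w: "w \<in> CS" "\<And>b. b \<in> C \<Longrightarrow> gm w b = t b" using dense[of t] by auto
    have "gm w (l j) = (\<Sum>i<k. fscale (M (i, j)) (l i))" if "j < k" for j
      using w(2)[of "l j"] that l lC by (auto simp: t_def bij_betw_def the_inv_into_f_f)
    then show ?thesis using \<eta>_eqI[OF w(1) M] w(1) by blast
  qed
  have ker: "z = 0" if z: "z \<in> CS" "\<eta> z = 0" for z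
  proof (rule ccontr)
    assume z0: "z \<noteq> 0"
    \<comment> \<open>The annihilator of \<open>L\<close> is a two-sided ideal. If it were nonzero,
      it would contain the unit and \<open>L\<close> would vanish.\<close>
    define I where "I = {z \<in> CS. \<forall>x\<in>L. gm z x = 0}"
    have "gm z x = 0" if "x \<in> L" for x
    proof -
      have "x \<in> fun_vs.span (l ` {..<k})" using that spC lC by simp
      then obtain c where c: "x = (\<Sum>i<k. fscale (c i) (l i))" using fv.span_family[of "{..<k}" x l] by auto
      show ?thesis unfolding c gm_sum_right gm_fscale_right using z
        by (intro sum.neutral) (simp add: act fun_vs.scale_eq_0_iff)
    qed
    then have "z \<in> I" using z by (simp add: I_def)
    have "tg 1 \<in> I"
    proof (rule geom_simple[OF _ _ _ \<open>z \<in> I\<close> z(1) z0])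
      show "fun_vs.subspace I" unfolding I_def
        by (rule fun_vs.subspaceI)
          (auto simp: gm_add_left gm_fscale_left fun_vs.subspace_0[OF subspace_CS]
            fun_vs.subspace_add[OF subspace_CS] fun_vs.subspace_scale[OF subspace_CS] fun_vs.scale_eq_0_iff)
      show "gm (tg a) u \<in> I" if "u \<in> I" for u a
        using that LCS unfolding I_def by (auto simp: gm_assoc subset_eq)
      show "gm u (tg a) \<in> I" if "u \<in> I" for u a
        using that LCS Lgm[of "tg a"] unfolding I_def by (auto simp: gm_assoc subset_eq)
    qed
    then have "x = 0" if "x \<in> L" for x using that gm_1_left[of x] LCS unfolding I_def by auto
    then show False using L(2) fun_vs.subspace_0[OF sL] by blast
  qed
  have inj: "inj_on \<eta> CS"
  proof (rule inj_onI)
    fix z w assume zw: "z \<in> CS" "w \<in> CS" "\<eta> z = \<eta> w"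
    have m: "fscale (-1) w \<in> CS" using zw fun_vs.subspace_scale[OF subspace_CS] by blast
    have "\<eta> (z + fscale (-1) w) = \<eta> z + fscale (-1) (\<eta> w)"
      by (simp only: \<eta>_add[OF zw(1) m] \<eta>_scale[OF zw(2)])
    also have "\<dots> = 0" using zw by (simp add: fun_eq_iff)
    finally have "z + fscale (-1) w = 0" using ker zw m fun_vs.subspace_add[OF subspace_CS] by blast
    then show "z = w" by (simp add: fun_eq_iff)
  qed
  have bij: "bij_betw \<eta> CS (mats k)"
    unfolding bij_betw_def using inj surj \<eta>_in by (auto simp: image_def)
  have \<eta>_sum: "\<eta> (\<Sum>i\<in>I. fscale (c i) (x i)) = (\<Sum>i\<in>I. fscale (c i) (\<eta> (x i)))"
    if "finite I" "\<And>i. i \<in> I \<Longrightarrow> x i \<in> CS" for I :: "'z set" and c x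
    using that
  proof (induction I)
    case empty
    have "\<eta> (fscale 0 0) = fscale 0 (\<eta> 0)" using fun_vs.subspace_0[OF subspace_CS] by (rule \<eta>_scale)
    then show ?case by (simp only: fun_vs.scale_zero_left sum.empty)
  next
    case (insert i I)
    have "(\<Sum>i\<in>I. fscale (c i) (x i)) \<in> CS"
      using insert by (intro fun_vs.subspace_sum[OF subspace_CS] fun_vs.subspace_scale[OF subspace_CS]) auto
    moreover have "fscale (c i) (x i) \<in> CS" "x i \<in> CS"
      using insert.prems fun_vs.subspace_scale[OF subspace_CS] by auto
    moreover have "\<eta> (\<Sum>i\<in>I. fscale (c i) (x i)) = (\<Sum>i\<in>I. fscale (c i) (\<eta> (x i)))"
      using insert.prems by (intro insert.IH) auto
    ultimately show ?case by (simp only: sum.insert[OF insert.hyps] \<eta>_add \<eta>_scale)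
  qed
  have "card Basis \<le> k * k"
  proof -
    have "fv.indep_fam Basis (\<lambda>b. \<eta> (tg b))"
      unfolding fv.indep_fam_def
    proof (intro allI impI ballI)
      fix c b assume c: "(\<Sum>b\<in>Basis. fscale (c b) (\<eta> (tg b))) = 0" and b: "b \<in> Basis"
      then have "\<eta> (\<Sum>b\<in>Basis. fscale (c b) (tg b)) = 0" using \<eta>_sum[OF finite_Basis, of tg c] by simp
      then have "(\<Sum>b\<in>Basis. fscale (c b) (tg b)) = 0"
        by (intro ker) (auto intro!: fun_vs.subspace_sum[OF subspace_CS] fun_vs.subspace_scale[OF subspace_CS])
      then have "(\<Sum>b\<in>Basis. fscale (c b) (dlt b)) = 0" by (simp add: tg_Basis)
      then show "c b = 0" using fv.indep_famD[OF indep_dlt[OF finite_Basis]] b by blast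
    qed
    then have "card Basis \<le> card ({..<k} \<times> {..<k})"
      using \<eta>_in[OF tg_in] by (intro indep_coord[OF _ finite_Basis]) (auto simp: mats_def)
    then show ?thesis by simp
  qed
  moreover have "k * k \<le> card Basis"
  proof -
    have "\<forall>p\<in>{..<k} \<times> {..<k}. \<exists>z\<in>CS. \<eta> z = dlt p"
      using surj by (auto intro!: surj)
    then obtain z where z: "\<And>p. p \<in> {..<k} \<times> {..<k} \<Longrightarrow> z p \<in> CS \<and> \<eta> (z p) = dlt p" by metis
    have "fv.indep_fam ({..<k} \<times> {..<k}) z"
      unfolding fv.indep_fam_def
    proof (intro allI impI ballI)
      fix c p assume c: "(\<Sum>p\<in>{..<k} \<times> {..<k}. fscale (c p) (z p)) = 0" and p: "p \<in> {..<k} \<times> {..<k}"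
      have "(\<Sum>p\<in>{..<k} \<times> {..<k}. fscale (c p) (dlt p)) = (\<Sum>p\<in>{..<k} \<times> {..<k}. fscale (c p) (\<eta> (z p)))"
        using z by (intro sum.cong) auto
      also have "\<dots> = \<eta> (\<Sum>p\<in>{..<k} \<times> {..<k}. fscale (c p) (z p))" using z by (subst \<eta>_sum) auto
      also have "\<dots> = 0" unfolding c using \<eta>_sum[of "{}" "\<lambda>_. 0" "\<lambda>_. 0"] by simp
      finally show "c p = 0"
        using fv.indep_famD[OF indep_dlt[of "{..<k} \<times> {..<k}"], of c p] p by simp
    qed
    then have "card ({..<k} \<times> {..<k}) \<le> card Basis"
      using z by (intro indep_coord[OF finite_Basis]) auto
    then show ?thesis by simp
  qed
  moreover have "card Basis = n\<^sup>2" using assms dim_UNIV by (simp add: has_degree_def)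
  ultimately have "k\<^sup>2 = n\<^sup>2" by (simp add: power2_eq_square)
  then have "k = n" by simp
  then show ?thesis using bij \<eta>_add \<eta>_scale \<eta>_mult \<eta>_1 by blast
qed

end

declare plus_fun_apply [simp del] zero_fun_apply [simp del] fscale_apply [simp del]
  minus_apply [simp del] uminus_apply [simp del]

lemmas fun_app = plus_fun_apply zero_fun_apply fscale_apply minus_apply uminus_apply

section \<open>Algebras with a fixed splitting over the closure\<close>

locale split_csa = central_simple_algebra scale Basis
  for scale :: "'f::field \<Rightarrow> 'a::ring_1 \<Rightarrow> 'a" and Basis :: "'a set" +
  fixes n :: nat and \<eta> :: "('a \<Rightarrow> 'f alg_closure) \<Rightarrow> 'f alg_closure mtx"
  assumes card_Basis: "card Basis = n * n"
    and \<eta>_bij: "bij_betw \<eta> CS (mats n)"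
    and \<eta>_add: "z \<in> CS \<Longrightarrow> w \<in> CS \<Longrightarrow> \<eta> (z + w) = \<eta> z + \<eta> w"
    and \<eta>_scale: "z \<in> CS \<Longrightarrow> \<eta> (fscale c z) = fscale c (\<eta> z)"
    and \<eta>_mult: "z \<in> CS \<Longrightarrow> w \<in> CS \<Longrightarrow> \<eta> (gm z w) = mm n (\<eta> z) (\<eta> w)"
    and \<eta>_1: "\<eta> (tg 1) = idm n"
begin

lemma n_pos: "0 < n"
proof -
  have "Basis \<noteq> {}"
  proof
    assume "Basis = {}"
    then have "(1::'a) = 0" using rp_sum[of 1] by simp
    then show False by simp
  qed
  then have "card Basis > 0" using finite_Basis by (simp add: card_gt_0_iff)
  then show ?thesis using card_Basis by simp
qed

lemma \<eta>_in [simp]: "z \<in> CS \<Longrightarrow> \<eta> z \<in> mats n"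
  using \<eta>_bij bij_betwE by blast

lemma zero_CS [simp]: "0 \<in> CS" by (rule fun_vs.subspace_0[OF subspace_CS])

lemma \<eta>_0: "\<eta> 0 = 0"
proof -
  have "\<eta> (fscale 0 0) = fscale 0 (\<eta> 0)" by (rule \<eta>_scale) simp
  then show ?thesis by (simp only: fun_vs.scale_zero_left)
qed

lemma \<eta>_sum:
  assumes "finite I" "\<And>i. i \<in> I \<Longrightarrow> x i \<in> CS"
  shows "\<eta> (\<Sum>i\<in>I. fscale (c i) (x i)) = (\<Sum>i\<in>I. fscale (c i) (\<eta> (x i)))"
  using assms
proof (induction I)
  case empty
  show ?case by (simp only: sum.empty \<eta>_0)
next
  case (insert i I)
  have "(\<Sum>i\<in>I. fscale (c i) (x i)) \<in> CS"
    using insert by (intro fun_vs.subspace_sum[OF subspace_CS] fun_vs.subspace_scale[OF subspace_CS]) auto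
  moreover have "fscale (c i) (x i) \<in> CS" "x i \<in> CS"
    using insert.prems fun_vs.subspace_scale[OF subspace_CS] by auto
  moreover have "\<eta> (\<Sum>i\<in>I. fscale (c i) (x i)) = (\<Sum>i\<in>I. fscale (c i) (\<eta> (x i)))"
    using insert.prems by (intro insert.IH) auto
  ultimately show ?case by (simp only: sum.insert[OF insert.hyps] \<eta>_add \<eta>_scale)
qed

lemma \<eta>_inj: "z \<in> CS \<Longrightarrow> w \<in> CS \<Longrightarrow> \<eta> z = \<eta> w \<Longrightarrow> z = w"
  using \<eta>_bij by (auto simp: bij_betw_def inj_on_def)

definition \<eta>i :: "'f alg_closure mtx \<Rightarrow> 'a \<Rightarrow> 'f alg_closure" where
  "\<eta>i M = inv_into CS \<eta> M"

lemma \<eta>i_in [simp]: "M \<in> mats n \<Longrightarrow> \<eta>i M \<in> CS"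
  unfolding \<eta>i_def using \<eta>_bij by (metis bij_betw_def inv_into_into)

lemma \<eta>_\<eta>i [simp]: "M \<in> mats n \<Longrightarrow> \<eta> (\<eta>i M) = M"
  unfolding \<eta>i_def using \<eta>_bij by (rule bij_betw_inv_into_right)

lemma \<eta>i_\<eta>: "z \<in> CS \<Longrightarrow> \<eta>i (\<eta> z) = z"
  by (rule \<eta>_inj) simp_all

lemma \<eta>i_add: "M \<in> mats n \<Longrightarrow> N \<in> mats n \<Longrightarrow> \<eta>i (M + N) = \<eta>i M + \<eta>i N"
  by (rule \<eta>_inj)
    (simp_all add: fun_vs.subspace_add[OF subspace_CS] fun_vs.subspace_add[OF subspace_mats] \<eta>_add)

lemma \<eta>i_fscale: "M \<in> mats n \<Longrightarrow> \<eta>i (fscale c M) = fscale c (\<eta>i M)"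
  by (rule \<eta>_inj)
    (simp_all add: fun_vs.subspace_scale[OF subspace_CS] fun_vs.subspace_scale[OF subspace_mats] \<eta>_scale)

lemma \<eta>i_mm: "M \<in> mats n \<Longrightarrow> N \<in> mats n \<Longrightarrow> \<eta>i (mm n M N) = gm (\<eta>i M) (\<eta>i N)"
  by (rule \<eta>_inj) (simp_all add: \<eta>_mult)

text \<open>The original algebra inside the matrices over the closure, of which it is a form over
  the base field.\<close>

definition \<iota> :: "'a \<Rightarrow> 'f alg_closure mtx" where "\<iota> x = \<eta> (tg x)"

lemma \<iota>_in [simp]: "\<iota> x \<in> mats n" by (simp add: \<iota>_def)
lemma \<iota>_add: "\<iota> (x + y) = \<iota> x + \<iota> y" by (simp only: \<iota>_def tg_add \<eta>_add tg_in)
lemma \<iota>_scale: "\<iota> (scale c x) = fscale (to_ac c) (\<iota> x)" by (simp only: \<iota>_def tg_scale \<eta>_scale tg_in)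
lemma \<iota>_mult: "\<iota> (x * y) = mm n (\<iota> x) (\<iota> y)" by (simp only: \<iota>_def tg_mult \<eta>_mult tg_in)
lemma \<iota>_1: "\<iota> 1 = idm n" by (simp add: \<iota>_def \<eta>_1)
lemma \<iota>_0: "\<iota> 0 = 0" using \<iota>_scale[of 0 0] by (simp only: scale_zero_left to_ac_0 fun_vs.scale_zero_left)

lemma \<eta>i_\<iota>: "\<eta>i (\<iota> x) = tg x" by (simp add: \<iota>_def \<eta>i_\<eta>)

lemma \<iota>_inj: "\<iota> x = \<iota> y \<Longrightarrow> x = y"
  unfolding \<iota>_def using \<eta>_inj[OF tg_in tg_in] tg_inj by blast

lemma \<iota>_expand: "M \<in> mats n \<Longrightarrow> M = (\<Sum>b\<in>Basis. fscale (\<eta>i M b) (\<iota> b))"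
  using arg_cong[OF CS_expand[OF \<eta>i_in], of M \<eta>]
  by (simp only: \<eta>_\<eta>i \<eta>_sum[OF finite_Basis tg_in] \<iota>_def)

lemma \<iota>_sum: "\<iota> (\<Sum>i\<in>I. scale (c i) (x i)) = (\<Sum>i\<in>I. fscale (to_ac (c i)) (\<iota> (x i)))"
  by (induction I rule: infinite_finite_induct)
    (simp_all only: sum.infinite sum.empty sum.insert not_False_eq_True \<iota>_0 \<iota>_add \<iota>_scale)

end

lemma poly_zero_of_roots:
  fixes p :: "'k::field poly"
  assumes "finite S" "\<And>x. x \<in> S \<Longrightarrow> poly p x = 0" "degree p < card S"
  shows "p = 0"
proof (rule ccontr)
  assume p: "p \<noteq> 0"
  have "card S \<le> card {x. poly p x = 0}"
    using assms poly_roots_finite[OF p] by (intro card_mono) auto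
  also have "\<dots> \<le> degree p" using p by (rule card_poly_roots_bound)
  finally show False using assms(3) by simp
qed

lemma degree_diff_monic:
  fixes p q :: "'k::field poly"
  assumes "degree p = d" "degree q = d" "lead_coeff p = 1" "lead_coeff q = 1" "0 < d"
  shows "degree (p - q) < d"
proof (rule degree_lessI)
  show "p - q \<noteq> 0 \<or> 0 < d" using assms by simp
  show "\<forall>k\<ge>d. coeff (p - q) k = 0"
  proof (intro allI impI)
    fix k assume "k \<ge> d"
    then show "coeff (p - q) k = 0" using assms by (cases "k = d") (auto simp: coeff_eq_0)
  qed
qed

section \<open>Finite base fields\<close>

context
  fixes q :: nat
  assumes fin: "finite (UNIV :: 'f::field set)" and q: "q = card (UNIV :: 'f set)"
begin

lemma card_field_ge_2: "2 \<le> q"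
proof -
  have "card {0, 1 :: 'f} \<le> q" unfolding q using fin by (intro card_mono) auto
  then show ?thesis by simp
qed

text \<open>Multiplication by a nonzero element permutes the nonzero elements, so their product can
  be cancelled.\<close>

lemma power_card_field: "(c :: 'f) ^ q = c"
proof (cases "c = 0")
  case True
  then show ?thesis using card_field_ge_2 by simp
next
  case False
  let ?U = "UNIV - {0 :: 'f}"
  have "(\<Prod>x\<in>?U. c * x) = (\<Prod>x\<in>?U. x)"
    by (rule prod.reindex_bij_witness[of _ "\<lambda>x. x / c" "\<lambda>x. c * x"]) (use False in auto)
  then have "c ^ card ?U * (\<Prod>x\<in>?U. x) = (\<Prod>x\<in>?U. x)" by (simp add: prod.distrib)
  moreover have "(\<Prod>x\<in>?U. x) \<noteq> 0" using fin by (subst prod_zero_iff) auto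
  ultimately have "c ^ card ?U = 1" by simp
  moreover have "q = Suc (card ?U)" unfolding q by (rule card.remove) (use fin in auto)
  ultimately show ?thesis by simp
qed

text \<open>The difference of these two monic polynomials of degree \<open>q\<close> has smaller
  degree and vanishes at all \<open>q\<close> elements of the base field.\<close>

lemma frobenius_poly: "(z :: 'f alg_closure) ^ q - z = (\<Prod>c\<in>UNIV. z - to_ac c)"
proof -
  define p :: "'f alg_closure poly" where "p = monom 1 q - [:0, 1:]"
  define r :: "'f alg_closure poly" where "r = (\<Prod>c\<in>UNIV. [:- to_ac (c::'f), 1:])"
  have q1: "1 < q" using card_field_ge_2 by simp
  have dp: "degree p = q" "lead_coeff p = 1"
  proof -
    have d: "degree (- [:0, 1 :: 'f alg_closure:]) < degree (monom (1 :: 'f alg_closure) q)"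
      using q1 by (simp add: degree_monom_eq)
    show "degree p = q"
      unfolding p_def diff_conv_add_uminus degree_add_eq_left[OF d] by (simp add: degree_monom_eq)
    then show "lead_coeff p = 1" using q1 by (simp add: p_def coeff_pCons split: nat.splits)
  qed
  have dr: "degree r = q" unfolding r_def q by (subst degree_prod_eq_sum_degree) auto
  have lr: "lead_coeff r = 1" unfolding r_def lead_coeff_prod by simp
  have "degree (p - r) < card (range (to_ac :: 'f \<Rightarrow> _))"
    using degree_diff_monic[OF dp(1) dr dp(2) lr] q1 by (simp add: card_image inj_to_ac flip: q)
  moreover have "poly (p - r) x = 0" if x: "x \<in> range (to_ac :: 'f \<Rightarrow> _)" for x
  proof -
    obtain c :: 'f where c: "x = to_ac c" using x by auto
    have "poly r x = 0" unfolding r_def poly_prod c using fin by (subst prod_zero_iff) auto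
    moreover have "x ^ q = x" unfolding c to_ac_power[symmetric] power_card_field ..
    ultimately show ?thesis by (simp add: p_def poly_monom)
  qed
  ultimately have "p - r = 0" using fin by (intro poly_zero_of_roots[of "range to_ac"]) auto
  then have "poly p z = poly r z" by simp
  then show ?thesis by (simp add: p_def r_def poly_monom poly_prod)
qed

lemma frobenius_fixed: "(z :: 'f alg_closure) ^ q = z \<Longrightarrow> z \<in> range (to_ac :: 'f \<Rightarrow> _)"
  using frobenius_poly[of z] fin by (auto simp: prod_zero_iff)

lemma frobenius_shift: "(z + to_ac (a::'f)) ^ q - (z + to_ac a) = z ^ q - z"
  unfolding frobenius_poly
  by (rule prod.reindex_bij_witness[of _ "\<lambda>c. c + a" "\<lambda>c. c - a"]) auto

text \<open>As a polynomial in \<open>x\<close>, the difference of both sides has degree below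
  \<open>q\<close>, and by \<open>frobenius_shift\<close> it vanishes on the \<open>q\<close>
  elements of the base field. No binomial coefficients are involved.\<close>

lemma frobenius_add: "(x + y :: 'f alg_closure) ^ q = x ^ q + y ^ q"
proof -
  define p :: "'f alg_closure poly" where
    "p = ([:y, 1:] ^ q - monom 1 q) + [:- y - (y ^ q - y):]"
  have q1: "1 < q" using card_field_ge_2 by simp
  have "degree ([:y, 1:] ^ q - monom 1 q) < q"
  proof (rule degree_diff_monic)
    show d: "degree ([:y, 1:] ^ q) = q" by (rule degree_linear_power)
    show "lead_coeff ([:y, 1:] ^ q) = 1" by (subst lead_coeff_power) simp
  qed (use q1 in \<open>simp_all add: degree_monom_eq\<close>)
  then have "degree p < card (range (to_ac :: 'f \<Rightarrow> _))"
    unfolding p_def using q1 by (intro degree_add_less) (simp_all add: card_image inj_to_ac flip: q)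
  moreover have "poly p z = 0" if z: "z \<in> range (to_ac :: 'f \<Rightarrow> _)" for z
  proof -
    obtain c :: 'f where c: "z = to_ac c" using z by auto
    have "z ^ q = z" unfolding c to_ac_power[symmetric] power_card_field ..
    then show ?thesis using frobenius_shift[of y c] c by (simp add: p_def poly_monom algebra_simps)
  qed
  ultimately have "p = 0" using fin by (intro poly_zero_of_roots[of "range to_ac"]) auto
  then have "poly p x = 0" by simp
  then show ?thesis by (simp add: p_def poly_monom algebra_simps)
qed

lemma frobenius_sum: "(\<Sum>i\<in>I. f i :: 'f alg_closure) ^ q = (\<Sum>i\<in>I. f i ^ q)"
  using card_field_ge_2 by (induction I rule: infinite_finite_induct) (auto simp: frobenius_add)

text \<open>A case of Lang's theorem for the general linear group: the fixed vector is found by solving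
  one separable polynomial equation along an orbit.\<close>

lemma semilinear_fixed_vector:
  fixes \<theta> :: "(nat \<Rightarrow> 'f alg_closure) \<Rightarrow> nat \<Rightarrow> 'f alg_closure"
  assumes n: "0 < n" and W: "W = coord_space {..<n}"
    and in_W: "\<And>v. v \<in> W \<Longrightarrow> \<theta> v \<in> W"
    and add: "\<And>v w. v \<in> W \<Longrightarrow> w \<in> W \<Longrightarrow> \<theta> (v + w) = \<theta> v + \<theta> w"
    and sc: "\<And>c v. v \<in> W \<Longrightarrow> \<theta> (fscale c v) = fscale (c ^ q) (\<theta> v)"
    and inj: "\<And>v. v \<in> W \<Longrightarrow> \<theta> v = 0 \<Longrightarrow> v = 0"
  shows "\<exists>w\<in>W. w \<noteq> 0 \<and> \<theta> w = w"
proof -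
  have sW: "fun_vs.subspace W" unfolding W by (rule subspace_coord)
  define y where "y i = (\<theta> ^^ i) (dlt (0::nat))" for i
  have yW: "y i \<in> W" for i
  proof (induction i)
    case 0 show ?case using n by (simp add: y_def W dlt_in)
  next
    case (Suc i) then show ?case using in_W by (simp add: y_def)
  qed
  have \<theta>y: "\<theta> (y i) = y (Suc i)" for i by (simp add: y_def)
  have y0: "y 0 \<noteq> 0" by (auto simp: y_def dlt_def fun_eq_iff fun_app)
  have yne: "y i \<noteq> 0" for i
  proof (induction i)
    case (Suc i) then show ?case using inj[OF yW[of i]] \<theta>y[of i] by auto
  qed (rule y0)
  have "\<exists>r. y r \<in> fun_vs.span (y ` {..<r})"
  proof (rule ccontr)
    assume no: "\<not> ?thesis"
    have "fv.indep_fam {..<k} y" for k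
    proof (induction k)
      case 0 show ?case by (simp add: fv.indep_fam_def)
    next
      case (Suc k)
      then show ?case using no fv.indep_fam_insert[of "{..<k}" k y] by (simp add: lessThan_Suc)
    qed
    then have "card {..<Suc n} \<le> card {..<n}" using yW W by (intro indep_coord[of _ _ y]) auto
    then show False by simp
  qed
  then obtain r where r: "y r \<in> fun_vs.span (y ` {..<r})"
    and rmin: "\<And>k. k < r \<Longrightarrow> y k \<notin> fun_vs.span (y ` {..<k})"
    using exists_least_iff[of "\<lambda>r. y r \<in> fun_vs.span (y ` {..<r})"] by blast
  have "fv.indep_fam {..<k} y" if "k \<le> r" for k
    using that
  proof (induction k)
    case 0 show ?case by (simp add: fv.indep_fam_def)
  next
    case (Suc k)
    then show ?case using rmin[of k] fv.indep_fam_insert[of "{..<k}" k y] by (simp add: lessThan_Suc)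
  qed
  then have ind: "fv.indep_fam {..<r} y" by simp
  have "r \<noteq> 0" using r y0 by (cases r) auto
  then obtain s where s: "r = Suc s" by (cases r) auto
  obtain a where a: "y r = (\<Sum>i<r. fscale (a i) (y i))"
    using r fv.span_family[of "{..<r}" "y r" y] by auto
  \<comment> \<open>Let \<open>w\<close> be a combination of the \<open>y i\<close> with
    coefficients \<open>c i\<close>, the last one being \<open>t\<close>. Comparing coefficients in
    \<open>\<theta> w = w\<close> gives \<open>c 0 = a 0 t^q\<close> and
    \<open>c (Suc i) = (c i)^q + a (Suc i) t^q\<close>, with the condition \<open>c s = t\<close>
    left over. \<open>P i\<close> is \<open>c i\<close> as a polynomial in \<open>t\<close>.\<close>
  define P where "P = rec_nat (monom (a 0) q) (\<lambda>i p. p ^ q + monom (a (Suc i)) q)"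
  have P0: "P 0 = monom (a 0) q" and PS: "P (Suc i) = P i ^ q + monom (a (Suc i)) q" for i
    by (simp_all add: P_def)
  have q2: "2 \<le> q" by (rule card_field_ge_2)
  have Pdvd: "monom 1 q dvd P i" for i
  proof (induction i)
    case 0
    show ?case unfolding P0 by (rule dvdI[of _ _ "[:a 0:]"]) (simp add: smult_monom)
  next
    case (Suc i)
    have "monom 1 q dvd P i ^ q" using Suc q2 by (simp add: dvd_power_same[THEN dvd_trans] dvd_trans[OF Suc dvd_power])
    moreover have "monom 1 q dvd monom (a (Suc i)) q"
      by (rule dvdI[of _ _ "[:a (Suc i):]"]) (simp add: smult_monom)
    ultimately show ?case unfolding PS by (rule dvd_add)
  qed
  \<comment> \<open>Every term of \<open>P i\<close> is divisible by \<open>X^q\<close>, so its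
    \<open>q\<close>-th power starts only in degree \<open>q * q\<close> and does not disturb the
    coefficient of \<open>X^q\<close>.\<close>
  have Pc: "coeff (P i) q = a i" for i
  proof (cases i)
    case 0 then show ?thesis by (simp add: P0)
  next
    case (Suc j)
    obtain g where g: "P j = monom 1 q * g" using Pdvd[of j] by (elim dvdE)
    have "P j ^ q = monom 1 (q * q) * g ^ q" unfolding g power_mult_distrib by (simp add: monom_power mult.commute)
    then have "coeff (P j ^ q) q = 0" using q2 by (simp add: coeff_monom_mult)
    then show ?thesis unfolding Suc PS by simp
  qed
  have Pz: "\<forall>j\<le>i. a j = 0" if "P i = 0" for i
    using that
  proof (induction i)
    case 0
    then show ?case using Pc[of 0] by simp
  next
    case (Suc i)
    have "a (Suc i) = 0" using Pc[of "Suc i"] Suc.prems by simp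
    then have "P i ^ q = 0" using Suc.prems unfolding PS by simp
    then have "P i = 0" by simp
    then show ?case using Suc.IH \<open>a (Suc i) = 0\<close> le_Suc_eq by auto
  qed
  \<comment> \<open>If \<open>P s\<close> vanished, so would all coefficients \<open>a i\<close>,
    and \<open>y r\<close> would be zero.\<close>
  have "P s \<noteq> 0"
  proof
    assume "P s = 0"
    then have "a i = 0" if "i < r" for i using Pz[of s] s that by auto
    then have "y r = 0" unfolding a by (intro sum.neutral) (auto simp: fun_vs.scale_zero_left)
    then show False using yne by blast
  qed
  obtain g where g: "P s = monom 1 q * g" using Pdvd[of s] by (elim dvdE)
  \<comment> \<open>A nonzero solution of \<open>P s = t\<close> is needed, so \<open>X\<close> is
    divided out. The quotient \<open>G\<close> vanishes at 0 without being zero, hence is not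
    constant, and a root of \<open>G - 1\<close> is automatically nonzero.\<close>
  define G where "G = monom 1 (q - 1) * g"
  have PG: "P s = monom 1 1 * G"
    unfolding G_def g mult.assoc[symmetric] mult_monom using q2 by simp
  have "poly G 0 = 0" unfolding G_def using q2 by (simp add: poly_monom)
  have "G \<noteq> 0" using \<open>P s \<noteq> 0\<close> PG by auto
  have "degree (G - 1) > 0"
  proof (rule ccontr)
    assume "\<not> ?thesis"
    then obtain c where "G - 1 = [:c:]" by (metis degree_eq_zeroE gr0I)
    then have "G = [:c + 1:]" by (simp add: diff_eq_eq one_pCons)
    then show False using \<open>poly G 0 = 0\<close> \<open>G \<noteq> 0\<close> by simp
  qed
  then obtain t where t: "poly (G - 1) t = 0" using alg_closed_imp_poly_has_root by blast
  have Gt: "poly G t = 1" using t by simp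
  have t0: "t \<noteq> 0" using Gt \<open>poly G 0 = 0\<close> by auto
  have Pt: "poly (P s) t = t" unfolding PG using Gt by (simp add: poly_monom)
  define c where "c i = poly (P i) t" for i
  have c0: "c 0 = t ^ q * a 0" by (simp add: c_def P0 poly_monom mult.commute)
  have cS: "c (Suc i) = c i ^ q + t ^ q * a (Suc i)" for i by (simp add: c_def PS poly_monom mult.commute)
  have cs: "c s = t" by (simp add: c_def Pt)
  define w where "w = (\<Sum>i<r. fscale (c i) (y i))"
  have wW: "w \<in> W" unfolding w_def using yW by (intro fun_vs.subspace_sum[OF sW] fun_vs.subspace_scale[OF sW])
  have "w \<noteq> 0"
  proof
    assume "w = 0"
    then have "c s = 0" using fv.indep_famD[OF ind, of c s] s by (simp add: w_def)
    then show False using cs t0 by simp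
  qed
  have \<theta>sum: "\<theta> (\<Sum>i<k. fscale (c i) (y i)) = (\<Sum>i<k. fscale (c i ^ q) (y (Suc i)))" for k
  proof (induction k)
    case 0
    have "\<theta> (fscale 0 (y 0)) = fscale (0 ^ q) (\<theta> (y 0))" using yW by (rule sc)
    moreover have "fscale (0 ^ q) v = 0" "fscale 0 v = 0" for v :: "nat \<Rightarrow> 'f alg_closure"
      using q2 by (auto simp: fun_eq_iff fun_app)
    ultimately show ?case by (simp only: lessThan_0 sum.empty)
  next
    case (Suc k)
    have "(\<Sum>i<k. fscale (c i) (y i)) \<in> W"
      using yW by (intro fun_vs.subspace_sum[OF sW] fun_vs.subspace_scale[OF sW])
    moreover have "fscale (c k) (y k) \<in> W" using yW by (intro fun_vs.subspace_scale[OF sW])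
    ultimately show ?case
      using Suc yW by (simp only: sum.lessThan_Suc add sc \<theta>y)
  qed
  have "\<theta> w = (\<Sum>i<s. fscale (c i ^ q) (y (Suc i))) + fscale (t ^ q) (y r)"
    unfolding w_def \<theta>sum unfolding s sum.lessThan_Suc cs ..
  also have "\<dots> = (\<Sum>i<s. fscale (c i ^ q) (y (Suc i))) + (\<Sum>i<r. fscale (t ^ q * a i) (y i))"
    unfolding a fun_vs.scale_sum_right fun_vs.scale_scale ..
  also have "(\<Sum>i<r. fscale (t ^ q * a i) (y i))
      = fscale (t ^ q * a 0) (y 0) + (\<Sum>i<s. fscale (t ^ q * a (Suc i)) (y (Suc i)))"
    unfolding s by (rule sum.lessThan_Suc_shift)
  also have "(\<Sum>i<s. fscale (c i ^ q) (y (Suc i))) + (fscale (t ^ q * a 0) (y 0)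
      + (\<Sum>i<s. fscale (t ^ q * a (Suc i)) (y (Suc i))))
    = fscale (c 0) (y 0) + (\<Sum>i<s. fscale (c (Suc i)) (y (Suc i)))"
    unfolding c0 cS fun_vs.scale_left_distrib sum.distrib by (simp only: add_ac)
  also have "\<dots> = w" unfolding w_def s by (rule sum.lessThan_Suc_shift[symmetric])
  finally show ?thesis using wW \<open>w \<noteq> 0\<close> by blast
qed

end

section \<open>Excluding finite base fields by a small representation\<close>

lemma sum_pairs_unit: "(\<Sum>p\<in>(A \<times> B) \<times> {()}. f p) = (\<Sum>a\<in>A. \<Sum>b\<in>B. f ((a, b), ()))"
  unfolding sum.cartesian_product
  by (rule sum.reindex_bij_witness[of _ "\<lambda>p. (p, ())" fst]) auto

lemma sc_mult_base_matrices:
  "sc_mult (matrix_algebra s (base_field :: ('k::field, unit) sc_algebra)) u v ((i, j), ()) =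
     (if i < s \<and> j < s then \<Sum>k<s. u ((i, k), ()) * v ((k, j), ()) else 0)"
proof -
  let ?M = "matrix_algebra s (base_field :: ('k, unit) sc_algebra)"
  have idx: "idx ?M = ({..<s} \<times> {..<s}) \<times> {()}" by (auto simp: matrix_algebra_def base_field_def)
  have "(\<Sum>P\<in>idx ?M. \<Sum>Q\<in>idx ?M. u P * v Q * sc ?M P Q ((i, j), ()))
     = (\<Sum>a<s. \<Sum>b<s. \<Sum>a'<s. \<Sum>b'<s. if i = a then if b = a' then if j = b' then
          u ((a, b), ()) * v ((a', b'), ()) else 0 else 0 else 0)"
    unfolding idx sum_pairs_unit
    by (intro sum.cong refl) (auto simp: matrix_algebra_def base_field_def)
  also have "\<dots> = (\<Sum>a<s. if i = a then if j < s then \<Sum>b<s. u ((a, b), ()) * v ((b, j), ()) else 0 else 0)"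
  proof (rule sum.cong[OF refl])
    fix a assume "a \<in> {..<s}"
    have "(\<Sum>b'<s. if i = a then if b = a' then if j = b' then u ((a, b), ()) * v ((a', b'), ()) else 0 else 0 else 0)
        = (if b = a' then if i = a \<and> j < s then u ((a, b), ()) * v ((b, j), ()) else 0 else 0)" for b a'
      by (cases "i = a"; cases "b = a'") simp_all
    then have "(\<Sum>b<s. \<Sum>a'<s. \<Sum>b'<s. if i = a then if b = a' then if j = b' then u ((a, b), ()) * v ((a', b'), ()) else 0 else 0 else 0)
        = (\<Sum>b<s. \<Sum>a'<s. if b = a' then if i = a \<and> j < s then u ((a, b), ()) * v ((b, j), ()) else 0 else 0)"
      by (simp only:)
    also have "\<dots> = (\<Sum>b<s. if i = a \<and> j < s then u ((a, b), ()) * v ((b, j), ()) else 0)"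
      by (intro sum.cong refl) simp
    finally show "(\<Sum>b<s. \<Sum>a'<s. \<Sum>b'<s. if i = a then if b = a' then if j = b' then u ((a, b), ()) * v ((a', b'), ()) else 0 else 0 else 0)
        = (if i = a then if j < s then \<Sum>b<s. u ((a, b), ()) * v ((b, j), ()) else 0 else 0)"
      by auto
  qed
  finally show ?thesis
    unfolding sc_mult_def by (auto simp: idx sum.delta' cong: if_cong)
qed

context central_simple_algebra
begin

lemma rp_mult: "rp (x * y) c = (\<Sum>i\<in>Basis. \<Sum>j\<in>Basis. rp x i * rp y j * rp (i * j) c)"
proof -
  have "x * y = (\<Sum>i\<in>Basis. scale (rp x i) i) * (\<Sum>j\<in>Basis. scale (rp y j) j)" by (simp only: rp_sum)
  also have "\<dots> = (\<Sum>i\<in>Basis. \<Sum>j\<in>Basis. scale (rp x i * rp y j) (i * j))"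
    unfolding sum_product by (intro sum.cong refl) (simp add: scale_mult_left scale_mult_right)
  finally have "x * y = (\<Sum>i\<in>Basis. \<Sum>j\<in>Basis. scale (rp x i * rp y j) (i * j))" .
  then show ?thesis by (simp only: rp_sum_fun rp_scale)
qed

lemma rp_eqI: "(\<And>b. b \<in> Basis \<Longrightarrow> rp x b = rp y b) \<Longrightarrow> x = y"
proof -
  assume eq: "\<And>b. b \<in> Basis \<Longrightarrow> rp x b = rp y b"
  have "x = (\<Sum>b\<in>Basis. scale (rp x b) b)" by (rule rp_sum[symmetric])
  also have "\<dots> = (\<Sum>b\<in>Basis. scale (rp y b) b)" by (intro sum.cong refl) (simp only: eq)
  also have "\<dots> = y" by (rule rp_sum)
  finally show "x = y" .
qed

lemma rp_combination:
  assumes "b \<in> Basis"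
  shows "rp (\<Sum>c\<in>Basis. scale (f c) c) b = f b"
proof -
  have "rp (\<Sum>c\<in>Basis. scale (f c) c) b = (\<Sum>c\<in>Basis. if c = b then f b else 0)"
    unfolding rp_sum_fun rp_scale by (intro sum.cong) (auto simp: rp_Basis)
  then show ?thesis using assms finite_Basis by simp
qed

text \<open>By simplicity the representation is faithful, so its degree cannot be smaller than
  \<open>n\<close>; then it is bijective onto the matrices over the base field, and the algebra is
  split.\<close>

lemma brauer_trivial_of_representation:
  fixes \<rho> :: "'a \<Rightarrow> 'f mtx"
  assumes cB: "card Basis = n * n" and d: "0 < d" "d \<le> n"
    and in_mats: "\<And>x. \<rho> x \<in> mats d"
    and add: "\<And>x y. \<rho> (x + y) = \<rho> x + \<rho> y"
    and sc: "\<And>c x. \<rho> (scale c x) = fscale c (\<rho> x)"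
    and mult: "\<And>x y. \<rho> (x * y) = mm d (\<rho> x) (\<rho> y)"
    and one: "\<rho> 1 = idm d"
  shows "brauer_equiv (tensor_power (coord_algebra scale Basis) 1) (base_field :: ('f, unit) sc_algebra)"
proof -
  have \<rho>0: "\<rho> 0 = 0" using sc[of 0 0] by (simp only: scale_zero_left fun_vs.scale_zero_left)
  have idm0: "idm d \<noteq> (0 :: 'f mtx)"
  proof
    assume "idm d = (0 :: 'f mtx)"
    then have "idm d (0, 0) = (0 :: 'f)" by (simp add: fun_app)
    then show False using d by (simp add: idm_apply)
  qed
  have ker: "x = 0" if "\<rho> x = 0" for x
  proof -
    have "two_sided_ideal {x. \<rho> x = 0}"
      unfolding two_sided_ideal_def by (simp add: \<rho>0 add mult)
    then have "{x. \<rho> x = 0} = {0} \<or> {x. \<rho> x = 0} = UNIV" by (rule simple)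
    moreover have "1 \<notin> {x. \<rho> x = 0}" using one idm0 by simp
    ultimately show ?thesis using that by blast
  qed
  have \<rho>sum: "\<rho> (\<Sum>b\<in>B. scale (c b) b) = (\<Sum>b\<in>B. fscale (c b) (\<rho> b))" for c B
    by (induction B rule: infinite_finite_induct)
      (simp_all only: sum.infinite sum.empty sum.insert not_False_eq_True \<rho>0 add sc)
  have inj: "x = y" if "\<rho> x = \<rho> y" for x y
  proof -
    have "\<rho> (x + scale (-1) y) = \<rho> x + fscale (-1) (\<rho> y)" by (simp only: add sc)
    also have "\<dots> = 0" using that by (simp add: fun_eq_iff fun_app)
    finally have "x + scale (-1) y = 0" by (rule ker)
    then show ?thesis by simp
  qed
  have ind: "fv.indep_fam Basis \<rho>"
    unfolding fv.indep_fam_def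
  proof (intro allI impI ballI)
    fix c b assume c: "(\<Sum>b\<in>Basis. fscale (c b) (\<rho> b)) = 0" and b: "b \<in> Basis"
    then have "(\<Sum>b\<in>Basis. scale (c b) b) = 0" using \<rho>sum[of c Basis] by (intro ker) simp
    then have "rp (\<Sum>b\<in>Basis. scale (c b) b) b = rp 0 b" by simp
    also have "rp 0 b = 0" using rp_scale[of 0 0 b] by simp
    finally show "c b = 0" using rp_combination[OF b, of c] by simp
  qed
  have sub: "\<rho> ` Basis \<subseteq> coord_space ({..<d} \<times> {..<d})" using in_mats by (auto simp: mats_def)
  have "card Basis \<le> card ({..<d} \<times> {..<d})"
    by (rule indep_coord[OF _ finite_Basis ind sub]) simp
  then have "n * n \<le> d * d" using cB by simp
  have dn: "d = n"
  proof (rule ccontr)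
    assume "d \<noteq> n"
    then have "d * d < n * n" using d(2) by (intro mult_strict_mono) auto
    then show False using \<open>n * n \<le> d * d\<close> by simp
  qed
  have surj: "\<exists>x. \<rho> x = M" if M: "M \<in> mats d" for M
  proof -
    have f: "finite (dlt ` ({..<d} \<times> {..<d}) :: 'f mtx set)" by simp
    have s: "mats d \<subseteq> fun_vs.span (dlt ` ({..<d} \<times> {..<d}) :: 'f mtx set)"
      unfolding mats_def by (rule coord_span) simp
    have c: "card (dlt ` ({..<d} \<times> {..<d}) :: 'f mtx set) \<le> card Basis"
      using card_image_le[of "{..<d} \<times> {..<d}" dlt] cB dn by simp
    have "fun_vs.span (\<rho> ` Basis) = fun_vs.span (dlt ` ({..<d} \<times> {..<d}))"
      using sub s c by (intro fv.indep_fam_spans[OF finite_Basis ind _ f]) (auto simp: mats_def)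
    then have "M \<in> fun_vs.span (\<rho> ` Basis)" using M s by blast
    then obtain c where "M = (\<Sum>b\<in>Basis. fscale (c b) (\<rho> b))"
      using fv.span_family[OF finite_Basis] by auto
    then have "\<rho> (\<Sum>b\<in>Basis. scale (c b) b) = M" by (simp only: \<rho>sum)
    then show ?thesis ..
  qed
  define A where "A = matrix_algebra 1 (tensor_power (coord_algebra scale Basis) 1)"
  let ?B = "matrix_algebra d (base_field :: ('f, unit) sc_algebra)"
  have idxA: "idx A = (\<lambda>b. ((0, 0), [b])) ` Basis"
    by (auto simp: A_def matrix_algebra_def tensor_power_def coord_algebra_def length_Suc_conv image_iff)
  have injA: "inj_on (\<lambda>b. ((0::nat, 0::nat), [b])) Basis" by (rule inj_onI) simp
  have idxB: "idx ?B = ({..<d} \<times> {..<d}) \<times> UNIV" by (simp add: matrix_algebra_def base_field_def)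
  \<comment> \<open>The first tensor power is indexed by one-element lists and sits in matrices of
    size one; \<open>rd\<close> turns such coordinates back into an element of the algebra.\<close>
  define rd where "rd z = (\<Sum>b\<in>Basis. scale (z ((0::nat, 0::nat), [b])) b)" for z :: "(nat \<times> nat) \<times> 'a list \<Rightarrow> 'f"
  have rp_rd: "rp (rd z) b = z ((0, 0), [b])" if "b \<in> Basis" for z b
    unfolding rd_def using rp_combination[OF that] .
  define h where "h z = (\<lambda>(p, u::unit). \<rho> (rd z) p)" for z :: "(nat \<times> nat) \<times> 'a list \<Rightarrow> 'f"
  have rd_add: "rd (z + w) = rd z + rd w" for z w
    by (rule rp_eqI) (simp add: rp_rd rp_add fun_app)
  have rd_sc: "rd (fscale c z) = scale c (rd z)" for c z
    by (rule rp_eqI) (simp add: rp_rd rp_scale fun_app)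
  have rd_mult: "rd (sc_mult A z w) = rd z * rd w" for z w
  proof (rule rp_eqI)
    fix c assume c: "c \<in> Basis"
    then have "((0, 0), [c]) \<in> idx A" unfolding idxA by (rule imageI)
    then have "rp (rd (sc_mult A z w)) c
        = (\<Sum>i\<in>Basis. \<Sum>j\<in>Basis. z ((0, 0), [i]) * w ((0, 0), [j]) * sc A ((0, 0), [i]) ((0, 0), [j]) ((0, 0), [c]))"
      unfolding rp_rd[OF c] sc_mult_def by (simp only: if_True idxA sum.reindex[OF injA] comp_def)
    also have "\<dots> = rp (rd z * rd w) c"
      by (subst rp_mult[of "rd z" "rd w"], intro sum.cong refl) (simp add: rp_rd A_def matrix_algebra_def tensor_power_def coord_algebra_def)
    finally show "rp (rd (sc_mult A z w)) c = rp (rd z * rd w) c" .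
  qed
  have "sc_iso A ?B"
    unfolding sc_iso_def
  proof (intro exI[of _ h] conjI ballI allI)
    show "bij_betw h (coord_space (idx A)) (coord_space (idx ?B))"
      unfolding bij_betw_def
    proof
      show "inj_on h (coord_space (idx A))"
      proof (rule inj_onI)
        fix z w assume zw: "z \<in> coord_space (idx A)" "w \<in> coord_space (idx A)" "h z = h w"
        have "\<rho> (rd z) p = \<rho> (rd w) p" for p using fun_cong[OF zw(3), of "(p, ())"] by (simp add: h_def)
        then have "rd z = rd w" by (intro inj ext)
        then have eq: "z ((0, 0), [b]) = w ((0, 0), [b])" if "b \<in> Basis" for b using rp_rd[OF that] by metis
        show "z = w"
        proof
          fix p show "z p = w p"
          proof (cases "p \<in> idx A")
            case True
            then show ?thesis using eq by (auto simp: idxA)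
          next
            case False
            then have "z p = 0" "w p = 0" using zw(1,2) unfolding coord_space_def by blast+
            then show ?thesis by simp
          qed
        qed
      qed
      show "h ` coord_space (idx A) = coord_space (idx ?B)"
      proof (intro equalityI subsetI)
        fix y assume "y \<in> h ` coord_space (idx A)"
        then show "y \<in> coord_space (idx ?B)"
          using in_mats by (auto simp: h_def idxB coord_space_def mats_def)
      next
        fix y :: "(nat \<times> nat) \<times> unit \<Rightarrow> 'f" assume y: "y \<in> coord_space (idx ?B)"
        define M where "M = (\<lambda>p. y (p, ()))"
        have "M \<in> mats d" using y by (auto simp: M_def idxB coord_space_def mats_def)
        then obtain x where x: "\<rho> x = M" using surj by blast
        define z where "z = (\<lambda>(p, xs). if p = (0::nat, 0::nat) \<and> length xs = 1 then rp x (hd xs) else 0)"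
        have z: "z \<in> coord_space (idx A)"
          by (auto simp: z_def idxA coord_space_def image_iff length_Suc_conv rp_out)
        have "rd z = x" by (rule rp_eqI) (simp add: rp_rd z_def)
        then have "h z = y" using x by (auto simp: h_def M_def)
        then show "y \<in> h ` coord_space (idx A)" using z by blast
      qed
    qed
    fix z w
    show "h (z + w) = h z + h w"
      by (rule ext) (auto simp: h_def rd_add add fun_app)
    show "h (sc_mult A z w) = sc_mult ?B (h z) (h w)"
    proof (rule ext)
      fix t :: "(nat \<times> nat) \<times> unit"
      obtain i j where t: "t = ((i, j), ())" by (metis surj_pair unit.exhaust)
      have "h (sc_mult A z w) t = mm d (\<rho> (rd z)) (\<rho> (rd w)) (i, j)"
        by (simp add: h_def rd_mult mult t)
      also have "\<dots> = sc_mult ?B (h z) (h w) t"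
        unfolding t sc_mult_base_matrices
        using matsD[OF mm_in[OF in_mats in_mats], of i j "rd z" "rd w"]
        by (auto simp: mm_apply h_def)
      finally show "h (sc_mult A z w) t = sc_mult ?B (h z) (h w) t" .
    qed
  next
    show "h (fscale c z) = fscale c (h z)" for c z
      by (rule ext) (auto simp: h_def rd_sc sc fun_app)
  qed
  then show ?thesis unfolding brauer_equiv_def A_def using d(1) by (intro exI[of _ 1] exI[of _ d]) simp
qed

end

context split_csa
begin

text \<open>Over a finite field, raising coordinates to the power \<open>q\<close> induces a
  multiplicative semilinear map \<open>\<Phi>\<close> of the matrices that fixes the algebra. It is
  accompanied by a semilinear map \<open>\<theta>\<close> of the column space with
  \<open>\<theta> (M v) = \<Phi> M (\<theta> v)\<close>. The fixed vectors of
  \<open>\<theta>\<close>, nonzero by Lang's theorem, give a representation over the base field,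
  which a nonsplit algebra does not have.\<close>

lemma infinite_base_field:
  assumes nontriv: "\<not> brauer_equiv (tensor_power (coord_algebra scale Basis) 1) (base_field :: ('f, unit) sc_algebra)"
  shows "infinite (UNIV :: 'f set)"
proof
  assume fin: "finite (UNIV :: 'f set)"
  define q where q: "q = card (UNIV :: 'f set)"
  define W where "W = (coord_space {..<n} :: (nat \<Rightarrow> 'f alg_closure) set)"
  have sW: "fun_vs.subspace W" unfolding W_def by (rule subspace_coord)
  define \<phi> where "\<phi> z = (\<lambda>b. z b ^ q)" for z :: "'a \<Rightarrow> 'f alg_closure"
  have q0: "0 < q" using card_field_ge_2[OF fin q] by simp
  have \<phi>_in: "\<phi> z \<in> CS" if "z \<in> CS" for z using that q0 by (auto simp: \<phi>_def coord_space_def)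
  have \<phi>_add: "\<phi> (z + w) = \<phi> z + \<phi> w" for z w
    by (rule ext) (simp add: \<phi>_def fun_app frobenius_add[OF fin q])
  have \<phi>_sc: "\<phi> (fscale c z) = fscale (c ^ q) (\<phi> z)" for c z
    by (rule ext) (simp add: \<phi>_def fun_app power_mult_distrib)
  have \<phi>_gm: "\<phi> (gm z w) = gm (\<phi> z) (\<phi> w)" for z w
    using q0 by (intro ext)
      (simp add: \<phi>_def gm_apply frobenius_sum[OF fin q] power_mult_distrib to_ac_power[symmetric]
        power_card_field[OF fin q] del: to_ac_power)
  have \<phi>_tg: "\<phi> (tg x) = tg x" for x
    by (rule ext) (simp add: \<phi>_def tg_apply to_ac_power[symmetric] power_card_field[OF fin q] del: to_ac_power)
  define \<Phi> where "\<Phi> M = \<eta> (\<phi> (\<eta>i M))" for M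
  have \<Phi>_in: "\<Phi> M \<in> mats n" if "M \<in> mats n" for M using that \<phi>_in by (simp add: \<Phi>_def)
  have \<Phi>_add: "\<Phi> (M + N) = \<Phi> M + \<Phi> N" if "M \<in> mats n" "N \<in> mats n" for M N
    using that \<phi>_in by (simp add: \<Phi>_def \<eta>i_add \<phi>_add \<eta>_add)
  have \<Phi>_sc: "\<Phi> (fscale c M) = fscale (c ^ q) (\<Phi> M)" if "M \<in> mats n" for c M
    using that \<phi>_in by (simp add: \<Phi>_def \<eta>i_fscale \<phi>_sc \<eta>_scale)
  have \<Phi>_mm: "\<Phi> (mm n M N) = mm n (\<Phi> M) (\<Phi> N)" if "M \<in> mats n" "N \<in> mats n" for M N
    using that \<phi>_in by (simp add: \<Phi>_def \<eta>i_mm \<phi>_gm \<eta>_mult)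
  have \<Phi>_\<iota>: "\<Phi> (\<iota> x) = \<iota> x" for x by (simp only: \<Phi>_def \<eta>i_\<iota> \<phi>_tg) (simp only: \<iota>_def)
  have E: "dlt (0, 0) \<in> mats n" using n_pos by simp
  have "\<Phi> (dlt (0, 0)) \<noteq> 0"
  proof
    assume "\<Phi> (dlt (0, 0)) = 0"
    then have "\<eta> (\<phi> (\<eta>i (dlt (0, 0)))) = \<eta> 0" by (simp add: \<Phi>_def \<eta>_0)
    then have p0: "\<phi> (\<eta>i (dlt (0, 0))) = 0" by (rule \<eta>_inj[rotated 2]) (simp_all add: \<phi>_in E)
    have "\<eta>i (dlt (0, 0)) b = 0" for b using fun_cong[OF p0, of b] q0 by (simp add: \<phi>_def fun_app)
    then have "\<eta>i (dlt (0, 0)) = 0" by (intro ext) (simp add: fun_app)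
    then have "dlt (0, 0) = (0 :: 'f alg_closure mtx)" using \<eta>_\<eta>i[OF E] \<eta>_0 by simp
    then have "dlt (0, 0) (0 :: nat, 0 :: nat) = (0 :: 'f alg_closure)" by (simp add: fun_app)
    then show False by (simp add: dlt_def)
  qed
  then obtain i0 j0 where ij: "\<Phi> (dlt (0, 0)) (i0, j0) \<noteq> 0" by (metis mtx_eqI zero_fun_apply)
  then have j0: "j0 < n" using \<Phi>_in[OF E] by (auto simp: mats_iff)
  define colm where "colm v = (\<lambda>(i, j). if j = (0::nat) then v i else 0)" for v :: "nat \<Rightarrow> 'f alg_closure"
  have colm_in: "colm v \<in> mats n" if "v \<in> W" for v
    using that n_pos by (auto simp: colm_def mats_iff W_def coord_space_def)
  have colm_add: "colm (v + w) = colm v + colm w" for v w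
    by (rule mtx_eqI) (simp add: colm_def fun_app)
  have colm_sc: "colm (fscale c v) = fscale c (colm v)" for c v
    by (rule mtx_eqI) (simp add: colm_def fun_app)
  have colm_mv: "colm (mv n M v) = mm n M (colm v)" for M v
    by (rule mtx_eqI) (simp add: colm_def mv_def mm_apply)
  have colm_dlt: "colm (dlt 0) = dlt (0, 0)"
    by (rule mtx_eqI) (simp add: colm_def dlt_def)
  \<comment> \<open>The vector is written into column 0, and column \<open>j0\<close> of the image
    under \<open>\<Phi>\<close> is read off. The column \<open>j0\<close> is one where the image of
    the matrix unit at \<open>(0, 0)\<close> does not vanish. This makes \<open>\<theta>\<close>
    injective, because any nonzero vector can be moved to the first basis vector by a
    matrix.\<close>
  define \<theta> where "\<theta> v = mv n (\<Phi> (colm v)) (dlt j0)" for v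
  have \<theta>_in: "\<theta> v \<in> W" if "v \<in> W" for v
    unfolding \<theta>_def W_def using \<Phi>_in[OF colm_in[OF that]] by (rule mv_in)
  have \<theta>_add: "\<theta> (v + w) = \<theta> v + \<theta> w" if "v \<in> W" "w \<in> W" for v w
    unfolding \<theta>_def colm_add \<Phi>_add[OF colm_in[OF that(1)] colm_in[OF that(2)]] by (rule mv_add_mat)
  have \<theta>_sc: "\<theta> (fscale c v) = fscale (c ^ q) (\<theta> v)" if "v \<in> W" for c v
    unfolding \<theta>_def colm_sc \<Phi>_sc[OF colm_in[OF that]] by (rule mv_fscale_mat)
  have \<theta>_mv: "\<theta> (mv n M v) = mv n (\<Phi> M) (\<theta> v)" if "v \<in> W" "M \<in> mats n" for M v
    unfolding \<theta>_def colm_mv \<Phi>_mm[OF that(2) colm_in[OF that(1)]] by (rule mv_mm)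
  have \<theta>_inj: "v = 0" if v: "v \<in> W" "\<theta> v = 0" for v
  proof (rule ccontr)
    assume "v \<noteq> 0"
    then obtain i where i: "v i \<noteq> 0" by (metis ext zero_fun_apply)
    then have "i < n" using v(1) by (auto simp: W_def coord_space_def)
    define M where "M = fscale (inverse (v i)) (dlt (0::nat, i))"
    have M: "M \<in> mats n" unfolding M_def using n_pos \<open>i < n\<close> by (intro fun_vs.subspace_scale[OF subspace_mats] dlt_mats)
    have "mv n (dlt (0, i)) v k = (if k = 0 then v i else 0)" for k
      using \<open>i < n\<close> by (simp add: mv_def dlt_pair if_distrib[of "\<lambda>u. u * _"] cong: if_cong)
    then have "mv n M v = dlt 0"
      unfolding M_def mv_fscale_mat by (intro ext) (simp add: fun_app i dlt_def)
    then have "\<theta> (dlt 0) = mv n (\<Phi> M) 0" using \<theta>_mv[OF v(1) M] v(2) by simp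
    then have "\<theta> (dlt 0) i0 = 0" by (simp add: mv_def fun_app)
    then show False using ij j0 by (simp add: \<theta>_def colm_dlt mv_dlt)
  qed
  obtain w0 where w0: "w0 \<in> W" "w0 \<noteq> 0" "\<theta> w0 = w0"
    using semilinear_fixed_vector[OF fin q n_pos W_def, of \<theta>] \<theta>_in \<theta>_add \<theta>_sc \<theta>_inj by blast
  define W0 where "W0 = {w \<in> W. \<theta> w = w}"
  have "W0 \<subseteq> fun_vs.span (dlt ` {..<n})" using coord_span[of "{..<n}"] by (auto simp: W0_def W_def)
  then obtain B where B: "B \<subseteq> W0" "finite B" "fun_vs.independent B" "W0 \<subseteq> fun_vs.span B"
      "card B \<le> card (dlt ` {..<n} :: (nat \<Rightarrow> 'f alg_closure) set)"
    by (rule fv.indep_basis_of) simp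
  define d where "d = card B"
  have dn: "d \<le> n" using B(5) card_image_le[of "{..<n}" "dlt :: nat \<Rightarrow> nat \<Rightarrow> 'f alg_closure"] by (simp add: d_def)
  have "B \<noteq> {}" using B(4) w0 by (auto simp: W0_def)
  then have d0: "0 < d" using B(2) by (simp add: d_def card_gt_0_iff)
  obtain b where b: "bij_betw b {..<d} B"
    using ex_bij_betw_nat_finite[OF B(2)] by (auto simp: d_def atLeast0LessThan)
  have bB: "b ` {..<d} = B" and bW0: "\<And>i. i < d \<Longrightarrow> b i \<in> W0" using b B(1) by (auto simp: bij_betw_def)
  have bW: "b i \<in> W" "\<theta> (b i) = b i" if "i < d" for i using bW0[OF that] by (auto simp: W0_def)
  have ind: "fv.indep_fam {..<d} b" using b B by (subst fv.indep_fam_iff) (auto simp: bij_betw_def)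
  have \<theta>sum: "\<theta> (\<Sum>i<k. fscale (c i) (b i)) = (\<Sum>i<k. fscale (c i ^ q) (b i))" if "k \<le> d" for c k
    using that
  proof (induction k)
    case 0
    have "\<theta> (fscale 0 w0) = fscale (0 ^ q) (\<theta> w0)" using w0(1) by (rule \<theta>_sc)
    then show ?case using q0 by (simp add: fun_vs.scale_zero_left)
  next
    case (Suc k)
    have "(\<Sum>i<k. fscale (c i) (b i)) \<in> W"
      using bW Suc.prems by (intro fun_vs.subspace_sum[OF sW] fun_vs.subspace_scale[OF sW]) auto
    moreover have "b k \<in> W" "\<theta> (b k) = b k" using bW Suc.prems by auto
    moreover have "fscale (c k) (b k) \<in> W" using \<open>b k \<in> W\<close> by (rule fun_vs.subspace_scale[OF sW])
    ultimately show ?case using Suc.IH Suc.prems by (simp add: \<theta>_add \<theta>_sc)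
  qed
  \<comment> \<open>With respect to a basis of fixed vectors, the coordinates of a fixed vector
    satisfy \<open>c^q = c\<close> and hence lie in the base field.\<close>
  have rat: "\<exists>c. w = (\<Sum>i<d. fscale (to_ac (c i :: 'f)) (b i))" if w: "w \<in> W0" for w
  proof -
    have "w \<in> fun_vs.span (b ` {..<d})" using w B(4) bB by auto
    then obtain c where c: "w = (\<Sum>i<d. fscale (c i) (b i))" using fv.span_family[of "{..<d}" w b] by auto
    have eq: "(\<Sum>i<d. fscale (c i ^ q) (b i)) = (\<Sum>i<d. fscale (c i) (b i))"
      using \<theta>sum[of d c] w c by (simp add: W0_def)
    have "c i ^ q = c i" if "i < d" for i
      by (rule fv.indep_fam_eqD[OF ind eq]) (use that in simp)
    then have "c i \<in> range (to_ac :: 'f \<Rightarrow> _)" if "i < d" for i using frobenius_fixed[OF fin q] that by blast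
    then have "to_ac (of_ac (c i)) = c i" if "i < d" for i using to_ac_of_ac that by blast
    then show ?thesis unfolding c by (intro exI[of _ "\<lambda>i. of_ac (c i)"] sum.cong) auto
  qed
  have "\<exists>R :: 'f mtx. R \<in> mats d \<and> (\<forall>j<d. mv n (\<iota> x) (b j) = (\<Sum>i<d. fscale (to_ac (R (i, j))) (b i)))" for x
  proof -
    have "mv n (\<iota> x) (b j) \<in> W0" if "j < d" for j
      using \<theta>_mv[OF bW(1)[OF that] \<iota>_in, of x] bW[OF that] mv_in[OF \<iota>_in, of x "b j"]
      by (simp add: W0_def \<Phi>_\<iota> W_def)
    then have "\<exists>c. mv n (\<iota> x) (b j) = (\<Sum>i<d. fscale (to_ac (c i :: 'f)) (b i))" if "j < d" for j
      using rat that by blast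
    then obtain c :: "nat \<Rightarrow> nat \<Rightarrow> 'f" where
      c: "\<And>j. j < d \<Longrightarrow> mv n (\<iota> x) (b j) = (\<Sum>i<d. fscale (to_ac (c j i)) (b i))" by metis
    show ?thesis
      by (rule exI[of _ "\<lambda>(i, j). if i < d \<and> j < d then c j i else 0"]) (auto simp: mats_iff c intro!: sum.cong)
  qed
  then obtain \<rho> :: "'a \<Rightarrow> 'f mtx" where
    \<rho>: "\<And>x. \<rho> x \<in> mats d \<and> (\<forall>j<d. mv n (\<iota> x) (b j) = (\<Sum>i<d. fscale (to_ac (\<rho> x (i, j))) (b i)))"
    by metis
  have \<rho>_in: "\<rho> x \<in> mats d" for x using \<rho> by blast
  have act: "mv n (\<iota> x) (b j) = (\<Sum>i<d. fscale (to_ac (\<rho> x (i, j))) (b i))" if "j < d" for x j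
    using \<rho> that by blast
  have \<rho>_eqI: "\<rho> x = M" if M: "M \<in> mats d"
    and eq: "\<And>j. j < d \<Longrightarrow> mv n (\<iota> x) (b j) = (\<Sum>i<d. fscale (to_ac (M (i, j))) (b i))" for x M
  proof (rule mtx_eqI)
    fix i j show "\<rho> x (i, j) = M (i, j)"
    proof (cases "i < d \<and> j < d")
      case True
      have "(\<Sum>i<d. fscale (to_ac (\<rho> x (i, j))) (b i)) = (\<Sum>i<d. fscale (to_ac (M (i, j))) (b i))"
        using act[of j x] eq[of j] True by simp
      from fv.indep_fam_eqD[OF ind this, of i] True show ?thesis by simp
    next
      case False
      then show ?thesis using matsD[OF \<rho>_in False] matsD[OF M False] by simp
    qed
  qed
  have "brauer_equiv (tensor_power (coord_algebra scale Basis) 1) (base_field :: ('f, unit) sc_algebra)"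
  proof (rule brauer_trivial_of_representation[OF card_Basis d0 dn \<rho>_in])
    show "\<rho> (x + y) = \<rho> x + \<rho> y" for x y
      by (rule \<rho>_eqI[OF fun_vs.subspace_add[OF subspace_mats \<rho>_in \<rho>_in]])
        (simp add: \<iota>_add mv_add_mat act fun_app fun_vs.scale_left_distrib sum.distrib)
    show "\<rho> (scale c x) = fscale c (\<rho> x)" for c x
      by (rule \<rho>_eqI[OF fun_vs.subspace_scale[OF subspace_mats \<rho>_in]])
        (simp add: \<iota>_scale mv_fscale_mat act fun_app fun_vs.scale_sum_right)
    show "\<rho> (x * y) = mm d (\<rho> x) (\<rho> y)" for x y
    proof (rule \<rho>_eqI)
      fix j assume j: "j < d"
      have mvs: "mv n (\<iota> x) (\<Sum>i<k. fscale (c i) (b i)) = (\<Sum>i<k. fscale (c i) (mv n (\<iota> x) (b i)))" for c k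
        by (induction k) (simp_all add: mv_add mv_fscale, simp add: mv_def fun_eq_iff fun_app)
      have "mv n (\<iota> (x * y)) (b j) = (\<Sum>i<d. fscale (to_ac (\<rho> y (i, j))) (mv n (\<iota> x) (b i)))"
        by (simp add: \<iota>_mult mv_mm act[OF j] mvs)
      also have "\<dots> = (\<Sum>i<d. fscale (to_ac (\<rho> y (i, j))) (\<Sum>r<d. fscale (to_ac (\<rho> x (r, i))) (b r)))"
        by (intro sum.cong refl) (simp add: act)
      also have "\<dots> = (\<Sum>r<d. fscale (to_ac (mm d (\<rho> x) (\<rho> y) (r, j))) (b r))"
        unfolding fun_vs.scale_sum_right
        by (subst sum.swap) (simp add: mm_apply to_ac_sum fun_vs.scale_sum_left fun_vs.scale_scale mult.commute)
      finally show "mv n (\<iota> (x * y)) (b j) = (\<Sum>i<d. fscale (to_ac (mm d (\<rho> x) (\<rho> y) (i, j))) (b i))" .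
    qed (simp add: \<rho>_in)
    show "\<rho> 1 = idm d"
    proof (rule \<rho>_eqI)
      fix j assume j: "j < d"
      have "(\<Sum>i<d. fscale (to_ac (idm d (i, j))) (b i)) = (\<Sum>i<d. if i = j then b i else 0)"
        by (intro sum.cong refl) (auto simp: idm_apply fun_vs.scale_zero_left)
      then show "mv n (\<iota> 1) (b j) = (\<Sum>i<d. fscale (to_ac (idm d (i, j))) (b i))"
        using j bW(1)[OF j] by (simp add: \<iota>_1 mv_idm W_def)
    qed simp
  qed
  with nontriv show False ..
qed

end

section \<open>A bimodule form of the space of matrices\<close>

lemma linear_bij_card_le:
  fixes h :: "('i \<Rightarrow> 'k::field) \<Rightarrow> 'j \<Rightarrow> 'k"
  assumes fin: "finite I" "finite J" and h: "bij_betw h (coord_space I) (coord_space J)"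
    and add: "\<And>x y. x \<in> coord_space I \<Longrightarrow> y \<in> coord_space I \<Longrightarrow> h (x + y) = h x + h y"
    and sc: "\<And>c x. x \<in> coord_space I \<Longrightarrow> h (fscale c x) = fscale c (h x)"
  shows "card J \<le> card I"
proof -
  have s: "fun_vs.subspace (coord_space I :: ('i \<Rightarrow> 'k) set)" by (rule subspace_coord)
  have "\<exists>x\<in>coord_space I. h x = dlt p" if "p \<in> J" for p
  proof -
    have "dlt p \<in> h ` coord_space I" using h dlt_in[OF that] by (simp add: bij_betw_def)
    then show ?thesis by (auto simp: image_iff)
  qed
  then obtain g where g: "\<And>p. p \<in> J \<Longrightarrow> g p \<in> coord_space I \<and> h (g p) = dlt p" by metis
  have h0: "h 0 = 0"
  proof -
    have "h (fscale 0 0) = fscale 0 (h 0)" using fun_vs.subspace_0[OF s] by (rule sc)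
    then show ?thesis by (simp only: fun_vs.scale_zero_left)
  qed
  have hsum: "h (\<Sum>p\<in>J'. fscale (c p) (g p)) = (\<Sum>p\<in>J'. fscale (c p) (dlt p))" if "J' \<subseteq> J" for c J'
    using finite_subset[OF that fin(2)] that
  proof (induction J')
    case empty
    show ?case by (simp only: sum.empty h0)
  next
    case (insert p J')
    have "(\<Sum>p\<in>J'. fscale (c p) (g p)) \<in> coord_space I"
      using insert g by (intro fun_vs.subspace_sum[OF s] fun_vs.subspace_scale[OF s]) auto
    moreover have "g p \<in> coord_space I" "h (g p) = dlt p" using g insert by auto
    moreover have "fscale (c p) (g p) \<in> coord_space I"
      using \<open>g p \<in> coord_space I\<close> by (rule fun_vs.subspace_scale[OF s])
    moreover have "h (\<Sum>p\<in>J'. fscale (c p) (g p)) = (\<Sum>p\<in>J'. fscale (c p) (dlt p))"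
      using insert by auto
    ultimately show ?case by (simp only: sum.insert[OF insert.hyps] add sc)
  qed
  have "fv.indep_fam J g"
    unfolding fv.indep_fam_def
  proof (intro allI impI ballI)
    fix c p assume c: "(\<Sum>p\<in>J. fscale (c p) (g p)) = 0" and p: "p \<in> J"
    have "(\<Sum>p\<in>J. fscale (c p) (dlt p)) = 0" using hsum[of J c] c h0 by simp
    then show "c p = 0" using fv.indep_famD[OF indep_dlt[OF fin(2)]] p by blast
  qed
  then show ?thesis using g by (intro indep_coord[OF fin(1,2)]) auto
qed

lemma sum_block:
  fixes r :: nat and f :: "(nat \<times> nat) \<times> 'l \<Rightarrow> 'k::comm_monoid_add"
  assumes "finite L" "i < r" "j < r" "\<And>a b xs. (a, b) \<noteq> (i, j) \<Longrightarrow> f ((a, b), xs) = 0"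
  shows "(\<Sum>P\<in>({..<r} \<times> {..<r}) \<times> L. f P) = (\<Sum>xs\<in>L. f ((i, j), xs))"
proof -
  have "finite (({..<r} \<times> {..<r}) \<times> L)" using assms(1) by (intro finite_cartesian_product finite_lessThan)
  then have "(\<Sum>P\<in>({..<r} \<times> {..<r}) \<times> L. f P) = (\<Sum>P\<in>{(i, j)} \<times> L. f P)"
    using assms(2-4) by (intro sum.mono_neutral_right) auto
  also have "\<dots> = (\<Sum>xs\<in>L. f ((i, j), xs))"
    by (rule sum.reindex_bij_witness[of _ "\<lambda>xs. ((i, j), xs)" snd]) auto
  finally show ?thesis .
qed

lemma sum_pair_lists:
  "(\<Sum>xs\<in>{xs. length xs = 2 \<and> set xs \<subseteq> B}. f xs) = (\<Sum>b\<in>B. \<Sum>c\<in>B. f [b, c])"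
  unfolding sum.cartesian_product
  by (rule sum.reindex_bij_witness[of _ "\<lambda>(b, c). [b, c]" "\<lambda>xs. (xs ! 0, xs ! 1)"])
    (auto simp: length_Suc_conv numeral_2_eq_2)

context split_csa
begin

lemma mats_induct [consumes 1, case_names zero step]:
  assumes "M \<in> mats n" "P 0" "\<And>c x M. M \<in> mats n \<Longrightarrow> P M \<Longrightarrow> P (fscale c (\<iota> x) + M)"
  shows "P M"
proof -
  have "M \<in> fun_vs.span (range \<iota>)"
    by (subst \<iota>_expand[OF assms(1)]) (intro fun_vs.span_sum fun_vs.span_scale fun_vs.span_base rangeI)
  then have "M \<in> mats n \<and> P M"
  proof (induction rule: fun_vs.span_induct_alt)
    case base
    show ?case using assms(2) subspace_mats fun_vs.subspace_0 by blast
  next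
    case (step c x y)
    then obtain a where x: "x = \<iota> a" by blast
    from step have y: "y \<in> mats n" "P y" by auto
    show ?case unfolding x
      using assms(3)[OF y] fun_vs.subspace_add[OF subspace_mats fun_vs.subspace_scale[OF subspace_mats \<iota>_in] y(1)]
      by blast
  qed
  then show ?thesis ..
qed

text \<open>The tensor square of \<open>A\<close> is Brauer trivial, so matrices of size
  \<open>r\<close> over it are matrices of size \<open>s\<close> over the base field. A corner of
  the standard module of the latter is a module over the tensor square, of dimension at most
  \<open>n * n\<close>. Matrix coefficients embed it into the matrices over the closure, where a
  pair \<open>(x, y)\<close> acts by \<open>M \<mapsto> x M y^T\<close>. As this action is
  irreducible over the closure, the image spans everything, and a basis of the module becomes the
  family \<open>v\<close>.\<close>

lemma ex_bimodule_form:
  assumes be: "brauer_equiv (tensor_power (coord_algebra scale Basis) 2) (base_field :: ('f, unit) sc_algebra)"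
  shows "\<exists>v :: nat \<Rightarrow> 'f alg_closure mtx. v ` {..<n * n} \<subseteq> mats n \<and> fv.indep_fam {..<n * n} v \<and>
    (\<forall>x y. \<forall>i<n * n. \<exists>c :: nat \<Rightarrow> 'f.
       mm n (mm n (\<iota> x) (v i)) (mt (\<iota> y)) = (\<Sum>j<n * n. fscale (to_ac (c j)) (v j)))"
proof -
  define L where "L = {xs. length xs = 2 \<and> set xs \<subseteq> Basis}"
  have finL: "finite L" unfolding L_def using finite_lists_length_eq[OF finite_Basis, of 2] by (simp add: conj_commute)
  have cardL: "card L = n * n * (n * n)"
    unfolding L_def using card_lists_length_eq[OF finite_Basis, of 2] card_Basis
    by (simp add: conj_commute power2_eq_square)
  obtain r s where rs: "0 < r" "0 < s"
    and "sc_iso (matrix_algebra r (tensor_power (coord_algebra scale Basis) 2)) (matrix_algebra s (base_field :: ('f, unit) sc_algebra))"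
    using be unfolding brauer_equiv_def by blast
  define A where "A = matrix_algebra r (tensor_power (coord_algebra scale Basis) 2)"
  define B where "B = matrix_algebra s (base_field :: ('f, unit) sc_algebra)"
  have "sc_iso A B" unfolding A_def B_def by fact
  then obtain h where hbij: "bij_betw h (coord_space (idx A)) (coord_space (idx B))"
    and hadd: "\<And>z w. z \<in> coord_space (idx A) \<Longrightarrow> w \<in> coord_space (idx A) \<Longrightarrow> h (z + w) = h z + h w"
    and hmult: "\<And>z w. z \<in> coord_space (idx A) \<Longrightarrow> w \<in> coord_space (idx A) \<Longrightarrow> h (sc_mult A z w) = sc_mult B (h z) (h w)"
    and hsc: "\<And>c z. z \<in> coord_space (idx A) \<Longrightarrow> h (fscale c z) = fscale c (h z)"
    unfolding sc_iso_def by blast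
  have idxA: "idx A = ({..<r} \<times> {..<r}) \<times> L"
    by (simp add: A_def L_def matrix_algebra_def tensor_power_def coord_algebra_def)
  have idxB: "idx B = ({..<s} \<times> {..<s}) \<times> {()}" by (auto simp: B_def matrix_algebra_def base_field_def)
  have "card (idx B) \<le> card (idx A)"
    using finL by (intro linear_bij_card_le[OF _ _ hbij hadd hsc]) (auto simp: idxA idxB)
  then have "s * s \<le> (r * (n * n)) * (r * (n * n))" by (simp add: idxA idxB card_cartesian_product cardL mult_ac)
  have s_le: "s \<le> r * (n * n)"
  proof (rule ccontr)
    assume "\<not> ?thesis"
    then have "(r * (n * n)) * (r * (n * n)) < s * s" by (intro mult_strict_mono) auto
    then show False using \<open>s * s \<le> (r * (n * n)) * (r * (n * n))\<close> by simp
  qed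
  have sA: "fun_vs.subspace (coord_space (idx A) :: (_ \<Rightarrow> 'f) set)" by (rule subspace_coord)
  have h0: "h 0 = 0"
  proof -
    have "h (fscale 0 0) = fscale 0 (h 0)" using fun_vs.subspace_0[OF sA] by (rule hsc)
    then show ?thesis by (simp only: fun_vs.scale_zero_left)
  qed
  \<comment> \<open>\<open>pt i j x y\<close> is the tensor product of the matrix unit
    \<open>E_ij\<close> with \<open>x\<close> and \<open>y\<close>; \<open>Pm\<close> below is its
    image as a matrix of size \<open>s\<close>.\<close>
  define pt where "pt i j x y = (\<lambda>((a, b), xs). if (a, b) = (i, j) \<and> length xs = 2 then rp x (xs ! 0) * rp y (xs ! 1) else 0)"
    for i j :: nat and x y :: 'a
  have pt_in: "pt i j x y \<in> coord_space (idx A)" if "i < r" "j < r" for i j x y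
    unfolding coord_space_def
  proof (intro CollectI allI impI)
    fix P assume P: "P \<notin> idx A"
    obtain a b xs where abx: "P = ((a, b), xs)" by (metis surj_pair)
    show "pt i j x y P = 0"
    proof (cases "(a, b) = (i, j) \<and> length xs = 2")
      case True
      then obtain c d where cd: "xs = [c, d]" by (auto simp: length_Suc_conv numeral_2_eq_2)
      have "c \<notin> Basis \<or> d \<notin> Basis" using P True that abx cd by (auto simp: idxA L_def)
      then show ?thesis using rp_out by (auto simp: pt_def abx cd)
    qed (auto simp: pt_def abx)
  qed
  have pt_mult: "sc_mult A (pt i j x y) (pt k l x' y') = (if j = k then pt i l (x * x') (y * y') else 0)"
    if ij: "i < r" "j < r" "k < r" "l < r" for i j k l x y x' y'
  proof
    fix K :: "(nat \<times> nat) \<times> 'a list"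
    obtain a b zs where K: "K = ((a, b), zs)" by (metis surj_pair)
    show "sc_mult A (pt i j x y) (pt k l x' y') K = (if j = k then pt i l (x * x') (y * y') else 0) K"
    proof (cases "K \<in> idx A")
      case False
      then have "pt i l (x * x') (y * y') K = 0"
        using pt_in[OF ij(1) ij(4), of "x * x'" "y * y'"] unfolding coord_space_def by blast
      then show ?thesis using False by (simp add: sc_mult_def fun_app)
    next
      case True
      then obtain c d where cd: "zs = [c, d]" by (auto simp: idxA L_def K length_Suc_conv numeral_2_eq_2)
      have "sc_mult A (pt i j x y) (pt k l x' y') K
        = (\<Sum>P\<in>idx A. \<Sum>Q\<in>idx A. pt i j x y P * pt k l x' y' Q * sc A P Q K)"
        using True by (simp add: sc_mult_def)
      also have "\<dots> = (\<Sum>xs\<in>L. \<Sum>ys\<in>L. pt i j x y ((i, j), xs) * pt k l x' y' ((k, l), ys) * sc A ((i, j), xs) ((k, l), ys) K)"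
      proof -
        have inner: "(\<Sum>Q\<in>({..<r} \<times> {..<r}) \<times> L. pt i j x y P * pt k l x' y' Q * sc A P Q K)
          = (\<Sum>ys\<in>L. pt i j x y P * pt k l x' y' ((k, l), ys) * sc A P ((k, l), ys) K)" for P
          by (rule sum_block[OF finL ij(3,4)]) (auto simp: pt_def)
        have outer: "(\<Sum>P\<in>({..<r} \<times> {..<r}) \<times> L. \<Sum>ys\<in>L. pt i j x y P * pt k l x' y' ((k, l), ys) * sc A P ((k, l), ys) K)
          = (\<Sum>xs\<in>L. \<Sum>ys\<in>L. pt i j x y ((i, j), xs) * pt k l x' y' ((k, l), ys) * sc A ((i, j), xs) ((k, l), ys) K)"
          by (rule sum_block[OF finL ij(1,2)]) (auto simp: pt_def intro!: sum.neutral)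
        show ?thesis unfolding idxA inner by (rule outer)
      qed
      also have "\<dots> = (if j = k \<and> a = i \<and> b = l then rp (x * x') c * rp (y * y') d else 0)"
      proof (cases "j = k \<and> a = i \<and> b = l")
        case True
        have "(\<Sum>xs\<in>L. \<Sum>ys\<in>L. pt i j x y ((i, j), xs) * pt k l x' y' ((k, l), ys) * sc A ((i, j), xs) ((k, l), ys) K)
          = (\<Sum>p\<in>Basis. \<Sum>p'\<in>Basis. \<Sum>q\<in>Basis. \<Sum>q'\<in>Basis.
              (rp x p * rp x' q * rp (p * q) c) * (rp y p' * rp y' q' * rp (p' * q') d))"
          unfolding L_def sum_pair_lists using True
          by (intro sum.cong refl)
            (simp add: pt_def A_def matrix_algebra_def tensor_power_def coord_algebra_def K cd numeral_2_eq_2)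
        also have "\<dots> = (\<Sum>p\<in>Basis. \<Sum>q\<in>Basis. \<Sum>p'\<in>Basis. \<Sum>q'\<in>Basis.
              (rp x p * rp x' q * rp (p * q) c) * (rp y p' * rp y' q' * rp (p' * q') d))"
          by (intro sum.cong refl sum.swap)
        also have "\<dots> = rp (x * x') c * rp (y * y') d"
          unfolding rp_mult[of x x' c] rp_mult[of y y' d] sum_distrib_right
          unfolding sum_distrib_left by simp
        finally show ?thesis using True by simp
      next
        case False
        then show ?thesis
          by (auto intro!: sum.neutral simp: A_def matrix_algebra_def K)
      qed
      also have "\<dots> = (if j = k then pt i l (x * x') (y * y') else 0) K"
        by (auto simp: pt_def K cd fun_app)
      finally show ?thesis .
    qed
  qed
  have pt_add1: "pt i j (x + x') y = pt i j x y + pt i j x' y" for i j x x' y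
    by (rule ext) (auto simp: pt_def fun_app rp_add distrib_right)
  have pt_add2: "pt i j x (y + y') = pt i j x y + pt i j x y'" for i j x y y'
    by (rule ext) (auto simp: pt_def fun_app rp_add distrib_left)
  have pt_sc1: "pt i j (scale c x) y = fscale c (pt i j x y)" for i j c x y
    by (rule ext) (auto simp: pt_def fun_app rp_scale)
  have pt_sc2: "pt i j x (scale c y) = fscale c (pt i j x y)" for i j c x y
    by (rule ext) (auto simp: pt_def fun_app rp_scale)
  define Pm where "Pm i j x y = (\<lambda>p. h (pt i j x y) (p, ()))" for i j x y
  have Pm_in: "Pm i j x y \<in> mats s" if "i < r" "j < r" for i j x y
    using bij_betwE[OF hbij] pt_in[OF that, of x y] by (auto simp: Pm_def mats_def coord_space_def idxB)
  have Pm_mult: "mm s (Pm i j x y) (Pm k l x' y') = (if j = k then Pm i l (x * x') (y * y') else 0)"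
    if ij: "i < r" "j < r" "k < r" "l < r" for i j k l x y x' y'
  proof (rule mtx_eqI)
    fix a b
    have "mm s (Pm i j x y) (Pm k l x' y') (a, b) = sc_mult B (h (pt i j x y)) (h (pt k l x' y')) ((a, b), ())"
      unfolding B_def sc_mult_base_matrices
      using matsD[OF mm_in[OF Pm_in[OF ij(1,2)] Pm_in[OF ij(3,4)]], of a b x y x' y']
      by (auto simp: mm_apply Pm_def)
    also have "\<dots> = h (if j = k then pt i l (x * x') (y * y') else 0) ((a, b), ())"
      using hmult[OF pt_in[OF ij(1,2)] pt_in[OF ij(3,4)]] pt_mult[OF ij] by simp
    also have "\<dots> = (if j = k then Pm i l (x * x') (y * y') else 0) (a, b)"
      by (simp add: Pm_def h0 fun_app)
    finally show "mm s (Pm i j x y) (Pm k l x' y') (a, b) = (if j = k then Pm i l (x * x') (y * y') else 0) (a, b)" .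
  qed
  have Pm_add1: "Pm 0 0 (x + x') y = Pm 0 0 x y + Pm 0 0 x' y" for x x' y
    by (rule ext) (simp add: Pm_def pt_add1 hadd pt_in rs fun_app)
  have Pm_add2: "Pm 0 0 x (y + y') = Pm 0 0 x y + Pm 0 0 x y'" for x y y'
    by (rule ext) (simp add: Pm_def pt_add2 hadd pt_in rs fun_app)
  have Pm_sc1: "Pm 0 0 (scale c x) y = fscale c (Pm 0 0 x y)" for c x y
    by (rule ext) (simp add: Pm_def pt_sc1 hsc pt_in rs fun_app)
  have Pm_sc2: "Pm 0 0 x (scale c y) = fscale c (Pm 0 0 x y)" for c x y
    by (rule ext) (simp add: Pm_def pt_sc2 hsc pt_in rs fun_app)
  have Pm_01: "Pm 0 0 0 y = 0" "Pm 0 0 x 0 = 0" for x y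
    using Pm_sc1[of 0 0 y] Pm_sc2[of x 0 0] by (simp_all only: scale_zero_left fun_vs.scale_zero_left)
  have Pm_sum: "Pm 0 0 (\<Sum>b\<in>C. scale (f b) b) (\<Sum>b\<in>D. scale (g b) b)
      = (\<Sum>b\<in>C. \<Sum>b'\<in>D. fscale (f b * g b') (Pm 0 0 b b'))" for C D f g
  proof -
    have 1: "Pm 0 0 (\<Sum>b\<in>C. scale (f b) b) y = (\<Sum>b\<in>C. fscale (f b) (Pm 0 0 b y))" for y
      by (induction C rule: infinite_finite_induct)
        (simp_all only: sum.infinite sum.empty sum.insert not_False_eq_True Pm_01 Pm_add1 Pm_sc1)
    have 2: "Pm 0 0 x (\<Sum>b\<in>D. scale (g b) b) = (\<Sum>b\<in>D. fscale (g b) (Pm 0 0 x b))" for x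
      by (induction D rule: infinite_finite_induct)
        (simp_all only: sum.infinite sum.empty sum.insert not_False_eq_True Pm_01 Pm_add2 Pm_sc2)
    show ?thesis unfolding 1 unfolding 2 fun_vs.scale_sum_right fun_vs.scale_scale ..
  qed
  define WS where "WS = (coord_space {..<s} :: (nat \<Rightarrow> 'f) set)"
  \<comment> \<open>The corner idempotent \<open>E_00\<close> cuts a module over the tensor square
    out of the standard module of dimension \<open>s\<close>.\<close>
  define V0 where "V0 = mv s (Pm 0 0 1 1) ` WS"
  have V0_fix: "mv s (Pm 0 0 1 1) w = w" if w: "w \<in> V0" for w
  proof -
    obtain u where "w = mv s (Pm 0 0 1 1) u" using w by (auto simp: V0_def)
    then show ?thesis using Pm_mult[of 0 0 0 0 1 1 1 1] rs by (simp add: mv_mm[symmetric])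
  qed
  have V0W: "V0 \<subseteq> WS" unfolding V0_def WS_def using Pm_in rs by auto
  have "V0 \<subseteq> fun_vs.span (dlt ` {..<s})" using V0W coord_span[of "{..<s}"] by (auto simp: WS_def)
  then obtain C where C: "C \<subseteq> V0" "finite C" "fun_vs.independent C" "V0 \<subseteq> fun_vs.span C"
    by (rule fv.indep_basis_of) simp
  have mv_sum: "mv s M (\<Sum>i\<in>I. fscale (c i) (x i)) = (\<Sum>i\<in>I. fscale (c i) (mv s M (x i)))"
    for M :: "'f mtx" and I :: "'z set" and c x
  proof -
    have "mv s M 0 = 0" by (rule ext) (simp add: mv_def fun_app)
    then show ?thesis
      by (induction I rule: infinite_finite_induct)
        (simp_all only: sum.infinite sum.empty sum.insert not_False_eq_True mv_add mv_fscale)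
  qed
  have mv_mat_sum: "mv s (\<Sum>i\<in>I. M i) v = (\<Sum>i\<in>I. mv s (M i) v)"
    for M :: "'z \<Rightarrow> 'f mtx" and I v
  proof -
    have "mv s 0 v = 0" by (rule ext) (simp add: mv_def fun_app)
    then show ?thesis
      by (induction I rule: infinite_finite_induct)
        (simp_all only: sum.infinite sum.empty sum.insert not_False_eq_True mv_add_mat)
  qed
  have "r * card C \<le> s"
  proof -
    \<comment> \<open>The elements \<open>E_i0\<close> carry a basis of the corner to
      \<open>r\<close> mutually independent copies, so \<open>r\<close> times its dimension is at
      most \<open>s\<close>, which is at most \<open>r * (n * n)\<close>.\<close>
    define x where "x = (\<lambda>(i, c). mv s (Pm i 0 1 1) c)"
    have "fv.indep_fam ({..<r} \<times> C) x"
      unfolding fv.indep_fam_def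
    proof (intro allI impI ballI)
      fix a p assume a: "(\<Sum>p\<in>{..<r} \<times> C. fscale (a p) (x p)) = 0" and p: "p \<in> {..<r} \<times> C"
      obtain k c0 where kc: "p = (k, c0)" "k < r" "c0 \<in> C" using p by auto
      have "0 = mv s (Pm 0 k 1 1) (\<Sum>p\<in>{..<r} \<times> C. fscale (a p) (x p))"
        unfolding a by (rule ext) (simp add: mv_def fun_app)
      also have "\<dots> = (\<Sum>p\<in>{..<r} \<times> C. fscale (a p) (mv s (Pm 0 k 1 1) (x p)))"
        by (rule mv_sum)
      also have "\<dots> = (\<Sum>p\<in>{k} \<times> C. fscale (a p) (snd p))"
      proof (rule sum.mono_neutral_cong_right)
        show "finite ({..<r} \<times> C)" using C by simp
        show "{k} \<times> C \<subseteq> {..<r} \<times> C" using kc by auto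
        show "\<forall>p\<in>{..<r} \<times> C - {k} \<times> C. fscale (a p) (mv s (Pm 0 k 1 1) (x p)) = 0"
        proof
          fix p assume "p \<in> {..<r} \<times> C - {k} \<times> C"
          then obtain i c where "p = (i, c)" "i < r" "i \<noteq> k" by auto
          then have "mv s (Pm 0 k 1 1) (x p) = mv s 0 c"
            using Pm_mult[of 0 k i 0 1 1 1 1] kc rs by (simp add: x_def mv_mm[symmetric])
          also have "\<dots> = 0" by (rule ext) (simp add: mv_def fun_app)
          finally show "fscale (a p) (mv s (Pm 0 k 1 1) (x p)) = 0" by (simp only: fun_vs.scale_zero_right)
        qed
        fix p assume "p \<in> {k} \<times> C"
        then obtain c where c: "p = (k, c)" "c \<in> C" by auto
        then have "mv s (Pm 0 k 1 1) (x p) = mv s (Pm 0 0 1 1) c"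
          using Pm_mult[of 0 k k 0 1 1 1 1] kc rs by (simp add: x_def mv_mm[symmetric])
        also have "\<dots> = c" using c C(1) V0_fix by blast
        finally show "fscale (a p) (mv s (Pm 0 k 1 1) (x p)) = fscale (a p) (snd p)" by (simp add: c)
      qed
      also have "\<dots> = (\<Sum>c\<in>C. fscale (a (k, c)) c)"
        by (rule sum.reindex_bij_witness[of _ "\<lambda>c. (k, c)" snd]) auto
      finally have "(\<Sum>c\<in>C. fscale (a (k, c)) c) = 0" by simp
      then show "a p = 0"
        using fun_vs.independentD[OF C(3,2) order_refl, of "\<lambda>c. a (k, c)" c0] kc by simp
    qed
    moreover have "x ` ({..<r} \<times> C) \<subseteq> coord_space {..<s}"
      unfolding x_def using Pm_in rs by auto
    ultimately have "card ({..<r} \<times> C) \<le> card {..<s}" using C by (intro indep_coord[of _ _ x]) auto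
    then show ?thesis by (simp add: card_cartesian_product)
  qed
  then have "r * card C \<le> r * (n * n)" using s_le by (rule le_trans)
  then have cardC: "card C \<le> n * n" using rs by simp
  have "pt 0 0 1 1 \<noteq> 0"
  proof
    assume pt0: "pt 0 0 1 1 = 0"
    have "rp 1 b = rp 0 b" for b
    proof -
      have "pt 0 0 1 1 ((0, 0), [b, b]) = 0" unfolding pt0 by (simp add: fun_app)
      then show ?thesis using rp_scale[of 0 0 b] by (simp add: pt_def)
    qed
    then have "(1::'a) = 0" by (rule rp_eqI)
    then show False by simp
  qed
  have "Pm 0 0 1 1 \<noteq> 0"
  proof
    assume P0: "Pm 0 0 1 1 = 0"
    have "h (pt 0 0 1 1) = h 0"
    proof
      fix t :: "(nat \<times> nat) \<times> unit"
      obtain p where "t = (p, ())" by (metis surj_pair unit.exhaust)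
      then show "h (pt 0 0 1 1) t = h 0 t" using fun_cong[OF P0, of p] by (simp add: Pm_def h0 fun_app)
    qed
    then have "pt 0 0 1 1 = 0"
      by (rule inj_onD[OF bij_betw_imp_inj_on[OF hbij] _ pt_in[OF rs(1) rs(1)] fun_vs.subspace_0[OF sA]])
    then show False using \<open>pt 0 0 1 1 \<noteq> 0\<close> by simp
  qed
  then obtain p0 q0 where pq: "Pm 0 0 1 1 (p0, q0) \<noteq> 0" by (metis mtx_eqI zero_fun_apply)
  then have q0: "q0 < s" using Pm_in[OF rs(1) rs(1)] by (auto simp: mats_iff)
  \<comment> \<open>The coordinate \<open>p0\<close> of the result of applying the tensor of
    \<open>M\<close> and \<open>N\<close> to \<open>v\<close>, extended bilinearly to matrices over
    the closure.\<close>
  define f where "f v M N = (\<Sum>b\<in>Basis. \<Sum>b'\<in>Basis. \<eta>i M b * \<eta>i N b' * to_ac (mv s (Pm 0 0 b b') v p0))"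
    for v :: "nat \<Rightarrow> 'f" and M N
  have f_lin1: "f v (fscale c M + M') N = c * f v M N + f v M' N" if "M \<in> mats n" "M' \<in> mats n" for v c M M' N
    using that fun_vs.subspace_scale[OF subspace_mats that(1), of c]
    by (simp add: f_def \<eta>i_add \<eta>i_fscale fun_app sum_distrib_left sum.distrib algebra_simps)
  have f_lin2: "f v M (fscale c N + N') = c * f v M N + f v M N'" if "N \<in> mats n" "N' \<in> mats n" for v c M N N'
    using that fun_vs.subspace_scale[OF subspace_mats that(1), of c]
    by (simp add: f_def \<eta>i_add \<eta>i_fscale fun_app sum_distrib_left sum.distrib algebra_simps)
  have \<eta>i0: "\<eta>i 0 = 0" using \<eta>i_\<iota>[of 0] by (simp only: \<iota>_0 tg_0)
  have f_0: "f v 0 N = 0" "f v M 0 = 0" for v M N by (simp_all add: f_def \<eta>i0 fun_app)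
  have f_\<iota>: "f v (\<iota> x) (\<iota> y) = to_ac (mv s (Pm 0 0 x y) v p0)" for v x y
  proof -
    have "mv s (Pm 0 0 x y) v p0 = mv s (Pm 0 0 (\<Sum>b\<in>Basis. scale (rp x b) b) (\<Sum>b\<in>Basis. scale (rp y b) b)) v p0"
      by (simp only: rp_sum)
    also have "\<dots> = (\<Sum>b\<in>Basis. \<Sum>b'\<in>Basis. rp x b * rp y b' * mv s (Pm 0 0 b b') v p0)"
      unfolding Pm_sum mv_mat_sum mv_fscale_mat sum_fun_apply fscale_apply ..
    finally show ?thesis by (simp add: f_def \<eta>i_\<iota> tg_apply to_ac_sum)
  qed
  have f_act: "f (mv s (Pm 0 0 a b) v) M N = f v (mm n M (\<iota> a)) (mm n N (\<iota> b))"
    if "M \<in> mats n" "N \<in> mats n" for a b v M N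
    using that(1)
  proof (induction M rule: mats_induct)
    case zero
    show ?case by (simp only: f_0 mm_0_left)
  next
    case (step c x M)
    have "f (mv s (Pm 0 0 a b) v) (\<iota> x) N = f v (mm n (\<iota> x) (\<iota> a)) (mm n N (\<iota> b))"
      using that(2)
    proof (induction N rule: mats_induct)
      case zero
      show ?case by (simp only: f_0 mm_0_left)
    next
      case (step c y N)
      have "f (mv s (Pm 0 0 a b) v) (\<iota> x) (\<iota> y) = f v (\<iota> (x * a)) (\<iota> (y * b))"
        using Pm_mult[of 0 0 0 0 x y a b] rs by (simp add: f_\<iota> mv_mm[symmetric])
      then show ?case using step
        by (simp add: f_lin2 mm_add_left mm_fscale_left \<iota>_mult)
    qed
    then show ?case using step by (simp add: f_lin1 mm_add_left mm_fscale_left)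
  qed
  have "f (dlt q0) (idm n) (idm n) \<noteq> 0"
    using f_\<iota>[of "dlt q0" 1 1] pq q0 by (simp add: \<iota>_1 mv_dlt)
  have f_sum1: "f v (\<Sum>i\<in>I. fscale (c i) (g i)) N = (\<Sum>i\<in>I. c i * f v (g i) N)"
    if "finite I" "\<And>i. i \<in> I \<Longrightarrow> g i \<in> mats n" for v N c g and I :: "'z set"
    using that
  proof (induction I)
    case empty
    show ?case by (simp only: sum.empty f_0)
  next
    case (insert i I)
    have "(\<Sum>i\<in>I. fscale (c i) (g i)) \<in> mats n"
      using insert by (intro fun_vs.subspace_sum[OF subspace_mats] fun_vs.subspace_scale[OF subspace_mats]) auto
    then show ?case using insert by (simp add: f_lin1)
  qed
  have f_sum2: "f v M (\<Sum>i\<in>I. fscale (c i) (g i)) = (\<Sum>i\<in>I. c i * f v M (g i))"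
    if "finite I" "\<And>i. i \<in> I \<Longrightarrow> g i \<in> mats n" for v M c g and I :: "'z set"
    using that
  proof (induction I)
    case empty
    show ?case by (simp only: sum.empty f_0)
  next
    case (insert i I)
    have "(\<Sum>i\<in>I. fscale (c i) (g i)) \<in> mats n"
      using insert by (intro fun_vs.subspace_sum[OF subspace_mats] fun_vs.subspace_scale[OF subspace_mats]) auto
    then show ?case using insert by (simp add: f_lin2)
  qed
  have "\<exists>k<n. \<exists>l<n. f (dlt q0) (dlt (k, k)) (dlt (l, l)) \<noteq> 0"
  proof (rule ccontr)
    assume no: "\<not> ?thesis"
    have e: "idm n = (\<Sum>i<n. fscale 1 (dlt (i, i))) " by (simp only: idm_expand fun_vs.scale_one)
    have "f (dlt q0) (idm n) (idm n) = (\<Sum>i<n. \<Sum>j<n. f (dlt q0) (dlt (i, i)) (dlt (j, j)))"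
      unfolding e by (subst f_sum1, simp, simp, subst f_sum2, simp_all)
    also have "\<dots> = 0" using no by (intro sum.neutral ballI) auto
    finally show False using \<open>f (dlt q0) (idm n) (idm n) \<noteq> 0\<close> by simp
  qed
  then obtain k l where kl: "k < n" "l < n" "f (dlt q0) (dlt (k, k)) (dlt (l, l)) \<noteq> 0" by blast
  \<comment> \<open>With matrix units in the rows \<open>k\<close> and \<open>l\<close> as
    arguments, the right multiplications in \<open>f_act\<close> turn into the sandwich action. The
    indices \<open>k\<close> and \<open>l\<close> are chosen such that the entry at
    \<open>(k, l)\<close> is nonzero for one vector.\<close>
  define \<Phi> where "\<Phi> v = (\<lambda>(i, j). if i < n \<and> j < n then f v (dlt (k, i)) (dlt (l, j)) else 0)" for v
  have \<Phi>_in: "\<Phi> v \<in> mats n" for v by (auto simp: \<Phi>_def mats_iff)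
  have row: "mm n (dlt (k, i)) M = (\<Sum>j<n. fscale (M (i, j)) (dlt (k, j)))" if "i < n" "M \<in> mats n" for k i and M :: "'f alg_closure mtx"
  proof (rule mtx_eqI)
    fix s t
    show "mm n (dlt (k, i)) M (s, t) = (\<Sum>j<n. fscale (M (i, j)) (dlt (k, j))) (s, t)"
      using that matsD[OF that(2), of i t]
      by (auto simp: mm_dlt_left sum_fun_apply fun_app dlt_pair if_distrib[of "\<lambda>u. _ * u"] cong: if_cong)
  qed
  have \<Phi>_act: "\<Phi> (mv s (Pm 0 0 a b) v) = mm n (mm n (\<iota> a) (\<Phi> v)) (mt (\<iota> b))" for a b v
  proof (rule mtx_eqI)
    fix i j
    show "\<Phi> (mv s (Pm 0 0 a b) v) (i, j) = mm n (mm n (\<iota> a) (\<Phi> v)) (mt (\<iota> b)) (i, j)"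
    proof (cases "i < n \<and> j < n")
      case True
      have "\<Phi> (mv s (Pm 0 0 a b) v) (i, j) = f v (mm n (dlt (k, i)) (\<iota> a)) (mm n (dlt (l, j)) (\<iota> b))"
        using True kl by (simp add: \<Phi>_def f_act)
      also have "\<dots> = (\<Sum>i'<n. \<iota> a (i, i') * (\<Sum>j'<n. \<iota> b (j, j') * f v (dlt (k, i')) (dlt (l, j'))))"
      proof -
        have r: "mm n (dlt (k, i)) (\<iota> a) = (\<Sum>i'<n. fscale (\<iota> a (i, i')) (dlt (k, i')))"
          "mm n (dlt (l, j)) (\<iota> b) = (\<Sum>j'<n. fscale (\<iota> b (j, j')) (dlt (l, j')))"
          using True by (auto intro: row)
        have f1: "f v (\<Sum>i'<n. fscale (\<iota> a (i, i')) (dlt (k, i'))) N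
            = (\<Sum>i'<n. \<iota> a (i, i') * f v (dlt (k, i')) N)" for N
          by (rule f_sum1) (use kl in auto)
        have f2: "f v M (\<Sum>j'<n. fscale (\<iota> b (j, j')) (dlt (l, j')))
            = (\<Sum>j'<n. \<iota> b (j, j') * f v M (dlt (l, j')))" for M
          by (rule f_sum2) (use kl in auto)
        show ?thesis unfolding r f1 unfolding f2 ..
      qed
      also have "\<dots> = (\<Sum>i'<n. \<Sum>j'<n. \<iota> a (i, i') * \<Phi> v (i', j') * \<iota> b (j, j'))"
        unfolding sum_distrib_left by (intro sum.cong refl) (simp add: \<Phi>_def mult_ac)
      also have "\<dots> = (\<Sum>j'<n. \<Sum>i'<n. \<iota> a (i, i') * \<Phi> v (i', j') * \<iota> b (j, j'))" by (rule sum.swap)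
      also have "\<dots> = mm n (mm n (\<iota> a) (\<Phi> v)) (mt (\<iota> b)) (i, j)"
        by (simp add: mm_apply sum_distrib_right)
      finally show ?thesis .
    next
      case False
      have "mm n (mm n (\<iota> a) (\<Phi> v)) (mt (\<iota> b)) \<in> mats n" using \<Phi>_in by simp
      then show ?thesis using False matsD by (auto simp: \<Phi>_def)
    qed
  qed
  have \<Phi>_lin: "\<Phi> (\<Sum>c\<in>C. fscale (g c) c) = (\<Sum>c\<in>C. fscale (to_ac (g c)) (\<Phi> c))" for g
  proof (rule mtx_eqI)
    fix i j
    have "f (\<Sum>c\<in>C. fscale (g c) c) M N = (\<Sum>c\<in>C. to_ac (g c) * f c M N)" for M N
    proof -
      have "f (\<Sum>c\<in>C. fscale (g c) c) M N = (\<Sum>b\<in>Basis. \<Sum>b'\<in>Basis. \<Sum>c\<in>C. to_ac (g c) * (\<eta>i M b * \<eta>i N b' * to_ac (mv s (Pm 0 0 b b') c p0)))"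
      proof -
        have ms: "mv s M (\<Sum>c\<in>C. fscale (g c) c) = (\<Sum>c\<in>C. fscale (g c) (mv s M c))" for M by (rule mv_sum)
        show ?thesis
          unfolding f_def ms sum_fun_apply fscale_apply to_ac_sum to_ac_mult sum_distrib_left
          by (simp only: mult_ac)
      qed
      also have "\<dots> = (\<Sum>b\<in>Basis. \<Sum>c\<in>C. \<Sum>b'\<in>Basis. to_ac (g c) * (\<eta>i M b * \<eta>i N b' * to_ac (mv s (Pm 0 0 b b') c p0)))"
        by (intro sum.cong refl sum.swap)
      also have "\<dots> = (\<Sum>c\<in>C. \<Sum>b\<in>Basis. \<Sum>b'\<in>Basis. to_ac (g c) * (\<eta>i M b * \<eta>i N b' * to_ac (mv s (Pm 0 0 b b') c p0)))"
        by (rule sum.swap)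
      finally show ?thesis by (simp add: f_def sum_distrib_left)
    qed
    then show "\<Phi> (\<Sum>c\<in>C. fscale (g c) c) (i, j) = (\<Sum>c\<in>C. fscale (to_ac (g c)) (\<Phi> c)) (i, j)"
      by (cases "i < n"; cases "j < n") (simp_all add: \<Phi>_def sum_fun_apply fun_app)
  qed
  have comb: "\<exists>g. \<Phi> v = (\<Sum>c\<in>C. fscale (to_ac (g c)) (\<Phi> c))" if v: "v \<in> WS" for v
  proof -
    have "\<Phi> v = \<Phi> (mv s (Pm 0 0 1 1) v)"
      unfolding \<Phi>_act using \<Phi>_in by (simp add: \<iota>_1 mm_idl mm_idr)
    moreover have "mv s (Pm 0 0 1 1) v \<in> fun_vs.span C" using v C(4) by (auto simp: V0_def)
    then obtain g where "mv s (Pm 0 0 1 1) v = (\<Sum>c\<in>C. fscale (g c) c)"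
      using fv.span_family[OF C(2), of _ "\<lambda>c. c"] by auto
    ultimately show ?thesis using \<Phi>_lin by metis
  qed
  have inW: "mv s (Pm 0 0 a b) v \<in> WS" for a b v unfolding WS_def using Pm_in[OF rs(1) rs(1)] by (rule mv_in)
  have CW: "C \<subseteq> WS" using C(1) V0W by blast
  have stable: "\<exists>g. mm n (mm n (\<iota> x) (\<Phi> c)) (mt (\<iota> y)) = (\<Sum>c\<in>C. fscale (to_ac (g c)) (\<Phi> c))" for x y c
    using comb[OF inW[of x y c]] unfolding \<Phi>_act .
  \<comment> \<open>This span is stable under all sandwich operations and contains the nonzero
    matrix \<open>M0\<close>. Matrix units on both sides isolate a nonzero entry of
    \<open>M0\<close>, so every matrix unit lies in the span.\<close>
  define S where "S = fun_vs.span (\<Phi> ` C)"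
  have sS: "fun_vs.subspace S" unfolding S_def by (rule fun_vs.subspace_span)
  have S\<iota>: "mm n (mm n (\<iota> x) M) (mt (\<iota> y)) \<in> S" if M: "M \<in> S" for x y M
  proof -
    obtain g where g: "M = (\<Sum>c\<in>C. fscale (g c) (\<Phi> c))" using M fv.span_family[OF C(2)] by (auto simp: S_def)
    show ?thesis
      unfolding g mm_sum_left mm_sum_right mm_fscale_left mm_fscale_right
    proof (intro fun_vs.subspace_sum[OF sS] fun_vs.subspace_scale[OF sS])
      fix c assume "c \<in> C"
      obtain g' where eq: "mm n (mm n (\<iota> x) (\<Phi> c)) (mt (\<iota> y)) = (\<Sum>c\<in>C. fscale (to_ac (g' c)) (\<Phi> c))"
        using stable by blast
      show "mm n (mm n (\<iota> x) (\<Phi> c)) (mt (\<iota> y)) \<in> S"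
        unfolding S_def eq by (intro fun_vs.span_sum fun_vs.span_scale fun_vs.span_base imageI)
    qed
  qed
  have Smm: "mm n (mm n X1 M) (mt X2) \<in> S" if M: "M \<in> S" and X1: "X1 \<in> mats n" and X2: "X2 \<in> mats n" for X1 X2 M
    using X1
  proof (induction X1 rule: mats_induct)
    case zero show ?case using fun_vs.subspace_0[OF sS] by (simp only: mm_0_left)
  next
    case (step c x X1)
    have "mm n (mm n (\<iota> x) M) (mt X2) \<in> S"
      using X2
    proof (induction X2 rule: mats_induct)
      case zero show ?case using fun_vs.subspace_0[OF sS] by (simp only: mm_0_right mt_0)
    next
      case (step c y X2)
      then show ?case unfolding mt_add mt_fscale mm_add_right mm_fscale_right
        using S\<iota>[OF M] by (intro fun_vs.subspace_add[OF sS] fun_vs.subspace_scale[OF sS])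
    qed
    with step show ?case unfolding mm_add_left mm_fscale_left
      by (intro fun_vs.subspace_add[OF sS] fun_vs.subspace_scale[OF sS])
  qed
  have "dlt q0 \<in> WS" unfolding WS_def using q0 by (intro dlt_in) simp
  then obtain g0 where g0: "\<Phi> (dlt q0) = (\<Sum>c\<in>C. fscale (to_ac (g0 c)) (\<Phi> c))" using comb by blast
  define M0 where "M0 = \<Phi> (dlt q0)"
  have M0S: "M0 \<in> S" unfolding M0_def g0 S_def
    by (intro fun_vs.span_sum fun_vs.span_scale fun_vs.span_base imageI)
  have M0kl: "M0 (k, l) \<noteq> 0" using kl by (simp add: M0_def \<Phi>_def)
  have dS: "dlt (i, j) \<in> S" if "i < n" "j < n" for i j
  proof -
    have "mm n (mm n (dlt (i, k)) M0) (mt (dlt (j, l))) = fscale (M0 (k, l)) (dlt (i, j))"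
    proof (rule mtx_eqI)
      fix s t
      have "mt (dlt (j, l)) = (dlt (l, j) :: 'f alg_closure mtx)" by (rule mtx_eqI) (auto simp: dlt_pair)
      then show "mm n (mm n (dlt (i, k)) M0) (mt (dlt (j, l))) (s, t) = fscale (M0 (k, l)) (dlt (i, j)) (s, t)"
        using kl that by (simp add: mm_dlt_right mm_dlt_left fun_app dlt_pair)
    qed
    then have "fscale (M0 (k, l)) (dlt (i, j)) \<in> S" using Smm[OF M0S, of "dlt (i, k)" "dlt (j, l)"] kl that by simp
    then have "fscale (inverse (M0 (k, l))) (fscale (M0 (k, l)) (dlt (i, j))) \<in> S" by (rule fun_vs.subspace_scale[OF sS])
    then show ?thesis using M0kl by (simp add: fun_vs.scale_scale)
  qed
  have Sall: "mats n \<subseteq> S"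
  proof
    fix M :: "'f alg_closure mtx" assume M: "M \<in> mats n"
    show "M \<in> S"
      by (subst mats_expand[OF M]) (auto intro!: fun_vs.subspace_sum[OF sS] fun_vs.subspace_scale[OF sS] dS)
  qed
  obtain J where J: "J \<subseteq> C" "fv.indep_fam J \<Phi>" "\<Phi> ` C \<subseteq> fun_vs.span (\<Phi> ` J)"
    using fv.max_indep_subfam[OF C(2)] by blast
  have fJ: "finite J" using J(1) C(2) finite_subset by blast
  have "S \<subseteq> fun_vs.span (\<Phi> ` J)" unfolding S_def using J(3) by (simp add: fun_vs.span_minimal fun_vs.subspace_span)
  then have "fun_vs.dim (mats n :: 'f alg_closure mtx set) = card J"
    using Sall \<Phi>_in by (intro fv.dim_family[OF fJ J(2)]) auto
  then have "card J = n * n" by (simp add: dim_mats)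
  \<comment> \<open>The images span a space of dimension \<open>n * n\<close>, while
    \<open>C\<close> has at most \<open>n * n\<close> elements; so the images of all elements of
    \<open>C\<close> are independent.\<close>
  then have JC: "J = C" using J(1) C(2) cardC by (simp add: card_seteq)
  have cC: "card C = n * n" using \<open>card J = n * n\<close> JC by simp
  obtain e where e: "bij_betw e {..<n * n} C"
    using ex_bij_betw_nat_finite[OF C(2)] cC by (auto simp: atLeast0LessThan)
  have re: "(\<Sum>c\<in>C. F c) = (\<Sum>j<n * n. F (e j))" for F :: "_ \<Rightarrow> 'f alg_closure mtx"
    by (rule sum.reindex_bij_betw[OF e, symmetric])
  have indC: "fv.indep_fam C \<Phi>" using J(2) JC by simp
  show ?thesis
  proof (intro exI[of _ "\<lambda>j. \<Phi> (e j)"] conjI allI impI)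
    show "(\<lambda>j. \<Phi> (e j)) ` {..<n * n} \<subseteq> mats n" using \<Phi>_in by auto
    show "fv.indep_fam {..<n * n} (\<lambda>j. \<Phi> (e j))"
      using indC e fv.indep_fam_iff[OF C(2), of \<Phi>]
      by (subst fv.indep_fam_iff) (auto simp: bij_betw_def inj_on_def image_image[symmetric, of \<Phi> e])
    fix x y i
    obtain g where "mm n (mm n (\<iota> x) (\<Phi> (e i))) (mt (\<iota> y)) = (\<Sum>c\<in>C. fscale (to_ac (g c)) (\<Phi> c))"
      using stable by blast
    then show "\<exists>c. mm n (mm n (\<iota> x) (\<Phi> (e i))) (mt (\<iota> y)) = (\<Sum>j<n * n. fscale (to_ac (c j)) (\<Phi> (e j)))"
      unfolding re by (intro exI[of _ "\<lambda>j. g (e j)"])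
  qed
qed

end

section \<open>Rational functions near a point\<close>

text \<open>Polynomial functions in the generators \<open>G\<close> with coefficients in
  \<open>C\<close>. The parameter \<open>C\<close> separates openness over the base field from
  openness over the closure.\<close>

inductive pfn :: "'k::field set \<Rightarrow> ('u \<Rightarrow> 'k) set \<Rightarrow> ('u \<Rightarrow> 'k) \<Rightarrow> bool"
  for C :: "'k set" and G :: "('u \<Rightarrow> 'k) set" where
  const: "c \<in> C \<Longrightarrow> pfn C G (\<lambda>u. c)"
| gen: "g \<in> G \<Longrightarrow> pfn C G g"
| add: "pfn C G p \<Longrightarrow> pfn C G q \<Longrightarrow> pfn C G (\<lambda>u. p u + q u)"
| mult: "pfn C G p \<Longrightarrow> pfn C G q \<Longrightarrow> pfn C G (\<lambda>u. p u * q u)"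

text \<open>Instantiated once with a whole field and once with the image of the base field in its
  closure.\<close>

locale coeff_field =
  fixes C :: "'k::field set"
  assumes zero_C: "0 \<in> C" and one_C: "1 \<in> C" and minus_C: "-1 \<in> C"
begin

lemma pfn_sum: "(\<And>i. i \<in> I \<Longrightarrow> pfn C G (f i)) \<Longrightarrow> pfn C G (\<lambda>u. \<Sum>i\<in>I. f i u)"
proof (induction I rule: infinite_finite_induct)
  case (insert i I)
  then show ?case by (simp add: pfn.add)
qed (simp_all add: pfn.const zero_C)

text \<open>Validity on a principal open neighbourhood of \<open>u0\<close> whose equation has the
  prescribed coefficients.\<close>

definition ev :: "('u \<Rightarrow> 'k) set \<Rightarrow> 'u \<Rightarrow> ('u \<Rightarrow> bool) \<Rightarrow> bool" where
  "ev G u0 P \<longleftrightarrow> (\<exists>q. pfn C G q \<and> q u0 \<noteq> 0 \<and> (\<forall>u. q u \<noteq> 0 \<longrightarrow> P u))"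

lemma ev_conj: "ev G u0 P \<Longrightarrow> ev G u0 Q \<Longrightarrow> ev G u0 (\<lambda>u. P u \<and> Q u)"
proof -
  assume "ev G u0 P" "ev G u0 Q"
  then obtain p q where "pfn C G p" "p u0 \<noteq> 0" "\<forall>u. p u \<noteq> 0 \<longrightarrow> P u"
    "pfn C G q" "q u0 \<noteq> 0" "\<forall>u. q u \<noteq> 0 \<longrightarrow> Q u" unfolding ev_def by blast
  then show ?thesis unfolding ev_def by (intro exI[of _ "\<lambda>u. p u * q u"]) (simp add: pfn.mult)
qed

lemma ev_mono: "ev G u0 P \<Longrightarrow> (\<And>u. P u \<Longrightarrow> Q u) \<Longrightarrow> ev G u0 Q"
  unfolding ev_def by blast

lemma ev_True: "(\<And>u. P u) \<Longrightarrow> ev G u0 P"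
  unfolding ev_def by (intro exI[of _ "\<lambda>u. 1"]) (simp add: pfn.const one_C)

text \<open>Membership in the local ring at \<open>u0\<close>: agreement with a fraction is demanded
  only where its denominator does not vanish, and this must include \<open>u0\<close>.\<close>

definition rat :: "('u \<Rightarrow> 'k) set \<Rightarrow> 'u \<Rightarrow> ('u \<Rightarrow> 'k) \<Rightarrow> bool" where
  "rat G u0 f \<longleftrightarrow> (\<exists>p q. pfn C G p \<and> pfn C G q \<and> q u0 \<noteq> 0 \<and> (\<forall>u. q u \<noteq> 0 \<longrightarrow> f u = p u / q u))"

lemma rat_pfn: "pfn C G p \<Longrightarrow> rat G u0 p"
  unfolding rat_def by (intro exI[of _ p] exI[of _ "\<lambda>u. 1"]) (simp add: pfn.const one_C)

lemma ratE:
  assumes "rat G u0 f"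
  obtains p q where "pfn C G p" "pfn C G q" "q u0 \<noteq> 0" "\<And>u. q u \<noteq> 0 \<Longrightarrow> f u = p u / q u"
  using assms unfolding rat_def by blast

lemma rat_add: assumes "rat G u0 f" "rat G u0 g" shows "rat G u0 (\<lambda>u. f u + g u)"
proof -
  obtain p q where 1: "pfn C G p" "pfn C G q" "q u0 \<noteq> 0" "\<And>u. q u \<noteq> 0 \<Longrightarrow> f u = p u / q u" using ratE[OF assms(1)] by blast
  obtain p' q' where 2: "pfn C G p'" "pfn C G q'" "q' u0 \<noteq> 0" "\<And>u. q' u \<noteq> 0 \<Longrightarrow> g u = p' u / q' u" using ratE[OF assms(2)] by blast
  show ?thesis unfolding rat_def
    using 1 2 by (intro exI[of _ "\<lambda>u. p u * q' u + p' u * q u"] exI[of _ "\<lambda>u. q u * q' u"])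
      (auto intro: pfn.add pfn.mult simp: add_frac_eq)
qed

lemma rat_mult: assumes "rat G u0 f" "rat G u0 g" shows "rat G u0 (\<lambda>u. f u * g u)"
proof -
  obtain p q where 1: "pfn C G p" "pfn C G q" "q u0 \<noteq> 0" "\<And>u. q u \<noteq> 0 \<Longrightarrow> f u = p u / q u" using ratE[OF assms(1)] by blast
  obtain p' q' where 2: "pfn C G p'" "pfn C G q'" "q' u0 \<noteq> 0" "\<And>u. q' u \<noteq> 0 \<Longrightarrow> g u = p' u / q' u" using ratE[OF assms(2)] by blast
  show ?thesis unfolding rat_def
    using 1 2 by (intro exI[of _ "\<lambda>u. p u * p' u"] exI[of _ "\<lambda>u. q u * q' u"])
      (auto intro: pfn.mult)
qed

lemma rat_const: "c \<in> C \<Longrightarrow> rat G u0 (\<lambda>u. c)"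
  by (rule rat_pfn) (rule pfn.const)

lemma rat_diff: assumes "rat G u0 f" "rat G u0 g" shows "rat G u0 (\<lambda>u. f u - g u)"
  using rat_add[OF assms(1) rat_mult[OF rat_const[OF minus_C] assms(2)]] by simp

lemma rat_sum: "(\<And>i. i \<in> I \<Longrightarrow> rat G u0 (f i)) \<Longrightarrow> rat G u0 (\<lambda>u. \<Sum>i\<in>I. f i u)"
proof (induction I rule: infinite_finite_induct)
  case (insert i I)
  then show ?case by (simp add: rat_add)
qed (simp_all add: rat_const zero_C)

lemma rat_inverse: assumes "rat G u0 f" "f u0 \<noteq> 0" shows "rat G u0 (\<lambda>u. inverse (f u))"
proof -
  obtain p q where 1: "pfn C G p" "pfn C G q" "q u0 \<noteq> 0" "\<And>u. q u \<noteq> 0 \<Longrightarrow> f u = p u / q u" using ratE[OF assms(1)] by blast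
  have "p u0 \<noteq> 0" using 1(3,4) assms(2) by auto
  then show ?thesis unfolding rat_def
    using 1 by (intro exI[of _ "\<lambda>u. q u * q u"] exI[of _ "\<lambda>u. p u * q u"])
      (auto intro: pfn.mult)
qed

lemma rat_nonzero: assumes "rat G u0 f" "f u0 \<noteq> 0" shows "ev G u0 (\<lambda>u. f u \<noteq> 0)"
proof -
  obtain p q where 1: "pfn C G p" "pfn C G q" "q u0 \<noteq> 0" "\<And>u. q u \<noteq> 0 \<Longrightarrow> f u = p u / q u" using ratE[OF assms(1)] by blast
  have "p u0 \<noteq> 0" using 1(3,4) assms(2) by auto
  then show ?thesis unfolding ev_def
    using 1 by (intro exI[of _ "\<lambda>u. p u * q u"]) (auto intro: pfn.mult)
qed

text \<open>Gaussian elimination over the local ring of rational functions regular at the base point.\<close>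

lemma dual_frame:
  fixes v :: "nat \<Rightarrow> 'u \<Rightarrow> 'i \<Rightarrow> 'k"
  assumes I: "finite I" and v: "\<And>j i. j < k \<Longrightarrow> i \<in> I \<Longrightarrow> rat G u0 (\<lambda>u. v j u i)"
    and in_I: "\<And>j. j < k \<Longrightarrow> v j u0 \<in> coord_space I"
    and ind: "fv.indep_fam {..<k} (\<lambda>j. v j u0)"
  shows "\<exists>f. (\<forall>j<k. \<forall>i\<in>I. rat G u0 (\<lambda>u. f j u i)) \<and>
    ev G u0 (\<lambda>u. \<forall>j<k. \<forall>l<k. (\<Sum>i\<in>I. f j u i * v l u i) = (if j = l then 1 else 0))"
  using v in_I ind
proof (induction k)
  case 0
  show ?case by (simp add: ev_True)
next
  case (Suc k)
  have ik: "fv.indep_fam {..<k} (\<lambda>j. v j u0)"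
    using Suc.prems(3) by (rule fv.indep_fam_mono[rotated 2]) auto
  have "\<exists>f. (\<forall>j<k. \<forall>i\<in>I. rat G u0 (\<lambda>u. f j u i)) \<and>
    ev G u0 (\<lambda>u. \<forall>j<k. \<forall>l<k. (\<Sum>i\<in>I. f j u i * v l u i) = (if j = l then 1 else 0))"
    by (rule Suc.IH[OF Suc.prems(1) Suc.prems(2) ik]) simp_all
  then obtain f where fr: "\<And>j i. j < k \<Longrightarrow> i \<in> I \<Longrightarrow> rat G u0 (\<lambda>u. f j u i)"
    and fd: "ev G u0 (\<lambda>u. \<forall>j<k. \<forall>l<k. (\<Sum>i\<in>I. f j u i * v l u i) = (if j = l then 1 else 0))"
    by blast
  define c where "c j u = (\<Sum>i\<in>I. f j u i * v k u i)" for j u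
  define v' where "v' u i = v k u i - (\<Sum>j<k. c j u * v j u i)" for u i
  have cr: "rat G u0 (c j)" if "j < k" for j
    unfolding c_def using that Suc.prems(1)[of k] by (intro rat_sum rat_mult fr) auto
  have vr: "rat G u0 (\<lambda>u. v' u i)" if "i \<in> I" for i
    unfolding v'_def using that Suc.prems(1) by (intro rat_diff rat_sum rat_mult cr) auto
  have "\<exists>i0\<in>I. v' u0 i0 \<noteq> 0"
  proof (rule ccontr)
    assume no: "\<not> ?thesis"
    define d where "d j = (if j = k then 1 else - c j u0)" for j
    have "(\<Sum>j<Suc k. fscale (d j) (v j u0)) = 0"
    proof
      fix i
      show "(\<Sum>j<Suc k. fscale (d j) (v j u0)) i = 0 i"
      proof (cases "i \<in> I")
        case True
        then have "v' u0 i = 0" using no by blast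
        then show ?thesis by (simp add: sum_fun_apply fun_app d_def v'_def sum_negf)
      next
        case False
        then have "v j u0 i = 0" if "j < Suc k" for j using Suc.prems(2)[OF that] by (simp add: coord_space_def)
        then show ?thesis by (simp add: sum_fun_apply fun_app)
      qed
    qed
    then have "d k = 0" by (rule fv.indep_famD[OF Suc.prems(3)]) simp
    then show False by (simp add: d_def)
  qed
  then obtain i0 where i0: "i0 \<in> I" "v' u0 i0 \<noteq> 0" by blast
  \<comment> \<open>Applied to a vector, \<open>f'\<close> takes the coordinate \<open>i0\<close> of
    what is left after eliminating the first \<open>k\<close> members and divides by the pivot
    \<open>v' u i0\<close>. Then \<open>F\<close> corrects the earlier functionals so that they
    vanish on \<open>v k\<close>.\<close>
  define f' where "f' u i = ((if i = i0 then 1 else 0) - (\<Sum>j<k. v j u i0 * f j u i)) * inverse (v' u i0)" for u i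
  have f'r: "rat G u0 (\<lambda>u. f' u i)" if "i \<in> I" for i
    unfolding f'_def using that i0 Suc.prems(1) zero_C one_C
    by (intro rat_mult rat_diff rat_sum fr rat_inverse vr rat_const) auto
  define F where "F j u i = (if j = k then f' u i else f j u i - c j u * f' u i)" for j u i
  have Fr: "rat G u0 (\<lambda>u. F j u i)" if "j < Suc k" "i \<in> I" for j i
  proof (cases "j = k")
    case True
    then show ?thesis using f'r[OF that(2)] by (simp add: F_def)
  next
    case False
    then have "j < k" using that by simp
    then show ?thesis using False rat_diff[OF fr rat_mult[OF cr f'r]] that by (simp add: F_def)
  qed
  have "ev G u0 (\<lambda>u. \<forall>j<Suc k. \<forall>l<Suc k. (\<Sum>i\<in>I. F j u i * v l u i) = (if j = l then 1 else 0))"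
  proof (rule ev_mono[OF ev_conj[OF fd rat_nonzero[OF vr[OF i0(1)] i0(2)]]])
    fix u assume u: "(\<forall>j<k. \<forall>l<k. (\<Sum>i\<in>I. f j u i * v l u i) = (if j = l then 1 else 0)) \<and> v' u i0 \<noteq> 0"
    have f'v: "(\<Sum>i\<in>I. f' u i * w i) = (w i0 - (\<Sum>j<k. v j u i0 * (\<Sum>i\<in>I. f j u i * w i))) * inverse (v' u i0)" for w
    proof -
      have "(\<Sum>i\<in>I. f' u i * w i) = (\<Sum>i\<in>I. (if i = i0 then w i0 else 0) - (\<Sum>j<k. v j u i0 * (f j u i * w i))) * inverse (v' u i0)"
        unfolding sum_distrib_right f'_def by (intro sum.cong refl) (simp add: algebra_simps sum_distrib_left)
      also have "(\<Sum>i\<in>I. (if i = i0 then w i0 else 0) - (\<Sum>j<k. v j u i0 * (f j u i * w i)))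
          = w i0 - (\<Sum>i\<in>I. \<Sum>j<k. v j u i0 * (f j u i * w i))"
        using I i0 by (simp add: sum_subtractf)
      also have "(\<Sum>i\<in>I. \<Sum>j<k. v j u i0 * (f j u i * w i)) = (\<Sum>j<k. v j u i0 * (\<Sum>i\<in>I. f j u i * w i))"
        by (subst sum.swap) (simp add: sum_distrib_left)
      finally show ?thesis .
    qed
    have "(\<Sum>i\<in>I. f' u i * v l u i) = (if l = k then 1 else 0)" if l: "l < Suc k" for l
    proof (cases "l = k")
      case True
      have "(\<Sum>i\<in>I. f' u i * v k u i) = v' u i0 * inverse (v' u i0)"
        unfolding f'v by (simp add: v'_def c_def mult.commute)
      then show ?thesis using True u by simp
    next
      case False
      then have lk: "l < k" using l by simp
      have "(\<Sum>j<k. v j u i0 * (\<Sum>i\<in>I. f j u i * v l u i)) = (\<Sum>j<k. if j = l then v l u i0 else 0)"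
        using u lk by (intro sum.cong) auto
      then show ?thesis unfolding f'v using False lk by simp
    qed
    note f'l = this
    show "\<forall>j<Suc k. \<forall>l<Suc k. (\<Sum>i\<in>I. F j u i * v l u i) = (if j = l then 1 else 0)"
    proof (intro allI impI)
      fix j l assume jl: "j < Suc k" "l < Suc k"
      show "(\<Sum>i\<in>I. F j u i * v l u i) = (if j = l then 1 else 0)"
      proof (cases "j = k")
        case True
        then show ?thesis using f'l[OF jl(2)] by (simp add: F_def eq_commute)
      next
        case False
        then have jk: "j < k" using jl by simp
        have "(\<Sum>i\<in>I. F j u i * v l u i) = (\<Sum>i\<in>I. f j u i * v l u i) - c j u * (\<Sum>i\<in>I. f' u i * v l u i)"
          using False by (simp add: F_def left_diff_distrib sum_subtractf sum_distrib_left mult.assoc)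
        also have "\<dots> = (if j = l then 1 else 0)"
        proof (cases "l = k")
          case True
          then show ?thesis using f'l[OF jl(2)] False by (simp add: c_def)
        next
          case False
          then show ?thesis using f'l[OF jl(2)] u jk jl by simp
        qed
        finally show ?thesis .
      qed
    qed
  qed
  then show ?case using Fr by (intro exI[of _ F]) simp
qed

text \<open>This is what makes the coefficients of a linear relation rational functions of the
  parameter.\<close>

lemma dual_frame_coeff:
  fixes v :: "nat \<Rightarrow> 'i \<Rightarrow> 'k"
  assumes "finite I" "\<forall>j<k. \<forall>l<k. (\<Sum>i\<in>I. f j i * v l i) = (if j = l then 1 else 0)"
    "w = (\<Sum>l<k. fscale (c l) (v l))" "j < k"
  shows "c j = (\<Sum>i\<in>I. f j i * w i)"
proof -
  have "(\<Sum>i\<in>I. f j i * w i) = (\<Sum>i\<in>I. \<Sum>l<k. c l * (f j i * v l i))"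
    unfolding assms(3) sum_fun_apply fun_app by (simp add: sum_distrib_left mult.left_commute)
  also have "\<dots> = (\<Sum>l<k. c l * (\<Sum>i\<in>I. f j i * v l i))"
    by (subst sum.swap) (simp add: sum_distrib_left)
  also have "\<dots> = (\<Sum>l<k. if l = j then c j else 0)" using assms(2,4) by (intro sum.cong) auto
  finally show ?thesis using assms(4) by simp
qed

text \<open>Functionals that are dual to the family certify its independence, and by
  \<open>dual_frame\<close> they exist on a whole neighbourhood.\<close>

lemma ev_indep:
  fixes v :: "nat \<Rightarrow> 'u \<Rightarrow> 'i \<Rightarrow> 'k"
  assumes I: "finite I" and v: "\<And>j i. j < k \<Longrightarrow> i \<in> I \<Longrightarrow> rat G u0 (\<lambda>u. v j u i)"
    and in_I: "\<And>j. j < k \<Longrightarrow> v j u0 \<in> coord_space I"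
    and ind: "fv.indep_fam {..<k} (\<lambda>j. v j u0)"
  shows "ev G u0 (\<lambda>u. fv.indep_fam {..<k} (\<lambda>j. v j u))"
proof -
  obtain f where "ev G u0 (\<lambda>u. \<forall>j<k. \<forall>l<k. (\<Sum>i\<in>I. f j u i * v l u i) = (if j = l then 1 else 0))"
    using dual_frame[OF I v in_I ind] by auto
  then show ?thesis
  proof (rule ev_mono)
    fix u assume u: "\<forall>j<k. \<forall>l<k. (\<Sum>i\<in>I. f j u i * v l u i) = (if j = l then 1 else 0)"
    show "fv.indep_fam {..<k} (\<lambda>j. v j u)"
      unfolding fv.indep_fam_def
    proof (intro allI impI ballI)
      fix c j assume c: "(\<Sum>j<k. fscale (c j) (v j u)) = 0" and j: "j \<in> {..<k}"
      have "c j = (\<Sum>i\<in>I. f j u i * 0 i)"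
        by (rule dual_frame_coeff[OF I u]) (use c j in auto)
      then show "c j = 0" by (simp add: fun_app)
    qed
  qed
qed

text \<open>A dual frame for the columns of a matrix is a left inverse of it, written row by
  row.\<close>

lemma ev_left_inverse:
  fixes M :: "'u \<Rightarrow> 'k mtx"
  assumes M: "\<And>i j. i < n \<Longrightarrow> j < n \<Longrightarrow> rat G u0 (\<lambda>u. M u (i, j))" and Min: "\<And>u. M u \<in> mats n"
    and N: "mm n N (M u0) = idm n"
  shows "ev G u0 (\<lambda>u. \<exists>N\<in>mats n. mm n N (M u) = idm n)"
proof -
  define v where "v j u = (\<lambda>i. M u (i, j))" for j u
  have "fv.indep_fam {..<n} (\<lambda>j. v j u0)"
    unfolding fv.indep_fam_def
  proof (intro allI impI ballI)
    fix c j assume c: "(\<Sum>j<n. fscale (c j) (v j u0)) = 0" and j: "j \<in> {..<n}"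
    define w where "w = (\<lambda>i. if i < n then c i else 0)"
    have w: "w \<in> coord_space {..<n}" by (auto simp: w_def coord_space_def)
    have "mv n (M u0) w = (\<Sum>j<n. fscale (c j) (v j u0))"
      by (rule ext) (simp add: mv_def sum_fun_apply fun_app v_def w_def mult.commute)
    then have "mv n (mm n N (M u0)) w = mv n N 0" unfolding mv_mm c by simp
    then have "w j = 0" unfolding N mv_idm[OF w] by (simp add: mv_def fun_app)
    then show "c j = 0" using j by (simp add: w_def)
  qed
  then obtain f where "ev G u0 (\<lambda>u. \<forall>j<n. \<forall>l<n. (\<Sum>i\<in>{..<n}. f j u i * v l u i) = (if j = l then 1 else 0))"
    using dual_frame[of "{..<n}" n G u0 v] M Min by (auto simp: v_def coord_space_def mats_iff)
  then show ?thesis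
  proof (rule ev_mono)
    fix u assume u: "\<forall>j<n. \<forall>l<n. (\<Sum>i\<in>{..<n}. f j u i * v l u i) = (if j = l then 1 else 0)"
    define N where "N = (\<lambda>(j, i). if j < n \<and> i < n then f j u i else 0)"
    have Nin: "N \<in> mats n" by (auto simp: N_def mats_iff)
    have "mm n N (M u) = idm n"
    proof (rule mtx_eqI)
      fix j l
      show "mm n N (M u) (j, l) = idm n (j, l)"
      proof (cases "j < n \<and> l < n")
        case True
        then show ?thesis using u by (simp add: mm_apply N_def v_def idm_apply)
      next
        case False
        then show ?thesis using matsD[OF mm_in[OF Nin Min], of j l u] by (auto simp: idm_apply)
      qed
    qed
    then show "\<exists>N\<in>mats n. mm n N (M u) = idm n" using Nin by blast
  qed
qed

end

interpretation Kc: coeff_field "UNIV :: 'k::field set" by unfold_locales auto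

interpretation Fc: coeff_field "range (to_ac :: 'f::field \<Rightarrow> 'f alg_closure)"
proof
  show "0 \<in> range (to_ac :: 'f \<Rightarrow> 'f alg_closure)" by (rule range_eqI[of _ _ 0]) simp
  show "1 \<in> range (to_ac :: 'f \<Rightarrow> 'f alg_closure)" by (rule range_eqI[of _ _ 1]) simp
  show "-1 \<in> range (to_ac :: 'f \<Rightarrow> 'f alg_closure)" by (rule range_eqI[of _ _ "-1"]) simp
qed

lemma pfn_univariate:
  fixes p :: "('i \<Rightarrow> 'k::field) \<Rightarrow> 'k"
  assumes "pfn C {\<lambda>u. u i | i. i \<in> I} p"
  shows "\<exists>q. \<forall>t. p (u(i := t)) = poly q t"
  using assms
proof (induction p rule: pfn.induct)
  case (const c)
  show ?case by (rule exI[of _ "[:c:]"]) simp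
next
  case (gen g)
  then obtain k where "g = (\<lambda>u. u k)" by auto
  then show ?case
    by (intro exI[of _ "if k = i then [:0, 1:] else [:u k:]"]) simp
next
  case (add p q)
  then obtain a b where "\<forall>t. p (u(i := t)) = poly a t" "\<forall>t. q (u(i := t)) = poly b t" by blast
  then show ?case by (intro exI[of _ "a + b"]) (simp del: fun_upd_apply)
next
  case (mult p q)
  then obtain a b where "\<forall>t. p (u(i := t)) = poly a t" "\<forall>t. q (u(i := t)) = poly b t" by blast
  then show ?case by (intro exI[of _ "a * b"]) (simp del: fun_upd_apply)
qed

text \<open>The coordinates are moved into \<open>D\<close> one after the other; as a function of a
  single coordinate, \<open>p\<close> is a nonzero polynomial and has only finitely many
  zeros.\<close>

lemma ex_rational_nonzero:
  fixes p :: "('i \<Rightarrow> 'k::field) \<Rightarrow> 'k"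
  assumes "pfn C {\<lambda>u. u i | i. i \<in> I} p" "p u0 \<noteq> 0" "finite I" "infinite D"
  shows "\<exists>u. (\<forall>i\<in>I. u i \<in> D) \<and> p u \<noteq> 0"
proof -
  have "\<exists>u. (\<forall>i\<in>J. u i \<in> D) \<and> p u \<noteq> 0" if "J \<subseteq> I" for J
    using finite_subset[OF that assms(3)] that
  proof (induction J)
    case empty
    then show ?case using assms(2) by auto
  next
    case (insert j J)
    then obtain u where u: "\<forall>i\<in>J. u i \<in> D" "p u \<noteq> 0" by auto
    obtain q where q: "\<And>t. p (u(j := t)) = poly q t" using pfn_univariate[OF assms(1)] by blast
    have "poly q (u j) \<noteq> 0" using q[of "u j"] u(2) by simp
    then have "q \<noteq> 0" by auto
    then have "finite {t. poly q t = 0}" by (rule poly_roots_finite)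
    then have "\<not> D \<subseteq> {t. poly q t = 0}" using assms(4) finite_subset by blast
    then obtain t where "t \<in> D" "poly q t \<noteq> 0" by blast
    moreover from this have "p (u(j := t)) \<noteq> 0" by (simp only: q) simp
    moreover have "\<forall>i\<in>insert j J. (u(j := t)) i \<in> D" using u(1) \<open>t \<in> D\<close> by simp
    ultimately show ?case by blast
  qed
  from this[OF order_refl] show ?thesis .
qed

text \<open>The columns of \<open>N\<close> are independent, hence a basis, and both products can be
  compared on them.\<close>

lemma left_inverse_right:
  fixes M N :: "'k::field mtx"
  assumes M: "M \<in> mats n" and N: "N \<in> mats n" and MN: "mm n M N = idm n"
  shows "mm n N M = idm n"
proof -
  define col where "col j = (\<lambda>i. N (i, j))" for j
  have colin: "col ` {..<n} \<subseteq> coord_space {..<n}" using N by (auto simp: col_def coord_space_def mats_iff)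
  have mvN: "mv n N w = (\<Sum>j<n. fscale (w j) (col j))" for w
    by (rule ext) (simp add: mv_def sum_fun_apply fun_app col_def mult.commute)
  have "fv.indep_fam {..<n} col"
    unfolding fv.indep_fam_def
  proof (intro allI impI ballI)
    fix c j assume c: "(\<Sum>j<n. fscale (c j) (col j)) = 0" and j: "j \<in> {..<n}"
    define w where "w = (\<lambda>i. if i < n then c i else 0)"
    have w: "w \<in> coord_space {..<n}" by (auto simp: w_def coord_space_def)
    have "mv n N w = (\<Sum>j<n. fscale (c j) (col j))" unfolding mvN by (intro sum.cong) (auto simp: w_def)
    then have "mv n (mm n M N) w = mv n M 0" unfolding mv_mm c by simp
    then have "w j = 0" unfolding MN mv_idm[OF w] by (simp add: mv_def fun_app)
    then show "c j = 0" using j by (simp add: w_def)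
  qed
  moreover have "card (dlt ` {..<n} :: (nat \<Rightarrow> 'k) set) \<le> card {..<n}" by (rule card_image_le) simp
  moreover have cs: "coord_space {..<n} \<subseteq> fun_vs.span (dlt ` {..<n} :: (nat \<Rightarrow> 'k) set)" by (rule coord_span) simp
  ultimately have sp: "fun_vs.span (col ` {..<n}) = fun_vs.span (dlt ` {..<n} :: (nat \<Rightarrow> 'k) set)"
    using colin by (intro fv.indep_fam_spans) auto
  show ?thesis
  proof (rule mtx_eqI)
    fix i j
    show "mm n N M (i, j) = idm n (i, j)"
    proof (cases "i < n \<and> j < n")
      case True
      then have d: "dlt j \<in> coord_space {..<n}" by (intro dlt_in) simp
      then have "dlt j \<in> fun_vs.span (col ` {..<n})" using sp cs by auto
      then obtain c where "dlt j = (\<Sum>j<n. fscale (c j) (col j))" using fv.span_family[of "{..<n}" "dlt j" col] by auto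
      then have Nc: "mv n N c = dlt j" by (simp add: mvN)
      have "mv n (mm n N M) (dlt j) = mv n N (mv n (mm n M N) c)" by (simp add: mv_mm Nc)
      also have "\<dots> = mv n N c"
        unfolding MN by (rule ext) (auto simp: mv_def idm_apply if_distrib[of "\<lambda>u. u * _"] intro!: sum.cong cong: if_cong)
      finally have "mv n (mm n N M) (dlt j) i = dlt j i" using Nc by simp
      then have "mm n N M (i, j) = dlt j i" using True by (simp add: mv_dlt)
      then show ?thesis using True by (simp add: idm_apply dlt_def)
    next
      case False
      then show ?thesis using matsD[OF mm_in[OF N M], of i j] by (auto simp: idm_apply)
    qed
  qed
qed

section \<open>Transposition and symmetric elements\<close>

context vec_sp
begin

lemma ex_functional:
  assumes "x \<notin> local.span C"
  shows "\<exists>lam. (\<forall>a b. lam (a + b) = lam a + lam b) \<and> (\<forall>c a. lam (c *s a) = c * lam a) \<and>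
    lam x = 1 \<and> (\<forall>z\<in>local.span C. lam z = 0)"
proof -
  obtain B0 where B0: "B0 \<subseteq> C" "local.independent B0" "C \<subseteq> local.span B0"
    using maximal_independent_subset[of C] by blast
  have sp: "local.span C \<subseteq> local.span B0" using B0(3) by (simp add: span_minimal)
  have x: "x \<notin> local.span B0" using assms span_mono[OF B0(1)] by blast
  then have ix: "local.independent (insert x B0)" using B0(2) by (rule independent_insertI)
  define D where "D = extend_basis (insert x B0)"
  have D: "local.independent D" "insert x B0 \<subseteq> D" "local.span D = UNIV"
    using independent_extend_basis[OF ix] extend_basis_superset[OF ix] span_extend_basis[OF ix] by (auto simp: D_def)
  define lam where "lam z = representation D z x" for z
  have "lam (a + b) = lam a + lam b" for a b
    using representation_add[OF D(1), of b a] D(3) by (simp add: lam_def)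
  moreover have "lam (c *s a) = c * lam a" for c a
    using representation_scale[OF D(1), of a c] D(3) by (simp add: lam_def)
  moreover have "lam x = 1" using representation_basis[OF D(1), of x] D(2) by (simp add: lam_def)
  moreover have "lam z = 0" if "z \<in> local.span C" for z
  proof -
    have "z \<in> local.span B0" using sp that by blast
    then have "representation D z = representation B0 z"
      using D(1,2) by (intro representation_extend) auto
    moreover have "x \<notin> B0" using x span_base by blast
    ultimately show ?thesis using representation_ne_zero[of B0 z x] by (auto simp: lam_def)
  qed
  ultimately show ?thesis by blast
qed

end

section \<open>Linear functionals of the closure over the base field\<close>

interpretation KF: vec_sp "\<lambda>(c :: 'f::field) (z :: 'f alg_closure). to_ac c * z"
  by unfold_locales (auto simp: algebra_simps)

definition F_linear :: "('f::field alg_closure \<Rightarrow> 'f) \<Rightarrow> bool" where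
  "F_linear \<psi> \<longleftrightarrow> (\<forall>a b. \<psi> (a + b) = \<psi> a + \<psi> b) \<and> (\<forall>c a. \<psi> (to_ac c * a) = c * \<psi> a)"

lemma F_linear_sum: "F_linear \<psi> \<Longrightarrow> \<psi> (\<Sum>i\<in>I. f i) = (\<Sum>i\<in>I. \<psi> (f i))"
proof -
  assume \<psi>: "F_linear \<psi>"
  have "\<psi> (to_ac 0 * 0) = 0 * \<psi> 0" using \<psi> unfolding F_linear_def by blast
  then have "\<psi> 0 = 0" by simp
  then show ?thesis using \<psi> by (induction I rule: infinite_finite_induct) (auto simp: F_linear_def)
qed

lemma F_linear_mult: "F_linear \<psi> \<Longrightarrow> \<psi> (a * to_ac c) = \<psi> a * c"
  by (simp add: F_linear_def mult.commute)

lemma ex_F_linear: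
  assumes "k \<noteq> (0 :: 'f::field alg_closure)"
  shows "\<exists>\<psi> :: 'f alg_closure \<Rightarrow> 'f. F_linear \<psi> \<and> \<psi> k = 1"
proof -
  have "k \<notin> KF.span {}" using assms by simp
  from KF.ex_functional[OF this] show ?thesis unfolding F_linear_def by blast
qed

text \<open>The functionals are the coordinates for a basis of the closure over the base field, and
  \<open>B\<close> consists of the basis elements that occur in \<open>S\<close>.\<close>

lemma F_linear_decomposition:
  fixes S :: "'f::field alg_closure set"
  assumes "finite S"
  shows "\<exists>B \<psi>. finite B \<and> (\<forall>\<beta>. F_linear (\<psi> \<beta> :: 'f alg_closure \<Rightarrow> 'f)) \<and>
    (\<forall>k\<in>S. k = (\<Sum>\<beta>\<in>B. \<beta> * to_ac (\<psi> \<beta> k)))"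
proof -
  define D where "D = (KF.extend_basis {} :: 'f alg_closure set)"
  have i0: "KF.independent ({} :: 'f alg_closure set)" by (rule KF.independent_empty)
  have D: "KF.independent D" "KF.span D = UNIV"
    unfolding D_def using KF.independent_extend_basis[OF i0] KF.span_extend_basis[OF i0] by auto
  define \<psi> where "\<psi> \<beta> k = KF.representation D k \<beta>" for \<beta> k :: "'f alg_closure"
  define B where "B = (\<Union>k\<in>S. {\<beta>. \<psi> \<beta> k \<noteq> 0})"
  have finB: "finite B" unfolding B_def \<psi>_def using assms KF.finite_representation by blast
  have "F_linear (\<psi> \<beta>)" for \<beta>
    unfolding F_linear_def \<psi>_def using D
    by (simp add: KF.representation_add[OF D(1)] KF.representation_scale[OF D(1)])
  moreover have "k = (\<Sum>\<beta>\<in>B. \<beta> * to_ac (\<psi> \<beta> k))" if "k \<in> S" for k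
  proof -
    have "k \<in> KF.span D" using D(2) by simp
    from KF.sum_nonzero_representation_eq[OF D(1) this]
    have "k = (\<Sum>\<beta> | \<psi> \<beta> k \<noteq> 0. to_ac (\<psi> \<beta> k) * \<beta>)" by (simp add: \<psi>_def)
    also have "\<dots> = (\<Sum>\<beta>\<in>B. to_ac (\<psi> \<beta> k) * \<beta>)"
      using that finB by (intro sum.mono_neutral_left) (auto simp: B_def)
    finally show ?thesis by (simp add: mult.commute)
  qed
  ultimately show ?thesis using finB by blast
qed

lemma central_matrix:
  fixes C :: "'k::field mtx"
  assumes n: "0 < n" and C: "C \<in> mats n" and comm: "\<And>M. M \<in> mats n \<Longrightarrow> mm n M C = mm n C M"
  shows "C = fscale (C (0, 0)) (idm n)"
proof (rule mtx_eqI)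
  fix k j
  show "C (k, j) = fscale (C (0, 0)) (idm n) (k, j)"
  proof (cases "k < n \<and> j < n")
    case True
    have "mm n (dlt (0, k)) C (0, j) = mm n C (dlt (0, k)) (0, j)" using comm[of "dlt (0, k)"] True n by simp
    then show ?thesis using True n by (simp add: mm_dlt_left mm_dlt_right fun_app idm_apply eq_commute)
  next
    case False
    then show ?thesis using matsD[OF C False] by (auto simp: fun_app idm_apply)
  qed
qed

text \<open>The matrices \<open>v i\<close> span a form over the base field of the space of matrices, stable under
  \<open>M \<mapsto> x M y\<^sup>T\<close> for \<open>x\<close> and \<open>y\<close> in the algebra. It exists because the tensor square is split.\<close>

locale bimodule_form = split_csa scale Basis n \<eta>
  for scale :: "'f::field \<Rightarrow> 'a::ring_1 \<Rightarrow> 'a" and Basis :: "'a set" and n :: nat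
    and \<eta> :: "('a \<Rightarrow> 'f alg_closure) \<Rightarrow> 'f alg_closure mtx" +
  fixes v :: "nat \<Rightarrow> 'f alg_closure mtx"
  assumes v_in: "v ` {..<n * n} \<subseteq> mats n" and v_ind: "fv.indep_fam {..<n * n} v"
    and v_act: "\<And>x y i. i < n * n \<Longrightarrow> \<exists>c :: nat \<Rightarrow> 'f.
       mm n (mm n (\<iota> x) (v i)) (mt (\<iota> y)) = (\<Sum>j<n * n. fscale (to_ac (c j)) (v j))"
    and two: "(2 :: 'f) \<noteq> 0"
    and inf: "infinite (UNIV :: 'f set)"
begin

lemma two_ac: "(2 :: 'f alg_closure) \<noteq> 0"
  using two to_ac_eq_0_iff[of "2 :: 'f"] by simp

lemma v_mats [simp]: "i < n * n \<Longrightarrow> v i \<in> mats n" using v_in by auto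

definition Vf :: "'f alg_closure mtx set" where
  "Vf = {\<Sum>j<n * n. fscale (to_ac (c j)) (v j) | c. True}"

lemma Vf_iff: "M \<in> Vf \<longleftrightarrow> (\<exists>c. M = (\<Sum>j<n * n. fscale (to_ac (c j)) (v j)))"
  by (auto simp: Vf_def)

lemma Vf_mats: "M \<in> Vf \<Longrightarrow> M \<in> mats n"
  unfolding Vf_iff by (auto intro!: fun_vs.subspace_sum[OF subspace_mats] fun_vs.subspace_scale[OF subspace_mats])

lemma Vf_add: "M \<in> Vf \<Longrightarrow> M' \<in> Vf \<Longrightarrow> M + M' \<in> Vf"
proof -
  assume "M \<in> Vf" "M' \<in> Vf"
  then obtain c d where "M = (\<Sum>j<n * n. fscale (to_ac (c j)) (v j))" "M' = (\<Sum>j<n * n. fscale (to_ac (d j)) (v j))"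
    unfolding Vf_iff by blast
  then have "M + M' = (\<Sum>j<n * n. fscale (to_ac (c j + d j)) (v j))"
    by (simp add: fun_vs.scale_left_distrib sum.distrib)
  then show ?thesis unfolding Vf_iff by (intro exI[of _ "\<lambda>j. c j + d j"])
qed

lemma Vf_scale: "M \<in> Vf \<Longrightarrow> fscale (to_ac a) M \<in> Vf"
proof -
  assume "M \<in> Vf"
  then obtain c where "M = (\<Sum>j<n * n. fscale (to_ac (c j)) (v j))" unfolding Vf_iff by blast
  then have "fscale (to_ac a) M = (\<Sum>j<n * n. fscale (to_ac (a * c j)) (v j))"
    by (simp add: fun_vs.scale_sum_right)
  then show ?thesis unfolding Vf_iff by (intro exI[of _ "\<lambda>j. a * c j"])
qed

lemma v_Vf: "i < n * n \<Longrightarrow> v i \<in> Vf"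
proof -
  assume i: "i < n * n"
  have "(\<Sum>j<n * n. fscale (to_ac (if j = i then 1 else 0)) (v j)) = (\<Sum>j<n * n. if j = i then v i else 0)"
    by (intro sum.cong refl) auto
  then have "v i = (\<Sum>j<n * n. fscale (to_ac (if j = i then 1 else 0)) (v j))" using i by simp
  then show ?thesis unfolding Vf_iff by (intro exI[of _ "\<lambda>j. if j = i then 1 else 0"])
qed

lemma Vf_0: "0 \<in> Vf"
  unfolding Vf_iff by (intro exI[of _ "\<lambda>j. 0"]) (simp add: fun_vs.scale_zero_left)

lemma Vf_sum: "(\<And>i. i \<in> I \<Longrightarrow> f i \<in> Vf) \<Longrightarrow> (\<Sum>i\<in>I. f i) \<in> Vf"
  by (induction I rule: infinite_finite_induct) (auto simp: Vf_0 Vf_add)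

lemma Vf_diff: "M \<in> Vf \<Longrightarrow> M' \<in> Vf \<Longrightarrow> M - M' \<in> Vf"
  using Vf_add[of M "fscale (to_ac (-1)) M'"] Vf_scale[of M' "-1"] by simp

lemma lin_on_sandwich:
  assumes "A \<in> mats n" "B \<in> mats n"
  shows "fv.lin_on (mats n) (\<lambda>M. mm n (mm n A M) B)"
  unfolding fv.lin_on_def using assms subspace_mats
  by (auto simp: mm_add_left mm_add_right mm_fscale_left mm_fscale_right)

lemma lin_on_mt: "fv.lin_on (mats n) mt"
  unfolding fv.lin_on_def using subspace_mats by (auto simp: mt_add mt_fscale)

lemma Vf_act: "M \<in> Vf \<Longrightarrow> mm n (mm n (\<iota> x) M) (mt (\<iota> y)) \<in> Vf"
proof -
  assume "M \<in> Vf"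
  then obtain c where c: "M = (\<Sum>j<n * n. fscale (to_ac (c j)) (v j))" unfolding Vf_iff by blast
  have "mm n (mm n (\<iota> x) (v j)) (mt (\<iota> y)) \<in> Vf" if "j < n * n" for j
    using v_act[OF that] unfolding Vf_iff .
  then show ?thesis unfolding c mm_sum_left mm_sum_right mm_fscale_left mm_fscale_right
    by (intro Vf_sum Vf_scale) simp
qed

lemma v_span: "mats n \<subseteq> fun_vs.span (v ` {..<n * n})"
proof -
  have f: "finite (dlt ` ({..<n} \<times> {..<n}) :: 'f alg_closure mtx set)" by simp
  have s: "mats n \<subseteq> fun_vs.span (dlt ` ({..<n} \<times> {..<n}) :: 'f alg_closure mtx set)"
    unfolding mats_def by (rule coord_span) simp
  have c: "card (dlt ` ({..<n} \<times> {..<n}) :: 'f alg_closure mtx set) \<le> card {..<n * n}"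
    using card_image_le[of "{..<n} \<times> {..<n}" dlt] by simp
  have "fun_vs.span (v ` {..<n * n}) = fun_vs.span (dlt ` ({..<n} \<times> {..<n}))"
    using v_in s c by (intro fv.indep_fam_spans[OF _ v_ind _ f]) auto
  then show ?thesis using s by simp
qed

definition co :: "'f alg_closure mtx \<Rightarrow> nat \<Rightarrow> 'f alg_closure" where
  "co M = (SOME c. M = (\<Sum>i<n * n. fscale (c i) (v i)))"

lemma co: "M \<in> mats n \<Longrightarrow> M = (\<Sum>i<n * n. fscale (co M i) (v i))"
proof -
  assume "M \<in> mats n"
  then have "\<exists>c. M = (\<Sum>i<n * n. fscale (c i) (v i))"
    using v_span fv.span_family[of "{..<n * n}" M v] by auto
  then show ?thesis unfolding co_def by (rule someI_ex)
qed

lemma co_eqI: "M = (\<Sum>i<n * n. fscale (c i) (v i)) \<Longrightarrow> i < n * n \<Longrightarrow> co M i = c i"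
proof -
  assume M: "M = (\<Sum>i<n * n. fscale (c i) (v i))" and i: "i < n * n"
  have "M \<in> mats n" unfolding M
    by (auto intro!: fun_vs.subspace_sum[OF subspace_mats] fun_vs.subspace_scale[OF subspace_mats])
  from co[OF this] M have "(\<Sum>i<n * n. fscale (co M i) (v i)) = (\<Sum>i<n * n. fscale (c i) (v i))" by simp
  then show ?thesis by (rule fv.indep_fam_eqD[OF v_ind]) (use i in simp)
qed

lemma co_add: "M \<in> mats n \<Longrightarrow> M' \<in> mats n \<Longrightarrow> i < n * n \<Longrightarrow> co (M + M') i = co M i + co M' i"
proof (rule co_eqI)
  assume "M \<in> mats n" "M' \<in> mats n"
  then show "M + M' = (\<Sum>i<n * n. fscale (co M i + co M' i) (v i))"
    using co[of M] co[of M'] by (simp add: fun_vs.scale_left_distrib sum.distrib)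
qed

lemma co_fscale: "M \<in> mats n \<Longrightarrow> i < n * n \<Longrightarrow> co (fscale c M) i = c * co M i"
proof (rule co_eqI)
  assume "M \<in> mats n"
  then have "fscale c M = fscale c (\<Sum>i<n * n. fscale (co M i) (v i))" using co[of M] by simp
  then show "fscale c M = (\<Sum>i<n * n. fscale (c * co M i) (v i))"
    by (simp add: fun_vs.scale_sum_right)
qed

text \<open>A functional of the closure, applied to the coordinates with respect to
  \<open>v\<close>, brings any matrix into the form; linearity over the base field survives.\<close>

definition Psi :: "('f alg_closure \<Rightarrow> 'f) \<Rightarrow> 'f alg_closure mtx \<Rightarrow> 'f alg_closure mtx" where
  "Psi \<psi> M = (\<Sum>i<n * n. fscale (to_ac (\<psi> (co M i))) (v i))"

lemma Psi_Vf: "Psi \<psi> M \<in> Vf" unfolding Psi_def Vf_iff by (rule exI[of _ "\<lambda>i. \<psi> (co M i)"]) (rule refl)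

lemma Psi_mats [simp]: "Psi \<psi> M \<in> mats n" by (rule Vf_mats[OF Psi_Vf])

lemma operator_coords:
  assumes R: "fv.lin_on (mats n) R" and r: "\<And>i. i < n * n \<Longrightarrow> R (v i) = (\<Sum>j<n * n. fscale (to_ac (r i j)) (v j))"
  shows "R (\<Sum>i<n * n. fscale (c i) (v i)) = (\<Sum>j<n * n. fscale (\<Sum>i<n * n. c i * to_ac (r i j)) (v j))"
proof -
  have "R (\<Sum>i<n * n. fscale (c i) (v i)) = (\<Sum>i<n * n. fscale (c i) (R (v i)))"
    by (rule fv.lin_on_sum[OF R]) auto
  also have "\<dots> = (\<Sum>i<n * n. \<Sum>j<n * n. fscale (c i * to_ac (r i j)) (v j))"
    using r by (intro sum.cong refl) (simp add: fun_vs.scale_sum_right)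
  also have "\<dots> = (\<Sum>j<n * n. \<Sum>i<n * n. fscale (c i * to_ac (r i j)) (v j))" by (rule sum.swap)
  finally show ?thesis by (simp add: fun_vs.scale_sum_left)
qed

lemma operator_matrix:
  assumes "\<And>i. i < n * n \<Longrightarrow> R (v i) \<in> Vf"
  shows "\<exists>r. \<forall>i<n * n. R (v i) = (\<Sum>j<n * n. fscale (to_ac (r i j)) (v j))"
proof -
  have "\<forall>i. \<exists>c. i < n * n \<longrightarrow> R (v i) = (\<Sum>j<n * n. fscale (to_ac (c j)) (v j))"
    using assms unfolding Vf_iff by blast
  from choice[OF this] show ?thesis by blast
qed

text \<open>With respect to \<open>v\<close>, an operator that preserves the form has a matrix over
  the base field, through which the functional \<open>\<psi>\<close> passes.\<close>

lemma Psi_comm: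
  assumes \<psi>: "F_linear \<psi>" and R: "fv.lin_on (mats n) R" and RV: "\<And>i. i < n * n \<Longrightarrow> R (v i) \<in> Vf"
    and M: "M \<in> mats n"
  shows "Psi \<psi> (R M) = R (Psi \<psi> M)"
proof -
  obtain r where r: "\<And>i. i < n * n \<Longrightarrow> R (v i) = (\<Sum>j<n * n. fscale (to_ac (r i j)) (v j))"
    using operator_matrix[of R, OF RV] by blast
  have "R M = (\<Sum>j<n * n. fscale (\<Sum>i<n * n. co M i * to_ac (r i j)) (v j))"
    using operator_coords[OF R r, of "co M"] co[OF M] by simp
  then have c: "co (R M) j = (\<Sum>i<n * n. co M i * to_ac (r i j))" if "j < n * n" for j
    by (rule co_eqI) (rule that)
  have "Psi \<psi> (R M) = (\<Sum>j<n * n. fscale (\<Sum>i<n * n. to_ac (\<psi> (co M i)) * to_ac (r i j)) (v j))"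
    unfolding Psi_def by (intro sum.cong refl) (simp add: c F_linear_sum[OF \<psi>] F_linear_mult[OF \<psi>] to_ac_sum)
  also have "\<dots> = R (Psi \<psi> M)"
    unfolding Psi_def by (rule operator_coords[OF R r, symmetric])
  finally show ?thesis .
qed

lemma Psi_act: "F_linear \<psi> \<Longrightarrow> M \<in> mats n \<Longrightarrow>
    Psi \<psi> (mm n (mm n (\<iota> x) M) (mt (\<iota> y))) = mm n (mm n (\<iota> x) (Psi \<psi> M)) (mt (\<iota> y))"
  by (rule Psi_comm) (auto intro!: lin_on_sandwich Vf_act v_Vf)

lemma Psi_Fcomb:
  assumes \<psi>: "F_linear \<psi>" and M: "\<And>j. j \<in> J \<Longrightarrow> M j \<in> mats n" and J: "finite J"
  shows "Psi \<psi> (\<Sum>j\<in>J. fscale (to_ac (c j)) (M j)) = (\<Sum>j\<in>J. fscale (to_ac (c j)) (Psi \<psi> (M j)))"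
  using J M
proof (induction J)
  case empty
  have "co 0 i = 0" if "i < n * n" for i
    by (rule co_eqI[of _ "\<lambda>_. 0"]) (simp_all add: fun_vs.scale_zero_left that)
  then show ?case using F_linear_sum[OF \<psi>, of "\<lambda>_. 0" "{}"]
    by (simp add: Psi_def fun_vs.scale_zero_left)
next
  case (insert j J)
  have m: "(\<Sum>j\<in>J. fscale (to_ac (c j)) (M j)) \<in> mats n" "fscale (to_ac (c j)) (M j) \<in> mats n" "M j \<in> mats n"
    using insert.prems by (auto intro!: fun_vs.subspace_sum[OF subspace_mats] fun_vs.subspace_scale[OF subspace_mats])
  have "Psi \<psi> (fscale (to_ac (c j)) (M j) + (\<Sum>j\<in>J. fscale (to_ac (c j)) (M j)))
    = fscale (to_ac (c j)) (Psi \<psi> (M j)) + Psi \<psi> (\<Sum>j\<in>J. fscale (to_ac (c j)) (M j))"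
    unfolding Psi_def fun_vs.scale_sum_right sum.distrib[symmetric]
  proof (intro sum.cong refl)
    fix i assume "i \<in> {..<n * n}"
    then have "co (fscale (to_ac (c j)) (M j) + (\<Sum>j\<in>J. fscale (to_ac (c j)) (M j))) i
      = to_ac (c j) * co (M j) i + co (\<Sum>j\<in>J. fscale (to_ac (c j)) (M j)) i"
      using co_add[OF m(2,1)] co_fscale[OF m(3)] by simp
    then show "fscale (to_ac (\<psi> (co (fscale (to_ac (c j)) (M j) + (\<Sum>j\<in>J. fscale (to_ac (c j)) (M j))) i))) (v i)
      = fscale (to_ac (c j)) (fscale (to_ac (\<psi> (co (M j) i))) (v i)) + fscale (to_ac (\<psi> (co (\<Sum>j\<in>J. fscale (to_ac (c j)) (M j)) i))) (v i)"
      using \<psi> by (simp add: F_linear_def fun_vs.scale_left_distrib)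
  qed
  then show ?case using insert by simp
qed

text \<open>Transposition exchanges the two sides of the sandwich action, so
  \<open>Psi \<psi>\<close> conjugated by it still commutes with this action. Its linear extension
  from \<open>v\<close> to the closure commutes with all sandwich operations and is therefore a
  scalar \<open>c\<close>. Hence \<open>Psi \<psi>\<close> multiplies each \<open>mt (v i)\<close>
  by \<open>c\<close>, while its values lie in the form.\<close>

lemma transpose_scaled:
  "\<exists>c. c \<noteq> 0 \<and> (\<forall>i<n * n. fscale c (mt (v i)) \<in> Vf)"
proof -
  have N0: "0 < n * n" using n_pos by simp
  have v0: "v 0 \<noteq> 0"
  proof
    assume z: "v 0 = 0"
    have "(\<Sum>i<n * n. fscale (if i = 0 then 1 else 0) (v i)) = 0"
      by (intro sum.neutral) (auto simp: z fun_vs.scale_zero_left)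
    then have "(if (0::nat) = 0 then 1 else 0) = (0 :: 'f alg_closure)"
      by (rule fv.indep_famD[OF v_ind]) (use N0 in simp)
    then show False by simp
  qed
  have "\<exists>k<n * n. co (mt (v 0)) k \<noteq> 0"
  proof (rule ccontr)
    assume "\<not> ?thesis"
    then have "(\<Sum>i<n * n. fscale (co (mt (v 0)) i) (v i)) = 0" by (intro sum.neutral) (auto simp: fun_vs.scale_zero_left)
    then have "mt (v 0) = 0" using co[of "mt (v 0)"] N0 by simp
    then have "mt (mt (v 0)) = 0" by simp
    then show False using v0 by simp
  qed
  then obtain k where k: "k < n * n" "co (mt (v 0)) k \<noteq> 0" by blast
  \<comment> \<open>This functional does not kill the transpose of \<open>v 0\<close>, which will
    make the scalar nonzero.\<close>
  obtain \<psi> :: "'f alg_closure \<Rightarrow> 'f" where \<psi>: "F_linear \<psi>" "\<psi> (co (mt (v 0)) k) = 1"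
    using ex_F_linear[OF k(2)] by blast
  define T' where "T' M = mt (Psi \<psi> (mt M))" for M
  \<comment> \<open>\<open>T'\<close> is linear only over the base field; \<open>TK\<close> is the
    map that is linear over the closure and agrees with it on \<open>v\<close>.\<close>
  define TK where "TK M = (\<Sum>i<n * n. fscale (co M i) (T' (v i)))" for M
  have T'_in: "T' M \<in> mats n" for M by (simp add: T'_def)
  have TK_in: "TK M \<in> mats n" for M unfolding TK_def
    by (auto intro!: fun_vs.subspace_sum[OF subspace_mats] fun_vs.subspace_scale[OF subspace_mats] T'_in)
  have TK_add: "TK (M + M') = TK M + TK M'" if "M \<in> mats n" "M' \<in> mats n" for M M'
    unfolding TK_def sum.distrib[symmetric] using that
    by (intro sum.cong refl) (simp add: co_add fun_vs.scale_left_distrib)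
  have TK_sc: "TK (fscale c M) = fscale c (TK M)" if "M \<in> mats n" for c M
    unfolding TK_def fun_vs.scale_sum_right using that by (intro sum.cong refl) (simp add: co_fscale)
  have TK0: "TK 0 = 0"
    using TK_sc[OF fun_vs.subspace_0[OF subspace_mats], of 0] by (simp only: fun_vs.scale_zero_left)
  have T'_act: "T' (mm n (mm n (\<iota> x) M) (mt (\<iota> y))) = mm n (mm n (\<iota> x) (T' M)) (mt (\<iota> y))"
    if "M \<in> mats n" for x y M
  proof -
    have "mt (mm n (mm n (\<iota> x) M) (mt (\<iota> y))) = mm n (mm n (\<iota> y) (mt M)) (mt (\<iota> x))"
      by (simp add: mt_mm mm_assoc)
    then show ?thesis using Psi_act[OF \<psi>(1), of "mt M" y x] that
      by (simp add: T'_def mt_mm mm_assoc)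
  qed
  have T'_comb: "T' (\<Sum>j<n * n. fscale (to_ac (c j)) (v j)) = (\<Sum>j<n * n. fscale (to_ac (c j)) (T' (v j)))" for c
    unfolding T'_def mt_sum mt_fscale by (subst Psi_Fcomb[OF \<psi>(1)]) (simp_all add: mt_sum mt_fscale)
  have TK_act: "TK (mm n (mm n (\<iota> x) M) (mt (\<iota> y))) = mm n (mm n (\<iota> x) (TK M)) (mt (\<iota> y))"
    if M: "M \<in> mats n" for x y M
  proof -
    define R where "R M = mm n (mm n (\<iota> x) M) (mt (\<iota> y))" for M
    have R: "fv.lin_on (mats n) R" unfolding R_def by (rule lin_on_sandwich) simp_all
    obtain r where r: "\<And>i. i < n * n \<Longrightarrow> R (v i) = (\<Sum>j<n * n. fscale (to_ac (r i j)) (v j))"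
      using operator_matrix[of R] Vf_act v_Vf unfolding R_def by blast
    have "R M = (\<Sum>j<n * n. fscale (\<Sum>i<n * n. co M i * to_ac (r i j)) (v j))"
      using operator_coords[OF R r, of "co M"] co[OF M] by simp
    then have c: "co (R M) j = (\<Sum>i<n * n. co M i * to_ac (r i j))" if "j < n * n" for j
      by (rule co_eqI) (rule that)
    have "TK (R M) = (\<Sum>j<n * n. \<Sum>i<n * n. fscale (co M i * to_ac (r i j)) (T' (v j)))"
      unfolding TK_def by (intro sum.cong refl) (simp add: c fun_vs.scale_sum_left)
    also have "\<dots> = (\<Sum>i<n * n. \<Sum>j<n * n. fscale (co M i * to_ac (r i j)) (T' (v j)))" by (rule sum.swap)
    also have "\<dots> = (\<Sum>i<n * n. fscale (co M i) (R (T' (v i))))"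
    proof (intro sum.cong refl)
      fix i assume "i \<in> {..<n * n}"
      then have i: "i < n * n" by simp
      have "R (T' (v i)) = T' (R (v i))" unfolding R_def using T'_act[OF v_mats[OF i]] by simp
      also have "\<dots> = (\<Sum>j<n * n. fscale (to_ac (r i j)) (T' (v j)))" unfolding r[OF i] by (rule T'_comb)
      finally show "(\<Sum>j<n * n. fscale (co M i * to_ac (r i j)) (T' (v j))) = fscale (co M i) (R (T' (v i)))"
        by (simp add: fun_vs.scale_sum_right)
    qed
    also have "\<dots> = R (TK M)" unfolding TK_def by (rule fv.lin_on_sum[OF R, symmetric]) (simp_all add: T'_in)
    finally show ?thesis unfolding R_def .
  qed
  have TK_mm: "TK (mm n (mm n A M) (mt B)) = mm n (mm n A (TK M)) (mt B)"
    if A: "A \<in> mats n" and B: "B \<in> mats n" and M: "M \<in> mats n" for A B M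
    using A
  proof (induction A rule: mats_induct)
    case zero
    show ?case by (simp add: TK0)
  next
    case (step c x A)
    have s1: "TK (mm n (mm n (\<iota> x) M) (mt B)) = mm n (mm n (\<iota> x) (TK M)) (mt B)"
      using B
    proof (induction B rule: mats_induct)
      case zero
      show ?case by (simp add: TK0)
    next
      case (step d y B)
      then show ?case using M TK_act[OF M, of x y]
        by (simp add: mt_add mt_fscale mm_add_right mm_fscale_right TK_add TK_sc fun_vs.subspace_scale[OF subspace_mats])
    qed
    then show ?case using step M B
      by (simp add: mm_add_left mm_fscale_left TK_add TK_sc fun_vs.subspace_scale[OF subspace_mats])
  qed
  define C where "C = TK (idm n)"
  have Cl: "TK M = mm n M C" if "M \<in> mats n" for M
    using TK_mm[OF that idm_in idm_in] that TK_in by (simp add: C_def mm_idr)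
  have Cr: "TK M = mm n C M" if "M \<in> mats n" for M
    using TK_mm[of "idm n" "mt M" "idm n"] that TK_in by (simp add: C_def mm_idl)
  have "C = fscale (C (0, 0)) (idm n)"
  proof (rule central_matrix[OF n_pos])
    show "C \<in> mats n" unfolding C_def by (rule TK_in)
    show "mm n M C = mm n C M" if "M \<in> mats n" for M
      by (rule trans[OF Cl[OF that, symmetric] Cr[OF that]])
  qed
  then obtain c where c: "C = fscale c (idm n)" by blast
  have TKc: "TK M = fscale c M" if "M \<in> mats n" for M
    using Cr[OF that] that by (simp add: c mm_fscale_left mm_idl)
  have eq: "Psi \<psi> (mt (v i)) = fscale c (mt (v i))" if i: "i < n * n" for i
  proof -
    have co_v: "co (v i) j = (if j = i then 1 else 0)" if "j < n * n" for j
    proof (rule co_eqI[OF _ that])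
      have "(\<Sum>j<n * n. fscale (if j = i then 1 else 0) (v j)) = (\<Sum>j<n * n. if j = i then v i else 0)"
        by (intro sum.cong refl) (auto simp: fun_vs.scale_zero_left)
      then show "v i = (\<Sum>j<n * n. fscale (if j = i then 1 else 0) (v j))" using i by simp
    qed
    have "TK (v i) = (\<Sum>j<n * n. if j = i then T' (v i) else 0)"
      unfolding TK_def by (intro sum.cong refl) (auto simp: co_v fun_vs.scale_zero_left)
    then have "T' (v i) = fscale c (v i)" using i TKc[OF v_mats[OF i]] by simp
    then have "mt (T' (v i)) = fscale c (mt (v i))" by (simp add: mt_fscale)
    then show ?thesis by (simp add: T'_def)
  qed
  have "c \<noteq> 0"
  proof
    assume "c = 0"
    then have "Psi \<psi> (mt (v 0)) = 0" using eq[OF N0] by (simp add: fun_vs.scale_zero_left)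
    then have "to_ac (\<psi> (co (mt (v 0)) k)) = 0"
      unfolding Psi_def by (rule fv.indep_famD[OF v_ind]) (use k in simp)
    then show False using \<psi>(2) by simp
  qed
  moreover have "fscale c (mt (v i)) \<in> Vf" if "i < n * n" for i
    using Psi_Vf[of \<psi> "mt (v i)"] eq[OF that] by simp
  ultimately show ?thesis by blast
qed

text \<open>An alternating matrix is determined by its entries below the diagonal, of which there
  are fewer than half of \<open>n * n\<close>.\<close>

lemma alternating_family_card:
  fixes a :: "'i \<Rightarrow> 'f alg_closure mtx"
  assumes J: "finite J" and al: "\<And>i. i \<in> J \<Longrightarrow> a i \<in> mats n \<and> mt (a i) = - a i" and ind: "fv.indep_fam J a"
  shows "2 * card J < n * n"
proof -
  define P where "P = {(i, j). j < i \<and> i < n}"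
  have fP: "finite P" by (rule finite_subset[of _ "{..<n} \<times> {..<n}"]) (auto simp: P_def)
  define low where "low M = (\<lambda>p. if p \<in> P then M p else 0)" for M :: "'f alg_closure mtx"
  have "fv.indep_fam J (\<lambda>i. low (a i))"
    unfolding fv.indep_fam_def
  proof (intro allI impI ballI)
    fix c i assume c: "(\<Sum>i\<in>J. fscale (c i) (low (a i))) = 0" and i: "i \<in> J"
    have "(\<Sum>i\<in>J. fscale (c i) (a i)) = 0"
    proof (rule mtx_eqI)
      fix s t
      have z: "(\<Sum>i\<in>J. c i * a i (s, t)) = 0" if "(s, t) \<in> P" for s t
        using fun_cong[OF c, of "(s, t)"] that by (simp add: sum_fun_apply fun_app low_def)
      have anti: "a i (s, t) = - a i (t, s)" if "i \<in> J" for i s t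
      proof -
        have "mt (a i) (t, s) = (- a i) (t, s)" using al[OF that] by simp
        then show ?thesis by (simp add: fun_app)
      qed
      have swap: "(\<Sum>i\<in>J. c i * a i (s, t)) = - (\<Sum>i\<in>J. c i * a i (t, s))" for s t
        unfolding sum_negf[symmetric] by (intro sum.cong refl) (use anti in \<open>metis mult_minus_right\<close>)
      have "(\<Sum>i\<in>J. c i * a i (s, t)) = 0"
      proof (cases "s < n \<and> t < n")
        case False
        then have "a i (s, t) = 0" if "i \<in> J" for i using al[OF that] matsD by blast
        then show ?thesis by simp
      next
        case True
        consider "t < s" | "s < t" | "s = t" by linarith
        then show ?thesis
        proof cases
          case 1 then show ?thesis using z True by (simp add: P_def)
        next
          case 2 then show ?thesis using z[of t s] swap[of s t] True by (simp add: P_def)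
        next
          case 3
          have "2 * (\<Sum>i\<in>J. c i * a i (s, s)) = 0" using swap[of s s] by (metis add.right_inverse mult_2)
          then show ?thesis using two_ac 3 by simp
        qed
      qed
      then show "(\<Sum>i\<in>J. fscale (c i) (a i)) (s, t) = 0 (s, t)" by (simp add: sum_fun_apply fun_app)
    qed
    then show "c i = 0" by (rule fv.indep_famD[OF ind]) (rule i)
  qed
  then have "card J \<le> card P"
    by (intro indep_coord[OF fP J]) (auto simp: low_def coord_space_def)
  moreover have "2 * card P < n * n"
  proof -
    have "card (prod.swap ` P) = card P" by (rule card_image, rule inj_onI) (metis swap_swap)
    then have "2 * card P = card (P \<union> prod.swap ` P)"
      using fP by (subst card_Un_disjoint) (auto simp: P_def)
    also have "\<dots> < card ({..<n} \<times> {..<n})"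
    proof (rule psubset_card_mono)
      have "(0, 0) \<in> {..<n} \<times> {..<n}" using n_pos by simp
      moreover have "(0, 0) \<notin> P \<union> prod.swap ` P" by (auto simp: P_def)
      moreover have "P \<subseteq> {..<n} \<times> {..<n}" "prod.swap ` P \<subseteq> {..<n} \<times> {..<n}" by (auto simp: P_def)
      ultimately show "P \<union> prod.swap ` P \<subset> {..<n} \<times> {..<n}" by blast
    qed simp
    finally show ?thesis by simp
  qed
  ultimately show ?thesis by simp
qed

text \<open>If the scalar were irrational, the rational form would be a vector space over a quadratic
  extension on which transposition acts by conjugation, and its symmetric and alternating parts
  would have equal dimensions.\<close>

lemma transpose_scalar_rational:
  assumes c: "\<And>i. i < n * n \<Longrightarrow> fscale c (mt (v i)) \<in> Vf"
  shows "c \<in> range to_ac"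
proof (rule ccontr)
  assume irr: "c \<notin> range to_ac"
  obtain G where G: "\<And>i. i < n * n \<Longrightarrow> fscale c (mt (v i)) = (\<Sum>j<n * n. fscale (to_ac (G i j)) (v j))"
    using operator_matrix[of "\<lambda>M. fscale c (mt M)"] c by blast
  define a where "a i = v i - mt (v i)" for i
  obtain J where J: "J \<subseteq> {..<n * n}" "fv.indep_fam J a" "a ` {..<n * n} \<subseteq> fun_vs.span (a ` J)"
    using fv.max_indep_subfam[of "{..<n * n}" a] by auto
  have fJ: "finite J" using J(1) finite_subset by blast
  define gv where "gv i = (\<lambda>j. if j < n * n then G i j else 0)" for i
  have gv_exp: "gv i = (\<Sum>j<n * n. fscale (G i j) (dlt j))" for i
    by (rule ext) (auto simp: gv_def sum_fun_apply fun_app dlt_def if_distrib[of "\<lambda>u. _ * u"] cong: if_cong)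
  \<comment> \<open>It will be shown that \<open>U\<close> spans all coordinate vectors of length
    \<open>n * n\<close>. Then \<open>n * n\<close> is at most \<open>2 * card J\<close>, whereas
    \<open>J\<close> indexes independent alternating matrices.\<close>
  define U where "U = dlt ` J \<union> gv ` J"
  have "dlt l \<in> fun_vs.span U" if l: "l < n * n" for l
  proof (rule ccontr)
    assume "dlt l \<notin> fun_vs.span U"
    \<comment> \<open>A functional \<open>lam\<close> vanishing on \<open>U\<close> is applied to
      the coordinates in the relation that expresses \<open>c\<close> times \<open>a l\<close> by
      the members in \<open>J\<close>. All terms of \<open>J\<close> disappear, and
      \<open>c = lam (gv l)\<close> remains, which is rational.\<close>
    then obtain lam :: "(nat \<Rightarrow> 'f) \<Rightarrow> 'f" where lam: "\<And>x y. lam (x + y) = lam x + lam y" "\<And>c x. lam (fscale c x) = c * lam x"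
      "lam (dlt l) = 1" "\<And>z. z \<in> fun_vs.span U \<Longrightarrow> lam z = 0"
      using fv.ex_functional[of "dlt l" U] by blast
    have lam0: "lam 0 = 0" using lam(4)[OF fun_vs.span_zero] .
    have lamsum: "lam (\<Sum>j<k. fscale (f j) (dlt j)) = (\<Sum>j<k. f j * lam (dlt j))" for f k
      by (induction k) (simp_all add: lam0 lam)
    have lamgv: "lam (gv i) = (\<Sum>j<n * n. G i j * lam (dlt j))" for i unfolding gv_exp by (rule lamsum)
    have lamJ: "lam (dlt i) = 0" "lam (gv i) = 0" if "i \<in> J" for i
      using that by (auto intro!: lam(4) fun_vs.span_base simp: U_def)
    have "a l \<in> fun_vs.span (a ` J)" using J(3) l by auto
    then obtain k where k: "a l = (\<Sum>i\<in>J. fscale (k i) (a i))" using fv.span_family[OF fJ] by auto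
    define w where "w i j = (if j = i then c else 0) - to_ac (G i j)" for i j
    have wexp: "fscale c (a i) = (\<Sum>j<n * n. fscale (w i j) (v j))" if "i < n * n" for i
    proof -
      have "(\<Sum>j<n * n. fscale (if j = i then c else 0) (v j)) = (\<Sum>j<n * n. if j = i then fscale c (v i) else 0)"
        by (intro sum.cong refl) (auto simp: fun_vs.scale_zero_left)
      then have "(\<Sum>j<n * n. fscale (w i j) (v j)) = fscale c (v i) - fscale c (mt (v i))"
        using that by (simp add: w_def fun_vs.scale_left_diff_distrib sum_subtractf G)
      then show ?thesis by (simp add: a_def fun_vs.scale_right_diff_distrib)
    qed
    have "(\<Sum>j<n * n. fscale (w l j) (v j)) = fscale c (a l)" using wexp[OF l] by simp
    also have "\<dots> = (\<Sum>i\<in>J. fscale (k i) (fscale c (a i)))"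
      unfolding k fun_vs.scale_sum_right fun_vs.scale_scale by (simp add: mult.commute)
    also have "\<dots> = (\<Sum>i\<in>J. \<Sum>j<n * n. fscale (k i * w i j) (v j))"
    proof (intro sum.cong refl)
      fix i assume "i \<in> J"
      then have "i < n * n" using J(1) by auto
      from wexp[OF this] show "fscale (k i) (fscale c (a i)) = (\<Sum>j<n * n. fscale (k i * w i j) (v j))"
        by (simp add: fun_vs.scale_sum_right)
    qed
    also have "\<dots> = (\<Sum>j<n * n. \<Sum>i\<in>J. fscale (k i * w i j) (v j))" by (rule sum.swap)
    also have "\<dots> = (\<Sum>j<n * n. fscale (\<Sum>i\<in>J. k i * w i j) (v j))" by (simp add: fun_vs.scale_sum_left)
    finally have eqs: "(\<Sum>j<n * n. fscale (w l j) (v j)) = (\<Sum>j<n * n. fscale (\<Sum>i\<in>J. k i * w i j) (v j))" .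
    have eq: "w l j = (\<Sum>i\<in>J. k i * w i j)" if "j < n * n" for j
      by (rule fv.indep_fam_eqD[OF v_ind eqs]) (use that in simp)
    have wsum: "(\<Sum>j<n * n. w i j * to_ac (lam (dlt j))) = c * to_ac (lam (dlt i)) - to_ac (lam (gv i))" if "i < n * n" for i
    proof -
      have "(\<Sum>j<n * n. w i j * to_ac (lam (dlt j)))
        = (\<Sum>j<n * n. (if j = i then c * to_ac (lam (dlt i)) else 0) - to_ac (G i j * lam (dlt j)))"
        by (intro sum.cong refl) (auto simp: w_def algebra_simps)
      then show ?thesis using that by (simp add: sum_subtractf lamgv to_ac_sum)
    qed
    have "(\<Sum>j<n * n. w l j * to_ac (lam (dlt j))) = (\<Sum>j<n * n. \<Sum>i\<in>J. k i * (w i j * to_ac (lam (dlt j))))"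
      by (intro sum.cong refl) (simp add: eq sum_distrib_right mult.assoc)
    also have "\<dots> = (\<Sum>i\<in>J. k i * (\<Sum>j<n * n. w i j * to_ac (lam (dlt j))))"
      by (subst sum.swap) (simp add: sum_distrib_left)
    also have "\<dots> = 0"
    proof (intro sum.neutral ballI)
      fix i assume i: "i \<in> J"
      then have "i < n * n" using J(1) by auto
      then show "k i * (\<Sum>j<n * n. w i j * to_ac (lam (dlt j))) = 0" using lamJ[OF i] by (simp add: wsum)
    qed
    finally have "c = to_ac (lam (gv l))" using wsum[OF l] lam(3) by simp
    then show False using irr by blast
  qed
  then have "card {..<n * n} \<le> card U"
    using fJ by (intro fv.indep_fam_card_le[OF _ indep_dlt]) (auto simp: U_def)
  also have "\<dots> \<le> card (dlt ` J :: (nat \<Rightarrow> 'f) set) + card (gv ` J)" unfolding U_def by (rule card_Un_le)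
  also have "\<dots> \<le> card J + card J" using fJ by (intro add_mono card_image_le)
  finally have "n * n \<le> 2 * card J" by simp
  moreover have "2 * card J < n * n"
  proof (rule alternating_family_card[OF fJ _ J(2)])
    fix i assume "i \<in> J"
    then have "v i \<in> mats n" using J(1) by auto
    then show "a i \<in> mats n \<and> mt (a i) = - a i"
      by (simp add: a_def mt_diff fun_vs.subspace_diff[OF subspace_mats])
  qed
  ultimately show False by simp
qed

lemma Vf_mt:
  assumes "M \<in> Vf"
  shows "mt M \<in> Vf"
proof -
  obtain c where c: "c \<noteq> 0" "\<And>i. i < n * n \<Longrightarrow> fscale c (mt (v i)) \<in> Vf" using transpose_scaled by blast
  obtain d where d: "c = to_ac d" using transpose_scalar_rational[OF c(2)] by blast
  have "mt (v i) \<in> Vf" if "i < n * n" for i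
    using Vf_scale[OF c(2)[OF that], of "inverse d"] c(1) by (simp add: d)
  then show ?thesis using assms unfolding Vf_iff[of M]
    by (auto simp: mt_sum mt_fscale intro!: Vf_sum Vf_scale)
qed

definition alt_Vf :: "'f alg_closure mtx set" where "alt_Vf = {w \<in> Vf. mt w = - w}"

lemma alt_Vf_comb:
  assumes "\<And>i. i \<in> I \<Longrightarrow> w i \<in> alt_Vf"
  shows "(\<Sum>i\<in>I. fscale (to_ac (c i)) (w i)) \<in> alt_Vf"
proof -
  have "mt (\<Sum>i\<in>I. fscale (to_ac (c i)) (w i)) = (\<Sum>i\<in>I. - fscale (to_ac (c i)) (w i))"
    unfolding mt_sum mt_fscale using assms by (intro sum.cong refl) (simp add: alt_Vf_def)
  then show ?thesis using assms by (auto simp: alt_Vf_def sum_negf intro!: Vf_sum Vf_scale)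
qed

text \<open>Half of \<open>M - M^T\<close>, expanded along \<open>v\<close>. The alternating parts
  of the \<open>v i\<close> belong to the form by its stability under transposition.\<close>

lemma alternating_span:
  assumes "M \<in> mats n" "mt M = - M"
  shows "M = (\<Sum>i<n * n. fscale (co M i / 2) (v i - mt (v i)))"
proof -
  have "M + M = (\<Sum>i<n * n. fscale (co M i) (v i)) - mt (\<Sum>i<n * n. fscale (co M i) (v i))"
    using co[OF assms(1)] assms(2) by simp
  then have e: "M + M = (\<Sum>i<n * n. fscale (co M i) (v i - mt (v i)))"
    by (simp add: mt_sum mt_fscale fun_vs.scale_right_diff_distrib sum_subtractf)
  have "M = fscale (1 / 2) (M + M)" using two_ac by (intro ext) (simp add: fun_app)
  also have "\<dots> = (\<Sum>i<n * n. fscale (co M i / 2) (v i - mt (v i)))"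
    unfolding e fun_vs.scale_sum_right by simp
  finally show ?thesis .
qed

lemma v_alt: "i < n * n \<Longrightarrow> v i - mt (v i) \<in> alt_Vf"
  by (simp add: alt_Vf_def Vf_diff Vf_mt v_Vf mt_diff)

text \<open>Invertibility is an open condition on the coefficients, satisfied at \<open>u0\<close>;
  so it is satisfied at a rational point, the base field being infinite.\<close>

lemma ex_rational_invertible:
  assumes I: "finite I" and w: "\<And>i. i \<in> I \<Longrightarrow> w i \<in> mats n"
    and N: "mm n N (\<Sum>i\<in>I. fscale (u0 i) (w i)) = idm n"
  shows "\<exists>c :: _ \<Rightarrow> 'f. \<exists>N\<in>mats n. mm n N (\<Sum>i\<in>I. fscale (to_ac (c i)) (w i)) = idm n"
proof -
  define M where "M u = (\<Sum>i\<in>I. fscale (u i) (w i))" for u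
  have Min: "M u \<in> mats n" for u unfolding M_def
    using w by (auto intro!: fun_vs.subspace_sum[OF subspace_mats] fun_vs.subspace_scale[OF subspace_mats])
  let ?G = "{\<lambda>u. u i | i. i \<in> I} :: (('b \<Rightarrow> 'f alg_closure) \<Rightarrow> 'f alg_closure) set"
  have entry: "pfn UNIV ?G (\<lambda>u. M u (s, t))" for s t
    unfolding M_def sum_fun_apply fun_app
    by (intro Kc.pfn_sum pfn.mult pfn.gen pfn.const) auto
  \<comment> \<open>The entries of the \<open>w i\<close> lie in the closure, so the equation of the
    open set does as well. Density asks only for infinitely many values of each coefficient, not for
    an equation over the base field.\<close>
  have "Kc.ev ?G u0 (\<lambda>u. \<exists>N\<in>mats n. mm n N (M u) = idm n)"
    by (rule Kc.ev_left_inverse[OF _ Min]) (auto intro!: Kc.rat_pfn entry N[folded M_def])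
  then obtain q where q: "pfn UNIV ?G q" "q u0 \<noteq> 0" "\<And>u. q u \<noteq> 0 \<Longrightarrow> \<exists>N\<in>mats n. mm n N (M u) = idm n"
    unfolding Kc.ev_def by blast
  have "infinite (range (to_ac :: 'f \<Rightarrow> _))" using inf by (simp add: finite_image_iff inj_to_ac)
  from ex_rational_nonzero[OF q(1,2) I this]
  obtain u where u: "\<forall>i\<in>I. u i \<in> range (to_ac :: 'f \<Rightarrow> _)" "q u \<noteq> 0" by blast
  have "M u = (\<Sum>i\<in>I. fscale (to_ac (of_ac (u i))) (w i))"
    unfolding M_def using u(1) by (intro sum.cong refl) (simp add: to_ac_of_ac)
  then show ?thesis using q(3)[OF u(2)] by (intro exI[of _ "\<lambda>i. of_ac (u i)"]) simp
qed

lemma ex_rational_alternating: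
  fixes B :: "'f alg_closure mtx"
  assumes B: "B \<in> mats n" "mt B = - B" "mm n B' B = idm n"
  shows "\<exists>J\<in>alt_Vf. \<exists>J'\<in>mats n. mm n J' J = idm n"
proof -
  have m: "v i - mt (v i) \<in> mats n" if "i \<in> {..<n * n}" for i
    using that by (simp add: fun_vs.subspace_diff[OF subspace_mats])
  have "mm n B' (\<Sum>i<n * n. fscale (co B i / 2) (v i - mt (v i))) = idm n"
    using B(3) alternating_span[OF B(1,2)] by simp
  from ex_rational_invertible[OF _ m this] obtain c :: "nat \<Rightarrow> 'f" and N where
    "N \<in> mats n" "mm n N (\<Sum>i<n * n. fscale (to_ac (c i)) (v i - mt (v i))) = idm n" by auto
  moreover have "(\<Sum>i<n * n. fscale (to_ac (c i)) (v i - mt (v i))) \<in> alt_Vf"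
    by (rule alt_Vf_comb) (simp add: v_alt)
  ultimately show ?thesis by blast
qed

end

section \<open>The symplectic involution defined by an alternating matrix of the form\<close>

locale symplectic_form = bimodule_form scale Basis n \<eta> v
  for scale :: "'f::field \<Rightarrow> 'a::ring_1 \<Rightarrow> 'a" and Basis :: "'a set" and n :: nat
    and \<eta> :: "('a \<Rightarrow> 'f alg_closure) \<Rightarrow> 'f alg_closure mtx" and v :: "nat \<Rightarrow> 'f alg_closure mtx" +
  fixes J J' :: "'f alg_closure mtx"
  assumes J_alt: "J \<in> alt_Vf" and J'_in [simp]: "J' \<in> mats n" and J'J: "mm n J' J = idm n"
begin

lemma J_in [simp]: "J \<in> mats n" using J_alt by (simp add: alt_Vf_def Vf_mats)

lemma JJ': "mm n J J' = idm n" by (rule left_inverse_right[OF J'_in J_in J'J])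

lemma mt_J: "mt J = - J" using J_alt by (simp add: alt_Vf_def)

lemma mt_J': "mt J' = - J'"
proof -
  have "mm n (mt J') (mt J) = idm n" using arg_cong[OF JJ', of mt] by (simp add: mt_mm)
  then have "mm n (- mt J') J = idm n" by (simp add: mt_J mm_uminus_left mm_uminus_right)
  then have "mm n (mm n (- mt J') J) J' = J'" by (simp add: mm_idl)
  moreover have "- mt J' \<in> mats n" by (rule fun_vs.subspace_neg[OF subspace_mats]) simp
  ultimately have "- mt J' = J'" by (simp only: mm_assoc JJ' mm_idr)
  then show ?thesis by (metis minus_minus)
qed

text \<open>The matrices fixed by the involution \<open>M \<mapsto> J M^T J'\<close>. The condition
  is put on \<open>M J\<close> because alternating matrices are what the form provides.\<close>

definition symmetric_mat :: "'f alg_closure mtx \<Rightarrow> bool" where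
  "symmetric_mat M \<longleftrightarrow> M \<in> mats n \<and> mt (mm n M J) = - mm n M J"

definition S :: "'a set" where "S = {a. symmetric_mat (\<iota> a)}"

text \<open>Multiplication by the invertible \<open>J\<close> maps the algebra injectively into the
  form, and both have dimension \<open>n * n\<close> over the base field.\<close>

lemma Vf_generated: "w \<in> Vf \<Longrightarrow> \<exists>a. w = mm n (\<iota> a) J"
proof -
  assume w: "w \<in> Vf"
  have "\<exists>g. mm n (\<iota> b) J = (\<Sum>j<n * n. fscale (to_ac (g j)) (v j))" for b
  proof -
    have "mm n (\<iota> b) J = mm n (mm n (\<iota> b) J) (mt (\<iota> 1))" by (simp add: \<iota>_1 mm_idr)
    also have "\<dots> \<in> Vf" using J_alt by (intro Vf_act) (simp add: alt_Vf_def)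
    finally show ?thesis unfolding Vf_iff .
  qed
  then obtain g where g: "\<And>b. mm n (\<iota> b) J = (\<Sum>j<n * n. fscale (to_ac (g b j)) (v j))" by metis
  define gg where "gg b = (\<lambda>j. if j < n * n then g b j else 0)" for b
  have comb: "mm n (\<iota> (\<Sum>b\<in>Basis. scale (c b) b)) J = (\<Sum>j<n * n. fscale (to_ac ((\<Sum>b\<in>Basis. fscale (c b) (gg b)) j)) (v j))" for c
  proof -
    have "mm n (\<iota> (\<Sum>b\<in>Basis. scale (c b) b)) J = (\<Sum>b\<in>Basis. \<Sum>j<n * n. fscale (to_ac (c b * g b j)) (v j))"
      unfolding \<iota>_sum mm_sum_left mm_fscale_left g fun_vs.scale_sum_right by simp
    also have "\<dots> = (\<Sum>j<n * n. \<Sum>b\<in>Basis. fscale (to_ac (c b * g b j)) (v j))" by (rule sum.swap)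
    also have "\<dots> = (\<Sum>j<n * n. fscale (to_ac ((\<Sum>b\<in>Basis. fscale (c b) (gg b)) j)) (v j))"
      by (intro sum.cong refl)
        (simp add: fun_vs.scale_sum_left[symmetric] to_ac_sum[symmetric] sum_fun_apply fun_app gg_def del: to_ac_mult)
    finally show ?thesis .
  qed
  have "fv.indep_fam Basis gg"
    unfolding fv.indep_fam_def
  proof (intro allI impI ballI)
    fix c b assume c: "(\<Sum>b\<in>Basis. fscale (c b) (gg b)) = 0" and b: "b \<in> Basis"
    have "mm n (\<iota> (\<Sum>b\<in>Basis. scale (c b) b)) J = 0"
      unfolding comb c by (intro sum.neutral) (simp add: fun_app fun_vs.scale_zero_left)
    then have "mm n (mm n (\<iota> (\<Sum>b\<in>Basis. scale (c b) b)) J) J' = 0" by simp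
    then have "\<iota> (\<Sum>b\<in>Basis. scale (c b) b) = \<iota> 0" by (simp add: mm_assoc JJ' mm_idr \<iota>_0)
    then have "(\<Sum>b\<in>Basis. scale (c b) b) = 0" by (rule \<iota>_inj)
    then show "c b = 0" using rp_combination[OF b, of c] rp_scale[of 0 0 b] by simp
  qed
  moreover have sub: "gg ` Basis \<subseteq> coord_space {..<n * n}" by (auto simp: gg_def coord_space_def)
  moreover have sp: "coord_space {..<n * n} \<subseteq> fun_vs.span (dlt ` {..<n * n} :: (nat \<Rightarrow> 'f) set)" by (rule coord_span) simp
  moreover have "card (dlt ` {..<n * n} :: (nat \<Rightarrow> 'f) set) \<le> card Basis"
    using card_image_le[of "{..<n * n}" "dlt :: nat \<Rightarrow> nat \<Rightarrow> 'f"] card_Basis by simp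
  ultimately have eq: "fun_vs.span (gg ` Basis) = fun_vs.span (dlt ` {..<n * n})"
    by (intro fv.indep_fam_spans[OF finite_Basis]) auto
  obtain d where d: "w = (\<Sum>j<n * n. fscale (to_ac (d j)) (v j))" using w unfolding Vf_iff by blast
  define dd where "dd = (\<lambda>j. if j < n * n then d j else 0)"
  have "dd \<in> coord_space {..<n * n}" by (auto simp: dd_def coord_space_def)
  then have "dd \<in> fun_vs.span (gg ` Basis)" using eq sp by blast
  then obtain c where c: "dd = (\<Sum>b\<in>Basis. fscale (c b) (gg b))" using fv.span_family[OF finite_Basis] by auto
  have "w = (\<Sum>j<n * n. fscale (to_ac (dd j)) (v j))" unfolding d by (intro sum.cong refl) (simp add: dd_def)
  also have "\<dots> = mm n (\<iota> (\<Sum>b\<in>Basis. scale (c b) b)) J" unfolding comb c ..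
  finally show ?thesis by blast
qed

lemma alt_Vf_S: "w \<in> alt_Vf \<Longrightarrow> \<exists>a\<in>S. w = mm n (\<iota> a) J"
  using Vf_generated[of w] by (auto simp: alt_Vf_def S_def symmetric_mat_def)

text \<open>Here \<open>M\<close> is defined only over the closure. Its components
  \<open>Psi (\<psi> \<beta>) M\<close> lie in the form. Since \<open>Psi\<close> commutes with
  transposition and with left multiplication by \<open>x\<close>, each component is alternating and
  stays so after multiplication by \<open>x\<close>. A rational combination of the components is
  invertible, and it has the shape \<open>a J\<close>.\<close>

lemma ex_symmetric_invertible:
  assumes M: "M \<in> mats n" "mt M = - M" "mt (mm n (\<iota> x) M) = - mm n (\<iota> x) M" "mm n N M = idm n"
  shows "\<exists>a\<in>S. x * a \<in> S \<and> (\<exists>N\<in>mats n. mm n N (\<iota> a) = idm n)"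
proof -
  obtain B :: "'f alg_closure set" and \<psi> where B: "finite B" and \<psi>: "\<And>\<beta>. F_linear (\<psi> \<beta> :: 'f alg_closure \<Rightarrow> 'f)"
    and dec: "\<And>k. k \<in> co M ` {..<n * n} \<Longrightarrow> k = (\<Sum>\<beta>\<in>B. \<beta> * to_ac (\<psi> \<beta> k))"
    using F_linear_decomposition[of "co M ` {..<n * n}"] by auto
  have "M = (\<Sum>i<n * n. fscale (co M i) (v i))" by (rule co[OF M(1)])
  also have "\<dots> = (\<Sum>i<n * n. \<Sum>\<beta>\<in>B. fscale (\<beta> * to_ac (\<psi> \<beta> (co M i))) (v i))"
    unfolding fun_vs.scale_sum_left[symmetric] using dec by (intro sum.cong refl arg_cong2[of _ _ _ _ fscale]) auto
  also have "\<dots> = (\<Sum>\<beta>\<in>B. fscale \<beta> (Psi (\<psi> \<beta>) M))"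
    unfolding Psi_def fun_vs.scale_sum_right fun_vs.scale_scale by (rule sum.swap)
  finally have M': "M = (\<Sum>\<beta>\<in>B. fscale \<beta> (Psi (\<psi> \<beta>) M))" .
  have alt: "Psi (\<psi> \<beta>) M \<in> alt_Vf" for \<beta>
  proof -
    have "mt (Psi (\<psi> \<beta>) M) = Psi (\<psi> \<beta>) (mt M)"
      by (rule Psi_comm[OF \<psi> lin_on_mt _ M(1), symmetric]) (simp add: Vf_mt v_Vf)
    also have "\<dots> = Psi (\<psi> \<beta>) (\<Sum>j\<in>{0::nat}. fscale (to_ac (-1)) M)" using M(2) by simp
    also have "\<dots> = - Psi (\<psi> \<beta>) M" by (subst Psi_Fcomb[OF \<psi>]) (simp_all add: M(1))
    finally show ?thesis by (simp add: alt_Vf_def Psi_Vf)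
  qed
  have xP: "Psi (\<psi> \<beta>) (mm n (\<iota> x) K) = mm n (\<iota> x) (Psi (\<psi> \<beta>) K)" if "K \<in> mats n" for \<beta> K
    using Psi_act[OF \<psi> that, of \<beta> x 1] that by (simp add: \<iota>_1 mm_idr)
  have xalt: "mt (mm n (\<iota> x) (Psi (\<psi> \<beta>) M)) = - mm n (\<iota> x) (Psi (\<psi> \<beta>) M)" for \<beta>
  proof -
    have m: "mm n (\<iota> x) M \<in> mats n" using M(1) by simp
    have "mt (Psi (\<psi> \<beta>) (mm n (\<iota> x) M)) = Psi (\<psi> \<beta>) (mt (mm n (\<iota> x) M))"
      by (rule Psi_comm[OF \<psi> lin_on_mt _ m, symmetric]) (simp add: Vf_mt v_Vf)
    also have "\<dots> = Psi (\<psi> \<beta>) (\<Sum>j\<in>{0::nat}. fscale (to_ac (-1)) (mm n (\<iota> x) M))" using M(3) by simp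
    also have "\<dots> = - Psi (\<psi> \<beta>) (mm n (\<iota> x) M)" by (subst Psi_Fcomb[OF \<psi>]) (simp_all add: m)
    finally show ?thesis by (simp add: xP M(1))
  qed
  have "mm n N (\<Sum>\<beta>\<in>B. fscale \<beta> (Psi (\<psi> \<beta>) M)) = idm n" using M(4) M' by simp
  from ex_rational_invertible[OF B Psi_mats this] obtain c :: "_ \<Rightarrow> 'f" and N' where
    N': "N' \<in> mats n" "mm n N' (\<Sum>\<beta>\<in>B. fscale (to_ac (c \<beta>)) (Psi (\<psi> \<beta>) M)) = idm n" by auto
  define w where "w = (\<Sum>\<beta>\<in>B. fscale (to_ac (c \<beta>)) (Psi (\<psi> \<beta>) M))"
  have "w \<in> alt_Vf" unfolding w_def by (rule alt_Vf_comb) (rule alt)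
  then obtain a where a: "a \<in> S" "w = mm n (\<iota> a) J" using alt_Vf_S by blast
  have "mt (mm n (\<iota> x) w) = - mm n (\<iota> x) w"
    unfolding w_def mm_sum_right mm_fscale_right mt_sum mt_fscale xalt by (simp add: sum_negf)
  then have "x * a \<in> S" by (simp add: S_def symmetric_mat_def \<iota>_mult mm_assoc a(2)[symmetric])
  moreover have "mm n (mm n (mm n J N') (\<iota> a)) J = J"
    using N' a(2) by (simp add: w_def[symmetric] mm_assoc mm_idr)
  then have "mm n (mm n (mm n (mm n J N') (\<iota> a)) J) J' = idm n" by (simp add: JJ')
  then have "mm n (mm n J N') (\<iota> a) = idm n" using N'(1) by (simp add: mm_assoc JJ' mm_idr)
  ultimately show ?thesis using a(1) N'(1) by (intro bexI[of _ a]) auto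
qed

end

section \<open>Algebras generated by a self-adjoint element\<close>

context split_csa
begin

definition pwr :: "('a \<Rightarrow> 'f alg_closure) \<Rightarrow> nat \<Rightarrow> 'a \<Rightarrow> 'f alg_closure" where
  "pwr z k = (gm z ^^ k) (tg 1)"

definition gp :: "('a \<Rightarrow> 'f alg_closure) \<Rightarrow> 'f alg_closure poly \<Rightarrow> 'a \<Rightarrow> 'f alg_closure" where
  "gp z p = fv.pop (gm z) p (tg 1)"

lemma lin_on_gm: "fv.lin_on CS (gm z)"
  unfolding fv.lin_on_def using subspace_CS by (auto simp: gm_add_right gm_fscale_right)

lemma pwr_in [simp]: "pwr z k \<in> CS"
  unfolding pwr_def by (rule fv.lin_on_pow[OF lin_on_gm tg_in])

lemma pwr_0: "pwr z 0 = tg 1" by (simp add: pwr_def)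
lemma pwr_Suc: "pwr z (Suc k) = gm z (pwr z k)" by (simp add: pwr_def)

lemma gp_in [simp]: "gp z p \<in> CS"
  unfolding gp_def by (rule fv.pop_in[OF lin_on_gm tg_in])

lemma gp_0 [simp]: "gp z 0 = 0" by (simp add: gp_def)

lemma gp_pCons: "gp z (pCons a p) = fscale a (tg 1) + gm z (gp z p)"
  unfolding gp_def by (rule fv.pop_pCons[OF lin_on_gm tg_in])

lemma gp_diff: "gp z (p - q) = gp z p - gp z q" unfolding gp_def by (rule fv.pop_diff)
lemma gp_sum: "gp z (\<Sum>i\<in>I. p i) = (\<Sum>i\<in>I. gp z (p i))" unfolding gp_def by (rule fv.pop_sum)
lemma gp_monom: "gp z (monom c i) = fscale c (pwr z i)"
  unfolding gp_def pwr_def by (rule fv.pop_pow[OF lin_on_gm tg_in])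

lemma gp_1: "gp z 1 = tg 1"
  by (simp only: one_pCons gp_pCons gp_0 gm_0 fun_vs.scale_one add_0_right)

lemma gp_expand: "degree p < k \<Longrightarrow> gp z p = (\<Sum>i<k. fscale (coeff p i) (pwr z i))"
  unfolding gp_def pwr_def
  by (subst fv.pop_bound[of p "k - 1"]) (auto simp: lessThan_Suc_atMost[symmetric])

lemma pop_gm: "z \<in> CS \<Longrightarrow> y \<in> CS \<Longrightarrow> fv.pop (gm z) p y = gm (gp z p) y"
proof (induction p)
  case 0
  show ?case by (simp add: gp_def)
next
  case (pCons a p)
  then show ?case
    by (simp add: fv.pop_pCons[OF lin_on_gm] gp_pCons gm_add_left gm_fscale_left gm_1_left gm_assoc)
qed

lemma gp_mult: "z \<in> CS \<Longrightarrow> gp z (p * q) = gm (gp z p) (gp z q)"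
proof -
  assume z: "z \<in> CS"
  have "gp z (p * q) = fv.pop (gm z) p (gp z q)" unfolding gp_def by (rule fv.pop_mult[OF lin_on_gm tg_in])
  also have "\<dots> = gm (gp z p) (gp z q)" by (rule pop_gm[OF z gp_in])
  finally show ?thesis .
qed

lemma gp_minimal:
  assumes "fv.indep_fam {..<k} (pwr z)" "gp z p = 0" "degree p < k"
  shows "p = 0"
proof (rule poly_eqI)
  fix i
  have "(\<Sum>i<k. fscale (coeff p i) (pwr z i)) = 0" using gp_expand[OF assms(3)] assms(2) by simp
  then show "coeff p i = coeff 0 i"
    using fv.indep_famD[OF assms(1)] assms(3) by (cases "i < k") (auto simp: coeff_eq_0)
qed

lemma dim_\<eta>:
  assumes "V \<subseteq> CS"
  shows "fun_vs.dim (\<eta> ` V) = fun_vs.dim V"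
proof -
  have "V \<subseteq> fun_vs.span (dlt ` Basis)" using assms CS_span by blast
  then obtain B where B: "B \<subseteq> V" "finite B" "fun_vs.independent B" "V \<subseteq> fun_vs.span B"
    by (rule fv.indep_basis_of) (simp add: finite_Basis)
  have BCS: "B \<subseteq> CS" using B(1) assms by blast
  have sumCS: "(\<Sum>b\<in>B. fscale (c b) b) \<in> CS" for c
    using BCS by (auto intro!: fun_vs.subspace_sum[OF subspace_CS] fun_vs.subspace_scale[OF subspace_CS])
  have \<eta>s: "\<eta> (\<Sum>b\<in>B. fscale (c b) b) = (\<Sum>b\<in>B. fscale (c b) (\<eta> b))" for c
    using BCS by (intro \<eta>_sum[OF B(2)]) auto
  have "fv.indep_fam B \<eta>"
    unfolding fv.indep_fam_def
  proof (intro allI impI ballI)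
    fix c b assume c: "(\<Sum>b\<in>B. fscale (c b) (\<eta> b)) = 0" and b: "b \<in> B"
    have "(\<Sum>b\<in>B. fscale (c b) b) = 0"
      by (rule \<eta>_inj[OF sumCS]) (simp_all add: \<eta>s c \<eta>_0)
    then show "c b = 0" using fun_vs.independentD[OF B(3,2) order_refl] b by blast
  qed
  moreover have "\<eta> ` V \<subseteq> fun_vs.span (\<eta> ` B)"
  proof safe
    fix w assume "w \<in> V"
    then obtain c where "w = (\<Sum>b\<in>B. fscale (c b) b)" using B(4) fv.span_family[OF B(2), of w "\<lambda>b. b"] by auto
    then show "\<eta> w \<in> fun_vs.span (\<eta> ` B)" unfolding fv.span_family[OF B(2)] using \<eta>s by auto
  qed
  ultimately have "fun_vs.dim (\<eta> ` V) = card B" using B by (intro fv.dim_family) auto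
  also have "card B = fun_vs.dim V" using B by (intro fun_vs.dim_unique[symmetric]) auto
  finally show ?thesis .
qed

lemma \<eta>_left_ideal: "z \<in> CS \<Longrightarrow> \<eta> ` (gm z ` CS) = mm n (\<eta> z) ` mats n"
proof -
  assume z: "z \<in> CS"
  have "\<eta> ` (gm z ` CS) = (\<lambda>w. mm n (\<eta> z) (\<eta> w)) ` CS"
    unfolding image_image using z by (intro image_cong refl) (simp add: \<eta>_mult)
  also have "\<dots> = mm n (\<eta> z) ` \<eta> ` CS" by (simp add: image_image)
  also have "\<eta> ` CS = mats n" using \<eta>_bij by (simp add: bij_betw_def)
  finally show ?thesis .
qed

text \<open>The \<open>m\<close> right ideals are independent in a space of dimension
  \<open>n * n\<close>, which is \<open>m\<close> times \<open>2 * n\<close>; so none of them can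
  exceed the lower bound.\<close>

lemma idempotent_dims:
  fixes e :: "nat \<Rightarrow> 'f alg_closure mtx"
  assumes nm: "n = 2 * m" and e: "\<And>i. i < m \<Longrightarrow> e i \<in> mats n"
    and orth: "\<And>i j. i < m \<Longrightarrow> j < m \<Longrightarrow> mm n (e i) (e j) = (if i = j then e i else 0)"
    and ge: "\<And>i. i < m \<Longrightarrow> 2 * n \<le> fun_vs.dim (mm n (e i) ` mats n)"
    and k: "k < m"
  shows "fun_vs.dim (mm n (e k) ` mats n) = 2 * n"
proof -
  have "\<exists>B. B \<subseteq> mm n (e i) ` mats n \<and> finite B \<and> fun_vs.independent B \<and> card B = fun_vs.dim (mm n (e i) ` mats n)"
    if i: "i < m" for i
  proof -
    have "mm n (e i) ` mats n \<subseteq> fun_vs.span (dlt ` ({..<n} \<times> {..<n}))"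
      using coord_span[of "{..<n} \<times> {..<n}"] mm_in[OF e[OF i]] by (auto simp: mats_def)
    then obtain B where "B \<subseteq> mm n (e i) ` mats n" "finite B" "fun_vs.independent B" "mm n (e i) ` mats n \<subseteq> fun_vs.span B"
      by (rule fv.indep_basis_of) simp
    moreover from this have "fun_vs.dim (mm n (e i) ` mats n) = card B" by (intro fun_vs.dim_unique) auto
    ultimately show ?thesis by (intro exI[of _ B]) simp
  qed
  then have "\<forall>i. \<exists>B. i < m \<longrightarrow> B \<subseteq> mm n (e i) ` mats n \<and> finite B \<and>
    fun_vs.independent B \<and> card B = fun_vs.dim (mm n (e i) ` mats n)" by blast
  from choice[OF this] obtain B where B: "\<And>i. i < m \<Longrightarrow> B i \<subseteq> mm n (e i) ` mats n \<and> finite (B i) \<and>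
    fun_vs.independent (B i) \<and> card (B i) = fun_vs.dim (mm n (e i) ` mats n)" by blast
  have fS: "finite (Sigma {..<m} B)" using B by (intro finite_SigmaI) auto
  have "fv.indep_fam (Sigma {..<m} B) snd"
    unfolding fv.indep_fam_def
  proof (intro allI impI ballI)
    fix c p assume c: "(\<Sum>p\<in>Sigma {..<m} B. fscale (c p) (snd p)) = 0" and p: "p \<in> Sigma {..<m} B"
    obtain i b where ib: "p = (i, b)" "i < m" "b \<in> B i" using p by auto
    have ew: "mm n (e i) w = (if i = j then w else 0)" if jm: "j < m" and wB: "w \<in> B j" for j w
    proof -
      obtain M where M: "M \<in> mats n" "w = mm n (e j) M" using B[OF jm] wB by blast
      have "mm n (e i) w = mm n (mm n (e i) (e j)) M" by (simp add: M mm_assoc)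
      then show ?thesis using orth[OF ib(2) jm] M by auto
    qed
    have "0 = mm n (e i) (\<Sum>p\<in>Sigma {..<m} B. fscale (c p) (snd p))" unfolding c by simp
    also have "\<dots> = (\<Sum>p\<in>Sigma {..<m} B. fscale (c p) (mm n (e i) (snd p)))"
      by (simp only: mm_sum_right mm_fscale_right)
    also have "\<dots> = (\<Sum>p\<in>{i} \<times> B i. fscale (c p) (snd p))"
      using ib ew fS by (intro sum.mono_neutral_cong_right) auto
    also have "\<dots> = (\<Sum>w\<in>B i. fscale (c (i, w)) w)"
      by (rule sum.reindex_bij_witness[of _ "\<lambda>w. (i, w)" snd]) auto
    finally have "(\<Sum>w\<in>B i. fscale (c (i, w)) w) = 0" by simp
    moreover have "fun_vs.independent (B i)" "finite (B i)" using B[OF ib(2)] by auto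
    ultimately have "c (i, b) = 0"
      using fun_vs.independentD[of "B i" "B i" "\<lambda>w. c (i, w)" b] ib(3) by blast
    then show "c p = 0" using ib by simp
  qed
  moreover have "snd ` Sigma {..<m} B \<subseteq> coord_space ({..<n} \<times> {..<n})"
    using B mm_in[OF e] by (force simp: mats_def)
  ultimately have "card (Sigma {..<m} B) \<le> card ({..<n} \<times> {..<n})" using fS by (intro indep_coord[of _ _ snd]) auto
  then have le: "(\<Sum>i<m. card (B i)) \<le> n * n" using B by (simp add: card_SigmaI)
  have "(\<Sum>i<m. card (B i)) = card (B k) + (\<Sum>i\<in>{..<m} - {k}. card (B i))" using k by (simp add: sum.remove)
  moreover have "(\<Sum>i\<in>{..<m} - {k}. 2 * n) \<le> (\<Sum>i\<in>{..<m} - {k}. card (B i))" using B ge by (intro sum_mono) auto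
  moreover have "(\<Sum>i\<in>{..<m} - {k}. 2 * n) = (m - 1) * (2 * n)" using k by simp
  moreover have "n * n = 2 * n + (m - 1) * (2 * n)" using k by (cases m) (simp_all add: nm)
  ultimately have "card (B k) \<le> 2 * n" using le by linarith
  then show ?thesis using B[OF k] ge[OF k] by simp
qed

text \<open>The eigenprojections of a self-adjoint element are self-adjoint for the alternating form, hence
  of rank at least two.\<close>

lemma etale_of_separable:
  assumes nm: "n = 2 * m" and two: "(2 :: 'f) \<noteq> 0" and z: "z \<in> CS"
    and ind: "fv.indep_fam {..<m} (pwr z)"
    and f: "degree f = m" "lead_coeff f = 1" "gp z f = 0"
    and inv: "N \<in> mats n" "mm n N (\<eta> (gp z (pderiv f))) = idm n"
    and B: "B \<in> mats n" "mt B = - B" "B' \<in> mats n" "mm n B B' = idm n"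
    and zB: "mm n (\<eta> z) B = mm n B (mt (\<eta> z))"
  shows "frame_span m (pwr z) \<in> etale_variety scale Basis n m"
proof -
  have m0: "0 < m" using n_pos nm by simp
  have two': "(2 :: 'f alg_closure) \<noteq> 0" using two to_ac_eq_0_iff[of "2 :: 'f"] by simp
  have f0: "f \<noteq> 0" using f by auto
  \<comment> \<open>If \<open>a\<close> were a multiple root, then \<open>f\<close> would divide
    \<open>f' g\<close>. As \<open>f'(z)\<close> is invertible, \<open>g(z)\<close> would vanish,
    although \<open>g\<close> has degree below \<open>m\<close> and the powers are
    independent.\<close>
  have simple_root: "poly g a \<noteq> 0" if fg: "f = [:-a, 1:] * g" for a g
  proof
    assume "poly g a = 0"
    then obtain h where h: "g = [:-a, 1:] * h" by (rule root_factor)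
    have g0: "g \<noteq> 0" using fg f0 by auto
    have "degree f = Suc (degree g)" unfolding fg using g0 by (subst degree_mult_eq) auto
    then have dg: "degree g < m" using f by simp
    define l where "l = [:-a, 1:]"
    have "pderiv l = 1" by (simp add: l_def pderiv_pCons)
    moreover have l: "f = l * g" "g = l * h" using fg h by (simp_all add: l_def)
    ultimately have "pderiv f = l * pderiv g + g" unfolding l(1) by (simp add: pderiv_mult)
    then have "pderiv f * g = (l * g) * pderiv g + g * g" by (simp add: algebra_simps)
    also have "g * g = (l * g) * h" using l(2) by (metis mult.assoc mult.commute)
    finally have "pderiv f * g = f * (pderiv g + h)" unfolding l(1) by (simp add: distrib_left)
    then have "gm (gp z (pderiv f)) (gp z g) = 0"
      using gp_mult[OF z, of "pderiv f" g] gp_mult[OF z, of f "pderiv g + h"] f(3) by simp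
    then have "mm n (\<eta> (gp z (pderiv f))) (\<eta> (gp z g)) = 0"
      using \<eta>_mult[of "gp z (pderiv f)" "gp z g"] \<eta>_0 by simp
    then have "mm n (mm n N (\<eta> (gp z (pderiv f)))) (\<eta> (gp z g)) = 0" by (simp add: mm_assoc)
    then have "\<eta> (gp z g) = \<eta> 0" by (simp add: inv mm_idl \<eta>_0)
    then have "gp z g = 0" by (rule \<eta>_inj[OF gp_in zero_CS])
    then show False using gp_minimal[OF ind _ dg] g0 by simp
  qed
  obtain A where A: "size A = degree f" "f = smult (lead_coeff f) (\<Prod>x\<in>#A. [:-x, 1:])"
    using alg_closed_imp_factorization[OF f0] by blast
  have fA: "f = (\<Prod>x\<in>#A. [:-x, 1:])" using A(2) f(2) by simp
  have cnt: "count A a \<le> 1" for a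
  proof (rule ccontr)
    assume "\<not> count A a \<le> 1"
    then have "a \<in># A" "a \<in># A - {#a#}" by (auto simp: in_diff_count count_greater_zero_iff[symmetric] simp del: count_greater_zero_iff)
    then obtain A1 A2 where A1: "A = add_mset a A1" and A2: "A1 = add_mset a A2"
      by (metis add_mset_remove_trivial insert_DiffM)
    have "f = [:-a, 1:] * (\<Prod>x\<in>#A1. [:-x, 1:])" unfolding fA A1 by simp
    moreover have "poly (\<Prod>x\<in>#A1. [:-x, 1:]) a = 0" unfolding A2 by simp
    ultimately show False using simple_root by blast
  qed
  define S where "S = set_mset A"
  have AS: "A = mset_set S"
  proof (rule multiset_eqI)
    fix a show "count A a = count (mset_set S) a"
      using cnt[of a] by (cases "a \<in># A") (auto simp: S_def le_Suc_eq count_eq_zero_iff)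
  qed
  have cS: "card S = m" using A(1) f(1) AS by (metis size_mset_set)
  have fS: "finite S" by (simp add: S_def)
  obtain r where r: "bij_betw r {..<m} S"
    using ex_bij_betw_nat_finite[OF fS] cS by (auto simp: atLeast0LessThan)
  have rinj: "r i = r j \<longleftrightarrow> i = j" if "i < m" "j < m" for i j
    using r that by (auto simp: bij_betw_def inj_on_def)
  have fprod: "f = (\<Prod>i<m. [:- r i, 1:])"
  proof -
    have "f = (\<Prod>x\<in>S. [:-x, 1:])" unfolding fA by (subst AS) (simp add: prod_unfold_prod_mset)
    also have "\<dots> = (\<Prod>i<m. [:- r i, 1:])" using prod.reindex_bij_betw[OF r, of "\<lambda>x. [:-x, 1:]"] by simp
    finally show ?thesis .
  qed
  have vanish: "gp z p = 0" if p: "\<And>i. i < m \<Longrightarrow> poly p (r i) = 0" for p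
  proof -
    have roots: "poly f (r i) = 0" if "i < m" for i
      unfolding fprod poly_prod using that by (intro prod_zero) auto
    have eq: "p = (p div f) * f + p mod f" by simp
    have "poly (p mod f) x = 0" if "x \<in> r ` {..<m}" for x
    proof -
      obtain i where i: "x = r i" "i < m" using \<open>x \<in> r ` {..<m}\<close> by auto
      have "poly p x = poly ((p div f) * f + p mod f) x" by simp
      then show ?thesis using p[OF i(2)] roots[OF i(2)] i(1) by (simp only: poly_add poly_mult) simp
    qed
    moreover have "card (r ` {..<m}) = m" using r cS by (simp add: bij_betw_def)
    moreover have "degree (p mod f) < m" using degree_mod_less'[OF f0, of p] f(1) m0 by (cases "p mod f = 0") auto
    ultimately have "p mod f = 0" by (intro poly_zero_of_roots[of "r ` {..<m}"]) auto
    then have "p = (p div f) * f" using eq by simp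
    then have "gp z p = gm (gp z (p div f)) (gp z f)" using gp_mult[OF z] by metis
    then show ?thesis using f(3) by simp
  qed
  have agree: "gp z p = gp z p'" if "\<And>i. i < m \<Longrightarrow> poly p (r i) = poly p' (r i)" for p p'
    using vanish[of "p - p'"] that by (simp add: gp_diff)
  \<comment> \<open>The Lagrange interpolation polynomials of the roots. Evaluation at
    \<open>z\<close> depends only on the values at the roots, so they become orthogonal idempotents
    with sum 1.\<close>
  define L where "L i = (\<Prod>j\<in>{..<m} - {i}. smult (inverse (r i - r j)) [:- r j, 1:])" for i
  have Lr: "poly (L i) (r k) = (if i = k then 1 else 0)" if "i < m" "k < m" for i k
  proof (cases "i = k")
    case True
    have "poly (smult (inverse (r i - r j)) [:- r j, 1:]) (r i) = 1" if "j \<in> {..<m} - {i}" for j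
    proof -
      have "poly (smult (inverse (r i - r j)) [:- r j, 1:]) (r i) = inverse (r i - r j) * (r i - r j)"
        by (simp add: algebra_simps)
      then show ?thesis using rinj[of i j] that \<open>i < m\<close> by simp
    qed
    then have "poly (L i) (r i) = (\<Prod>j\<in>{..<m} - {i}. 1)"
      unfolding L_def poly_prod by (intro prod.cong refl)
    then show ?thesis using True by simp
  next
    case False
    then show ?thesis unfolding L_def poly_prod using that by (auto intro!: prod_zero bexI[of _ k])
  qed
  have dL: "degree (L i) < m" if "i < m" for i
  proof -
    have "degree (L i) \<le> (\<Sum>j\<in>{..<m} - {i}. degree (smult (inverse (r i - r j)) [:- r j, 1:]))"
      unfolding L_def
      using degree_prod_sum_le[of "{..<m} - {i}" "\<lambda>j. smult (inverse (r i - r j)) [:- r j, 1:]"]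
      by (simp only: comp_def finite_Diff finite_lessThan)
    also have "\<dots> \<le> (\<Sum>j\<in>{..<m} - {i}. 1)" by (intro sum_mono) simp
    also have "\<dots> < m" using that by simp
    finally show ?thesis .
  qed
  define e where "e i = gp z (L i)" for i
  have orth: "gm (e i) (e j) = (if i = j then e i else 0)" if "i < m" "j < m" for i j
  proof -
    have "gm (e i) (e j) = gp z (L i * L j)" by (simp add: e_def gp_mult[OF z])
    also have "\<dots> = gp z (if i = j then L i else 0)" using that by (intro agree) (auto simp: Lr)
    finally show ?thesis by (simp add: e_def)
  qed
  have esum: "(\<Sum>i<m. e i) = tg 1"
  proof -
    have "(\<Sum>i<m. e i) = gp z (\<Sum>i<m. L i)" by (simp add: e_def gp_sum)
    also have "\<dots> = gp z 1" by (intro agree) (simp add: poly_sum Lr)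
    finally show ?thesis by (simp add: gp_1)
  qed
  have e_ne: "e i \<noteq> 0" if "i < m" for i
  proof
    assume "e i = 0"
    then have "L i = 0" using gp_minimal[OF ind _ dL[OF that]] by (simp add: e_def)
    then show False using Lr[OF that that] by simp
  qed
  have comm: "gm (gp z p) z = gm z (gp z p)" for p
  proof -
    have z1: "gp z [:0, 1:] = z" using gm_1_right[OF z] by (simp add: gp_pCons fun_vs.scale_zero_left)
    have "gm (gp z p) (gp z [:0, 1:]) = gm (gp z [:0, 1:]) (gp z p)"
      unfolding gp_mult[OF z, symmetric] by (simp only: mult.commute)
    then show ?thesis unfolding z1 .
  qed
  \<comment> \<open>Self-adjointness for the form \<open>B\<close> passes from \<open>z\<close> to
    all polynomials in \<open>z\<close>, in particular to the idempotents.\<close>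
  have gB: "mm n (\<eta> (gp z p)) B = mm n B (mt (\<eta> (gp z p)))" for p
  proof (induction p)
    case 0
    show ?case by (simp add: \<eta>_0)
  next
    case (pCons a p)
    have e1: "\<eta> (gp z (pCons a p)) = fscale a (idm n) + mm n (\<eta> z) (\<eta> (gp z p))"
      using z by (simp add: gp_pCons \<eta>_add \<eta>_scale \<eta>_mult \<eta>_1 fun_vs.subspace_scale[OF subspace_CS])
    have e2: "mm n (\<eta> z) (\<eta> (gp z p)) = mm n (\<eta> (gp z p)) (\<eta> z)"
      using comm[of p] z \<eta>_mult[of z "gp z p"] \<eta>_mult[of "gp z p" z] by simp
    have "mm n (mm n (\<eta> z) (\<eta> (gp z p))) B = mm n B (mt (mm n (\<eta> (gp z p)) (\<eta> z)))"
      by (simp add: mm_assoc pCons.IH mt_mm) (simp add: mm_assoc[symmetric] zB)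
    then have "mm n (mm n (\<eta> z) (\<eta> (gp z p))) B = mm n B (mt (mm n (\<eta> z) (\<eta> (gp z p))))" using e2 by simp
    then show ?case unfolding e1 using B(1)
      by (simp add: mm_add_left mm_add_right mt_add mt_fscale mm_fscale_left mm_fscale_right mm_idl mm_idr)
  qed
  have ge: "2 * n \<le> fun_vs.dim (mm n (\<eta> (e i)) ` mats n)" if i: "i < m" for i
  proof -
    define M where "M = mm n (\<eta> (e i)) B"
    have Min: "M \<in> mats n" using B by (simp add: M_def e_def)
    have Mt: "mt M = - M"
      unfolding M_def e_def mt_mm B(2) by (simp add: gB mm_uminus_left)
    have "M \<noteq> 0"
    proof
      assume "M = 0"
      then have "mm n M B' = 0" by simp
      then have "\<eta> (e i) = \<eta> 0" by (simp add: M_def mm_assoc B e_def mm_idr \<eta>_0)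
      then have "e i = 0" by (rule \<eta>_inj[rotated 2]) (simp_all add: e_def)
      then show False using e_ne[OF i] by simp
    qed
    then obtain x where x: "fv.indep_fam ({..<2::nat} \<times> {..<n}) x" "x ` ({..<2} \<times> {..<n}) \<subseteq> mm n M ` mats n"
      using alternating_right_ideal[OF two' Min Mt] by blast
    have "mm n M ` mats n \<subseteq> mm n (\<eta> (e i)) ` mats n"
      unfolding M_def using B by (auto simp: mm_assoc)
    then have "card ({..<2::nat} \<times> {..<n}) \<le> fun_vs.dim (mm n (\<eta> (e i)) ` mats n)"
      using x coord_span[of "{..<n} \<times> {..<n}"]
      by (intro fv.indep_fam_le_dim[of _ x _ "dlt ` ({..<n} \<times> {..<n})"]) (auto simp: mats_def[symmetric] e_def)
    then show ?thesis by simp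
  qed
  have dims: "fun_vs.dim (gm (e i) ` CS) = n * (n div m)" if i: "i < m" for i
  proof -
    have "fun_vs.dim (gm (e i) ` CS) = fun_vs.dim (\<eta> ` gm (e i) ` CS)"
      by (rule dim_\<eta>[symmetric]) auto
    also have "\<dots> = fun_vs.dim (mm n (\<eta> (e i)) ` mats n)" by (simp add: \<eta>_left_ideal e_def)
    also have "\<dots> = 2 * n"
    proof (rule idempotent_dims[OF nm, where e = "\<lambda>i. \<eta> (e i)"])
      show "mm n (\<eta> (e i)) (\<eta> (e j)) = (if i = j then \<eta> (e i) else 0)" if "i < m" "j < m" for i j
        using orth[OF that] \<eta>_mult[of "e i" "e j"] by (auto simp: e_def \<eta>_0)
    qed (use i ge in \<open>simp_all add: e_def\<close>)
    finally show ?thesis using m0 by (simp add: nm)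
  qed
  have "fun_vs.span (e ` {..<m}) = fun_vs.span (pwr z ` {..<m})"
  proof (rule fv.indep_fam_spans)
    show "fv.indep_fam {..<m} e"
      unfolding fv.indep_fam_def
    proof (intro allI impI ballI)
      fix c i assume c: "(\<Sum>i<m. fscale (c i) (e i)) = 0" and i: "i \<in> {..<m}"
      have "gm (\<Sum>j<m. fscale (c j) (e j)) (e i) = (\<Sum>j<m. fscale (c j) (gm (e j) (e i)))"
        by (simp only: gm_sum_left gm_fscale_left)
      also have "\<dots> = (\<Sum>j<m. if j = i then fscale (c i) (e i) else 0)"
        using i orth by (intro sum.cong refl) auto
      also have "\<dots> = fscale (c i) (e i)" using i by simp
      finally have "fscale (c i) (e i) = 0" unfolding c by simp
      then show "c i = 0" using e_ne i by (simp add: fun_vs.scale_eq_0_iff)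
    qed
    show "e ` {..<m} \<subseteq> fun_vs.span (pwr z ` {..<m})"
    proof safe
      fix i assume "i < m"
      then show "e i \<in> fun_vs.span (pwr z ` {..<m})"
        unfolding e_def gp_expand[OF dL[OF \<open>i < m\<close>]] by (intro fun_vs.span_sum fun_vs.span_scale fun_vs.span_base imageI) simp
    qed
    show "card (pwr z ` {..<m}) \<le> card {..<m}" by (rule card_image_le) simp
  qed simp_all
  then have sp: "frame_span m (pwr z) = fun_vs.span (e ` {..<m})" unfolding frame_span_def by (rule sym)
  show ?thesis
    unfolding etale_variety_def mem_Collect_eq
  proof (intro exI[of _ e] conjI allI impI)
    show "e i \<in> CS" for i by (simp add: e_def)
  qed (assumption | rule orth esum dims sp)+
qed

lemma gp_diagonal:
  fixes e :: "nat \<Rightarrow> 'a \<Rightarrow> 'f alg_closure" and m :: nat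
  assumes e: "\<And>i. i < m \<Longrightarrow> e i \<in> CS"
    and orth: "\<And>i j. i < m \<Longrightarrow> j < m \<Longrightarrow> gm (e i) (e j) = (if i = j then e i else 0)"
    and esum: "(\<Sum>i<m. e i) = tg 1" and z: "z = (\<Sum>i<m. fscale (\<mu> i) (e i))"
  shows "gp z p = (\<Sum>i<m. fscale (poly p (\<mu> i)) (e i))"
proof (induction p)
  case 0
  show ?case by (simp add: fun_vs.scale_zero_left)
next
  case (pCons a p)
  have "gm z (\<Sum>j<m. fscale (poly p (\<mu> j)) (e j)) = (\<Sum>i<m. \<Sum>j<m. fscale (\<mu> i * poly p (\<mu> j)) (gm (e i) (e j)))"
    unfolding z gm_sum_left gm_fscale_left unfolding gm_sum_right gm_fscale_right fun_vs.scale_sum_right fun_vs.scale_scale ..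
  also have "\<dots> = (\<Sum>i<m. \<Sum>j<m. if j = i then fscale (\<mu> i * poly p (\<mu> i)) (e i) else 0)"
    by (intro sum.cong refl) (simp add: orth)
  also have "\<dots> = (\<Sum>i<m. fscale (\<mu> i * poly p (\<mu> i)) (e i))" by (intro sum.cong refl) simp
  finally show ?case
    unfolding gp_pCons pCons.IH esum[symmetric] fun_vs.scale_sum_right
    by (simp add: sum.distrib[symmetric] fun_vs.scale_left_distrib)
qed

text \<open>If two of the \<open>\<mu> i\<close> coincided, a polynomial of degree below
  \<open>m\<close> would kill \<open>z\<close>. So \<open>f\<close> has \<open>m\<close> distinct
  roots, its derivative is nonzero at each of them, and \<open>f'(z)\<close> is inverted on every
  idempotent separately.\<close>

lemma separable_of_diagonal:
  assumes e: "\<And>i. i < m \<Longrightarrow> e i \<in> CS"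
    and orth: "\<And>i j. i < m \<Longrightarrow> j < m \<Longrightarrow> gm (e i) (e j) = (if i = j then e i else 0)"
    and esum: "(\<Sum>i<m. e i) = tg 1" and z: "z = (\<Sum>i<m. fscale (\<mu> i) (e i))"
    and eind: "fv.indep_fam {..<m} e" and ind: "fv.indep_fam {..<m} (pwr z)"
    and f: "degree f = m" "gp z f = 0"
  shows "\<exists>N\<in>mats n. mm n N (\<eta> (gp z (pderiv f))) = idm n"
proof -
  have gpd: "gp z p = (\<Sum>i<m. fscale (poly p (\<mu> i)) (e i))" for p
    by (rule gp_diagonal[OF e orth esum z])
  have root: "poly f (\<mu> i) = 0" if "i < m" for i
    using fv.indep_famD[OF eind, of "\<lambda>i. poly f (\<mu> i)" i] f(2) gpd[of f] that by simp
  have inj: "\<mu> i \<noteq> \<mu> j" if ij: "i < m" "j < m" "i \<noteq> j" for i j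
  proof
    assume eq: "\<mu> i = \<mu> j"
    define q where "q = (\<Prod>k\<in>{..<m} - {j}. [:- \<mu> k, 1:])"
    have "degree q = card ({..<m} - {j})" unfolding q_def by (subst degree_prod_eq_sum_degree) auto
    then have dq: "degree q < m" using ij by simp
    have qr: "poly q (\<mu> k) = 0" if "k < m" for k
    proof (cases "k = j")
      case True
      then show ?thesis unfolding q_def poly_prod using ij eq by (intro prod_zero bexI[of _ i]) auto
    next
      case False
      then show ?thesis unfolding q_def poly_prod using that by (intro prod_zero bexI[of _ k]) auto
    qed
    have "gp z q = 0" unfolding gpd by (rule sum.neutral) (simp add: fun_vs.scale_zero_left qr)
    then have "q = 0" by (rule gp_minimal[OF ind _ dq])
    then show False unfolding q_def by (auto simp: prod_zero_iff)
  qed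
  have f0: "f \<noteq> 0 \<or> m = 0" using f by auto
  have d: "poly (pderiv f) (\<mu> i) \<noteq> 0" if i: "i < m" for i
  proof
    assume d0: "poly (pderiv f) (\<mu> i) = 0"
    obtain g where g: "f = [:- \<mu> i, 1:] * g" by (rule root_factor[OF root[OF i]])
    have f0: "f \<noteq> 0" using f i by auto
    then have g0: "g \<noteq> 0" using g by auto
    have "degree f = Suc (degree g)" unfolding g using g0 by (subst degree_mult_eq) auto
    then have dg: "degree g < m" using f by simp
    have "pderiv f = [:- \<mu> i, 1:] * pderiv g + g * pderiv [:- \<mu> i, 1:]" unfolding g by (rule pderiv_mult)
    then have "poly g (\<mu> i) = 0" using d0 by (simp add: pderiv_pCons)
    moreover have "poly g (\<mu> k) = 0" if "k < m" "k \<noteq> i" for k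
      using root[OF that(1)] inj[OF that(1) i that(2)] unfolding g by simp
    ultimately have "poly g (\<mu> k) = 0" if "k < m" for k using that by (cases "k = i") auto
    moreover have "card (\<mu> ` {..<m}) = m" using inj by (subst card_image) (auto simp: inj_on_def)
    ultimately have "g = 0" using dg by (intro poly_zero_of_roots[of "\<mu> ` {..<m}"]) auto
    then show False using g0 by simp
  qed
  define y where "y = (\<Sum>i<m. fscale (inverse (poly (pderiv f) (\<mu> i))) (e i))"
  have yCS: "y \<in> CS" unfolding y_def
    using e by (auto intro!: fun_vs.subspace_sum[OF subspace_CS] fun_vs.subspace_scale[OF subspace_CS])
  have "gm y (gp z (pderiv f)) = (\<Sum>i<m. \<Sum>j<m. fscale (inverse (poly (pderiv f) (\<mu> i)) * poly (pderiv f) (\<mu> j)) (gm (e i) (e j)))"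
    unfolding y_def gpd gm_sum_left gm_fscale_left unfolding gm_sum_right gm_fscale_right fun_vs.scale_sum_right fun_vs.scale_scale ..
  also have "\<dots> = (\<Sum>i<m. \<Sum>j<m. if j = i then e i else 0)"
    using d by (intro sum.cong refl) (auto simp: orth)
  also have "\<dots> = (\<Sum>i<m. e i)" by (intro sum.cong refl) simp
  also note esum
  finally have "mm n (\<eta> y) (\<eta> (gp z (pderiv f))) = idm n"
    using \<eta>_mult[OF yCS gp_in, of z "pderiv f"] \<eta>_1 by simp
  then show ?thesis using yCS by (intro bexI[of _ "\<eta> y"]) simp_all
qed

end

section \<open>Open conditions with equations over the base field\<close>

lemma pfn_value: "pfn C G p \<Longrightarrow> (\<And>g. g \<in> G \<Longrightarrow> g u \<in> R) \<Longrightarrow> C \<subseteq> R \<Longrightarrow>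
    (\<And>a b. a \<in> R \<Longrightarrow> b \<in> R \<Longrightarrow> a + b \<in> R \<and> a * b \<in> R) \<Longrightarrow> p u \<in> R"
  by (induction p rule: pfn.induct) auto

lemma pfn_polyfun:
  assumes "polyfun I m p" "\<And>j i. j < m \<Longrightarrow> i \<in> I \<Longrightarrow> pfn (range to_ac) G (\<lambda>u. v u j i)"
  shows "pfn (range to_ac) G (\<lambda>u. p (v u))"
  using assms(1) by (induction p rule: polyfun.induct) (auto intro: pfn.const pfn.add pfn.mult assms(2))

lemma (in coeff_field) ev_at: "ev G u0 P \<Longrightarrow> P u0"
  unfolding ev_def by blast

lemma pderiv_sum: "pderiv (\<Sum>i\<in>I. f i) = (\<Sum>i\<in>I. pderiv (f i))"
  by (induction I rule: infinite_finite_induct) (simp_all add: pderiv_add)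

text \<open>The monic polynomial belonging to a relation that expresses the \<open>m\<close>-th
  power by the lower ones.\<close>

definition charp :: "nat \<Rightarrow> (nat \<Rightarrow> 'k::field) \<Rightarrow> 'k poly" where
  "charp m c = monom 1 m - (\<Sum>i<m. monom (c i) i)"

lemma coeff_charp: "coeff (charp m c) k = (if k = m then 1 else if k < m then - c k else 0)"
  by (auto simp: charp_def coeff_sum)

lemma degree_charp: "degree (charp m c) = m"
proof (rule antisym)
  show "degree (charp m c) \<le> m" by (rule degree_le) (simp add: coeff_charp)
  show "m \<le> degree (charp m c)" by (rule le_degree) (simp add: coeff_charp)
qed

context split_csa
begin

abbreviation "FK \<equiv> range (to_ac :: 'f \<Rightarrow> 'f alg_closure)"

lemma pfn_gm:
  assumes "\<And>b. pfn FK G (\<lambda>u. x u b)" "\<And>b. pfn FK G (\<lambda>u. y u b)"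
  shows "pfn FK G (\<lambda>u. gm (x u) (y u) b)"
proof (cases "b \<in> Basis")
  case True
  show ?thesis unfolding gm_apply if_P[OF True] by (intro Fc.pfn_sum pfn.mult assms pfn.const rangeI)
next
  case False
  show ?thesis unfolding gm_apply if_not_P[OF False] by (intro pfn.const Fc.zero_C)
qed

lemma rat_gm_tg:
  assumes "\<And>b. Fc.rat G u0 (\<lambda>u. x u b)"
  shows "Fc.rat G u0 (\<lambda>u. gm (x u) (tg a) b)"
proof (cases "b \<in> Basis")
  case True
  show ?thesis unfolding gm_apply if_P[OF True] tg_apply
    by (intro Fc.rat_sum Fc.rat_mult assms Fc.rat_const rangeI)
next
  case False
  show ?thesis unfolding gm_apply if_not_P[OF False] by (intro Fc.rat_const Fc.zero_C)
qed

lemma pfn_pwr: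
  assumes "\<And>b. pfn FK G (\<lambda>u. x u b)"
  shows "pfn FK G (\<lambda>u. pwr (x u) k b)"
proof (induction k arbitrary: b)
  case 0
  show ?case unfolding pwr_0 tg_apply by (intro pfn.const rangeI)
next
  case (Suc k)
  show ?case unfolding pwr_Suc by (rule pfn_gm[OF assms Suc])
qed

lemma pwr_fscale: "pwr (fscale k z) j = fscale (k ^ j) (pwr z j)"
proof (induction j)
  case 0
  show ?case by (simp add: pwr_0)
next
  case (Suc j)
  show ?case by (simp add: pwr_Suc Suc gm_fscale_left gm_fscale_right mult.commute)
qed

definition unit_elt :: "('a \<Rightarrow> 'f alg_closure) \<Rightarrow> bool" where
  "unit_elt z \<longleftrightarrow> (\<exists>N\<in>mats n. mm n N (\<eta> z) = idm n)"

lemma unit_elt_cancel: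
  assumes "unit_elt z" "z \<in> CS" "y \<in> CS" "gm z y = 0"
  shows "y = 0"
proof -
  obtain N where N: "N \<in> mats n" "mm n N (\<eta> z) = idm n" using assms(1) unfolding unit_elt_def by blast
  have "mm n N (mm n (\<eta> z) (\<eta> y)) = 0" using \<eta>_mult[OF assms(2,3)] assms(4) \<eta>_0 by simp
  then have "\<eta> y = \<eta> 0" using assms(3) by (simp add: mm_assoc[symmetric] N mm_idl \<eta>_0)
  then show ?thesis by (rule \<eta>_inj[OF assms(3) zero_CS])
qed

lemma CS_sum: "(\<And>i. i \<in> I \<Longrightarrow> x i \<in> CS) \<Longrightarrow> (\<Sum>i\<in>I. fscale (c i) (x i)) \<in> CS"
  by (intro fun_vs.subspace_sum[OF subspace_CS] fun_vs.subspace_scale[OF subspace_CS])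

text \<open>Unlike the entries of \<open>\<eta> z\<close>, the coordinates of the products on the right hand side are
  polynomials over the base field.\<close>

lemma unit_elt_iff_indep:
  assumes e: "bij_betw e {..<n * n} Basis" and z: "z \<in> CS"
  shows "unit_elt z \<longleftrightarrow> fv.indep_fam {..<n * n} (\<lambda>j. gm z (tg (e j)))"
proof
  assume u: "unit_elt z"
  show "fv.indep_fam {..<n * n} (\<lambda>j. gm z (tg (e j)))"
    unfolding fv.indep_fam_def
  proof (intro allI impI ballI)
    fix c j assume c: "(\<Sum>j<n * n. fscale (c j) (gm z (tg (e j)))) = 0" and j: "j \<in> {..<n * n}"
    define y where "y = (\<Sum>j<n * n. fscale (c j) (tg (e j)))"
    have "y \<in> CS" unfolding y_def by (rule CS_sum) simp
    moreover have "gm z y = 0" unfolding y_def gm_sum_right gm_fscale_right by (rule c)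
    ultimately have "y = 0" by (rule unit_elt_cancel[OF u z])
    have "y (e j) = (\<Sum>k<n * n. c k * tg (e k) (e j))" unfolding y_def sum_fun_apply fun_app ..
    also have "\<dots> = (\<Sum>k<n * n. if k = j then c j else 0)"
    proof (intro sum.cong refl)
      fix k assume k: "k \<in> {..<n * n}"
      have "e j = e k \<longleftrightarrow> k = j" using e j k by (auto simp: bij_betw_def inj_on_def)
      moreover have "tg (e k) = dlt (e k)" using bij_betwE[OF e] k by (intro tg_Basis) blast
      ultimately show "c k * tg (e k) (e j) = (if k = j then c j else 0)" by (simp add: dlt_def)
    qed
    also have "\<dots> = c j" using j by simp
    finally show "c j = 0" using \<open>y = 0\<close> by (simp add: fun_app)
  qed
next
  assume ind: "fv.indep_fam {..<n * n} (\<lambda>j. gm z (tg (e j)))"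
  have "fun_vs.span ((\<lambda>j. gm z (tg (e j))) ` {..<n * n}) = fun_vs.span (dlt ` Basis)"
  proof (rule fv.indep_fam_spans[OF _ ind])
    show "(\<lambda>j. gm z (tg (e j))) ` {..<n * n} \<subseteq> fun_vs.span (dlt ` Basis)"
      using CS_span gm_in by blast
    show "card (dlt ` Basis) \<le> card {..<n * n}"
      using card_image_le[OF finite_Basis, of dlt] card_Basis by simp
  qed (simp_all add: finite_Basis)
  then have "tg 1 \<in> fun_vs.span ((\<lambda>j. gm z (tg (e j))) ` {..<n * n})" using CS_span tg_in by blast
  then obtain c where c: "tg 1 = (\<Sum>j<n * n. fscale (c j) (gm z (tg (e j))))"
    unfolding fv.span_family[OF finite_lessThan] by blast
  define y where "y = (\<Sum>j<n * n. fscale (c j) (tg (e j)))"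
  have y: "y \<in> CS" unfolding y_def by (rule CS_sum) simp
  have "gm z y = tg 1" unfolding y_def gm_sum_right gm_fscale_right c ..
  then have "mm n (\<eta> z) (\<eta> y) = idm n" using \<eta>_mult[OF z y] \<eta>_1 by simp
  then have "mm n (\<eta> y) (\<eta> z) = idm n" by (rule left_inverse_right[OF \<eta>_in[OF z] \<eta>_in[OF y]])
  then show "unit_elt z" unfolding unit_elt_def using y by (intro bexI[of _ "\<eta> y"]) simp_all
qed

lemma ev_unit_elt:
  assumes r: "\<And>b. Fc.rat G u0 (\<lambda>u. x u b)" and x: "\<And>u. x u \<in> CS" and u: "unit_elt (x u0)"
  shows "Fc.ev G u0 (\<lambda>u. unit_elt (x u))"
proof -
  obtain e where e: "bij_betw e {..<n * n} Basis"
    using ex_bij_betw_nat_finite[OF finite_Basis] card_Basis by (auto simp: atLeast0LessThan)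
  show ?thesis unfolding unit_elt_iff_indep[OF e x]
    by (rule Fc.ev_indep[OF finite_Basis]) (use u unit_elt_iff_indep[OF e x] rat_gm_tg[OF r] in auto)
qed

lemma gp_charp: "gp z (charp m c) = pwr z m - (\<Sum>i<m. fscale (c i) (pwr z i))"
  by (simp add: charp_def gp_diff gp_sum gp_monom)

lemma gp_pderiv_charp: "gp z (pderiv (charp m c)) =
    fscale (of_nat m) (pwr z (m - 1)) - (\<Sum>i<m. fscale (of_nat i * c i) (pwr z (i - 1)))"
  by (simp add: charp_def pderiv_diff pderiv_sum pderiv_monom gp_diff gp_sum gp_monom)

definition idem_sys :: "nat \<Rightarrow> (nat \<Rightarrow> 'a \<Rightarrow> 'f alg_closure) \<Rightarrow> bool" where
  "idem_sys m e \<longleftrightarrow> (\<forall>i<m. e i \<in> CS) \<and> (\<forall>i<m. \<forall>j<m. gm (e i) (e j) = (if i = j then e i else 0)) \<and>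
     (\<Sum>i<m. e i) = tg 1 \<and> (\<forall>i<m. fun_vs.dim (gm (e i) ` CS) = n * (n div m))"

lemma etale_iff:
  "E \<in> etale_variety scale Basis n m \<longleftrightarrow> (\<exists>e. idem_sys m e \<and> E = fun_vs.span (e ` {..<m}))"
  unfolding etale_variety_def idem_sys_def by blast

lemma idem_sysD:
  assumes "idem_sys m e" "n = 2 * m" "i < m"
  shows "e i \<in> CS" "j < m \<Longrightarrow> gm (e i) (e j) = (if i = j then e i else 0)"
    "fun_vs.dim (gm (e i) ` CS) = 2 * n"
proof -
  show "e i \<in> CS" "j < m \<Longrightarrow> gm (e i) (e j) = (if i = j then e i else 0)"
    using assms(1,3) by (simp_all add: idem_sys_def)
  have "n div m = 2" using assms(2,3) by simp
  then show "fun_vs.dim (gm (e i) ` CS) = 2 * n" using assms(1,3) by (simp add: idem_sys_def)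
qed

lemma idem_sys_sum: "idem_sys m e \<Longrightarrow> (\<Sum>i<m. e i) = tg 1" by (simp add: idem_sys_def)

lemma idem_indep:
  assumes e: "idem_sys m e" and nm: "n = 2 * m"
  shows "fv.indep_fam {..<m} e"
  unfolding fv.indep_fam_def
proof (intro allI impI ballI)
  fix c i assume c: "(\<Sum>i<m. fscale (c i) (e i)) = 0" and "i \<in> {..<m}"
  then have i: "i < m" by simp
  have "gm (\<Sum>j<m. fscale (c j) (e j)) (e i) = (\<Sum>j<m. fscale (c j) (gm (e j) (e i)))"
    by (simp only: gm_sum_left gm_fscale_left)
  also have "\<dots> = (\<Sum>j<m. if j = i then fscale (c i) (e i) else 0)"
    using idem_sysD(2)[OF e nm _ i] by (intro sum.cong refl) auto
  also have "\<dots> = fscale (c i) (e i)" using i by simp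
  finally have "fscale (c i) (e i) = 0" unfolding c by simp
  moreover have "e i \<noteq> 0"
  proof
    assume "e i = 0"
    then have "gm (e i) ` CS = (\<lambda>_. 0) ` CS" by simp
    also have "\<dots> = {0}" using zero_CS by blast
    finally have "gm (e i) ` CS = {0}" .
    moreover have "fun_vs.dim {0 :: 'a \<Rightarrow> 'f alg_closure} = 0"
      by (rule fun_vs.dim_unique[of "{}"]) (auto simp: fun_vs.independent_empty)
    ultimately show False using idem_sysD(3)[OF e nm i] n_pos by simp
  qed
  ultimately show "c i = 0" by (simp add: fun_vs.scale_eq_0_iff)
qed

lemma idem_combination:
  assumes e: "idem_sys m e" and nm: "n = 2 * m" and z: "z = (\<Sum>i<m. fscale (\<mu> i) (e i))"
  shows "gp z p = (\<Sum>i<m. fscale (poly p (\<mu> i)) (e i))"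
  by (rule gp_diagonal[OF _ _ idem_sys_sum[OF e] z]) (auto simp: idem_sysD[OF e nm])

lemma idem_powers_span:
  assumes e: "idem_sys m e" and nm: "n = 2 * m" and z: "z \<in> fun_vs.span (e ` {..<m})"
    and ind: "fv.indep_fam {..<m} (pwr z)"
  shows "frame_span m (pwr z) = fun_vs.span (e ` {..<m})"
proof -
  obtain \<mu> where z: "z = (\<Sum>i<m. fscale (\<mu> i) (e i))"
    using z unfolding fv.span_family[OF finite_lessThan] by blast
  have "pwr z k \<in> fun_vs.span (e ` {..<m})" for k
  proof -
    have "pwr z k = gp z (monom 1 k)" by (simp add: gp_monom)
    also have "\<dots> = (\<Sum>i<m. fscale (poly (monom 1 k) (\<mu> i)) (e i))" by (rule idem_combination[OF e nm z])
    finally show ?thesis unfolding fv.span_family[OF finite_lessThan]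
      by (rule exI[of _ "\<lambda>i. poly (monom 1 k) (\<mu> i)"])
  qed
  then show ?thesis unfolding frame_span_def
    using card_image_le[of "{..<m}" e] by (intro fv.indep_fam_spans[OF _ ind]) auto
qed

text \<open>A combination of the idempotents with distinct coefficients generates: a relation among
  its first \<open>m\<close> powers is a polynomial of degree below \<open>m\<close> with
  \<open>m\<close> roots.\<close>

lemma idem_generator:
  assumes e: "idem_sys m e" and nm: "n = 2 * m"
  shows "\<exists>z\<in>fun_vs.span (e ` {..<m}). fv.indep_fam {..<m} (pwr z)"
proof -
  obtain \<mu> :: "nat \<Rightarrow> 'f alg_closure" where \<mu>: "inj \<mu>"
    using infinite_countable_subset[OF infinite_alg_closed] by blast
  define z where "z = (\<Sum>i<m. fscale (\<mu> i) (e i))"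
  have "fv.indep_fam {..<m} (pwr z)"
    unfolding fv.indep_fam_def
  proof (intro allI impI ballI)
    fix c k assume c: "(\<Sum>k<m. fscale (c k) (pwr z k)) = 0" and k: "k \<in> {..<m}"
    define p where "p = (\<Sum>k<m. monom (c k) k)"
    have "gp z p = 0" unfolding p_def gp_sum gp_monom by (rule c)
    then have "(\<Sum>i<m. fscale (poly p (\<mu> i)) (e i)) = 0"
      unfolding idem_combination[OF e nm z_def] .
    then have root: "poly p (\<mu> i) = 0" if "i < m" for i
      using fv.indep_famD[OF idem_indep[OF e nm], of "\<lambda>i. poly p (\<mu> i)" i] that by simp
    have cp: "coeff p j = (if j < m then c j else 0)" for j by (auto simp: p_def coeff_sum)
    have "degree p \<le> m - 1" by (rule degree_le) (use k in \<open>auto simp: cp\<close>)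
    then have "degree p < card (\<mu> ` {..<m})" using k \<mu> by (auto simp: card_image inj_on_def)
    then have "p = 0" using root by (intro poly_zero_of_roots[of "\<mu> ` {..<m}"]) auto
    then show "c k = 0" using cp[of k] k by simp
  qed
  moreover have "z \<in> fun_vs.span (e ` {..<m})"
    unfolding fv.span_family[OF finite_lessThan] z_def by (rule exI[of _ \<mu>]) (rule refl)
  ultimately show ?thesis by (intro bexI[of _ z])
qed

lemma ex_alternating_idem:
  assumes e: "idem_sys m e" and nm: "n = 2 * m"
  shows "\<exists>B\<in>mats n. \<exists>B'\<in>mats n. mt B = - B \<and> mm n B' B = idm n \<and> mm n B B' = idm n \<and>
    (\<forall>z\<in>fun_vs.span (e ` {..<m}). mt (mm n (\<eta> z) B) = - mm n (\<eta> z) B)"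
proof -
  have eC: "e i \<in> CS" if "i < m" for i by (rule idem_sysD(1)[OF e nm that])
  have "\<exists>B\<in>mats n. \<exists>B'\<in>mats n. mt B = - B \<and> mm n B' B = idm n \<and> mm n B B' = idm n \<and>
    (\<forall>i<m. mt (mm n (\<eta> (e i)) B) = - mm n (\<eta> (e i)) B)"
  proof (rule ex_alternating_compatible[OF n_pos])
    show "mm n (\<eta> (e i)) (\<eta> (e j)) = (if i = j then \<eta> (e i) else 0)" if "i < m" "j < m" for i j
      using idem_sysD(2)[OF e nm that] \<eta>_mult[OF eC[OF that(1)] eC[OF that(2)]] by (auto simp: \<eta>_0)
    have "(\<Sum>i<m. \<eta> (e i)) = (\<Sum>i<m. fscale 1 (\<eta> (e i)))" by simp
    also have "\<dots> = \<eta> (\<Sum>i<m. fscale 1 (e i))" by (rule \<eta>_sum[symmetric]) (auto simp: eC)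
    also have "\<dots> = idm n" by (simp add: idem_sys_sum[OF e] \<eta>_1)
    finally show "(\<Sum>i<m. \<eta> (e i)) = idm n" .
    show "fun_vs.dim (mm n (\<eta> (e i)) ` mats n) = 2 * n" if "i < m" for i
    proof -
      have "gm (e i) ` CS \<subseteq> CS" by (rule image_subsetI) simp
      from dim_\<eta>[OF this] show ?thesis
        using \<eta>_left_ideal[OF eC[OF that]] idem_sysD(3)[OF e nm that] by simp
    qed
  qed (simp add: eC)
  then obtain B B' where B: "B \<in> mats n" "B' \<in> mats n" "mt B = - B" "mm n B' B = idm n" "mm n B B' = idm n"
    and c: "\<And>i. i < m \<Longrightarrow> mt (mm n (\<eta> (e i)) B) = - mm n (\<eta> (e i)) B" by blast
  have alt: "mt (mm n (\<eta> z) B) = - mm n (\<eta> z) B" if zs: "z \<in> fun_vs.span (e ` {..<m})" for z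
  proof -
    obtain \<mu> where z: "z = (\<Sum>i<m. fscale (\<mu> i) (e i))"
      using zs unfolding fv.span_family[OF finite_lessThan] by blast
    have "\<eta> z = (\<Sum>i<m. fscale (\<mu> i) (\<eta> (e i)))" unfolding z by (rule \<eta>_sum) (auto simp: eC)
    then have zB: "mm n (\<eta> z) B = (\<Sum>i<m. fscale (\<mu> i) (mm n (\<eta> (e i)) B))"
      by (simp only: mm_sum_left mm_fscale_left)
    have "mt (mm n (\<eta> z) B) = (\<Sum>i<m. - fscale (\<mu> i) (mm n (\<eta> (e i)) B))"
      unfolding zB mt_sum mt_fscale by (intro sum.cong refl) (simp add: c)
    then show ?thesis unfolding zB by (simp only: sum_negf)
  qed
  show ?thesis
  proof (rule bexI[of _ B], rule bexI[of _ B'], intro conjI ballI)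
    show "mt (mm n (\<eta> z) B) = - mm n (\<eta> z) B" if "z \<in> fun_vs.span (e ` {..<m})" for z
      using that by (rule alt)
  qed (rule B)+
qed

text \<open>Supplies at a given etale subalgebra the separability condition that is then spread over
  a neighbourhood of the parameter.\<close>

lemma unit_pderiv_of_etale:
  assumes nm: "n = 2 * m" and z: "z \<in> CS" and ind: "fv.indep_fam {..<m} (pwr z)"
    and dep: "pwr z m = (\<Sum>i<m. fscale (c i) (pwr z i))"
    and et: "frame_span m (pwr z) \<in> etale_variety scale Basis n m"
  shows "unit_elt (gp z (pderiv (charp m c)))"
proof -
  obtain e where e: "idem_sys m e" and sp: "frame_span m (pwr z) = fun_vs.span (e ` {..<m})"
    using et unfolding etale_iff by blast
  have "pwr z 1 \<in> frame_span m (pwr z)"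
  \<comment> \<open>For \<open>m = 1\<close> the frame consists of the unit alone, and
    \<open>z\<close> lies in its span by the given relation.\<close>
  proof (cases "m = 1")
    case True
    then have "pwr z 1 = (\<Sum>i<m. fscale (c i) (pwr z i))" using dep by simp
    then show ?thesis unfolding frame_span_def fv.span_family[OF finite_lessThan] by (rule exI[of _ c])
  next
    case False
    then have "1 < m" using n_pos nm by simp
    then show ?thesis unfolding frame_span_def by (intro fun_vs.span_base imageI) simp
  qed
  moreover have "pwr z 1 = z" using z by (simp add: pwr_Suc pwr_0 gm_1_right)
  ultimately have "z \<in> fun_vs.span (e ` {..<m})" unfolding sp by simp
  then obtain \<mu> where \<mu>: "z = (\<Sum>i<m. fscale (\<mu> i) (e i))"
    unfolding fv.span_family[OF finite_lessThan] by blast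
  have "gp z (charp m c) = 0" unfolding gp_charp using dep by simp
  then show ?thesis unfolding unit_elt_def
    by (intro separable_of_diagonal[OF _ _ idem_sys_sum[OF e] \<mu> idem_indep[OF e nm] ind degree_charp])
      (auto simp: idem_sysD[OF e nm])
qed

end

context split_csa
begin

lemma FK_closed: "a \<in> FK \<Longrightarrow> b \<in> FK \<Longrightarrow> a + b \<in> FK \<and> a * b \<in> FK"
  by (auto simp flip: to_ac_add to_ac_mult)

lemma of_nat_FK: "of_nat k \<in> FK"
  by (rule range_eqI[of _ _ "of_nat k"]) simp

lemma tg_of_rational:
  assumes z: "z \<in> CS" and r: "\<And>b. z b \<in> FK"
  shows "\<exists>x. z = tg x"
proof -
  have "tg (\<Sum>b\<in>Basis. scale (of_ac (z b)) b) = (\<Sum>b\<in>Basis. fscale (z b) (tg b))"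
    unfolding tg_sum tg_scale using r by (intro sum.cong refl) (simp add: to_ac_of_ac)
  also have "\<dots> = z" by (rule CS_expand[OF z, symmetric])
  finally show ?thesis by (metis)
qed

lemma \<eta>_pwr: "z \<in> CS \<Longrightarrow> \<eta> (pwr z k) = mpow n (\<eta> z) k"
  by (induction k) (simp_all add: pwr_0 pwr_Suc \<eta>_1 \<eta>_mult mpow_Suc)

lemma frame_iff_indep: "(\<And>j. w j \<in> CS) \<Longrightarrow> frame Basis m w \<longleftrightarrow> fv.indep_fam {..<m} w"
  by (simp add: frame_def fv.indep_fam_iff)

text \<open>An injective linear map of a finite-dimensional space is surjective. So the quotient
  exists in the original algebra although invertibility is tested over the closure.\<close>

lemma ex_left_division:
  assumes "unit_elt (tg a)"
  shows "\<exists>t. x = a * t"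
proof -
  have "inj (\<lambda>t. a * t)"
  proof (rule injI)
    fix t t' assume "a * t = a * t'"
    then have "a * (t - t') = 0" by (simp add: right_diff_distrib)
    then have "gm (tg a) (tg (t - t')) = 0" by (simp only: tg_mult[symmetric] tg_0)
    then have "tg (t - t') = 0" by (rule unit_elt_cancel[OF assms tg_in tg_in])
    then have "tg (t - t') = tg 0" by (simp only: tg_0)
    then have "t - t' = 0" by (rule tg_inj)
    then show "t = t'" by simp
  qed
  moreover have "Vector_Spaces.linear scale scale (\<lambda>t. a * t)"
    unfolding Vector_Spaces.linear_iff by (simp add: distrib_left scale_mult_right vector_space_axioms)
  ultimately have "surj (\<lambda>t. a * t)" by (rule linear_inj_imp_surj[rotated])
  then show ?thesis by (auto simp: surj_def)
qed

end

context symplectic_form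
begin

lemma symmetric_mat_iff: "symmetric_mat M \<longleftrightarrow> M \<in> mats n \<and> mm n J (mt M) = mm n M J"
proof -
  have "mt (mm n M J) = - mm n J (mt M)" by (simp only: mt_mm mt_J mm_uminus_left)
  then show ?thesis unfolding symmetric_mat_def by simp
qed

text \<open>Since \<open>x a = a T a\<close>, the involution sends it to \<open>a T* a\<close>,
  where \<open>T*\<close> is the image of \<open>T\<close>; symmetry of \<open>x a\<close> and
  cancellation of \<open>a\<close> on both sides give \<open>T* = T\<close>.\<close>

lemma symmetric_quotient:
  assumes a: "symmetric_mat a" and xa: "symmetric_mat (mm n x a)" and x: "x = mm n a T"
    and T: "T \<in> mats n" and N: "N \<in> mats n" "mm n N a = idm n"
  shows "symmetric_mat T"
proof -
  have aM: "a \<in> mats n" and aJ: "mm n J (mt a) = mm n a J" using a by (simp_all add: symmetric_mat_iff)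
  have aN: "mm n (mt a) (mt N) = idm n" using N(2) by (metis mt_mm mt_idm)
  have "mm n a (mm n (mm n J (mt T)) (mt a)) = mm n (mm n a J) (mm n (mt T) (mt a))" by (simp only: mm_assoc)
  also have "\<dots> = mm n (mm n J (mt a)) (mt x)" unfolding aJ x mt_mm ..
  also have "\<dots> = mm n J (mt (mm n x a))" by (simp only: mt_mm mm_assoc)
  also have "\<dots> = mm n (mm n x a) J" using xa by (simp add: symmetric_mat_iff)
  also have "\<dots> = mm n a (mm n T (mm n a J))" unfolding x by (simp only: mm_assoc)
  also have "\<dots> = mm n a (mm n (mm n T J) (mt a))" unfolding aJ[symmetric] by (simp only: mm_assoc)
  finally have "mm n N (mm n a (mm n (mm n J (mt T)) (mt a))) = mm n N (mm n a (mm n (mm n T J) (mt a)))" by simp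
  then have "mm n (mm n J (mt T)) (mt a) = mm n (mm n T J) (mt a)"
    unfolding mm_assoc[of n N a, symmetric] N(2) using aM T by (simp add: mm_idl)
  then have "mm n (mm n (mm n J (mt T)) (mt a)) (mt N) = mm n (mm n (mm n T J) (mt a)) (mt N)" by simp
  then have "mm n J (mt T) = mm n T J"
    unfolding mm_assoc[of n _ "mt a" "mt N"] aN using T by (simp add: mm_idr)
  then show ?thesis using T by (simp add: symmetric_mat_iff)
qed

text \<open>The alternating parts of the \<open>v i\<close> have the shape \<open>s i J\<close>. The
  same family \<open>s\<close> spans the symmetric matrices over the closure and \<open>S\<close>
  over the base field, so one parameter space serves general and rational points.\<close>

lemma ex_symmetric_basis:
  "\<exists>s :: nat \<Rightarrow> 'a. (\<forall>i<n * n. s i \<in> S) \<and>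
    (\<forall>M. symmetric_mat M \<longrightarrow> (\<exists>c. M = (\<Sum>i<n * n. fscale (c i) (\<iota> (s i))))) \<and>
    (\<forall>a\<in>S. \<exists>c. a = (\<Sum>i<n * n. scale (c i) (s i)))"
proof -
  have "\<forall>i. \<exists>a. i < n * n \<longrightarrow> a \<in> S \<and> v i - mt (v i) = mm n (\<iota> a) J" using alt_Vf_S[OF v_alt] by blast
  from choice[OF this] obtain s where s: "\<And>i. i < n * n \<Longrightarrow> s i \<in> S \<and> v i - mt (v i) = mm n (\<iota> (s i)) J" by blast
  have sp: "M = (\<Sum>i<n * n. fscale (co (mm n M J) i / 2) (\<iota> (s i)))" if sM: "symmetric_mat M" for M
  proof -
    have M: "M \<in> mats n" "mt (mm n M J) = - mm n M J" using sM by (auto simp: symmetric_mat_def)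
    have MJ: "mm n M J = (\<Sum>i<n * n. fscale (co (mm n M J) i / 2) (v i - mt (v i)))"
      using M by (intro alternating_span) simp_all
    have "M = mm n (mm n M J) J'" using M by (simp add: mm_assoc JJ' mm_idr)
    also have "\<dots> = (\<Sum>i<n * n. fscale (co (mm n M J) i / 2) (mm n (v i - mt (v i)) J'))"
      by (subst MJ) (simp only: mm_sum_left mm_fscale_left)
    also have "\<dots> = (\<Sum>i<n * n. fscale (co (mm n M J) i / 2) (\<iota> (s i)))"
      using s by (intro sum.cong refl) (simp add: mm_assoc JJ' mm_idr)
    finally show ?thesis .
  qed
  have "\<exists>c. a = (\<Sum>i<n * n. scale (c i) (s i))" if aS: "a \<in> S" for a
  proof -
    have "mm n (\<iota> a) J = mm n (mm n (\<iota> a) J) (mt (\<iota> 1))" by (simp add: \<iota>_1 mm_idr)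
    also have "\<dots> \<in> Vf" using J_alt by (intro Vf_act) (simp add: alt_Vf_def)
    finally obtain c where "mm n (\<iota> a) J = (\<Sum>j<n * n. fscale (to_ac (c j)) (v j))" unfolding Vf_iff by blast
    then have c: "co (mm n (\<iota> a) J) i = to_ac (c i)" if "i < n * n" for i using that by (rule co_eqI)
    have "\<iota> a = (\<Sum>i<n * n. fscale (co (mm n (\<iota> a) J) i / 2) (\<iota> (s i)))"
      by (rule sp) (use aS in \<open>simp add: S_def\<close>)
    also have "\<dots> = (\<Sum>i<n * n. fscale (to_ac (c i / 2)) (\<iota> (s i)))"
      by (intro sum.cong refl) (simp add: c to_ac_divide)
    also have "\<dots> = \<iota> (\<Sum>i<n * n. scale (c i / 2) (s i))" by (rule \<iota>_sum[symmetric])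
    finally have "a = (\<Sum>i<n * n. scale (c i / 2) (s i))" by (rule \<iota>_inj)
    then show ?thesis by (rule exI[of _ "\<lambda>i. c i / 2"])
  qed
  moreover have "\<exists>c. M = (\<Sum>i<n * n. fscale (c i) (\<iota> (s i)))" if "symmetric_mat M" for M
    by (rule exI[of _ "\<lambda>i. co (mm n M J) i / 2"]) (rule sp[OF that])
  ultimately show ?thesis using s by (intro exI[of _ s]) simp
qed

end

section \<open>The parametrization\<close>

text \<open>A parameter \<open>u\<close> lists the coefficients of \<open>a\<close> with respect to the spanning family \<open>s\<close> of the
  symmetric elements, followed by those of \<open>t\<close>.\<close>

locale etale_chart = symplectic_form scale Basis n \<eta> v J J'
  for scale :: "'f::field \<Rightarrow> 'a::ring_1 \<Rightarrow> 'a" and Basis :: "'a set" and n :: nat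
    and \<eta> :: "('a \<Rightarrow> 'f alg_closure) \<Rightarrow> 'f alg_closure mtx" and v :: "nat \<Rightarrow> 'f alg_closure mtx"
    and J J' :: "'f alg_closure mtx" +
  fixes s :: "nat \<Rightarrow> 'a" and m :: nat
  assumes nm: "n = 2 * m" and s_S: "\<And>i. i < n * n \<Longrightarrow> s i \<in> S"
    and s_span: "\<And>M. symmetric_mat M \<Longrightarrow> \<exists>c. M = (\<Sum>i<n * n. fscale (c i) (\<iota> (s i)))"
    and s_span_F: "\<And>a. a \<in> S \<Longrightarrow> \<exists>c. a = (\<Sum>i<n * n. scale (c i) (s i))"
begin

abbreviation "ET \<equiv> etale_variety scale Basis n m"

abbreviation coord_fns :: "((nat \<Rightarrow> 'f alg_closure) \<Rightarrow> 'f alg_closure) set" where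
  "coord_fns \<equiv> {\<lambda>u. u i | i. i \<in> {..<2 * (n * n)}}"

definition comb :: "nat \<Rightarrow> (nat \<Rightarrow> 'f alg_closure) \<Rightarrow> 'a \<Rightarrow> 'f alg_closure" where
  "comb d u = (\<Sum>i<n * n. fscale (u (d + i)) (tg (s i)))"

definition gen_elt :: "(nat \<Rightarrow> 'f alg_closure) \<Rightarrow> 'a \<Rightarrow> 'f alg_closure" where
  "gen_elt u = gm (comb 0 u) (comb (n * n) u)"

lemma comb_in [simp]: "comb d u \<in> CS"
  unfolding comb_def by (rule CS_sum) simp

lemma gen_elt_in [simp]: "gen_elt u \<in> CS"
  by (simp add: gen_elt_def)

lemma pfn_comb: "d + n * n \<le> 2 * (n * n) \<Longrightarrow> pfn FK coord_fns (\<lambda>u. comb d u b)"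
  unfolding comb_def sum_fun_apply fun_app tg_apply
  by (intro Fc.pfn_sum pfn.mult pfn.gen pfn.const rangeI) auto

lemma pfn_pwr_gen_elt: "pfn FK coord_fns (\<lambda>u. pwr (gen_elt u) k b)"
  unfolding gen_elt_def by (intro pfn_pwr pfn_gm pfn_comb) simp_all

lemma \<eta>_comb: "\<eta> (comb d u) = (\<Sum>i<n * n. fscale (u (d + i)) (\<iota> (s i)))"
  unfolding comb_def \<iota>_def by (rule \<eta>_sum) auto

lemma symmetric_comb: "symmetric_mat (\<eta> (comb d u))"
proof -
  have "mt (mm n (\<eta> (comb d u)) J) = (\<Sum>i<n * n. - fscale (u (d + i)) (mm n (\<iota> (s i)) J))"
    unfolding \<eta>_comb mm_sum_left mm_fscale_left mt_sum mt_fscale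
    using s_S by (intro sum.cong refl) (simp add: S_def symmetric_mat_def)
  also have "\<dots> = - mm n (\<eta> (comb d u)) J"
    unfolding \<eta>_comb mm_sum_left mm_fscale_left by (rule sum_negf)
  finally show ?thesis by (simp add: symmetric_mat_def)
qed

lemma comb_scale: "comb d (\<lambda>i. k * u i) = fscale k (comb d u)"
  unfolding comb_def fun_vs.scale_sum_right fun_vs.scale_scale ..

lemma gen_elt_scale: "gen_elt (\<lambda>i. k * u i) = fscale (k ^ 2) (gen_elt u)"
  by (simp add: gen_elt_def comb_scale gm_fscale_left gm_fscale_right power2_eq_square)

lemma \<eta>_gen_elt: "\<eta> (gen_elt u) = mm n (\<eta> (comb 0 u)) (\<eta> (comb (n * n) u))"
  by (simp add: gen_elt_def \<eta>_mult)

text \<open>The element is a product of the alternating matrices \<open>a J\<close> and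
  \<open>J' T\<close>, so a polynomial of degree at most \<open>m\<close> kills it. Independence of
  the first \<open>m\<close> powers makes the degree equal to \<open>m\<close>.\<close>

lemma pwr_dependent:
  assumes unit: "unit_elt (comb 0 u)" and ind: "fv.indep_fam {..<m} (pwr (gen_elt u))"
  shows "\<exists>c. pwr (gen_elt u) m = (\<Sum>i<m. fscale (c i) (pwr (gen_elt u) i))"
proof -
  obtain N where N: "N \<in> mats n" "mm n N (\<eta> (comb 0 u)) = idm n" using unit unfolding unit_elt_def by blast
  define B where "B = mm n (\<eta> (comb 0 u)) J"
  define T where "T = \<eta> (comb (n * n) u)"
  have B: "B \<in> mats n" "mt B = - B" using symmetric_comb[of 0 u] by (simp_all add: B_def symmetric_mat_def)
  have T: "T \<in> mats n" "mm n J (mt T) = mm n T J" using symmetric_comb[of "n * n" u] by (simp_all add: T_def symmetric_mat_iff)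
  have C: "mt (mm n J' T) = - mm n J' T"
  proof -
    have "mm n (mt T) J' = mm n J' (mm n (mm n J (mt T)) J')" using T(1) by (simp add: mm_assoc[symmetric] J'J mm_idl)
    also have "\<dots> = mm n J' T" unfolding T(2) using T(1) by (simp add: mm_assoc JJ' mm_idr)
    finally show ?thesis by (simp add: mt_mm mt_J' mm_uminus_right)
  qed
  have "mm n (mm n J' N) B = mm n J' (mm n (mm n N (\<eta> (comb 0 u))) J)" by (simp only: B_def mm_assoc)
  then have "mm n (mm n J' N) B = idm n" by (simp add: N(2) mm_idl J'J)
  moreover have "mm n B (mm n J' T) = \<eta> (gen_elt u)"
  proof -
    have "mm n B (mm n J' T) = mm n (mm n (\<eta> (comb 0 u)) (mm n J J')) T" by (simp only: B_def mm_assoc)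
    then show ?thesis by (simp add: JJ' mm_idr \<eta>_gen_elt T_def)
  qed
  ultimately obtain p where p: "p \<noteq> 0" "2 * degree p \<le> n"
    "(\<Sum>i\<le>degree p. fscale (coeff p i) (mpow n (\<eta> (gen_elt u)) i)) = 0"
    using alternating_product_annihilator[OF two_ac B mm_in[OF J'_in T(1)] C] by auto
  have "\<eta> (gp (gen_elt u) p) = (\<Sum>i<Suc (degree p). fscale (coeff p i) (\<eta> (pwr (gen_elt u) i)))"
    unfolding gp_expand[OF lessI] by (rule \<eta>_sum) auto
  also have "\<dots> = 0" using p(3) by (simp add: \<eta>_pwr lessThan_Suc_atMost)
  finally have "\<eta> (gp (gen_elt u) p) = \<eta> 0" by (simp add: \<eta>_0)
  then have g0: "gp (gen_elt u) p = 0" by (rule \<eta>_inj[OF gp_in zero_CS])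
  then have "\<not> degree p < m" using gp_minimal[OF ind] p(1) by blast
  then have d: "degree p = m" using p(2) nm by simp
  define l where "l = lead_coeff p"
  have l: "l \<noteq> 0" "coeff p m = l" using p(1) d by (auto simp: l_def)
  have "gp (gen_elt u) p = (\<Sum>i<Suc m. fscale (coeff p i) (pwr (gen_elt u) i))" using d by (intro gp_expand) simp
  then have e: "fscale l (pwr (gen_elt u) m) = - (\<Sum>i<m. fscale (coeff p i) (pwr (gen_elt u) i))"
    using g0 l(2) by (simp add: eq_neg_iff_add_eq_0 add.commute)
  have "pwr (gen_elt u) m = fscale (inverse l) (fscale l (pwr (gen_elt u) m))" using l(1) by simp
  also have "\<dots> = (\<Sum>i<m. fscale (- (inverse l * coeff p i)) (pwr (gen_elt u) i))"
    unfolding e by (simp add: fun_vs.scale_minus_right fun_vs.scale_sum_right sum_negf)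
  finally show ?thesis by (rule exI[of _ "\<lambda>i. - (inverse l * coeff p i)"])
qed

text \<open>Both \<open>(a T) (a J)\<close> and \<open>(a J) (a T)^T\<close> equal
  \<open>a T J a^T\<close>, because \<open>a\<close> and \<open>T\<close> are symmetric. So the
  generator is self-adjoint for \<open>a J\<close>, and the criterion for separable elements
  applies.\<close>

lemma etale_of_unit:
  assumes unit: "unit_elt (comb 0 u)" and ind: "fv.indep_fam {..<m} (pwr (gen_elt u))"
    and dep: "pwr (gen_elt u) m = (\<Sum>i<m. fscale (c i) (pwr (gen_elt u) i))"
    and du: "unit_elt (gp (gen_elt u) (pderiv (charp m c)))"
  shows "frame_span m (pwr (gen_elt u)) \<in> ET"
proof -
  obtain N where N: "N \<in> mats n" "mm n N (\<eta> (comb 0 u)) = idm n" using unit unfolding unit_elt_def by blast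
  obtain N2 where N2: "N2 \<in> mats n" "mm n N2 (\<eta> (gp (gen_elt u) (pderiv (charp m c)))) = idm n" using du unfolding unit_elt_def by blast
  define a where "a = \<eta> (comb 0 u)"
  define T where "T = \<eta> (comb (n * n) u)"
  have a: "a \<in> mats n" "mm n J (mt a) = mm n a J" using symmetric_comb[of 0 u] by (simp_all add: a_def symmetric_mat_iff)
  have T: "mm n J (mt T) = mm n T J" using symmetric_comb[of "n * n" u] by (simp_all add: T_def symmetric_mat_iff)
  show ?thesis
  proof (rule etale_of_separable[OF nm two gen_elt_in ind degree_charp _ _ N2])
    show "lead_coeff (charp m c) = 1" by (simp add: degree_charp coeff_charp)
    show "gp (gen_elt u) (charp m c) = 0" using dep by (simp add: gp_charp)
    show "mm n a J \<in> mats n" "mm n J' N \<in> mats n" using a N by simp_all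
    show "mt (mm n a J) = - mm n a J" using symmetric_comb[of 0 u] by (simp add: a_def symmetric_mat_def)
    have "mm n a N = idm n" by (rule left_inverse_right[OF N(1) a(1)]) (use N in \<open>simp add: a_def\<close>)
    moreover have "mm n (mm n a J) (mm n J' N) = mm n (mm n a (mm n J J')) N" by (simp only: mm_assoc)
    ultimately show "mm n (mm n a J) (mm n J' N) = idm n" using a by (simp add: JJ' mm_idr)
    have "mm n (mm n a J) (mt (\<eta> (gen_elt u))) = mm n a (mm n (mm n J (mt T)) (mt a))"
      by (simp only: \<eta>_gen_elt mt_mm mm_assoc a_def T_def)
    also have "\<dots> = mm n a (mm n T (mm n J (mt a)))" unfolding T by (simp only: mm_assoc)
    also have "\<dots> = mm n (\<eta> (gen_elt u)) (mm n a J)" unfolding a(2) by (simp only: \<eta>_gen_elt mm_assoc a_def T_def)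
    finally show "mm n (\<eta> (gen_elt u)) (mm n a J) = mm n (mm n a J) (mt (\<eta> (gen_elt u)))" by (rule sym)
  qed
qed

text \<open>Invertibility of the first factor makes the form \<open>a J\<close> nondegenerate;
  independence makes the powers a frame, so that the point depends on the parameter by
  polynomials.\<close>

definition good :: "('a \<Rightarrow> 'f alg_closure) set set \<Rightarrow> (nat \<Rightarrow> 'f alg_closure) \<Rightarrow> bool" where
  "good U u \<longleftrightarrow> unit_elt (comb 0 u) \<and> fv.indep_fam {..<m} (pwr (gen_elt u)) \<and> frame_span m (pwr (gen_elt u)) \<in> U"

text \<open>Goodness is open over the base field. The relation for the \<open>m\<close>-th power
  persists by \<open>pwr_dependent\<close>; its coefficients are not polynomials, but a dual frame
  makes them rational near \<open>u0\<close>. So the derivative of the polynomial of the relation,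
  evaluated at the generator, is rational too and stays invertible, which keeps the subalgebra
  etale.\<close>

lemma ev_good:
  assumes W: "grass_open Basis m W" and u0: "good (ET \<inter> W) u0"
  shows "Fc.ev coord_fns u0 (good (ET \<inter> W))"
proof -
  have unit: "unit_elt (comb 0 u0)" and ind: "fv.indep_fam {..<m} (pwr (gen_elt u0))"
    and et: "frame_span m (pwr (gen_elt u0)) \<in> ET" "frame_span m (pwr (gen_elt u0)) \<in> W"
    using u0 by (auto simp: good_def)
  obtain c0 where c0: "pwr (gen_elt u0) m = (\<Sum>i<m. fscale (c0 i) (pwr (gen_elt u0) i))"
    using pwr_dependent[OF unit ind] by blast
  have r: "Fc.rat coord_fns u0 (\<lambda>u. pwr (gen_elt u) k b)" for k b by (rule Fc.rat_pfn[OF pfn_pwr_gen_elt])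
  have "\<exists>f. (\<forall>j<m. \<forall>i\<in>Basis. Fc.rat coord_fns u0 (\<lambda>u. f j u i)) \<and>
    Fc.ev coord_fns u0 (\<lambda>u. \<forall>j<m. \<forall>l<m. (\<Sum>i\<in>Basis. f j u i * pwr (gen_elt u) l i) = (if j = l then 1 else 0))"
    by (rule Fc.dual_frame[OF finite_Basis, where v = "\<lambda>j u. pwr (gen_elt u) j"]) (use r ind in simp_all)
  then obtain f where fr': "\<forall>j<m. \<forall>i\<in>Basis. Fc.rat coord_fns u0 (\<lambda>u. f j u i)"
    and fd: "Fc.ev coord_fns u0 (\<lambda>u. \<forall>j<m. \<forall>l<m. (\<Sum>i\<in>Basis. f j u i * pwr (gen_elt u) l i) = (if j = l then 1 else 0))"
    by (elim exE conjE)
  have fr: "Fc.rat coord_fns u0 (\<lambda>u. f j u i)" if "j < m" "i \<in> Basis" for j i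
    using fr' that by simp
  define c where "c j u = (\<Sum>b\<in>Basis. f j u b * pwr (gen_elt u) m b)" for j u
  have cr: "Fc.rat coord_fns u0 (c j)" if "j < m" for j
    unfolding c_def using that by (intro Fc.rat_sum Fc.rat_mult fr r)
  \<comment> \<open>Away from the neighbourhood on which \<open>f\<close> is dual to the powers,
    \<open>y u\<close> has no meaning; \<open>yc\<close> identifies it with the derivative of the
    true relation on that neighbourhood.\<close>
  define y where "y u = gp (gen_elt u) (pderiv (charp m (\<lambda>j. c j u)))" for u
  have yc: "y u = gp (gen_elt u) (pderiv (charp m c'))"
    if d: "\<forall>j<m. \<forall>l<m. (\<Sum>i\<in>Basis. f j u i * pwr (gen_elt u) l i) = (if j = l then 1 else 0)"
      and c': "pwr (gen_elt u) m = (\<Sum>i<m. fscale (c' i) (pwr (gen_elt u) i))" for u c'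
  proof -
    have "c' j = c j u" if "j < m" for j
      unfolding c_def by (rule Fc.dual_frame_coeff[OF finite_Basis d c' that])
    then have "charp m (\<lambda>j. c j u) = charp m c'" unfolding charp_def by simp
    then show ?thesis by (simp add: y_def)
  qed
  have "unit_elt (y u0)"
    unfolding yc[OF Fc.ev_at[OF fd] c0] by (rule unit_pderiv_of_etale[OF nm gen_elt_in ind c0 et(1)])
  moreover have "Fc.rat coord_fns u0 (\<lambda>u. y u b)" for b
    unfolding y_def gp_pderiv_charp fun_app sum_fun_apply
    by (intro Fc.rat_diff Fc.rat_mult Fc.rat_sum Fc.rat_const of_nat_FK r) (rule cr, simp)
  ultimately have ey: "Fc.ev coord_fns u0 (\<lambda>u. unit_elt (y u))"
    by (intro ev_unit_elt) (simp_all add: y_def)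
  have eu: "Fc.ev coord_fns u0 (\<lambda>u. unit_elt (comb 0 u))"
  proof (rule ev_unit_elt)
    show "Fc.rat coord_fns u0 (\<lambda>u. comb 0 u b)" for b by (rule Fc.rat_pfn[OF pfn_comb]) simp
  qed (simp_all add: unit)
  have ei: "Fc.ev coord_fns u0 (\<lambda>u. fv.indep_fam {..<m} (pwr (gen_elt u)))"
    by (rule Fc.ev_indep[OF finite_Basis, where v = "\<lambda>j u. pwr (gen_elt u) j"]) (use r ind in simp_all)
  obtain P where P: "\<And>p. p \<in> P \<Longrightarrow> polyfun Basis m p"
    "\<And>u. frame Basis m u \<Longrightarrow> frame_span m u \<in> W \<longleftrightarrow> (\<exists>p\<in>P. p u \<noteq> 0)"
    using W unfolding grass_open_def by blast
  have fi: "frame Basis m (pwr (gen_elt u)) \<longleftrightarrow> fv.indep_fam {..<m} (pwr (gen_elt u))" for u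
    by (rule frame_iff_indep) simp
  obtain p where p: "p \<in> P" "p (pwr (gen_elt u0)) \<noteq> 0" using P(2)[of "pwr (gen_elt u0)"] fi ind et(2) by blast
  have "pfn FK coord_fns (\<lambda>u. p (pwr (gen_elt u)))"
    by (rule pfn_polyfun[OF P(1)[OF p(1)]]) (rule pfn_pwr_gen_elt)
  then have eW: "Fc.ev coord_fns u0 (\<lambda>u. p (pwr (gen_elt u)) \<noteq> 0)" using p(2) by (intro Fc.rat_nonzero Fc.rat_pfn)
  show ?thesis
  proof (rule Fc.ev_mono[OF Fc.ev_conj[OF Fc.ev_conj[OF ey fd] Fc.ev_conj[OF eu Fc.ev_conj[OF ei eW]]]])
    fix u assume u: "(unit_elt (y u) \<and> (\<forall>j<m. \<forall>l<m. (\<Sum>i\<in>Basis. f j u i * pwr (gen_elt u) l i) = (if j = l then 1 else 0))) \<and>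
      unit_elt (comb 0 u) \<and> fv.indep_fam {..<m} (pwr (gen_elt u)) \<and> p (pwr (gen_elt u)) \<noteq> 0"
    obtain c' where c': "pwr (gen_elt u) m = (\<Sum>i<m. fscale (c' i) (pwr (gen_elt u) i))"
      using pwr_dependent[of u] u by blast
    have "frame_span m (pwr (gen_elt u)) \<in> ET"
      by (rule etale_of_unit[OF _ _ c']) (use u yc[OF _ c'] in auto)
    moreover have "frame_span m (pwr (gen_elt u)) \<in> W" using P(2)[of "pwr (gen_elt u)"] fi u p(1) by blast
    ultimately show "good (ET \<inter> W) u" using u by (simp add: good_def)
  qed
qed

text \<open>Scaling the parameter scales the generator by a square and leaves its subalgebra
  unchanged. This homogeneity allows curves to be parametrized by the projective line.\<close>

lemma good_scale:
  assumes k: "k \<noteq> 0"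
  shows "frame_span m (pwr (gen_elt (\<lambda>i. k * u i))) = frame_span m (pwr (gen_elt u))" (is ?A)
    and "good U u \<Longrightarrow> good U (\<lambda>i. k * u i)"
proof -
  let ?k = "k ^ 2"
  have pw: "pwr (gen_elt (\<lambda>i. k * u i)) j = fscale (?k ^ j) (pwr (gen_elt u) j)" for j
    by (simp add: gen_elt_scale pwr_fscale)
  show A: ?A
    unfolding frame_span_def
  proof (rule antisym; rule fun_vs.span_minimal[OF _ fun_vs.subspace_span]; rule image_subsetI)
    fix j assume j: "j \<in> {..<m}"
    show "pwr (gen_elt (\<lambda>i. k * u i)) j \<in> fun_vs.span (pwr (gen_elt u) ` {..<m})"
      unfolding pw using j by (intro fun_vs.span_scale fun_vs.span_base imageI)
    have "pwr (gen_elt u) j = fscale (inverse (?k ^ j)) (pwr (gen_elt (\<lambda>i. k * u i)) j)" unfolding pw using k by simp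
    also have "\<dots> \<in> fun_vs.span (pwr (gen_elt (\<lambda>i. k * u i)) ` {..<m})"
      using j by (intro fun_vs.span_scale fun_vs.span_base imageI)
    finally show "pwr (gen_elt u) j \<in> fun_vs.span (pwr (gen_elt (\<lambda>i. k * u i)) ` {..<m})" .
  qed
  assume g: "good U u"
  then have ind: "fv.indep_fam {..<m} (pwr (gen_elt u))" by (simp add: good_def)
  have "fv.indep_fam {..<m} (pwr (gen_elt (\<lambda>i. k * u i)))"
    unfolding fv.indep_fam_def pw fun_vs.scale_scale
  proof (intro allI impI ballI)
    fix c j assume "(\<Sum>j<m. fscale (c j * ?k ^ j) (pwr (gen_elt u) j)) = 0" and "j \<in> {..<m}"
    then have "c j * ?k ^ j = 0" by (rule fv.indep_famD[OF ind])
    then show "c j = 0" using k by simp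
  qed
  moreover have "unit_elt (comb 0 (\<lambda>i. k * u i))"
  proof -
    obtain N where "N \<in> mats n" "mm n N (\<eta> (comb 0 u)) = idm n" using g unfolding good_def unit_elt_def by blast
    then show ?thesis unfolding unit_elt_def comb_scale using k
      by (intro bexI[of _ "fscale (inverse k) N"])
        (simp_all add: \<eta>_scale mm_fscale_left mm_fscale_right fun_vs.subspace_scale[OF subspace_mats])
  qed
  ultimately show "good U (\<lambda>i. k * u i)" using g A by (simp add: good_def)
qed

text \<open>Over the closure every alternating \<open>B\<close> compatible with the idempotents has
  the shape \<open>a J\<close> with \<open>a = B J'\<close>, and dividing the generator by
  \<open>a\<close> on the left gives the second factor.\<close>

lemma ex_params:
  assumes E: "E \<in> ET"
  shows "\<exists>u. good {E} u"
proof -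
  obtain e where e: "idem_sys m e" "E = fun_vs.span (e ` {..<m})" using E unfolding etale_iff by blast
  obtain z where z: "z \<in> fun_vs.span (e ` {..<m})" "fv.indep_fam {..<m} (pwr z)"
    using idem_generator[OF e(1) nm] by blast
  have zE: "frame_span m (pwr z) = E" using idem_powers_span[OF e(1) nm z] e(2) by simp
  have zC: "z \<in> CS"
  proof -
    obtain \<mu> where "z = (\<Sum>i<m. fscale (\<mu> i) (e i))" using z(1) unfolding fv.span_family[OF finite_lessThan] by blast
    then show ?thesis using CS_sum[of "{..<m}" e \<mu>] idem_sysD(1)[OF e(1) nm] by simp
  qed
  obtain B B' where B: "B \<in> mats n" "B' \<in> mats n" "mt B = - B" "mm n B' B = idm n" "mm n B B' = idm n"
    "mt (mm n (\<eta> z) B) = - mm n (\<eta> z) B"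
    using ex_alternating_idem[OF e(1) nm] z(1) by blast
  define a where "a = mm n B J'"
  define T where "T = mm n J (mm n B' (\<eta> z))"
  have aT: "a \<in> mats n" "T \<in> mats n" using B zC by (simp_all add: a_def T_def)
  have aJ: "mm n a J = B" using B(1) by (simp add: a_def mm_assoc J'J mm_idr)
  have sa: "symmetric_mat a" using aJ B(3) aT by (simp add: symmetric_mat_def)
  have "mm n a T = mm n (mm n B (mm n J' J)) (mm n B' (\<eta> z))" by (simp only: a_def T_def mm_assoc)
  also have "\<dots> = mm n (mm n B B') (\<eta> z)" using B(1) by (simp add: J'J mm_idr mm_assoc)
  also have "\<dots> = \<eta> z" using zC by (simp add: B(5) mm_idl)
  finally have x: "\<eta> z = mm n a T" by simp
  have "mm n (mm n J B') a = mm n (mm n J (mm n B' B)) J'" by (simp only: a_def mm_assoc)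
  then have Na: "mm n (mm n J B') a = idm n" by (simp add: B(4) mm_idr JJ')
  have sT: "symmetric_mat T"
  proof (rule symmetric_quotient[OF sa _ x aT(2) _ Na])
    have "mm n (mm n (\<eta> z) a) J = mm n (\<eta> z) B" by (simp only: mm_assoc aJ)
    then show "symmetric_mat (mm n (\<eta> z) a)" using B(6) aT zC by (simp add: symmetric_mat_def)
  qed (simp add: B)
  obtain c d where c: "a = (\<Sum>i<n * n. fscale (c i) (\<iota> (s i)))" and d: "T = (\<Sum>i<n * n. fscale (d i) (\<iota> (s i)))"
    using s_span[OF sa] s_span[OF sT] by blast
  define u where "u i = (if i < n * n then c i else d (i - n * n))" for i
  have ea: "\<eta> (comb 0 u) = a" and eT: "\<eta> (comb (n * n) u) = T" by (simp_all add: \<eta>_comb c d u_def)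
  have "\<eta> (gen_elt u) = \<eta> z" by (simp add: \<eta>_gen_elt ea eT x)
  then have "gen_elt u = z" by (rule \<eta>_inj[OF gen_elt_in zC])
  moreover have "unit_elt (comb 0 u)" unfolding unit_elt_def ea using Na B(2) by (intro bexI[of _ "mm n J B'"]) simp_all
  ultimately show ?thesis using z(2) zE by (intro exI[of _ u]) (simp add: good_def)
qed

lemma infinite_FK: "infinite FK"
  using inf by (simp add: finite_image_iff inj_to_ac)

text \<open>A generator with rational coordinates exists by density, since generators form an open
  set in a space with a rational frame. The compatible form exists at first only over the closure,
  and \<open>ex_symmetric_invertible\<close> replaces it by \<open>a J\<close> with \<open>a\<close>
  in the algebra.\<close>

lemma ex_rational_params:
  assumes E: "E \<in> rational_points Basis m ET"
  shows "\<exists>u. (\<forall>i. u i \<in> FK) \<and> good {E} u"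
proof -
  obtain w where w: "frame Basis m w" "\<And>j i. j < m \<Longrightarrow> w j i \<in> FK" and Ew: "E = frame_span m w" and "E \<in> ET"
    using E unfolding rational_points_def by blast
  then obtain e where e: "idem_sys m e" "E = fun_vs.span (e ` {..<m})" unfolding etale_iff by blast
  have wC: "w j \<in> CS" if "j < m" for j using w(1) that by (simp add: frame_def)
  obtain z where z: "z \<in> fun_vs.span (e ` {..<m})" "fv.indep_fam {..<m} (pwr z)"
    using idem_generator[OF e(1) nm] by blast
  have we: "fun_vs.span (w ` {..<m}) = fun_vs.span (e ` {..<m})" using Ew e(2) by (simp add: frame_span_def)
  define Z where "Z u = (\<Sum>j<m. fscale (u j) (w j))" for u
  obtain \<mu> where \<mu>: "z = Z \<mu>" using z(1) unfolding we[symmetric] fv.span_family[OF finite_lessThan] Z_def by blast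
  let ?G = "{\<lambda>u. u i | i. i \<in> {..<m}} :: ((nat \<Rightarrow> 'f alg_closure) \<Rightarrow> 'f alg_closure) set"
  have pZ: "pfn FK ?G (\<lambda>u. Z u b)" for b
    unfolding Z_def sum_fun_apply fun_app using w(2)
    by (intro Fc.pfn_sum pfn.mult pfn.gen pfn.const) auto
  have ind_ev: "Fc.ev ?G \<mu> (\<lambda>u. fv.indep_fam {..<m} (pwr (Z u)))"
  proof (rule Fc.ev_indep[OF finite_Basis])
    show "Fc.rat ?G \<mu> (\<lambda>u. pwr (Z u) j i)" for j i by (rule Fc.rat_pfn[OF pfn_pwr[OF pZ]])
  qed (use z(2) \<mu> in simp_all)
  then obtain q where q: "pfn FK ?G q" "q \<mu> \<noteq> 0" "\<And>u. q u \<noteq> 0 \<Longrightarrow> fv.indep_fam {..<m} (pwr (Z u))"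
    unfolding Fc.ev_def by blast
  obtain u where u: "\<And>i. i < m \<Longrightarrow> u i \<in> FK" "q u \<noteq> 0"
    using ex_rational_nonzero[OF q(1,2) finite_lessThan infinite_FK] by auto
  have ZC: "Z u \<in> CS" unfolding Z_def by (rule CS_sum) (simp add: wC)
  have "Z u b \<in> FK" for b
    by (rule pfn_value[OF pZ]) (use u(1) FK_closed in auto)
  then obtain x where x: "Z u = tg x" using tg_of_rational[OF ZC] by blast
  have zx: "tg x \<in> fun_vs.span (e ` {..<m})"
    unfolding we[symmetric] fv.span_family[OF finite_lessThan] x[symmetric] Z_def by (rule exI[of _ u]) (rule refl)
  have ind: "fv.indep_fam {..<m} (pwr (tg x))" using q(3)[OF u(2)] x by simp
  have xE: "frame_span m (pwr (tg x)) = E" using idem_powers_span[OF e(1) nm zx ind] e(2) by simp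
  obtain B B' where B: "B \<in> mats n" "B' \<in> mats n" "mt B = - B" "mm n B' B = idm n"
    "mt (mm n (\<eta> (tg x)) B) = - mm n (\<eta> (tg x)) B"
    using ex_alternating_idem[OF e(1) nm] zx by blast
  obtain a N where a: "a \<in> S" "x * a \<in> S" and N: "N \<in> mats n" "mm n N (\<iota> a) = idm n"
    using ex_symmetric_invertible[OF B(1,3) B(5)[folded \<iota>_def] B(4)] by blast
  have ua: "unit_elt (tg a)" unfolding unit_elt_def using N by (auto simp: \<iota>_def)
  obtain t where t: "x = a * t" using ex_left_division[OF ua] by blast
  have "symmetric_mat (\<iota> t)"
    by (rule symmetric_quotient[of "\<iota> a" "\<iota> x", OF _ _ _ _ N]) (use a t in \<open>simp_all add: S_def \<iota>_mult\<close>)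
  then have "t \<in> S" by (simp add: S_def)
  then obtain c d where c: "a = (\<Sum>i<n * n. scale (c i) (s i))" and d: "t = (\<Sum>i<n * n. scale (d i) (s i))"
    using s_span_F[OF a(1)] s_span_F[of t] by blast
  define r where "r i = to_ac (if i < n * n then c i else d (i - n * n))" for i
  have ea: "comb 0 r = tg a" and et: "comb (n * n) r = tg t"
    unfolding c d tg_sum tg_scale by (simp_all add: comb_def r_def)
  have "gen_elt r = tg x" unfolding gen_elt_def ea et t tg_mult ..
  then have "good {E} r" unfolding good_def ea using ua ind xE by simp
  moreover have "\<forall>i. r i \<in> FK" by (simp add: r_def)
  ultimately show ?thesis by (intro exI[of _ r] conjI)
qed

lemma good_rational:
  assumes g: "good U u" and u: "\<And>i. i < 2 * (n * n) \<Longrightarrow> u i \<in> FK"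
  shows "frame_span m (pwr (gen_elt u)) \<in> rational_points Basis m U"
proof -
  have "pwr (gen_elt u) j b \<in> FK" for j b
    by (rule pfn_value[OF pfn_pwr_gen_elt]) (use u FK_closed in auto)
  moreover have "frame Basis m (pwr (gen_elt u))"
    using g frame_iff_indep[of "pwr (gen_elt u)" m] by (simp add: good_def)
  ultimately show ?thesis using g unfolding rational_points_def good_def by blast
qed

end

section \<open>R-equivalence\<close>

lemma R_trivial_of_linked:
  assumes ne: "rational_points I m Y \<noteq> {}"
    and linked: "\<And>p q. p \<in> rational_points I m Y \<Longrightarrow> q \<in> rational_points I m Y \<Longrightarrow> (p, q) \<in> elem_linked I m Y"
  shows "R_trivial I m Y"
proof -
  let ?R = "rational_points I m Y"
  have sub: "elem_linked I m Y \<subseteq> ?R \<times> ?R" by (auto simp: elem_linked_def)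
  have eq: "equiv ?R (?R \<times> ?R)" by (auto simp: equiv_def refl_on_def sym_def trans_def)
  have "R_equivalence I m Y = ?R \<times> ?R"
  proof
    show "R_equivalence I m Y \<subseteq> ?R \<times> ?R" unfolding R_equivalence_def using eq sub by blast
    show "?R \<times> ?R \<subseteq> R_equivalence I m Y" unfolding R_equivalence_def using linked by blast
  qed
  moreover have "?R // (?R \<times> ?R) = {?R}" using ne by (auto simp: quotient_def)
  ultimately show ?thesis by (simp add: R_trivial_def)
qed

lemma frame_line:
  "frame P1_idx 1 w \<longleftrightarrow> w 0 \<in> coord_space P1_idx \<and> w 0 \<noteq> 0" for w :: "nat \<Rightarrow> nat \<Rightarrow> 'k::field"
  by (auto simp: frame_def lessThan_Suc fun_vs.dependent_single)

lemma frame_span_line: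
  fixes w w' :: "nat \<Rightarrow> nat \<Rightarrow> 'k::field"
  assumes "frame P1_idx 1 w" "frame_span 1 w = frame_span 1 w'"
  shows "\<exists>k. k \<noteq> 0 \<and> w 0 = fscale k (w' 0)"
proof -
  have "w 0 \<in> frame_span 1 w" unfolding frame_span_def by (intro fun_vs.span_base imageI) simp
  then have "w 0 \<in> fun_vs.span {w' 0}" unfolding assms(2) by (simp add: frame_span_def lessThan_Suc)
  then obtain k where k: "w 0 = fscale k (w' 0)" unfolding fun_vs.span_singleton by blast
  moreover have "k \<noteq> 0" using assms(1) k unfolding frame_line by auto
  ultimately show ?thesis by blast
qed

context etale_chart
begin

definition line :: "(nat \<Rightarrow> 'f alg_closure) \<Rightarrow> (nat \<Rightarrow> 'f alg_closure) \<Rightarrow>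
    (nat \<Rightarrow> nat \<Rightarrow> 'f alg_closure) \<Rightarrow> nat \<Rightarrow> 'f alg_closure" where
  "line \<alpha> \<beta> w = (\<lambda>i. w 0 0 * \<alpha> i + w 0 1 * \<beta> i)"

lemma line_rescale:
  assumes "frame P1_idx 1 w" "frame_span 1 w = frame_span 1 w'"
  shows "\<exists>k. k \<noteq> 0 \<and> line \<alpha> \<beta> w = (\<lambda>i. k * line \<alpha> \<beta> w' i)"
proof -
  obtain k where "k \<noteq> 0" "w 0 = fscale k (w' 0)" using frame_span_line[OF assms] by blast
  then show ?thesis by (intro exI[of _ k]) (simp add: line_def fun_app algebra_simps)
qed

lemma polyfun_line:
  assumes \<alpha>: "\<And>i. \<alpha> i \<in> FK" and \<beta>: "\<And>i. \<beta> i \<in> FK" and p: "pfn FK coord_fns p"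
  shows "polyfun P1_idx 1 (\<lambda>w. p (line \<alpha> \<beta> w))"
  using p
proof (induction p rule: pfn.induct)
  case (const c)
  then obtain d where "c = to_ac d" by blast
  then show ?case by (simp add: polyfun.const)
next
  case (gen g)
  then obtain i where g: "g = (\<lambda>u. u i)" by blast
  obtain a b where "\<alpha> i = to_ac a" "\<beta> i = to_ac b" using \<alpha>[of i] \<beta>[of i] by blast
  then have "(\<lambda>w. g (line \<alpha> \<beta> w)) = (\<lambda>w. w 0 0 * to_ac a + w 0 1 * to_ac b)" by (simp add: g line_def)
  then show ?case by (simp add: polyfun.add polyfun.mult polyfun.const polyfun.coord)
qed (simp_all add: polyfun.add polyfun.mult)

text \<open>The projective line through the parameters \<open>\<alpha>\<close> and
  \<open>\<beta>\<close> is mapped to the variety; \<open>V\<close> consists of its good points, and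
  the two coordinate points of the line go to the two given subalgebras.\<close>

lemma linked_of_good:
  assumes W: "grass_open Basis m W" and U: "U = ET \<inter> W"
    and \<alpha>: "\<And>i. \<alpha> i \<in> FK" "good U \<alpha>" and \<beta>: "\<And>i. \<beta> i \<in> FK" "good U \<beta>"
  shows "(frame_span m (pwr (gen_elt \<alpha>)), frame_span m (pwr (gen_elt \<beta>))) \<in> elem_linked Basis m U"
proof -
  define \<gamma> where "\<gamma> w = line \<alpha> \<beta> w" for w
  define V where "V = {frame_span 1 w | w. frame P1_idx 1 w \<and> good U (\<gamma> w)}"
  have good_iff: "frame_span 1 w \<in> V \<longleftrightarrow> good U (\<gamma> w)" if w: "frame P1_idx 1 w" for w
  proof
    assume "frame_span 1 w \<in> V"
    then obtain w' where w': "frame_span 1 w = frame_span 1 w'" "good U (\<gamma> w')" unfolding V_def by blast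
    obtain k where "k \<noteq> 0" "\<gamma> w = (\<lambda>i. k * \<gamma> w' i)" using line_rescale[OF w w'(1)] unfolding \<gamma>_def by blast
    then show "good U (\<gamma> w)" using good_scale(2) w'(2) by simp
  next
    assume "good U (\<gamma> w)"
    then show "frame_span 1 w \<in> V" unfolding V_def using w by blast
  qed
  have V_sub: "V \<subseteq> grassmannian P1_idx 1" unfolding V_def grassmannian_def by blast
  \<comment> \<open>As equations serve all polynomials whose nonvanishing forces goodness; openness
    of the good parameters provides one of them at each point of \<open>V\<close>.\<close>
  have V_open: "grass_open P1_idx 1 V"
    unfolding grass_open_def
  proof (intro conjI V_sub exI[of _ "{p. polyfun P1_idx 1 p \<and> (\<forall>w. p w \<noteq> 0 \<longrightarrow> good U (\<gamma> w))}"] ballI allI impI)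
    fix w :: "nat \<Rightarrow> nat \<Rightarrow> 'f alg_closure" assume w: "frame P1_idx 1 w"
    show "frame_span 1 w \<in> V \<longleftrightarrow> (\<exists>p\<in>{p. polyfun P1_idx 1 p \<and> (\<forall>w. p w \<noteq> 0 \<longrightarrow> good U (\<gamma> w))}. p w \<noteq> 0)"
      unfolding good_iff[OF w]
    proof
      assume "good U (\<gamma> w)"
      then have "Fc.ev coord_fns (\<gamma> w) (good U)" unfolding U by (rule ev_good[OF W])
      then obtain q where q: "pfn FK coord_fns q" "q (\<gamma> w) \<noteq> 0" "\<forall>u. q u \<noteq> 0 \<longrightarrow> good U u"
        unfolding Fc.ev_def by blast
      have "polyfun P1_idx 1 (\<lambda>w. q (\<gamma> w))" unfolding \<gamma>_def by (rule polyfun_line[OF \<alpha>(1) \<beta>(1) q(1)])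
      then show "\<exists>p\<in>{p. polyfun P1_idx 1 p \<and> (\<forall>w. p w \<noteq> 0 \<longrightarrow> good U (\<gamma> w))}. p w \<noteq> 0"
        using q(2,3) by (intro bexI[of _ "\<lambda>w. q (\<gamma> w)"]) simp_all
    next
      assume "\<exists>p\<in>{p. polyfun P1_idx 1 p \<and> (\<forall>w. p w \<noteq> 0 \<longrightarrow> good U (\<gamma> w))}. p w \<noteq> 0"
      then show "good U (\<gamma> w)" by blast
    qed
  qed simp
  \<comment> \<open>The choice of a frame of the line does not matter, since another frame only
    rescales the parameter.\<close>
  define \<phi> where "\<phi> E = frame_span m (pwr (gen_elt (\<gamma> (SOME w. frame P1_idx 1 w \<and> E = frame_span 1 w))))" for E
  have \<phi>: "\<phi> (frame_span 1 w) = frame_span m (pwr (gen_elt (\<gamma> w)))" if w: "frame P1_idx 1 w" for w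
  proof -
    define w' where "w' = (SOME w'. frame P1_idx 1 w' \<and> frame_span 1 w = frame_span 1 w')"
    have "frame P1_idx 1 w' \<and> frame_span 1 w = frame_span 1 w'"
      unfolding w'_def by (rule someI[of _ w]) (intro conjI w refl)
    then have w': "frame P1_idx 1 w'" "frame_span 1 w' = frame_span 1 w" by simp_all
    obtain k where "k \<noteq> 0" "\<gamma> w' = (\<lambda>i. k * \<gamma> w i)" using line_rescale[OF w'] unfolding \<gamma>_def by blast
    then show ?thesis using good_scale(1)[of k "\<gamma> w"] unfolding \<phi>_def w'_def[symmetric] by simp
  qed
  have mor: "morphism P1_idx 1 V Basis m U \<phi>"
    unfolding morphism_def
  proof (intro conjI ballI)
    fix E assume E: "E \<in> V"
    then obtain w where w: "E = frame_span 1 w" "frame P1_idx 1 w" "good U (\<gamma> w)" unfolding V_def by blast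
    show "\<phi> E \<in> U" using w(3) unfolding w(1) \<phi>[OF w(2)] by (simp add: good_def)
    show "\<exists>W v. grass_open P1_idx 1 W \<and> E \<in> W \<and> (\<forall>j<m. \<forall>i\<in>Basis. polyfun P1_idx 1 (\<lambda>u. v u j i)) \<and>
      (\<forall>u. frame P1_idx 1 u \<and> frame_span 1 u \<in> V \<inter> W \<longrightarrow>
         frame Basis m (v u) \<and> frame_span m (v u) = \<phi> (frame_span 1 u))"
    proof (intro exI[of _ V] exI[of _ "\<lambda>w. pwr (gen_elt (\<gamma> w))"] conjI allI ballI impI V_open E)
      show "polyfun P1_idx 1 (\<lambda>u. pwr (gen_elt (\<gamma> u)) j i)" for j i
        unfolding \<gamma>_def by (rule polyfun_line[OF \<alpha>(1) \<beta>(1) pfn_pwr_gen_elt])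
    next
      fix u :: "nat \<Rightarrow> nat \<Rightarrow> 'f alg_closure" assume u: "frame P1_idx 1 u \<and> frame_span 1 u \<in> V \<inter> V"
      then have "good U (\<gamma> u)" using good_iff by blast
      then show "frame Basis m (pwr (gen_elt (\<gamma> u)))"
        using frame_iff_indep[of "pwr (gen_elt (\<gamma> u))" m] by (simp add: good_def)
      show "frame_span m (pwr (gen_elt (\<gamma> u))) = \<phi> (frame_span 1 u)" using \<phi> u by simp
    qed
  qed
  define pt :: "nat \<Rightarrow> nat \<Rightarrow> nat \<Rightarrow> 'f alg_closure" where "pt k = (\<lambda>j i. if i = k then 1 else 0)" for k
  have ptf: "frame P1_idx 1 (pt k)" if "k < 2" for k
    using that unfolding frame_line by (auto simp: pt_def coord_space_def fun_eq_iff fun_app)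
  have ptv: "\<gamma> (pt 0) = \<alpha>" "\<gamma> (pt 1) = \<beta>" by (simp_all add: \<gamma>_def line_def pt_def)
  have ptr: "frame_span 1 (pt k) \<in> rational_points P1_idx 1 V" if k: "k < 2" "good U (\<gamma> (pt k))" for k
  proof -
    have "pt k j i \<in> FK" for j i unfolding pt_def using Fc.zero_C Fc.one_C by simp
    moreover have "frame_span 1 (pt k) \<in> V" using good_iff[OF ptf[OF k(1)]] k(2) by simp
    ultimately show ?thesis unfolding rational_points_def using ptf[OF k(1)] by blast
  qed
  have p0: "frame_span 1 (pt 0) \<in> rational_points P1_idx 1 V" by (rule ptr) (simp_all add: ptv \<alpha>(2))
  have p1: "frame_span 1 (pt 1) \<in> rational_points P1_idx 1 V"
  proof (rule ptr)
    show "good U (\<gamma> (pt 1))" unfolding ptv by (rule \<beta>(2))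
  qed simp
  have i0: "frame_span m (pwr (gen_elt \<alpha>)) \<in> \<phi> ` rational_points P1_idx 1 V"
    using p0 \<phi>[OF ptf[of 0]] by (intro image_eqI[of _ _ "frame_span 1 (pt 0)"]) (simp_all add: ptv)
  have i1: "frame_span m (pwr (gen_elt \<beta>)) \<in> \<phi> ` rational_points P1_idx 1 V"
    using p1 \<phi>[OF ptf[of 1]] ptv(2) by (intro image_eqI[of _ _ "frame_span 1 (pt 1)"]) simp_all
  have "open_subvariety P1_idx 1 P1 V"
    unfolding open_subvariety_def P1_def using V_open V_sub by blast
  moreover have "V \<noteq> {}" using p0 unfolding rational_points_def by blast
  ultimately show ?thesis unfolding elem_linked_def
    using mor i0 i1 good_rational[OF \<alpha>(2) \<alpha>(1)] good_rational[OF \<beta>(2) \<beta>(1)] by blast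
qed

text \<open>A good parameter of some point over the closure has a rational good parameter in its
  neighbourhood, so there is a rational point. Any two rational points have rational parameters, and
  a single line joins them.\<close>

lemma R_trivial_open:
  assumes U: "open_subvariety Basis m ET U" "U \<noteq> {}"
  shows "R_trivial Basis m U"
proof -
  obtain W where W: "grass_open Basis m W" "U = ET \<inter> W" using U(1) unfolding open_subvariety_def by blast
  have gU: "good U u" if "good {E} u" "E \<in> U" for E u using that by (auto simp: good_def)
  show ?thesis
  proof (rule R_trivial_of_linked)
    obtain E where E: "E \<in> U" using U(2) by blast
    then obtain u0 where "good {E} u0" using ex_params W(2) by blast
    then have "Fc.ev coord_fns u0 (good U)" using ev_good[OF W(1)] gU E W(2) by simp
    then obtain q where q: "pfn FK coord_fns q" "q u0 \<noteq> 0" "\<forall>u. q u \<noteq> 0 \<longrightarrow> good U u"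
      unfolding Fc.ev_def by blast
    obtain u where u: "\<forall>i\<in>{..<2 * (n * n)}. u i \<in> FK" "q u \<noteq> 0"
      using ex_rational_nonzero[OF q(1,2) finite_lessThan infinite_FK] by blast
    have "good U u" using q(3) u(2) by simp
    then have "frame_span m (pwr (gen_elt u)) \<in> rational_points Basis m U" by (rule good_rational) (use u(1) in simp)
    then show "rational_points Basis m U \<noteq> {}" by blast
  next
    fix p q assume pq: "p \<in> rational_points Basis m U" "q \<in> rational_points Basis m U"
    have "p \<in> rational_points Basis m ET" "q \<in> rational_points Basis m ET" "p \<in> U" "q \<in> U"
      using pq unfolding rational_points_def W(2) by blast+
    then obtain \<alpha> \<beta> where \<alpha>: "\<And>i. \<alpha> i \<in> FK" "good {p} \<alpha>" and \<beta>: "\<And>i. \<beta> i \<in> FK" "good {q} \<beta>"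
      using ex_rational_params by blast
    have "(frame_span m (pwr (gen_elt \<alpha>)), frame_span m (pwr (gen_elt \<beta>))) \<in> elem_linked Basis m U"
      using \<alpha> \<beta> gU \<open>p \<in> U\<close> \<open>q \<in> U\<close> by (intro linked_of_good[OF W]) auto
    then show "(p, q) \<in> elem_linked Basis m U" using \<alpha>(2) \<beta>(2) by (simp add: good_def)
  qed
qed

end

section \<open>Assembling the chart for the given algebra\<close>

theorem theorem6p7:
  fixes scale :: "'f::field \<Rightarrow> 'a::ring_1 \<Rightarrow> 'a"
    and Basis :: "'a set"
    and n m :: nat
    and U :: "('a \<Rightarrow> 'f alg_closure) set set"
  assumes "CHAR('f) \<noteq> 2"
    and "central_simple_algebra scale Basis"
    and "has_exponent scale Basis 2"
    and "has_degree scale n" and "n = 2 * m"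
    and "open_subvariety Basis m (etale_variety scale Basis n m) U"
    and "U \<noteq> {}"
  shows "R_trivial Basis m U"
proof -
  interpret central_simple_algebra scale Basis by fact
  have ex2: "brauer_equiv (tensor_power (coord_algebra scale Basis) 2) (base_field :: ('f, unit) sc_algebra)"
    and ex1: "\<not> brauer_equiv (tensor_power (coord_algebra scale Basis) 1) (base_field :: ('f, unit) sc_algebra)"
    using assms(3) by (simp_all add: has_exponent_def)
  obtain \<eta> where \<eta>: "bij_betw \<eta> CS (mats n)"
    "\<forall>z w. z \<in> CS \<longrightarrow> w \<in> CS \<longrightarrow> \<eta> (z + w) = \<eta> z + \<eta> w"
    "\<forall>c z. z \<in> CS \<longrightarrow> \<eta> (fscale c z) = fscale c (\<eta> z)"
    "\<forall>z w. z \<in> CS \<longrightarrow> w \<in> CS \<longrightarrow> \<eta> (gm z w) = mm n (\<eta> z) (\<eta> w)" "\<eta> (tg 1) = idm n"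
    using splitting[OF assms(4)] by (elim exE conjE)
  have "card Basis = n * n"
    using assms(4) dim_UNIV by (simp add: has_degree_def power2_eq_square)
  then interpret split_csa scale Basis n \<eta> using \<eta> by unfold_locales simp_all
  have two: "(2 :: 'f) \<noteq> 0"
  proof
    assume "(2 :: 'f) = 0"
    then have "CHAR('f) dvd 2" using of_nat_eq_0_iff_char_dvd[of 2, where 'a = 'f] by simp
    then show False using assms(1) dvd_imp_le[of "CHAR('f)" 2] CHAR_not_1'[where 'a = 'f]
      by (cases "CHAR('f) = 0") auto
  qed
  obtain v where v: "v ` {..<n * n} \<subseteq> mats n" "fv.indep_fam {..<n * n} v"
    "\<forall>x y. \<forall>i<n * n. \<exists>c :: nat \<Rightarrow> 'f.
       mm n (mm n (\<iota> x) (v i)) (mt (\<iota> y)) = (\<Sum>j<n * n. fscale (to_ac (c j)) (v j))"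
    using ex_bimodule_form[OF ex2] by (elim exE conjE)
  \<comment> \<open>Here it matters that the exponent is 2 and not 1: the algebra is not split,
    which excludes a finite base field.\<close>
  interpret bimodule_form scale Basis n \<eta> v
    using v two infinite_base_field[OF ex1] by unfold_locales simp_all
  \<comment> \<open>This point need not be rational. It only shows that invertible alternating
    matrices exist over the closure; density then finds one in the form.\<close>
  obtain E where "E \<in> etale_variety scale Basis n m"
    using assms(6,7) unfolding open_subvariety_def by blast
  then obtain e where e: "idem_sys m e" unfolding etale_iff by blast
  obtain B B' where "B \<in> mats n" "B' \<in> mats n" and B: "mt B = - B" "mm n B' B = idm n"
    and "mm n B B' = idm n" "\<forall>z\<in>fun_vs.span (e ` {..<m}). mt (mm n (\<eta> z) B) = - mm n (\<eta> z) B"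
    using ex_alternating_idem[OF e assms(5)] by (elim bexE conjE)
  from ex_rational_alternating[OF this(1) B] obtain J J' where J: "J \<in> alt_Vf" "J' \<in> mats n" "mm n J' J = idm n" by blast
  interpret symplectic_form scale Basis n \<eta> v J J' using J by unfold_locales
  obtain s where s: "\<forall>i<n * n. s i \<in> S"
    "\<forall>M. symmetric_mat M \<longrightarrow> (\<exists>c. M = (\<Sum>i<n * n. fscale (c i) (\<iota> (s i))))"
    "\<forall>a\<in>S. \<exists>c. a = (\<Sum>i<n * n. scale (c i) (s i))"
    using ex_symmetric_basis by (elim exE conjE)
  interpret etale_chart scale Basis n \<eta> v J J' s m using s assms(5) by unfold_locales simp_all
  show ?thesis by (rule R_trivial_open[OF assms(6,7)])
qed

end
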